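(* Let $s_1>-\frac12$, $s_2\ge 0$, and let $0<\epsilon<\frac1{100}$ be such that $s_1\ge -\frac12+8\epsilon$. Put $b=\frac12+\frac{\epsilon}{2}$, $b'=-\frac12+\epsilon$, $\sigma=\frac12+\epsilon$, and let $X$ and $\tilde X$ be the spaces associated with $(s_1,s_2,\epsilon)$ defined in the context. Then there is a constant $C>0$ such that for all $u_1,u_2\in X$, $$\|\partial_x(u_1u_2)\|_{\tilde X}\le C\,\|u_1\|_{X}\,\|u_2\|_{X}.$$
   Context: Functions depend on $(x,y,t)\in\mathbb{R}^3$; $\mathscr{F}$ is the Fourier transform in $(x,y,t)$, with dual variable $\zeta=(\xi,\eta,\tau)$. Write $\langle\cdot\rangle=1+|\cdot|$, $\phi(\xi,\eta)=\xi^3-\frac{\eta^2+1}{\xi}$ and $\lambda=\tau-\phi(\xi,\eta)$. For $\sigma,s_1,s_2,b\in\mathbb{R}$ the space $X_\sigma^{s_1,s_2,b}$ is defined by the norm $$\|u\|_{X_\sigma^{s_1,s_2,b}}=\big\|\langle\xi\rangle^{s_1+\sigma}|\xi|^{-\sigma}\langle\eta\rangle^{s_2}\langle\lambda\rangle^{b}\mathscr{F}u(\zeta)\big\|_{L^2_\zeta(\mathbb{R}^3)}.$$ With $b=\frac12+\frac\epsilon2$, $b'=-\frac12+\epsilon$, $\sigma=\frac12+\epsilon$, set $$X_1=X_0^{s_1,s_2,b-b'},\quad X_2=X_\sigma^{s_1,s_2,b}\cap X_\sigma^{s_1-3\epsilon,s_2,b+\epsilon},$$ $$\tilde X_1=X_0^{s_1,s_2,0},\quad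 \tilde X_2=X_\sigma^{s_1,s_2,b'}\cap X_\sigma^{s_1-3\epsilon,s_2,b'+\epsilon},$$ and $X=X_1+X_2$, $\tilde X=\tilde X_1+\tilde X_2$ with the norms $$\|u\|_X=\inf\{\|v\|_{X_1}+\|w\|_{X_2}: u=v+w,\ v\in X_1,\ w\in X_2\},$$ $$\|u\|_{\tilde X}=\inf\{\|v\|_{\tilde X_1}+\|w\|_{\tilde X_2}: u=v+w,\ v\in \tilde X_1,\ w\in\tilde X_2\}.$$ Intersections carry the sum of the norms. The expression $\partial_x(u_1u_2)$ is understood on the Fourier side, i.e. (up to a normalizing constant) $\mathscr{F}[\partial_x(u_1u_2)](\zeta)=i\xi\int_{\mathbb{R}^3}\mathscr{F}u_1(\zeta_1)\mathscr{F}u_2(\zeta-\zeta_1)\,d\zeta_1$. *)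

theory Defs
  imports "HOL-Analysis.Analysis"
begin

section \<open>Schwartz functions and tempered distributions on three-dimensional space\<close>

type_synonym r3 = "real \<times> real \<times> real"

definition partial_deriv :: "r3 \<Rightarrow> (r3 \<Rightarrow> complex) \<Rightarrow> r3 \<Rightarrow> complex" where
  "partial_deriv e f z = frechet_derivative f (at z) e"

text \<open>Iterated partial derivatives are indexed by lists of basis vectors.\<close>

definition iter_deriv :: "r3 list \<Rightarrow> (r3 \<Rightarrow> complex) \<Rightarrow> r3 \<Rightarrow> complex" where
  "iter_deriv es f = foldr partial_deriv es f"

definition schwartz :: "(r3 \<Rightarrow> complex) set" where
  "schwartz = {f. \<forall>es. set es \<subseteq> Basis \<longrightarrow>
     (\<forall>z. iter_deriv es f differentiable (at z)) \<and>
     (\<forall>k::nat. bounded (range (\<lambda>z. (1 + norm z) ^ k *\<^sub>R iter_deriv es f z)))}"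

definition schwartz_norm :: "nat \<Rightarrow> (r3 \<Rightarrow> complex) \<Rightarrow> real" where
  "schwartz_norm N f =
     (\<Sum>es | set es \<subseteq> Basis \<and> length es \<le> N. SUP z. (1 + norm z) ^ N * cmod (iter_deriv es f z))"

text \<open>Distributions are functionals on \<open>schwartz\<close>; they are required to vanish outside it, so that
  equality of distributions is equality of functions.\<close>

type_synonym distribution = "(r3 \<Rightarrow> complex) \<Rightarrow> complex"

definition tempered :: "distribution set" where
  "tempered = {u.
     (\<forall>f. f \<notin> schwartz \<longrightarrow> u f = 0) \<and>
     (\<forall>f\<in>schwartz. \<forall>g\<in>schwartz. u (\<lambda>z. f z + g z) = u f + u g) \<and>
     (\<forall>f\<in>schwartz. \<forall>c. u (\<lambda>z. c * f z) = c * u f) \<and>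
     (\<exists>C N. \<forall>f\<in>schwartz. cmod (u f) \<le> C * schwartz_norm N f)}"

definition fourier :: "(r3 \<Rightarrow> complex) \<Rightarrow> r3 \<Rightarrow> complex" where
  "fourier f \<zeta> = (LINT z|lborel. cis (- (z \<bullet> \<zeta>)) * f z)"

text \<open>The Fourier transform of a tempered distribution, defined by duality, is the function \<open>F\<close>
  (unique up to null sets).\<close>

definition has_fourier :: "distribution \<Rightarrow> (r3 \<Rightarrow> complex) \<Rightarrow> bool" where
  "has_fourier u F \<longleftrightarrow> u \<in> tempered \<and> F \<in> borel_measurable lborel \<and>
     (\<forall>f\<in>schwartz. integrable lborel (\<lambda>\<zeta>. F \<zeta> * f \<zeta>) \<and>
                   u (fourier f) = (LINT \<zeta>|lborel. F \<zeta> * f \<zeta>))"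

definition FT :: "distribution \<Rightarrow> r3 \<Rightarrow> complex" where
  "FT u = (SOME F. has_fourier u F)"

section \<open>The weighted spaces\<close>

definition bracket :: "real \<Rightarrow> real" where
  "bracket x = 1 + \<bar>x\<bar>"

definition phi :: "real \<Rightarrow> real \<Rightarrow> real" where
  "phi \<xi> \<eta> = \<xi> ^ 3 - (\<eta>\<^sup>2 + 1) / \<xi>"

text \<open>The values at \<open>\<xi> = 0\<close> (where Isabelle's division and \<open>powr\<close> return 0) are irrelevant: this is
  a null set.\<close>

definition weight :: "real \<Rightarrow> real \<Rightarrow> real \<Rightarrow> real \<Rightarrow> r3 \<Rightarrow> real" where
  "weight \<sigma> s1 s2 b = (\<lambda>(\<xi>, \<eta>, \<tau>).
     bracket \<xi> powr (s1 + \<sigma>) * \<bar>\<xi>\<bar> powr (- \<sigma>) * bracket \<eta> powr s2 * bracket (\<tau> - phi \<xi> \<eta>) powr b)"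

definition Xs :: "real \<Rightarrow> real \<Rightarrow> real \<Rightarrow> real \<Rightarrow> distribution set" where
  "Xs \<sigma> s1 s2 b = {u. (\<exists>F. has_fourier u F) \<and>
     integrable lborel (\<lambda>\<zeta>. (weight \<sigma> s1 s2 b \<zeta> * cmod (FT u \<zeta>))\<^sup>2)}"

definition Xs_norm :: "real \<Rightarrow> real \<Rightarrow> real \<Rightarrow> real \<Rightarrow> distribution \<Rightarrow> real" where
  "Xs_norm \<sigma> s1 s2 b u = sqrt (LINT \<zeta>|lborel. (weight \<sigma> s1 s2 b \<zeta> * cmod (FT u \<zeta>))\<^sup>2)"

definition sum_space :: "distribution set \<Rightarrow> distribution set \<Rightarrow> distribution set" where
  "sum_space A B = {u. \<exists>v\<in>A. \<exists>w\<in>B. u = (\<lambda>f. v f + w f)}"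

definition sum_norm :: "distribution set \<Rightarrow> (distribution \<Rightarrow> real) \<Rightarrow>
    distribution set \<Rightarrow> (distribution \<Rightarrow> real) \<Rightarrow> distribution \<Rightarrow> real" where
  "sum_norm A nA B nB u = Inf {nA v + nB w | v w. v \<in> A \<and> w \<in> B \<and> u = (\<lambda>f. v f + w f)}"

definition X1 :: "real \<Rightarrow> real \<Rightarrow> real \<Rightarrow> real \<Rightarrow> distribution set" where
  "X1 s1 s2 b b' = Xs 0 s1 s2 (b - b')"

definition X1_norm :: "real \<Rightarrow> real \<Rightarrow> real \<Rightarrow> real \<Rightarrow> distribution \<Rightarrow> real" where
  "X1_norm s1 s2 b b' = Xs_norm 0 s1 s2 (b - b')"

definition X2 :: "real \<Rightarrow> real \<Rightarrow> real \<Rightarrow> real \<Rightarrow> real \<Rightarrow> distribution set" where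
  "X2 s1 s2 \<epsilon> \<sigma> b = Xs \<sigma> s1 s2 b \<inter> Xs \<sigma> (s1 - 3 * \<epsilon>) s2 (b + \<epsilon>)"

definition X2_norm :: "real \<Rightarrow> real \<Rightarrow> real \<Rightarrow> real \<Rightarrow> real \<Rightarrow> distribution \<Rightarrow> real" where
  "X2_norm s1 s2 \<epsilon> \<sigma> b u = Xs_norm \<sigma> s1 s2 b u + Xs_norm \<sigma> (s1 - 3 * \<epsilon>) s2 (b + \<epsilon>) u"

definition Xt1 :: "real \<Rightarrow> real \<Rightarrow> distribution set" where
  "Xt1 s1 s2 = Xs 0 s1 s2 0"

definition Xt1_norm :: "real \<Rightarrow> real \<Rightarrow> distribution \<Rightarrow> real" where
  "Xt1_norm s1 s2 = Xs_norm 0 s1 s2 0"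

definition Xt2 :: "real \<Rightarrow> real \<Rightarrow> real \<Rightarrow> real \<Rightarrow> real \<Rightarrow> distribution set" where
  "Xt2 s1 s2 \<epsilon> \<sigma> b' = Xs \<sigma> s1 s2 b' \<inter> Xs \<sigma> (s1 - 3 * \<epsilon>) s2 (b' + \<epsilon>)"

definition Xt2_norm :: "real \<Rightarrow> real \<Rightarrow> real \<Rightarrow> real \<Rightarrow> real \<Rightarrow> distribution \<Rightarrow> real" where
  "Xt2_norm s1 s2 \<epsilon> \<sigma> b' u = Xs_norm \<sigma> s1 s2 b' u + Xs_norm \<sigma> (s1 - 3 * \<epsilon>) s2 (b' + \<epsilon>) u"

definition X :: "real \<Rightarrow> real \<Rightarrow> real \<Rightarrow> real \<Rightarrow> real \<Rightarrow> real \<Rightarrow> distribution set" where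
  "X s1 s2 \<epsilon> \<sigma> b b' = sum_space (X1 s1 s2 b b') (X2 s1 s2 \<epsilon> \<sigma> b)"

definition X_norm :: "real \<Rightarrow> real \<Rightarrow> real \<Rightarrow> real \<Rightarrow> real \<Rightarrow> real \<Rightarrow> distribution \<Rightarrow> real" where
  "X_norm s1 s2 \<epsilon> \<sigma> b b' =
     sum_norm (X1 s1 s2 b b') (X1_norm s1 s2 b b') (X2 s1 s2 \<epsilon> \<sigma> b) (X2_norm s1 s2 \<epsilon> \<sigma> b)"

definition Xt :: "real \<Rightarrow> real \<Rightarrow> real \<Rightarrow> real \<Rightarrow> real \<Rightarrow> distribution set" where
  "Xt s1 s2 \<epsilon> \<sigma> b' = sum_space (Xt1 s1 s2) (Xt2 s1 s2 \<epsilon> \<sigma> b')"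

definition Xt_norm :: "real \<Rightarrow> real \<Rightarrow> real \<Rightarrow> real \<Rightarrow> real \<Rightarrow> distribution \<Rightarrow> real" where
  "Xt_norm s1 s2 \<epsilon> \<sigma> b' =
     sum_norm (Xt1 s1 s2) (Xt1_norm s1 s2) (Xt2 s1 s2 \<epsilon> \<sigma> b') (Xt2_norm s1 s2 \<epsilon> \<sigma> b')"

section \<open>The bilinear expression\<close>

text \<open>\<open>v\<close> is the \<open>x\<close>-derivative of the product of \<open>u1\<close> and \<open>u2\<close>: the convolution of the Fourier
  transforms converges absolutely almost everywhere and, multiplied by \<open>i \<xi>\<close>, is the Fourier
  transform of \<open>v\<close>. The factor \<open>(2 pi)^-3\<close> is the one belonging to the normalization of
  \<open>fourier\<close>.\<close>

definition is_dx_product :: "distribution \<Rightarrow> distribution \<Rightarrow> distribution \<Rightarrow> bool" where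
  "is_dx_product u1 u2 v \<longleftrightarrow>
     (AE \<zeta> in lborel. integrable lborel (\<lambda>\<zeta>1. FT u1 \<zeta>1 * FT u2 (\<zeta> - \<zeta>1))) \<and>
     has_fourier v (\<lambda>\<zeta>. \<i> * complex_of_real (fst \<zeta>) *
       (complex_of_real (1 / (2 * pi) ^ 3) * (LINT \<zeta>1|lborel. FT u1 \<zeta>1 * FT u2 (\<zeta> - \<zeta>1))))"

end

theory Submission
  imports Defs "HOL-Probability.Characteristic_Functions" "HOL-Computational_Algebra.Polynomial"
begin

text \<open>
  Throughout, \<open>\<zeta> = (\<xi>, \<eta>, \<tau>)\<close> is a frequency, \<open>lam \<zeta> = \<tau> - phi \<xi> \<eta>\<close> its modulation and \<open>\<langle>x\<rangle>\<close> stands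
  for \<open>bracket x\<close>. On the Fourier side the theorem says that a convolution is bounded between weighted
  \<open>L\<^sup>2\<close> spaces; that estimate is one half of the proof, and the passage between functions on the
  Fourier side and tempered distributions is the other.

  Reduction to positive functions. If \<open>u = v + w\<close> with \<open>v\<close> in \<open>X1\<close> and \<open>w\<close> in \<open>X2\<close>, then the pointwise
  minimum \<open>W_in\<close> of the weight of \<open>X1\<close> and of the sum of the two weights of \<open>X2\<close> satisfies
  \<open>\<parallel>W_in * FT u\<parallel> \<le> sqrt 3 * (\<parallel>v\<parallel> + \<parallel>w\<parallel>)\<close>, so it controls the norm of \<open>X\<close> from below. The product is put
  entirely into the second summand of the target space; with the derivative this costs the multiplier
  \<open>m_out\<close>. By duality (\<open>sq_int_duality\<close>) it is enough to bound the trilinear form with kernel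
  \<open>m_out (x + y) / (W_in x * W_in y)\<close> on \<open>L\<^sup>2\<close>.

  The kernel. The resonance identity
  \<open>lam x + lam y - lam (x + y) = 3 \<xi> \<xi>\<^sub>1 \<xi>\<^sub>2 + Q / (\<xi> \<xi>\<^sub>1 \<xi>\<^sub>2)\<close> with \<open>Q \<ge> 0\<close> shows that the largest of the three
  modulations is at least \<open>\<bar>\<xi> \<xi>\<^sub>1 \<xi>\<^sub>2\<bar>\<close>, and this pays for the derivative. In logarithmic variables the
  comparison is piecewise linear (\<open>log_kernel_bound\<close>), and it gives a pointwise bound of the kernel by
  \<open>ktot\<close>, a sum of seven kernels of two kinds (\<open>kernel_bound\<close>): Strichartz kernels, which have the factor
  \<open>\<langle>\<xi>\<rangle> powr - \<delta> * \<langle>lam\<rangle> powr - (\<beta> / 2)\<close>, \<open>\<beta> > 1\<close>, in two of the three frequencies, and high-low kernels, in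
  which one frequency is at most a quarter of another one.

  The trilinear forms. By Cauchy-Schwarz a trilinear form is bounded as soon as the square of the
  kernel has a bounded integral over all pairs of frequencies with a given sum (\<open>trilinear_output\<close>).
  Integrating in \<open>\<tau>\<close> convolves two brackets, integrating in \<open>\<eta>\<close> is an integral of a bracket of a quadratic
  polynomial, and there remains an integral over the line with the phase \<open>Psi\<close>, which is estimated by
  Young's inequality and the substitution by \<open>Psi\<close> itself (\<open>nn_integral_hl\<close>, \<open>nn_integral_ss\<close>). For two
  frequencies \<open>\<xi>\<^sub>1\<close>, \<open>\<xi>\<^sub>2\<close> of opposite signs this fails, but the square of the convolution can be rearranged so
  that frequencies of the same sign are paired (\<open>strichartz_opposite_sign\<close>).

  Distributions. The Fourier transform \<open>FT u\<close> is a choice among all functions representing \<open>u\<close>, so one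
  needs that two such functions agree almost everywhere (\<open>has_fourier_unique\<close>): Schwartz functions
  approximate indicator functions of boxes. Conversely the product has to be constructed as a tempered
  distribution with a prescribed Fourier transform \<open>G\<close>. Fourier inversion, obtained from Gaussians,
  provides it when \<open>G\<close> is integrable against \<open>(1 + norm \<zeta>) ^ (- 6)\<close> (\<open>has_fourier_exists\<close>), and square integrability
  against the weight of the target space implies this because the inverse of that weight grows only
  polynomially (\<open>weight_out_lower\<close>).
\<close>

section \<open>Integrals of powers of the bracket\<close>

lemma bracket_ge_1: "1 \<le> bracket x" by (simp add: bracket_def)
lemma bracket_pos [simp]: "0 < bracket x" by (simp add: bracket_def add_pos_nonneg)
lemma bracket_neq_0 [simp]: "bracket x \<noteq> 0" using bracket_pos[of x] by linarith
lemma bracket_nonneg [simp]: "0 \<le> bracket x" by (simp add: bracket_def)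
lemma bracket_minus [simp]: "bracket (- x) = bracket x" by (simp add: bracket_def)
lemma bracket_measurable [measurable]: "bracket \<in> borel_measurable borel"
  unfolding bracket_def by measurable

lemma nn_integral_bracket_half:
  assumes "\<beta> > 1"
  shows "(\<integral>\<^sup>+x. ennreal (bracket x powr - \<beta>) * indicator {0..} x \<partial>lborel) = ennreal (1 / (\<beta> - 1))"
proof -
  have "(\<integral>\<^sup>+x. ennreal (bracket x powr - \<beta>) * indicator {0..} x \<partial>lborel) =
     (\<integral>\<^sup>+x. ennreal ((1 + \<bar>x\<bar>) powr - \<beta>) * indicator {0..} x \<partial>lborel)"
    by (simp add: bracket_def)
  also have "\<dots> = (\<integral>\<^sup>+x. ennreal ((1 + x) powr - \<beta>) * indicator {0..} x \<partial>lborel)"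
    by (intro nn_integral_cong) (auto split: split_indicator)
  also have "\<dots> = ennreal (0 - (- ((1 + 0) powr (1 - \<beta>) / (\<beta> - 1))))"
  proof (rule nn_integral_FTC_atLeast[where F = "\<lambda>x. - ((1 + x) powr (1 - \<beta>) / (\<beta> - 1))"])
    fix x :: real assume x: "0 \<le> x"
    have "((\<lambda>x. - ((1 + x) powr (1 - \<beta>) / (\<beta> - 1))) has_real_derivative
          - (((1 - \<beta>) * (1 + x) powr (1 - \<beta> - 1)) / (\<beta> - 1))) (at x)"
      using x assms by (auto intro!: derivative_eq_intros)
    moreover have "- (((1 - \<beta>) * (1 + x) powr (1 - \<beta> - 1)) / (\<beta> - 1)) = (1 + x) powr - \<beta>"
      using assms by (simp add: divide_simps) (simp add: algebra_simps)
    ultimately show "((\<lambda>x. - ((1 + x) powr (1 - \<beta>) / (\<beta> - 1))) has_real_derivative (1 + x) powr - \<beta>) (at x)"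
      by simp
  next
    have "((\<lambda>x::real. (1 + x) powr (1 - \<beta>)) \<longlongrightarrow> 0) at_top"
      by (rule tendsto_neg_powr) (use assms in \<open>auto intro: filterlim_tendsto_add_at_top tendsto_const filterlim_ident\<close>)
    from tendsto_minus[OF tendsto_divide[OF this tendsto_const[of "\<beta> - 1"]]] assms
    show "((\<lambda>x. - ((1 + x) powr (1 - \<beta>) / (\<beta> - 1))) \<longlongrightarrow> 0) at_top"
      by simp
  qed auto
  finally show ?thesis by simp
qed

lemma nn_integral_even:
  fixes f :: "real \<Rightarrow> ennreal"
  assumes [measurable]: "f \<in> borel_measurable borel" and even: "\<And>x. f (- x) = f x"
  shows "(\<integral>\<^sup>+x. f x \<partial>lborel) \<le> 2 * (\<integral>\<^sup>+x. f x * indicator {0..} x \<partial>lborel)"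
proof -
  have neg: "(\<integral>\<^sup>+x. f x * indicator {..0} x \<partial>lborel) = (\<integral>\<^sup>+x. f x * indicator {0..} x \<partial>lborel)"
    by (subst nn_integral_real_affine[where c = "-1" and t = 0])
       (auto simp: even intro!: nn_integral_cong split: split_indicator)
  have "(\<integral>\<^sup>+x. f x \<partial>lborel) \<le> (\<integral>\<^sup>+x. f x * indicator {0..} x + f x * indicator {..0} x \<partial>lborel)"
    by (intro nn_integral_mono) (auto split: split_indicator)
  also have "\<dots> = (\<integral>\<^sup>+x. f x * indicator {0..} x \<partial>lborel) + (\<integral>\<^sup>+x. f x * indicator {..0} x \<partial>lborel)"
    by (rule nn_integral_add) auto
  finally show ?thesis by (simp add: neg mult_2)
qed

lemma nn_integral_bracket_powr:
  assumes "\<beta> > 1"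
  shows "(\<integral>\<^sup>+x. ennreal (bracket x powr - \<beta>) \<partial>lborel) \<le> ennreal (2 / (\<beta> - 1))"
proof -
  have "(\<integral>\<^sup>+x. ennreal (bracket x powr - \<beta>) \<partial>lborel) \<le>
      2 * (\<integral>\<^sup>+x. ennreal (bracket x powr - \<beta>) * indicator {0..} x \<partial>lborel)"
    by (rule nn_integral_even) auto
  also have "\<dots> = ennreal (2 * (1 / (\<beta> - 1)))"
    unfolding nn_integral_bracket_half[OF assms]
    using assms by (subst ennreal_mult) auto
  finally show ?thesis by simp
qed

lemma nn_integral_bracket_subst_incr:
  assumes "\<beta> > 1" "a \<le> b"
    and deriv: "\<And>x. x \<in> {a..b} \<Longrightarrow> (g has_real_derivative g' x) (at x)"
    and cont: "continuous_on {a..b} g'"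
    and nn: "\<And>x. x \<in> {a..b} \<Longrightarrow> 0 \<le> g' x"
  shows "(\<integral>\<^sup>+x. ennreal (bracket (g x) powr - \<beta> * \<bar>g' x\<bar>) * indicator {a..b} x \<partial>lborel) \<le> ennreal (2 / (\<beta> - 1))"
proof -
  have "(\<integral>\<^sup>+x. ennreal (bracket (g x) powr - \<beta> * \<bar>g' x\<bar>) * indicator {a..b} x \<partial>lborel) =
    (\<integral>\<^sup>+x. ennreal (bracket (g x) powr - \<beta> * g' x * indicator {a..b} x) \<partial>lborel)"
    by (intro nn_integral_cong) (use nn in \<open>auto split: split_indicator\<close>)
  also have "\<dots> = (\<integral>\<^sup>+x. ennreal (bracket x powr - \<beta> * indicator {g a..g b} x) \<partial>lborel)"
    by (rule nn_integral_substitution[symmetric, OF _ deriv cont nn \<open>a \<le> b\<close>])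
       (auto simp: set_borel_measurable_def)
  also have "\<dots> \<le> (\<integral>\<^sup>+x. ennreal (bracket x powr - \<beta>) \<partial>lborel)"
    by (intro nn_integral_mono) (auto split: split_indicator)
  also have "\<dots> \<le> ennreal (2 / (\<beta> - 1))"
    by (rule nn_integral_bracket_powr) fact
  finally show ?thesis .
qed

text \<open>The substitution \<open>t = g x\<close> loses nothing on an interval where \<open>g\<close> is monotone, and the bound does not see
the interval; this is how every oscillating factor below is integrated.\<close>

lemma nn_integral_bracket_subst:
  assumes "\<beta> > 1"
    and deriv: "\<And>x. x \<in> {a..b} \<Longrightarrow> (g has_real_derivative g' x) (at x)"
    and cont: "continuous_on {a..b} g'"
    and nn: "(\<forall>x \<in> {a..b}. 0 \<le> g' x) \<or> (\<forall>x \<in> {a..b}. g' x \<le> 0)"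
  shows "(\<integral>\<^sup>+x. ennreal (bracket (g x) powr - \<beta> * \<bar>g' x\<bar>) * indicator {a..b} x \<partial>lborel) \<le> ennreal (2 / (\<beta> - 1))"
proof (cases "a \<le> b")
  case True
  from nn show ?thesis
  proof
    assume "\<forall>x \<in> {a..b}. 0 \<le> g' x"
    then show ?thesis
      by (intro nn_integral_bracket_subst_incr assms True) auto
  next
    assume *: "\<forall>x \<in> {a..b}. g' x \<le> 0"
    have "(\<integral>\<^sup>+x. ennreal (bracket (- g x) powr - \<beta> * \<bar>- g' x\<bar>) * indicator {a..b} x \<partial>lborel) \<le> ennreal (2 / (\<beta> - 1))"
      by (intro nn_integral_bracket_subst_incr assms True)
         (use * deriv cont in \<open>auto intro!: derivative_eq_intros continuous_intros\<close>)
    then show ?thesis by simp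
  qed
qed auto

text \<open>One of \<open>\<bar>x\<bar>\<close> and \<open>\<bar>y\<bar>\<close> is at least half of \<open>\<bar>x + y\<bar>\<close>, so one of the two factors can be replaced by the
bracket of the sum.\<close>

lemma bracket_conv_pointwise:
  assumes "\<beta> > 0"
  shows "bracket x powr - \<beta> * bracket y powr - \<beta> \<le> 2 powr \<beta> * bracket (x + y) powr - \<beta> * (bracket x powr - \<beta> + bracket y powr - \<beta>)"
proof -
  have main: "bracket x powr - \<beta> \<le> 2 powr \<beta> * bracket (x + y) powr - \<beta>" if "\<bar>y\<bar> \<le> \<bar>x\<bar>" for x y :: real
  proof -
    have "bracket (x + y) / 2 \<le> bracket x" using that by (simp add: bracket_def)
    then have "bracket x powr - \<beta> \<le> (bracket (x + y) / 2) powr - \<beta>"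
      using assms by (intro powr_mono2') auto
    also have "\<dots> = 2 powr \<beta> * bracket (x + y) powr - \<beta>"
      by (simp add: powr_divide powr_minus field_simps)
    finally show ?thesis .
  qed
  show ?thesis
  proof (cases "\<bar>y\<bar> \<le> \<bar>x\<bar>")
    case True
    have "bracket x powr - \<beta> * bracket y powr - \<beta> \<le> 2 powr \<beta> * bracket (x + y) powr - \<beta> * bracket y powr - \<beta>"
      by (intro mult_right_mono main True) auto
    also have "\<dots> \<le> 2 powr \<beta> * bracket (x + y) powr - \<beta> * (bracket x powr - \<beta> + bracket y powr - \<beta>)"
      by (intro mult_left_mono) auto
    finally show ?thesis .
  next
    case False
    have "bracket y powr - \<beta> * bracket x powr - \<beta> \<le> 2 powr \<beta> * bracket (y + x) powr - \<beta> * bracket x powr - \<beta>"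
      using False by (intro mult_right_mono main) auto
    also have "\<dots> \<le> 2 powr \<beta> * bracket (x + y) powr - \<beta> * (bracket x powr - \<beta> + bracket y powr - \<beta>)"
      by (subst add.commute, intro mult_left_mono) auto
    finally show ?thesis by (simp add: mult.commute)
  qed
qed

lemma nn_integral_translate:
  fixes f :: "'a::euclidean_space \<Rightarrow> ennreal"
  assumes [measurable]: "f \<in> borel_measurable borel"
  shows "(\<integral>\<^sup>+x. f (x + a) \<partial>lborel) = (\<integral>\<^sup>+x. f x \<partial>lborel)"
    and "(\<integral>\<^sup>+x. f (a + x) \<partial>lborel) = (\<integral>\<^sup>+x. f x \<partial>lborel)"
    and "(\<integral>\<^sup>+x. f (x - a) \<partial>lborel) = (\<integral>\<^sup>+x. f x \<partial>lborel)"
    and "(\<integral>\<^sup>+x. f (a - x) \<partial>lborel) = (\<integral>\<^sup>+x. f x \<partial>lborel)"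
    and "(\<integral>\<^sup>+x. f (- x) \<partial>lborel) = (\<integral>\<^sup>+x. f x \<partial>lborel)"
proof -
  have p: "(\<integral>\<^sup>+x. f x \<partial>lborel) = (\<integral>\<^sup>+x. f (b + x) \<partial>lborel)" for b
    by (subst lborel_affine[of 1 b]) (simp_all add: nn_integral_density nn_integral_distr)
  have m: "(\<integral>\<^sup>+x. f x \<partial>lborel) = (\<integral>\<^sup>+x. f (b - x) \<partial>lborel)" for b
    by (subst lborel_affine[of "-1" b]) (simp_all add: nn_integral_density nn_integral_distr)
  show "(\<integral>\<^sup>+x. f (x + a) \<partial>lborel) = (\<integral>\<^sup>+x. f x \<partial>lborel)" using p[of a] by (simp add: add.commute)
  show "(\<integral>\<^sup>+x. f (a + x) \<partial>lborel) = (\<integral>\<^sup>+x. f x \<partial>lborel)" using p[of a] by simp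
  show "(\<integral>\<^sup>+x. f (x - a) \<partial>lborel) = (\<integral>\<^sup>+x. f x \<partial>lborel)" using p[of "- a"] by simp
  show "(\<integral>\<^sup>+x. f (a - x) \<partial>lborel) = (\<integral>\<^sup>+x. f x \<partial>lborel)" using m[of a] by simp
  show "(\<integral>\<^sup>+x. f (- x) \<partial>lborel) = (\<integral>\<^sup>+x. f x \<partial>lborel)" using m[of 0] by simp
qed

text \<open>This is the integration over \<open>\<tau>\<close>: two modulations are combined into one.\<close>

lemma nn_integral_bracket_conv:
  assumes "\<beta> > 1"
  shows "(\<integral>\<^sup>+t. ennreal (bracket (t - a) powr - \<beta> * bracket (c - t) powr - \<beta>) \<partial>lborel)
     \<le> ennreal (2 powr \<beta> * 4 / (\<beta> - 1) * bracket (c - a) powr - \<beta>)"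
proof -
  let ?K = "2 powr \<beta> * bracket (c - a) powr - \<beta>"
  have "(\<integral>\<^sup>+t. ennreal (bracket (t - a) powr - \<beta> * bracket (c - t) powr - \<beta>) \<partial>lborel) \<le>
    (\<integral>\<^sup>+t. ennreal ?K * (ennreal (bracket (t - a) powr - \<beta>) + ennreal (bracket (c - t) powr - \<beta>)) \<partial>lborel)"
  proof (intro nn_integral_mono)
    fix t
    show "ennreal (bracket (t - a) powr - \<beta> * bracket (c - t) powr - \<beta>) \<le>
      ennreal ?K * (ennreal (bracket (t - a) powr - \<beta>) + ennreal (bracket (c - t) powr - \<beta>))"
      using bracket_conv_pointwise[of \<beta> "t - a" "c - t"] assms
      by (auto simp flip: ennreal_plus ennreal_mult intro!: ennreal_leI)
  qed
  also have "\<dots> = ennreal ?K * ((\<integral>\<^sup>+t. ennreal (bracket (t - a) powr - \<beta>) \<partial>lborel) + (\<integral>\<^sup>+t. ennreal (bracket (c - t) powr - \<beta>) \<partial>lborel))"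
    by (subst nn_integral_cmult) (auto simp: nn_integral_add)
  also have "\<dots> = ennreal ?K * ((\<integral>\<^sup>+t. ennreal (bracket t powr - \<beta>) \<partial>lborel) + (\<integral>\<^sup>+t. ennreal (bracket t powr - \<beta>) \<partial>lborel))"
    using nn_integral_translate(3)[of "\<lambda>t. ennreal (bracket t powr - \<beta>)" a]
       nn_integral_translate(4)[of "\<lambda>t. ennreal (bracket t powr - \<beta>)" c] by simp
  also have "\<dots> \<le> ennreal ?K * (ennreal (2 / (\<beta> - 1)) + ennreal (2 / (\<beta> - 1)))"
    by (intro mult_left_mono add_mono nn_integral_bracket_powr assms) auto
  also have "\<dots> = ennreal (?K * (2 / (\<beta> - 1) + 2 / (\<beta> - 1)))"
    using assms by (simp add: ennreal_mult[symmetric] flip: ennreal_plus)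
  also have "?K * (2 / (\<beta> - 1) + 2 / (\<beta> - 1)) = 2 powr \<beta> * 4 / (\<beta> - 1) * bracket (c - a) powr - \<beta>"
    by simp
  finally show ?thesis .
qed

text \<open>For \<open>\<bar>y\<bar> \<le> sqrt \<langle>B\<rangle> / 2\<close> the square cannot cancel \<open>B\<close>, and the interval has length comparable to
\<open>sqrt \<langle>B\<rangle>\<close>. Beyond it the derivative \<open>2 y\<close> of the argument is at least \<open>sqrt \<langle>B\<rangle>\<close>, so substituting the argument
gains that factor.\<close>

lemma nn_integral_bracket_square_aux:
  assumes "\<beta> > 1"
  shows "(\<integral>\<^sup>+y. ennreal (bracket (B + y\<^sup>2) powr - \<beta>) * indicator {0..} y \<partial>lborel) \<le> ennreal ((2 powr \<beta> + 2 / (\<beta> - 1)) * bracket B powr - (1 / 2))"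
proof -
  \<comment> \<open>the two halves of the integral meet where \<open>2 y = sqrt \<langle>B\<rangle>\<close>\<close>
  define s where "s = sqrt (bracket B) / 2"
  have s: "s > 0" by (simp add: s_def)
  have ssq: "s\<^sup>2 = bracket B / 4" by (simp add: s_def power_divide)
  have near: "(\<integral>\<^sup>+y. ennreal (bracket (B + y\<^sup>2) powr - \<beta>) * indicator {0..s} y \<partial>lborel) \<le> ennreal (2 powr \<beta> * bracket B powr - (1 / 2))"
  proof -
    have "(\<integral>\<^sup>+y. ennreal (bracket (B + y\<^sup>2) powr - \<beta>) * indicator {0..s} y \<partial>lborel) \<le>
       (\<integral>\<^sup>+y. ennreal (2 powr \<beta> * bracket B powr - \<beta>) * indicator {0..s} y \<partial>lborel)"
    proof (intro nn_integral_mono)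
      fix y :: real
      show "ennreal (bracket (B + y\<^sup>2) powr - \<beta>) * indicator {0..s} y \<le> ennreal (2 powr \<beta> * bracket B powr - \<beta>) * indicator {0..s} y"
      proof (cases "y \<in> {0..s}")
        case True
        then have "y\<^sup>2 \<le> s\<^sup>2" by (intro power_mono) auto
        then have "y\<^sup>2 \<le> bracket B / 4" by (simp add: ssq)
        then have "bracket B / 2 \<le> bracket (B + y\<^sup>2)"
        proof -
          have "\<bar>B\<bar> - y\<^sup>2 \<le> \<bar>B + y\<^sup>2\<bar>" using zero_le_power2[of y] by linarith
          moreover have "(1 + a) / 2 \<le> 1 + b" if "w \<le> (1 + a) / 4" "a - w \<le> b" "0 \<le> a" for a b w :: real
            using that by simp
          ultimately show ?thesis using \<open>y\<^sup>2 \<le> bracket B / 4\<close> unfolding bracket_def by (metis abs_ge_zero)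
        qed
        then have "bracket (B + y\<^sup>2) powr - \<beta> \<le> (bracket B / 2) powr - \<beta>"
          using assms by (intro powr_mono2') auto
        also have "\<dots> = 2 powr \<beta> * bracket B powr - \<beta>"
          by (simp add: powr_divide powr_minus field_simps)
        finally show ?thesis using True by (auto intro!: ennreal_leI)
      qed auto
    qed
    also have "\<dots> = ennreal (2 powr \<beta> * bracket B powr - \<beta> * s)"
      using s by (simp add: nn_integral_cmult ennreal_mult)
    also have "\<dots> \<le> ennreal (2 powr \<beta> * bracket B powr - (1 / 2))"
    proof (rule ennreal_leI)
      have "bracket B powr - \<beta> * s = bracket B powr (1 / 2 - \<beta>) / 2"
        by (simp add: s_def powr_half_sqrt[symmetric] flip: powr_add)
      also have "\<dots> \<le> bracket B powr (- (1 / 2)) / 2"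
        using assms by (intro divide_right_mono powr_mono bracket_ge_1) auto
      also have "\<dots> \<le> bracket B powr (- (1 / 2))" by simp
      finally show "2 powr \<beta> * bracket B powr - \<beta> * s \<le> 2 powr \<beta> * bracket B powr - (1 / 2)"
        by (simp add: mult.assoc)
    qed
    finally show ?thesis .
  qed
  have far_n: "(\<integral>\<^sup>+y. ennreal (bracket (B + y\<^sup>2) powr - \<beta>) * indicator {s..s + real n} y \<partial>lborel) \<le> ennreal (2 / (\<beta> - 1) * bracket B powr - (1 / 2))" for n
  proof -
    have "(\<integral>\<^sup>+y. ennreal (bracket (B + y\<^sup>2) powr - \<beta>) * indicator {s..s + real n} y \<partial>lborel) \<le>
      (\<integral>\<^sup>+y. ennreal (bracket B powr - (1/2)) * (ennreal (bracket (B + y\<^sup>2) powr - \<beta> * \<bar>2 * y\<bar>) * indicator {s..s + real n} y) \<partial>lborel)"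
    proof (intro nn_integral_mono)
      fix y
      show "ennreal (bracket (B + y\<^sup>2) powr - \<beta>) * indicator {s..s + real n} y \<le>
        ennreal (bracket B powr - (1/2)) * (ennreal (bracket (B + y\<^sup>2) powr - \<beta> * \<bar>2 * y\<bar>) * indicator {s..s + real n} y)"
      proof (cases "y \<in> {s..s + real n}")
        case True
        then have y: "s \<le> y" by auto
        have "1 = bracket B powr - (1/2) * sqrt (bracket B)"
          by (simp add: powr_half_sqrt[symmetric] flip: powr_add)
        also have "\<dots> \<le> bracket B powr - (1/2) * \<bar>2 * y\<bar>"
          using y s by (intro mult_left_mono) (auto simp: s_def)
        finally have "bracket (B + y\<^sup>2) powr - \<beta> * 1 \<le> bracket (B + y\<^sup>2) powr - \<beta> * (bracket B powr - (1/2) * \<bar>2 * y\<bar>)"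
          by (intro mult_left_mono) auto
        then show ?thesis using True
          by (auto simp flip: ennreal_mult intro!: ennreal_leI simp: mult_ac)
      qed auto
    qed
    also have "\<dots> = ennreal (bracket B powr - (1/2)) * (\<integral>\<^sup>+y. (ennreal (bracket (B + y\<^sup>2) powr - \<beta> * \<bar>2 * y\<bar>) * indicator {s..s + real n} y) \<partial>lborel)"
      by (rule nn_integral_cmult) measurable
    also have "\<dots> \<le> ennreal (bracket B powr - (1/2)) * ennreal (2 / (\<beta> - 1))"
      by (intro mult_left_mono nn_integral_bracket_subst assms)
         (use s in \<open>auto intro!: derivative_eq_intros continuous_intros\<close>)
    also have "\<dots> = ennreal (2 / (\<beta> - 1) * bracket B powr - (1 / 2))"
      using assms by (simp add: ennreal_mult[symmetric] mult.commute)
    finally show ?thesis .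
  qed
  have far: "(\<integral>\<^sup>+y. ennreal (bracket (B + y\<^sup>2) powr - \<beta>) * indicator {s..} y \<partial>lborel) \<le> ennreal (2 / (\<beta> - 1) * bracket B powr - (1 / 2))"
  proof -
    have "(\<integral>\<^sup>+y. ennreal (bracket (B + y\<^sup>2) powr - \<beta>) * indicator {s..} y \<partial>lborel) =
       (\<integral>\<^sup>+y. (SUP n. ennreal (bracket (B + y\<^sup>2) powr - \<beta>) * indicator {s..s + real n} y) \<partial>lborel)"
    proof (intro nn_integral_cong antisym)
      fix y
      obtain n where "y \<le> s + real n" using real_arch_simple[of "y - s"] by (auto simp: algebra_simps)
      then have "ennreal (bracket (B + y\<^sup>2) powr - \<beta>) * indicator {s..} y \<le> ennreal (bracket (B + y\<^sup>2) powr - \<beta>) * indicator {s..s + real n} y"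
        by (auto split: split_indicator)
      also have "\<dots> \<le> (SUP n. ennreal (bracket (B + y\<^sup>2) powr - \<beta>) * indicator {s..s + real n} y)"
        by (rule SUP_upper) auto
      finally show "ennreal (bracket (B + y\<^sup>2) powr - \<beta>) * indicator {s..} y \<le> (SUP n. ennreal (bracket (B + y\<^sup>2) powr - \<beta>) * indicator {s..s + real n} y)" .
    qed (auto intro!: SUP_least split: split_indicator)
    also have "\<dots> = (SUP n. (\<integral>\<^sup>+y. ennreal (bracket (B + y\<^sup>2) powr - \<beta>) * indicator {s..s + real n} y \<partial>lborel))"
      by (rule nn_integral_monotone_convergence_SUP) (auto simp: incseq_def le_fun_def split: split_indicator)
    also have "\<dots> \<le> ennreal (2 / (\<beta> - 1) * bracket B powr - (1 / 2))"
      by (intro SUP_least far_n)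
    finally show ?thesis .
  qed
  have "(\<integral>\<^sup>+y. ennreal (bracket (B + y\<^sup>2) powr - \<beta>) * indicator {0..} y \<partial>lborel) \<le>
    (\<integral>\<^sup>+y. ennreal (bracket (B + y\<^sup>2) powr - \<beta>) * indicator {0..s} y + ennreal (bracket (B + y\<^sup>2) powr - \<beta>) * indicator {s..} y \<partial>lborel)"
    by (intro nn_integral_mono) (auto split: split_indicator)
  also have "\<dots> = (\<integral>\<^sup>+y. ennreal (bracket (B + y\<^sup>2) powr - \<beta>) * indicator {0..s} y \<partial>lborel) + (\<integral>\<^sup>+y. ennreal (bracket (B + y\<^sup>2) powr - \<beta>) * indicator {s..} y \<partial>lborel)"
    by (rule nn_integral_add) auto
  also have "\<dots> \<le> ennreal (2 powr \<beta> * bracket B powr - (1 / 2)) + ennreal (2 / (\<beta> - 1) * bracket B powr - (1 / 2))"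
    by (intro add_mono near far)
  also have "\<dots> = ennreal ((2 powr \<beta> + 2 / (\<beta> - 1)) * bracket B powr - (1 / 2))"
    using assms by (simp add: algebra_simps flip: ennreal_plus)
  finally show ?thesis .
qed

definition sq_const :: "real \<Rightarrow> real" where "sq_const \<beta> = 2 * (2 powr \<beta> + 2 / (\<beta> - 1))"

lemma sq_const_nonneg: "\<beta> > 1 \<Longrightarrow> 0 \<le> sq_const \<beta>" by (simp add: sq_const_def)

lemma nn_integral_bracket_square:
  assumes "\<beta> > 1"
  shows "(\<integral>\<^sup>+y. ennreal (bracket (B + y\<^sup>2) powr - \<beta>) \<partial>lborel) \<le> ennreal (sq_const \<beta> * bracket B powr - (1 / 2))"
proof -
  have "(\<integral>\<^sup>+y. ennreal (bracket (B + y\<^sup>2) powr - \<beta>) \<partial>lborel) \<le> 2 * (\<integral>\<^sup>+y. ennreal (bracket (B + y\<^sup>2) powr - \<beta>) * indicator {0..} y \<partial>lborel)"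
    by (rule nn_integral_even) auto
  also have "\<dots> \<le> 2 * ennreal ((2 powr \<beta> + 2 / (\<beta> - 1)) * bracket B powr - (1 / 2))"
    by (intro mult_left_mono nn_integral_bracket_square_aux assms) auto
  also have "\<dots> = ennreal (sq_const \<beta> * bracket B powr - (1 / 2))"
    unfolding sq_const_def mult.assoc by (metis ennreal_mult' ennreal_numeral zero_le_numeral)
  finally show ?thesis .
qed

text \<open>This is the integration over \<open>\<eta>\<close>: the sum of two modulations with given total frequency is a quadratic
polynomial in \<open>\<eta>\<close>, and scaling reduces it to \<open>B + y\<^sup>2\<close>.\<close>

lemma nn_integral_bracket_quadratic:
  assumes "\<beta> > 1" "c \<noteq> 0"
  shows "(\<integral>\<^sup>+y. ennreal (bracket (B + c * (y - y0)\<^sup>2) powr - \<beta>) \<partial>lborel) \<le> ennreal (sq_const \<beta> * \<bar>c\<bar> powr - (1 / 2) * bracket B powr - (1 / 2))"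
proof -
  define d where "d = sqrt \<bar>c\<bar>"
  have d: "d > 0" "d\<^sup>2 = \<bar>c\<bar>" using assms by (auto simp: d_def)
  have dp: "\<bar>c\<bar> powr - (1 / 2) = 1 / d"
    using assms by (simp add: d_def powr_half_sqrt[symmetric] powr_minus field_simps)
  have *: "bracket (B + c * (y0 + 1 / d * y - y0)\<^sup>2) = bracket (sgn c * B + y\<^sup>2)" for y
  proof -
    have "c * (y0 + 1 / d * y - y0)\<^sup>2 = sgn c * y\<^sup>2"
      using d assms by (simp add: power_divide) (metis abs_0_eq mult.commute nonzero_mult_div_cancel_left sgn_mult_abs times_divide_eq_left)
    then show ?thesis using assms
      by (cases "c > 0") (auto simp: sgn_if bracket_def abs_minus_commute)
  qed
  have "(\<integral>\<^sup>+y. ennreal (bracket (B + c * (y - y0)\<^sup>2) powr - \<beta>) \<partial>lborel) =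
    ennreal \<bar>1 / d\<bar> * (\<integral>\<^sup>+y. ennreal (bracket (B + c * (y0 + 1 / d * y - y0)\<^sup>2) powr - \<beta>) \<partial>lborel)"
    by (rule nn_integral_real_affine) (use d in auto)
  also have "\<dots> = ennreal (1 / d) * (\<integral>\<^sup>+y. ennreal (bracket (sgn c * B + y\<^sup>2) powr - \<beta>) \<partial>lborel)"
    using d unfolding * by simp
  also have "\<dots> \<le> ennreal (1 / d) * ennreal (sq_const \<beta> * bracket (sgn c * B) powr - (1 / 2))"
    by (intro mult_left_mono nn_integral_bracket_square assms) auto
  also have "bracket (sgn c * B) = bracket B"
    using assms by (auto simp: sgn_if)
  finally show ?thesis using d sq_const_nonneg[OF assms(1)]
    by (simp add: dp ennreal_mult[symmetric] mult_ac)
qed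

section \<open>Integrals along the phase on a line\<close>

lemma nn_integral_lin4:
  fixes f g h k :: "'a \<Rightarrow> ennreal"
  assumes "f \<in> borel_measurable M" "g \<in> borel_measurable M" "h \<in> borel_measurable M" "k \<in> borel_measurable M"
  shows "(\<integral>\<^sup>+x. a * f x + b * g x + (c * h x + d * k x) \<partial>M) =
    a * (\<integral>\<^sup>+x. f x \<partial>M) + b * (\<integral>\<^sup>+x. g x \<partial>M) + (c * (\<integral>\<^sup>+x. h x \<partial>M) + d * (\<integral>\<^sup>+x. k x \<partial>M))"
  using assms by (simp add: nn_integral_add nn_integral_cmult)

lemma inverse_square_le_1:
  fixes y :: real
  assumes "1 \<le> \<bar>y\<bar>"
  shows "1 / y\<^sup>2 \<le> 1"
proof -
  have "1 \<le> y\<^sup>2" using one_le_power[OF assms, of 2] by simp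
  then have "0 < y\<^sup>2" by linarith
  with \<open>1 \<le> y\<^sup>2\<close> show ?thesis by (subst divide_le_eq_1_pos)
qed

lemma nn_integral_abs_powr:
  fixes s c :: real
  assumes "s < 1" "0 \<le> c"
  shows "(\<integral>\<^sup>+x. ennreal (\<bar>x\<bar> powr - s) * indicator {-c..c} x \<partial>lborel) \<le> ennreal (2 * (c powr (1 - s) / (1 - s)))"
proof -
  have "(\<integral>\<^sup>+x. ennreal (\<bar>x\<bar> powr - s) * indicator {-c..c} x \<partial>lborel) \<le>
    2 * (\<integral>\<^sup>+x. ennreal (\<bar>x\<bar> powr - s) * indicator {-c..c} x * indicator {0..} x \<partial>lborel)"
    by (rule nn_integral_even) (auto split: split_indicator)
  also have "(\<integral>\<^sup>+x. ennreal (\<bar>x\<bar> powr - s) * indicator {-c..c} x * indicator {0..} x \<partial>lborel) =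
     (\<integral>\<^sup>+x. ennreal (if x \<in> {0..c} then x powr - s else 0) \<partial>lborel)"
    using assms by (intro nn_integral_cong) (auto split: split_indicator)
  also have "\<dots> = ennreal (c powr (1 - s) / (1 - s))"
  proof (rule nn_integral_has_integral_lborel)
    have "((\<lambda>x. x powr - s) has_integral (c powr (- s + 1) / (- s + 1))) {0..c}"
      by (rule has_integral_powr_from_0) (use assms in auto)
    then show "((\<lambda>x. if x \<in> {0..c} then x powr - s else 0) has_integral (c powr (1 - s) / (1 - s))) UNIV"
      unfolding has_integral_restrict_UNIV by (simp add: add.commute[of "- s"])
  qed auto
  also have "2 * ennreal (c powr (1 - s) / (1 - s)) = ennreal (2 * (c powr (1 - s) / (1 - s)))"
    by (metis ennreal_mult' ennreal_numeral zero_le_numeral)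
  finally show ?thesis .
qed

text \<open>The part of the sum of two phases that remains after completing the square in \<open>\<eta>\<close>; \<open>p\<close> and \<open>r - p\<close> are the
two \<open>\<xi>\<close>-frequencies.\<close>

definition Psi :: "real \<Rightarrow> real \<Rightarrow> real" where
  "Psi r p = p ^ 3 + (r - p) ^ 3 - 1 / p - 1 / (r - p)"

text \<open>The derivative of \<open>Psi r\<close>, factored so that its sign can be read off where \<open>\<bar>p * (r - p)\<bar> \<ge> 1\<close>.\<close>

definition Psi' :: "real \<Rightarrow> real \<Rightarrow> real" where
  "Psi' r p = (p\<^sup>2 - (r - p)\<^sup>2) * (3 - 1 / (p * (r - p))\<^sup>2)"

lemma Psi_measurable [measurable]: "(\<lambda>p. Psi r p) \<in> borel_measurable borel"
  unfolding Psi_def by measurable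
lemma Psi'_measurable [measurable]: "(\<lambda>p. Psi' r p) \<in> borel_measurable borel"
  unfolding Psi'_def by measurable

lemma DERIV_Psi:
  assumes "p \<noteq> 0" "p \<noteq> r"
  shows "((\<lambda>p. a - Psi r p) has_real_derivative - Psi' r p) (at p)"
proof -
  have "((\<lambda>p. a - Psi r p) has_real_derivative - (3 * p\<^sup>2 - 3 * (r - p)\<^sup>2 + 1 / p\<^sup>2 - 1 / (r - p)\<^sup>2)) (at p)"
    unfolding Psi_def using assms
    by (auto intro!: derivative_eq_intros simp: power2_eq_square)
  moreover have "3 * p\<^sup>2 - 3 * q\<^sup>2 + 1 / p\<^sup>2 - 1 / q\<^sup>2 = (p\<^sup>2 - q\<^sup>2) * (3 - 1 / (p * q)\<^sup>2)" if "q \<noteq> 0" for q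
    using that assms by (simp add: field_simps power_mult_distrib)
  ultimately show ?thesis using assms by (simp add: Psi'_def)
qed

lemma continuous_on_Psi':
  assumes "\<And>p. p \<in> S \<Longrightarrow> p \<noteq> 0 \<and> p \<noteq> r"
  shows "continuous_on S (\<lambda>p. - Psi' r p)"
proof -
  have "0 \<notin> S" "r \<notin> S" using assms by blast+
  then show ?thesis unfolding Psi'_def by (auto intro!: continuous_intros)
qed

text \<open>Where \<open>\<bar>p * (r - p)\<bar> \<ge> 1\<close> the last factor of \<open>Psi'\<close> is at least \<open>2\<close>, so \<open>Psi\<close> is monotone as long as
\<open>p\<^sup>2 - (r - p)\<^sup>2\<close> keeps its sign, and \<open>Psi\<close> can be used as the variable of integration.\<close>

lemma nn_integral_Psi:
  assumes "\<beta> > 1"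
    and "\<And>p. p \<in> {u..v} \<Longrightarrow> p \<noteq> 0 \<and> p \<noteq> r"
    and "\<And>p. p \<in> {u..v} \<Longrightarrow> 1 \<le> \<bar>p * (r - p)\<bar>"
    and "(\<forall>p \<in> {u..v}. p\<^sup>2 \<le> (r - p)\<^sup>2) \<or> (\<forall>p \<in> {u..v}. (r - p)\<^sup>2 \<le> p\<^sup>2)"
  shows "(\<integral>\<^sup>+p. ennreal (bracket (a - Psi r p) powr - \<beta> * \<bar>Psi' r p\<bar>) * indicator {u..v} p \<partial>lborel) \<le> ennreal (2 / (\<beta> - 1))"
proof -
  have pos: "0 \<le> 3 - 1 / (p * (r - p))\<^sup>2" if "p \<in> {u..v}" for p
  proof -
    have "1 / (p * (r - p))\<^sup>2 \<le> 1" using assms(3)[OF that] by (rule inverse_square_le_1)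
    then show ?thesis by linarith
  qed
  have "(\<integral>\<^sup>+p. ennreal (bracket (a - Psi r p) powr - \<beta> * \<bar>- Psi' r p\<bar>) * indicator {u..v} p \<partial>lborel) \<le> ennreal (2 / (\<beta> - 1))"
  proof (rule nn_integral_bracket_subst[OF assms(1)])
    show "((\<lambda>p. a - Psi r p) has_real_derivative - Psi' r x) (at x)" if "x \<in> {u..v}" for x
      using assms(2)[OF that] by (intro DERIV_Psi) auto
    show "continuous_on {u..v} (\<lambda>p. - Psi' r p)"
      using assms(2) by (intro continuous_on_Psi') auto
    show "(\<forall>x\<in>{u..v}. 0 \<le> - Psi' r x) \<or> (\<forall>x\<in>{u..v}. - Psi' r x \<le> 0)"
      using assms(4)
    proof
      assume *: "\<forall>p \<in> {u..v}. p\<^sup>2 \<le> (r - p)\<^sup>2"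
      show ?thesis
      proof (intro disjI1 ballI)
        fix x assume x: "x \<in> {u..v}"
        with * pos[OF x] show "0 \<le> - Psi' r x"
          unfolding Psi'_def by (simp add: mult_nonpos_nonneg)
      qed
    next
      assume *: "\<forall>p \<in> {u..v}. (r - p)\<^sup>2 \<le> p\<^sup>2"
      show ?thesis
      proof (intro disjI2 ballI)
        fix x assume x: "x \<in> {u..v}"
        with * pos[OF x] show "- Psi' r x \<le> 0"
          unfolding Psi'_def by simp
      qed
    qed
  qed
  then show ?thesis by simp
qed

lemma abs_Psi'_ge:
  assumes "1 \<le> \<bar>p * (r - p)\<bar>"
  shows "2 * (\<bar>r\<bar> * \<bar>2 * p - r\<bar>) \<le> \<bar>Psi' r p\<bar>"
proof -
  have "1 / (p * (r - p))\<^sup>2 \<le> 1" using assms by (rule inverse_square_le_1)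
  then have "2 \<le> \<bar>3 - 1 / (p * (r - p))\<^sup>2\<bar>" by linarith
  then have "\<bar>p\<^sup>2 - (r - p)\<^sup>2\<bar> * 2 \<le> \<bar>p\<^sup>2 - (r - p)\<^sup>2\<bar> * \<bar>3 - 1 / (p * (r - p))\<^sup>2\<bar>"
    by (intro mult_left_mono) auto
  moreover have "p\<^sup>2 - (r - p)\<^sup>2 = r * (2 * p - r)" by (simp add: power2_eq_square algebra_simps)
  ultimately show ?thesis unfolding Psi'_def by (simp add: abs_mult)
qed

section \<open>The high-low integrand\<close>

text \<open>The square of the high-low kernel after the integrations over \<open>\<tau>\<close> and \<open>\<eta>\<close>, with total \<open>\<xi>\<close>-frequency \<open>r\<close>.\<close>

definition hl_integrand :: "real \<Rightarrow> real \<Rightarrow> real \<Rightarrow> real" where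
  "hl_integrand r a p = (if \<bar>p\<bar> \<le> \<bar>r\<bar> / 4 then \<bar>r\<bar> powr (1/2) / \<bar>p\<bar> else 0) *
      \<bar>p * (r - p) / r\<bar> powr (1/2) * bracket (a - Psi r p) powr - (1/2)"

lemma hl_base:
  assumes "r \<noteq> 0" "\<bar>p\<bar> \<le> \<bar>r\<bar> / 4" "p \<noteq> 0"
  shows "hl_integrand r a p \<le> 2 * \<bar>r\<bar> powr (1/2) * \<bar>p\<bar> powr - (1/2) * bracket (a - Psi r p) powr - (1/2)"
proof -
  have "\<bar>r - p\<bar> \<le> 4 * \<bar>r\<bar>" using assms by linarith
  then have "\<bar>p\<bar> * (\<bar>r - p\<bar> / \<bar>r\<bar>) \<le> \<bar>p\<bar> * 4"
    using assms by (intro mult_left_mono) (auto simp: divide_le_eq)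
  then have "\<bar>p * (r - p) / r\<bar> \<le> 4 * \<bar>p\<bar>"
    by (simp add: abs_mult mult.commute)
  then have "\<bar>p * (r - p) / r\<bar> powr (1/2) \<le> (4 * \<bar>p\<bar>) powr (1/2)"
    by (intro powr_mono2) auto
  also have "\<dots> = 2 * \<bar>p\<bar> powr (1/2)" by (simp add: powr_mult powr_half_sqrt)
  finally have *: "\<bar>p * (r - p) / r\<bar> powr (1/2) \<le> 2 * \<bar>p\<bar> powr (1/2)" .
  have **: "\<bar>p\<bar> powr (1/2) / \<bar>p\<bar> = \<bar>p\<bar> powr - (1/2)"
    using assms powr_diff[of "\<bar>p\<bar>" "1/2" 1] by simp
  have "hl_integrand r a p \<le> (\<bar>r\<bar> powr (1/2) / \<bar>p\<bar>) * (2 * \<bar>p\<bar> powr (1/2)) * bracket (a - Psi r p) powr - (1/2)"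
    unfolding hl_integrand_def using assms * by (intro mult_right_mono mult_mono) auto
  also have "\<dots> = 2 * \<bar>r\<bar> powr (1/2) * (\<bar>p\<bar> powr (1/2) / \<bar>p\<bar>) * bracket (a - Psi r p) powr - (1/2)"
    by simp
  finally show ?thesis unfolding ** .
qed

text \<open>The hyperbola \<open>\<bar>p * (r - p)\<bar> = 1\<close> is avoided once \<open>\<bar>p\<bar> \<ge> 4 / \<bar>r\<bar>\<close>, and there the derivative of the phase is
as large as \<open>r\<^sup>2\<close>.\<close>

lemma hl_far_geometry:
  assumes "\<bar>p\<bar> \<le> \<bar>r\<bar> / 4" "4 / \<bar>r\<bar> \<le> \<bar>p\<bar>" "r \<noteq> 0"
  shows "p \<noteq> 0" "p \<noteq> r" "1 \<le> \<bar>p * (r - p)\<bar>" "p\<^sup>2 \<le> (r - p)\<^sup>2" "\<bar>r\<bar>\<^sup>2 \<le> \<bar>Psi' r p\<bar>"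
proof -
  have q: "\<bar>r\<bar> / 2 \<le> \<bar>r - p\<bar>" using assms(1) by linarith
  show "p \<noteq> 0" using assms(2,3) by auto
  show "p \<noteq> r" using assms(1,3) by auto
  have "1 \<le> (4 / \<bar>r\<bar>) * (\<bar>r\<bar> / 2)" using assms(3) by simp
  also have "\<dots> \<le> \<bar>p\<bar> * \<bar>r - p\<bar>" using assms q by (intro mult_mono) auto
  finally show 1: "1 \<le> \<bar>p * (r - p)\<bar>" by (simp add: abs_mult)
  have "\<bar>p\<bar> \<le> \<bar>r - p\<bar>" using assms(1) by linarith
  then show "p\<^sup>2 \<le> (r - p)\<^sup>2" by (simp add: abs_le_square_iff)
  have "\<bar>r\<bar>\<^sup>2 = 2 * (\<bar>r\<bar> * (\<bar>r\<bar> / 2))" by (simp add: power2_eq_square)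
  also have "\<dots> \<le> 2 * (\<bar>r\<bar> * \<bar>2 * p - r\<bar>)"
    using assms(1) by (intro mult_left_mono) (auto simp: abs_if split: if_splits)
  also have "\<dots> \<le> \<bar>Psi' r p\<bar>" by (rule abs_Psi'_ge[OF 1])
  finally show "\<bar>r\<bar>\<^sup>2 \<le> \<bar>Psi' r p\<bar>" .
qed

text \<open>Young's inequality with exponents \<open>3 / 2\<close> and \<open>3\<close>. The powers of \<open>\<bar>r\<bar>\<close> are distributed so that the second
term carries \<open>r\<^sup>2\<close>, the lower bound for the derivative of the phase, and the first one is integrable over
\<open>\<bar>p\<bar> \<le> \<bar>r\<bar> / 4\<close> with an integral independent of \<open>r\<close>.\<close>

lemma hl_young:
  assumes "r \<noteq> 0" "p \<noteq> 0"
  shows "\<bar>r\<bar> powr (1/2) * \<bar>p\<bar> powr - (1/2) * bracket A powr - (1/2) \<le>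
    \<bar>r\<bar> powr - (1/4) * \<bar>p\<bar> powr - (3/4) + bracket A powr - (3/2) * \<bar>r\<bar>\<^sup>2"
proof -
  define X where "X = \<bar>r\<bar> powr - (1/6) * \<bar>p\<bar> powr - (1/2)"
  define Y where "Y = \<bar>r\<bar> powr (2/3) * bracket A powr - (1/2)"
  have XY: "X * Y = \<bar>r\<bar> powr (1/2) * \<bar>p\<bar> powr - (1/2) * bracket A powr - (1/2)"
  proof -
    have "X * Y = (\<bar>r\<bar> powr - (1/6) * \<bar>r\<bar> powr (2/3)) * \<bar>p\<bar> powr - (1/2) * bracket A powr - (1/2)"
      by (simp add: X_def Y_def)
    then show ?thesis by (simp flip: powr_add)
  qed
  have X: "X powr (3/2) = \<bar>r\<bar> powr - (1/4) * \<bar>p\<bar> powr - (3/4)"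
    by (simp add: X_def powr_mult powr_powr)
  have Y: "Y powr 3 = bracket A powr - (3/2) * \<bar>r\<bar>\<^sup>2"
  proof -
    have "\<bar>r\<bar> powr 2 = \<bar>r\<bar>\<^sup>2" using assms by (simp add: powr_numeral)
    then show ?thesis by (simp add: Y_def powr_mult powr_powr)
  qed
  have "X * Y \<le> X powr (3/2) / (3/2) + Y powr 3 / 3"
    by (rule Youngs_inequality) (auto simp: X_def Y_def)
  also have "\<dots> \<le> X powr (3/2) + Y powr 3"
    by (intro add_mono) (auto simp: divide_simps)
  finally show ?thesis unfolding XY X Y .
qed

lemma hl_pointwise:
  assumes "r \<noteq> 0"
  shows "ennreal (hl_integrand r a p) \<le>
    ennreal (2 * \<bar>r\<bar> powr (1/2)) * (ennreal (\<bar>p\<bar> powr - (1/2)) * indicator {-(4/\<bar>r\<bar>)..4/\<bar>r\<bar>} p)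
    + ennreal (2 * \<bar>r\<bar> powr - (1/4)) * (ennreal (\<bar>p\<bar> powr - (3/4)) * indicator {-(\<bar>r\<bar>/4)..\<bar>r\<bar>/4} p)
    + (2 * (ennreal (bracket (a - Psi r p) powr - (3/2) * \<bar>Psi' r p\<bar>) * indicator {4/\<bar>r\<bar>..\<bar>r\<bar>/4} p)
      + 2 * (ennreal (bracket (a - Psi r p) powr - (3/2) * \<bar>Psi' r p\<bar>) * indicator {-(\<bar>r\<bar>/4)..-(4/\<bar>r\<bar>)} p))"
    (is "_ \<le> ?A + ?B + (?C + ?D)")
proof (cases "\<bar>p\<bar> \<le> \<bar>r\<bar> / 4 \<and> p \<noteq> 0")
  case False
  then have "hl_integrand r a p = 0" by (auto simp: hl_integrand_def)
  then show ?thesis by simp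
next
  case True
  note base = hl_base[OF assms, of p a]
  show ?thesis
  proof (cases "\<bar>p\<bar> \<le> 4 / \<bar>r\<bar>")
    case near: True
    have "hl_integrand r a p \<le> 2 * \<bar>r\<bar> powr (1/2) * \<bar>p\<bar> powr - (1/2) * bracket (a - Psi r p) powr - (1/2)"
      using base True by auto
    also have "\<dots> \<le> 2 * \<bar>r\<bar> powr (1/2) * \<bar>p\<bar> powr - (1/2) * 1"
      using powr_mono[of "-(1/2)" 0 "bracket (a - Psi r p)"] bracket_ge_1 by (intro mult_left_mono) auto
    finally have "ennreal (hl_integrand r a p) \<le> ?A"
      using near by (auto simp flip: ennreal_mult intro!: ennreal_leI simp: abs_le_iff)
    then show ?thesis by (intro add_increasing2 zero_le)
  next
    case far: False
    have g: "\<bar>r\<bar>\<^sup>2 \<le> \<bar>Psi' r p\<bar>" using hl_far_geometry[of p r] far True assms by auto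
    have "hl_integrand r a p \<le> 2 * (\<bar>r\<bar> powr (1/2) * \<bar>p\<bar> powr - (1/2) * bracket (a - Psi r p) powr - (1/2))"
      using base True by (auto simp: mult.assoc)
    also have "\<dots> \<le> 2 * (\<bar>r\<bar> powr - (1/4) * \<bar>p\<bar> powr - (3/4) + bracket (a - Psi r p) powr - (3/2) * \<bar>r\<bar>\<^sup>2)"
      using hl_young[of r p "a - Psi r p"] assms True by (intro mult_left_mono) auto
    also have "\<dots> \<le> 2 * (\<bar>r\<bar> powr - (1/4) * \<bar>p\<bar> powr - (3/4) + bracket (a - Psi r p) powr - (3/2) * \<bar>Psi' r p\<bar>)"
      using g by (intro mult_left_mono add_left_mono) auto
    finally have "ennreal (hl_integrand r a p) \<le> ennreal (2 * \<bar>r\<bar> powr - (1/4) * \<bar>p\<bar> powr - (3/4)) + ennreal (2 * (bracket (a - Psi r p) powr - (3/2) * \<bar>Psi' r p\<bar>))"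
      by (simp flip: ennreal_plus add: algebra_simps ennreal_leI)
    also have "ennreal (2 * \<bar>r\<bar> powr - (1/4) * \<bar>p\<bar> powr - (3/4)) = ?B"
      using True by (auto simp flip: ennreal_mult split: split_indicator simp: abs_le_iff)
    also have "ennreal (2 * (bracket (a - Psi r p) powr - (3/2) * \<bar>Psi' r p\<bar>)) = 2 * ennreal (bracket (a - Psi r p) powr - (3/2) * \<bar>Psi' r p\<bar>)"
      by (simp add: ennreal_mult')
    also have "\<dots> \<le> ?C + ?D"
    proof (cases "p > 0")
      case True
      then have "p \<in> {4/\<bar>r\<bar>..\<bar>r\<bar>/4}" using far \<open>\<bar>p\<bar> \<le> \<bar>r\<bar> / 4 \<and> p \<noteq> 0\<close> by auto
      then show ?thesis by simp
    next
      case False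
      then have "p \<in> {-(\<bar>r\<bar>/4)..-(4/\<bar>r\<bar>)}" using far \<open>\<bar>p\<bar> \<le> \<bar>r\<bar> / 4 \<and> p \<noteq> 0\<close> by auto
      then show ?thesis by simp
    qed
    finally have "ennreal (hl_integrand r a p) \<le> ?B + (?C + ?D)" by (simp add: add_left_mono)
    also have "\<dots> \<le> ?A + (?B + (?C + ?D))" by (rule add_increasing) auto
    finally show ?thesis by (simp only: add.assoc)
  qed
qed

text \<open>Near \<open>p = 0\<close> the bracket is dropped and the singularity \<open>\<bar>p\<bar> powr - (1 / 2)\<close> is integrated over
\<open>\<bar>p\<bar> \<le> 4 / \<bar>r\<bar>\<close>; away from it \<open>hl_young\<close> separates an integrable power from a term to which the
substitution by the phase applies.\<close>

lemma nn_integral_hl: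
  assumes "r \<noteq> 0"
  shows "(\<integral>\<^sup>+p. ennreal (hl_integrand r a p) \<partial>lborel) \<le> ennreal 48"
proof -
  let ?R = "\<bar>r\<bar>"
  define c where "c = (\<lambda>p. ennreal (bracket (a - Psi r p) powr - (3/2) * \<bar>Psi' r p\<bar>))"
  have [measurable]: "c \<in> borel_measurable borel" unfolding c_def by measurable
  have R: "?R > 0" using assms by simp
  have A: "ennreal (2 * ?R powr (1/2)) * (\<integral>\<^sup>+p. (ennreal (\<bar>p\<bar> powr - (1/2)) * indicator {-(4/?R)..4/?R} p) \<partial>lborel) \<le> ennreal 16"
  proof -
    have "ennreal (2 * ?R powr (1/2)) * (\<integral>\<^sup>+p. (ennreal (\<bar>p\<bar> powr - (1/2)) * indicator {-(4/?R)..4/?R} p) \<partial>lborel) \<le>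
      ennreal (2 * ?R powr (1/2)) * ennreal (2 * ((4/?R) powr (1 - 1/2) / (1 - 1/2)))"
      by (intro mult_left_mono nn_integral_abs_powr) auto
    also have "\<dots> = ennreal ((2 * ?R powr (1/2)) * (2 * ((4/?R) powr (1 - 1/2) / (1 - 1/2))))"
      by (rule ennreal_mult[symmetric]) auto
    also have "(2 * ?R powr (1/2)) * (2 * ((4/?R) powr (1 - 1/2) / (1 - 1/2))) = 16"
      using R by (simp add: powr_divide powr_half_sqrt)
    finally show ?thesis .
  qed
  have B: "ennreal (2 * ?R powr - (1/4)) * (\<integral>\<^sup>+p. (ennreal (\<bar>p\<bar> powr - (3/4)) * indicator {-(?R/4)..?R/4} p) \<partial>lborel) \<le> ennreal 16"
  proof -
    have "ennreal (2 * ?R powr - (1/4)) * (\<integral>\<^sup>+p. (ennreal (\<bar>p\<bar> powr - (3/4)) * indicator {-(?R/4)..?R/4} p) \<partial>lborel) \<le>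
      ennreal (2 * ?R powr - (1/4)) * ennreal (2 * ((?R/4) powr (1 - 3/4) / (1 - 3/4)))"
      by (intro mult_left_mono nn_integral_abs_powr) auto
    also have "\<dots> = ennreal ((2 * ?R powr - (1/4)) * (2 * ((?R/4) powr (1 - 3/4) / (1 - 3/4))))"
      by (rule ennreal_mult[symmetric]) auto
    also have "\<dots> \<le> ennreal 16"
    proof (rule ennreal_leI)
      have "(?R/4) powr (1/4) \<le> ?R powr (1/4)" by (intro powr_mono2) auto
      then have "?R powr - (1/4) * (?R/4) powr (1/4) \<le> ?R powr - (1/4) * ?R powr (1/4)"
        by (intro mult_left_mono) auto
      also have "\<dots> = 1" using R by (simp flip: powr_add)
      finally show "(2 * ?R powr - (1/4)) * (2 * ((?R/4) powr (1 - 3/4) / (1 - 3/4))) \<le> 16" by simp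
    qed
    finally show ?thesis .
  qed
  have C: "(\<integral>\<^sup>+p. c p * indicator {4/?R..?R/4} p \<partial>lborel) \<le> ennreal (2 / (3/2 - 1))"
    unfolding c_def
  proof (rule nn_integral_Psi)
    fix p assume p: "p \<in> {4/?R..?R/4}"
    then have "0 \<le> 4 / ?R" "4/?R \<le> p" "p \<le> ?R/4" by auto
    then have "\<bar>p\<bar> \<le> ?R/4" "4/?R \<le> \<bar>p\<bar>" by linarith+
    note g = hl_far_geometry[OF this assms]
    show "p \<noteq> 0 \<and> p \<noteq> r" "1 \<le> \<bar>p * (r - p)\<bar>" using g by auto
  next
    show "(\<forall>p\<in>{4/?R..?R/4}. p\<^sup>2 \<le> (r - p)\<^sup>2) \<or> (\<forall>p\<in>{4/?R..?R/4}. (r - p)\<^sup>2 \<le> p\<^sup>2)"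
    proof (intro disjI1 ballI)
      fix p assume p: "p \<in> {4/?R..?R/4}"
      then have "0 \<le> 4 / ?R" "4/?R \<le> p" "p \<le> ?R/4" by auto
      then have "\<bar>p\<bar> \<le> ?R/4" "4/?R \<le> \<bar>p\<bar>" by linarith+
      from hl_far_geometry(4)[OF this assms] show "p\<^sup>2 \<le> (r - p)\<^sup>2" .
    qed
  qed auto
  have D: "(\<integral>\<^sup>+p. c p * indicator {-(?R/4)..-(4/?R)} p \<partial>lborel) \<le> ennreal (2 / (3/2 - 1))"
    unfolding c_def
  proof (rule nn_integral_Psi)
    fix p assume p: "p \<in> {-(?R/4)..-(4/?R)}"
    then have "0 \<le> 4 / ?R" "p \<le> - (4/?R)" "-(?R/4) \<le> p" by auto
    then have "\<bar>p\<bar> \<le> ?R/4" "4/?R \<le> \<bar>p\<bar>" by linarith+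
    note g = hl_far_geometry[OF this assms]
    show "p \<noteq> 0 \<and> p \<noteq> r" "1 \<le> \<bar>p * (r - p)\<bar>" using g by auto
  next
    show "(\<forall>p\<in>{-(?R/4)..-(4/?R)}. p\<^sup>2 \<le> (r - p)\<^sup>2) \<or> (\<forall>p\<in>{-(?R/4)..-(4/?R)}. (r - p)\<^sup>2 \<le> p\<^sup>2)"
    proof (intro disjI1 ballI)
      fix p assume p: "p \<in> {-(?R/4)..-(4/?R)}"
      then have "0 \<le> 4 / ?R" "p \<le> - (4/?R)" "-(?R/4) \<le> p" by auto
      then have "\<bar>p\<bar> \<le> ?R/4" "4/?R \<le> \<bar>p\<bar>" by linarith+
      from hl_far_geometry(4)[OF this assms] show "p\<^sup>2 \<le> (r - p)\<^sup>2" .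
    qed
  qed auto
  have "(\<integral>\<^sup>+p. ennreal (hl_integrand r a p) \<partial>lborel) \<le>
    (\<integral>\<^sup>+p. ennreal (2 * ?R powr (1/2)) * (ennreal (\<bar>p\<bar> powr - (1/2)) * indicator {-(4/?R)..4/?R} p)
    + ennreal (2 * ?R powr - (1/4)) * (ennreal (\<bar>p\<bar> powr - (3/4)) * indicator {-(?R/4)..?R/4} p)
    + (2 * (c p * indicator {4/?R..?R/4} p) + 2 * (c p * indicator {-(?R/4)..-(4/?R)} p)) \<partial>lborel)"
    unfolding c_def by (intro nn_integral_mono hl_pointwise assms)
  also have "\<dots> = ennreal (2 * ?R powr (1/2)) * (\<integral>\<^sup>+p. (ennreal (\<bar>p\<bar> powr - (1/2)) * indicator {-(4/?R)..4/?R} p) \<partial>lborel)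
    + ennreal (2 * ?R powr - (1/4)) * (\<integral>\<^sup>+p. (ennreal (\<bar>p\<bar> powr - (3/4)) * indicator {-(?R/4)..?R/4} p) \<partial>lborel)
    + (2 * (\<integral>\<^sup>+p. c p * indicator {4/?R..?R/4} p \<partial>lborel) + 2 * (\<integral>\<^sup>+p. c p * indicator {-(?R/4)..-(4/?R)} p \<partial>lborel))"
    by (rule nn_integral_lin4) measurable
  also have "\<dots> \<le> ennreal 16 + ennreal 16 + (2 * ennreal (2 / (3/2 - 1)) + 2 * ennreal (2 / (3/2 - 1)))"
    by (intro add_mono mult_left_mono A B C D) auto
  also have "\<dots> = ennreal 48"
    by (simp flip: ennreal_numeral ennreal_mult ennreal_plus)
  finally show ?thesis .
qed

section \<open>The integrand for frequencies of the same sign\<close>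

text \<open>A majorant of the square of the Strichartz kernel after the integrations over \<open>\<tau>\<close> and \<open>\<eta>\<close>, restricted to frequencies \<open>p\<close>
and \<open>r - p\<close> of the same sign. The small power of \<open>\<langle>r\<rangle>\<close> is the loss that makes the integral uniformly bounded.\<close>

definition ss_integrand :: "real \<Rightarrow> real \<Rightarrow> real \<Rightarrow> real \<Rightarrow> real" where
  "ss_integrand \<delta> r a p = (if 0 < p * (r - p) then bracket r powr - (2 * \<delta>) else 0) *
      \<bar>p * (r - p) / r\<bar> powr (1/2) * bracket (a - Psi r p) powr - (1/2)"

lemma same_sign_abs:
  fixes p r :: real
  assumes "0 < p * (r - p)"
  shows "\<bar>p\<bar> \<le> \<bar>r\<bar>" "\<bar>r - p\<bar> \<le> \<bar>r\<bar>" "\<bar>2 * p - r\<bar> \<le> \<bar>r\<bar>" "r \<noteq> 0"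
  using assms by (auto simp: zero_less_mult_iff)

text \<open>If the product of two frequencies is less than \<open>1\<close>, the smaller one is at most \<open>1\<close>, and everything else is
bounded.\<close>

lemma ss_near:
  assumes "0 < p * (r - p)" "p * (r - p) < 1" "\<delta> > 0"
  shows "ennreal (ss_integrand \<delta> r a p) \<le> indicator {-1..1} p + indicator {-1..1} (r - p)"
proof -
  note ss = same_sign_abs[OF assms(1)]
  have small: "\<bar>x\<bar> \<le> 1" if "\<bar>x\<bar> \<le> \<bar>y\<bar>" "\<bar>x * y\<bar> < 1" for x y :: real
  proof (rule ccontr)
    assume "\<not> \<bar>x\<bar> \<le> 1"
    then have "1 * 1 \<le> \<bar>x\<bar> * \<bar>y\<bar>" using that by (intro mult_mono) auto
    then show False using that by (simp add: abs_mult)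
  qed
  have frac: "\<bar>x * y / r\<bar> \<le> 1" if "\<bar>x\<bar> \<le> 1" "\<bar>y\<bar> \<le> \<bar>r\<bar>" for x y :: real
  proof -
    have "\<bar>x\<bar> * \<bar>y\<bar> \<le> 1 * \<bar>r\<bar>" using that by (intro mult_mono) auto
    then show ?thesis using ss(4) by (simp add: abs_mult field_simps)
  qed
  have bd: "ss_integrand \<delta> r a p \<le> 1" if "\<bar>p * (r - p) / r\<bar> \<le> 1"
  proof -
    have "bracket r powr - (2 * \<delta>) \<le> 1" "bracket (a - Psi r p) powr - (1/2) \<le> 1" "\<bar>p * (r - p) / r\<bar> powr (1/2) \<le> 1"
      using powr_mono[of "- (2 * \<delta>)" 0 "bracket r"] powr_mono[of "- (1/2)" 0 "bracket (a - Psi r p)"]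
        powr_mono2[of "1/2" "\<bar>p * (r - p) / r\<bar>" 1] bracket_ge_1[of r] bracket_ge_1[of "a - Psi r p"] assms that by auto
    then show ?thesis unfolding ss_integrand_def using assms(1)
      by (auto intro!: mult_le_one)
  qed
  show ?thesis
  proof (cases "\<bar>p\<bar> \<le> \<bar>r - p\<bar>")
    case True
    then have 1: "\<bar>p\<bar> \<le> 1" using small[of p "r - p"] assms by simp
    then have "ennreal (ss_integrand \<delta> r a p) \<le> 1" using bd[OF frac[OF 1 ss(2)]] by (simp add: ennreal_le_1)
    also have "1 = (indicator {-1..1} p :: ennreal)" using 1 by (auto simp: abs_le_iff)
    finally show ?thesis by (rule add_increasing2[OF zero_le])
  next
    case False
    then have 1: "\<bar>r - p\<bar> \<le> 1" using small[of "r - p" p] assms by (simp add: mult.commute)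
    then have "ennreal (ss_integrand \<delta> r a p) \<le> 1" using bd frac[OF 1 ss(1)] by (simp add: ennreal_le_1 mult.commute)
    also have "1 = (indicator {-1..1} (r - p) :: ennreal)" using 1 by (auto simp: abs_le_iff)
    finally show ?thesis by (rule add_increasing[OF zero_le])
  qed
qed

text \<open>The power of \<open>\<bar>r\<bar>\<close> left over in \<open>ss_far\<close> is nonpositive; this is where the loss \<open>\<langle>r\<rangle> powr - (2 * \<delta>)\<close> is used.\<close>

lemma ss_far_exponent:
  fixes \<delta> :: real assumes "\<delta> > 0"
  defines "P \<equiv> 2 + 2 * \<delta>" and "s \<equiv> 1 / (1 + 2 * \<delta>)"
  shows "(1/2 - 2 * \<delta>) * (P / (P - 1)) + (1 - 2 * s) \<le> 0"
proof -
  have "(1/2 - 2 * \<delta>) * (P / (P - 1)) + (1 - 2 * s) = ((1/2 - 2 * \<delta>) * P + (P - 1) - 2) / (P - 1)"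
    using assms by (simp add: P_def s_def divide_simps) (simp add: algebra_simps)
  also have "(1/2 - 2 * \<delta>) * P + (P - 1) - 2 = - \<delta> - 4 * \<delta> * \<delta>"
    by (simp add: P_def algebra_simps)
  also have "(- \<delta> - 4 * \<delta> * \<delta>) / (P - 1) \<le> 0"
  proof (rule divide_nonpos_pos)
    have "0 \<le> \<delta> * \<delta>" by simp
    then show "- \<delta> - 4 * \<delta> * \<delta> \<le> 0" using assms by linarith
  qed (use assms in \<open>auto simp: P_def\<close>)
  finally show ?thesis .
qed

text \<open>Young's inequality with an exponent \<open>P\<close> slightly above \<open>2\<close>, applied to the splitting of the integrand by
\<open>(\<bar>2 p - r\<bar> * \<bar>r\<bar>) powr (1 / P)\<close>. The derivative of the phase vanishes at \<open>p = r / 2\<close> to first order: the first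
term receives a lower bound for this derivative, together with the bracket to a power \<open>P / 2 > 1\<close>, while the second
one receives \<open>\<bar>2 p - r\<bar> powr - s\<close>, and \<open>s < 1\<close> because \<open>P > 2\<close>.\<close>

lemma ss_far:
  assumes "1 \<le> p * (r - p)" "\<delta> > 0" "2 * p \<noteq> r"
  defines "P \<equiv> 2 + 2 * \<delta>" and "s \<equiv> 1 / (1 + 2 * \<delta>)"
  shows "ss_integrand \<delta> r a p \<le> bracket (a - Psi r p) powr - (P / 2) * \<bar>Psi' r p\<bar>
     + \<bar>r\<bar> powr (s - 1) * \<bar>2 * p - r\<bar> powr - s"
proof -
  have pos: "0 < p * (r - p)" using assms(1) by linarith
  note ss = same_sign_abs[OF pos]
  define x where "x = \<bar>2 * p - r\<bar>"
  define R where "R = \<bar>r\<bar>"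
  define A where "A = bracket (a - Psi r p)"
  have x: "x > 0" using assms(3) by (simp add: x_def)
  have "4 * (p * (r - p)) \<le> r\<^sup>2" using zero_le_power2[of "2 * p - r"] by (simp add: power2_eq_square algebra_simps)
  then have "1\<^sup>2 \<le> \<bar>r\<bar>\<^sup>2" using assms(1) by simp
  then have R: "1 \<le> R" unfolding R_def by (rule power2_le_imp_le) simp
  have A: "1 \<le> A" by (simp add: A_def bracket_ge_1)
  \<comment> \<open>the conjugate exponent; \<open>Q / P = s\<close>\<close>
  define Q where "Q = P / (P - 1)"
  have PQ: "P > 1" "Q > 1" using assms(2) by (auto simp: P_def Q_def field_simps)
  have PQ3: "1/P + 1/Q = 1" using PQ(1) unfolding Q_def by (simp add: field_simps)
  have base: "ss_integrand \<delta> r a p \<le> R powr (1/2 - 2 * \<delta>) * A powr - (1/2)"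
  proof -
    have "\<bar>p\<bar> * \<bar>r - p\<bar> \<le> \<bar>r\<bar> * \<bar>r\<bar>" using ss by (intro mult_mono) auto
    moreover have "\<bar>p * (r - p) / r\<bar> = \<bar>p\<bar> * \<bar>r - p\<bar> / \<bar>r\<bar>" by (simp add: abs_mult)
    ultimately have "\<bar>p * (r - p) / r\<bar> \<le> R" using ss(4) by (simp add: R_def divide_le_eq)
    then have 1: "\<bar>p * (r - p) / r\<bar> powr (1/2) \<le> R powr (1/2)" by (intro powr_mono2) auto
    have "R \<le> bracket r" by (simp add: R_def bracket_def)
    then have 2: "bracket r powr - (2 * \<delta>) \<le> R powr - (2 * \<delta>)" using R assms(2) by (intro powr_mono2') auto
    have "ss_integrand \<delta> r a p \<le> R powr - (2 * \<delta>) * R powr (1/2) * A powr - (1/2)"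
      unfolding ss_integrand_def A_def[symmetric] using 1 2 pos by (intro mult_right_mono mult_mono) auto
    then show ?thesis by (simp flip: powr_add)
  qed
  define X where "X = A powr - (1/2) * (x * R) powr (1/P)"
  define Y where "Y = R powr (1/2 - 2 * \<delta>) * (x * R) powr - (1/P)"
  have XY: "X * Y = R powr (1/2 - 2 * \<delta>) * A powr - (1/2)"
  proof -
    have "X * Y = R powr (1/2 - 2 * \<delta>) * A powr - (1/2) * ((x * R) powr (1/P) * (x * R) powr - (1/P))"
      by (simp add: X_def Y_def)
    also have "(x * R) powr (1/P) * (x * R) powr - (1/P) = 1" using x R by (simp flip: powr_add)
    finally show ?thesis by simp
  qed
  have XP: "X powr P \<le> A powr - (P / 2) * \<bar>Psi' r p\<bar>"
  proof -
    have "X powr P = A powr - (P / 2) * (x * R)"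
      using x R PQ by (simp add: X_def powr_mult powr_powr)
    also have "\<dots> \<le> A powr - (P / 2) * \<bar>Psi' r p\<bar>"
    proof (intro mult_left_mono)
      have "0 \<le> x * R" using x R by simp
      then show "x * R \<le> \<bar>Psi' r p\<bar>"
        using abs_Psi'_ge[of p r] assms(1) unfolding x_def R_def by (simp add: mult.commute)
    qed auto
    finally show ?thesis .
  qed
  have YQ: "Y powr Q \<le> R powr (s - 1) * x powr - s"
  proof -
    have "Q / P = 1 / (P - 1)" using PQ by (simp add: Q_def)
    then have sQ: "Q / P = s" by (simp add: s_def P_def)
    have "Y powr Q = R powr ((1/2 - 2 * \<delta>) * Q) * ((x * R) powr - (Q / P))"
      by (simp add: Y_def powr_mult powr_powr)
    also have "\<dots> = R powr ((1/2 - 2 * \<delta>) * Q) * (R powr - s * x powr - s)"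
      using x R by (simp add: sQ powr_mult mult.commute)
    also have "\<dots> = R powr ((1/2 - 2 * \<delta>) * Q - s) * x powr - s"
      by (simp add: powr_diff powr_minus_divide)
    also have "\<dots> \<le> R powr (s - 1) * x powr - s"
      using ss_far_exponent[OF assms(2)] R
      by (intro mult_right_mono powr_mono) (auto simp: Q_def P_def s_def)
    finally show ?thesis .
  qed
  have "X * Y \<le> X powr P / P + Y powr Q / Q"
    by (rule Youngs_inequality) (use PQ PQ3 in \<open>auto simp: X_def Y_def\<close>)
  also have "\<dots> \<le> X powr P + Y powr Q"
    using PQ by (intro add_mono) (auto simp: divide_simps mult_le_cancel_left1)
  also have "\<dots> \<le> A powr - (P / 2) * \<bar>Psi' r p\<bar> + R powr (s - 1) * x powr - s"
    by (intro add_mono XP YQ)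
  finally show ?thesis using base XY unfolding A_def R_def x_def by linarith
qed

lemma ss_region:
  assumes "1 \<le> p * (r - p)"
  shows "p \<in> {r / 2 - sqrt (r\<^sup>2 / 4 - 1)..r / 2} \<or> p \<in> {r / 2..r / 2 + sqrt (r\<^sup>2 / 4 - 1)}"
proof -
  have "(p - r / 2)\<^sup>2 \<le> r\<^sup>2 / 4 - 1" using assms by (simp add: power2_eq_square algebra_simps)
  then have "\<bar>p - r / 2\<bar> \<le> sqrt (r\<^sup>2 / 4 - 1)" by (intro real_le_rsqrt) simp
  then show ?thesis by (auto simp: abs_le_iff)
qed

lemma ss_region_conv:
  assumes "2 \<le> \<bar>r\<bar>" "\<bar>p - r / 2\<bar> \<le> sqrt (r\<^sup>2 / 4 - 1)"
  shows "1 \<le> p * (r - p)"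
proof -
  have "2\<^sup>2 \<le> \<bar>r\<bar>\<^sup>2" using assms(1) by (intro power_mono) auto
  then have "0 \<le> r\<^sup>2 / 4 - 1" by simp
  moreover have "\<bar>p - r / 2\<bar>\<^sup>2 \<le> (sqrt (r\<^sup>2 / 4 - 1))\<^sup>2" using assms(2) by (intro power_mono) auto
  ultimately have "(p - r / 2)\<^sup>2 \<le> r\<^sup>2 / 4 - 1" by simp
  then show ?thesis by (simp add: power2_eq_square algebra_simps)
qed

definition ss_const :: "real \<Rightarrow> real" where
  "ss_const \<delta> = 4 + 4 / \<delta> + (1 + 2 * \<delta>) / \<delta>"

text \<open>The stationary point \<open>p = r / 2\<close> of the phase splits the region \<open>p * (r - p) \<ge> 1\<close> into two intervals on
which the phase is monotone; they are used for the first term of \<open>ss_far\<close>. The second term is a power with a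
singularity at the stationary point.\<close>

lemma nn_integral_ss:
  assumes "\<delta> > 0"
  shows "(\<integral>\<^sup>+p. ennreal (ss_integrand \<delta> r a p) \<partial>lborel) \<le> ennreal (ss_const \<delta>)"
proof -
  define P where "P = 2 + 2 * \<delta>"
  define s where "s = 1 / (1 + 2 * \<delta>)"
  \<comment> \<open>for \<open>\<bar>r\<bar> < 2\<close> the region \<open>p * (r - p) \<ge> 1\<close> is empty; a negative half-width makes both intervals empty\<close>
  define D where "D = (if 2 \<le> \<bar>r\<bar> then sqrt (r\<^sup>2 / 4 - 1) else - 1)"
  define c where "c = (\<lambda>p. ennreal (bracket (a - Psi r p) powr - (P / 2) * \<bar>Psi' r p\<bar>))"
  define e where "e = (\<lambda>y. ennreal (\<bar>y\<bar> powr - s) * indicator {-\<bar>r\<bar>..\<bar>r\<bar>} y)"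
  have [measurable]: "c \<in> borel_measurable borel" "e \<in> borel_measurable borel" unfolding c_def e_def by measurable
  have s: "s < 1" "0 < s" "1 - s = 2 * \<delta> / (1 + 2 * \<delta>)" using assms by (auto simp: s_def field_simps)
  have P: "P / 2 > 1" "P / 2 - 1 = \<delta>" using assms by (auto simp: P_def field_simps)
  have pw: "ennreal (ss_integrand \<delta> r a p) \<le> (indicator {-1..1} p + indicator {-1..1} (r - p)) +
      ((c p * indicator {r/2 - D..r/2} p + c p * indicator {r/2..r/2 + D} p) + ennreal (\<bar>r\<bar> powr (s - 1)) * e (- r + 2 * p))"
    if "2 * p \<noteq> r" for p
  proof -
    consider "p * (r - p) \<le> 0" | "0 < p * (r - p)" "p * (r - p) < 1" | "1 \<le> p * (r - p)" by linarith
    then show ?thesis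
    proof cases
      case 1
      then have "ss_integrand \<delta> r a p = 0" by (simp add: ss_integrand_def)
      then show ?thesis by simp
    next
      case 2
      from ss_near[OF this assms] show ?thesis by (rule add_increasing2[OF zero_le])
    next
      case 3
      have "4 * (p * (r - p)) \<le> r\<^sup>2" using zero_le_power2[of "2 * p - r"] by (simp add: power2_eq_square algebra_simps)
      then have "2\<^sup>2 \<le> \<bar>r\<bar>\<^sup>2" using 3 by simp
      then have r2: "2 \<le> \<bar>r\<bar>" by (rule power2_le_imp_le) simp
      have pos: "0 < p * (r - p)" using 3 by linarith
      have le1: "ennreal (ss_integrand \<delta> r a p) \<le> c p + ennreal (\<bar>r\<bar> powr (s - 1)) * ennreal (\<bar>2 * p - r\<bar> powr - s)"
        using ss_far[OF 3 assms that, of a] unfolding c_def P_def s_def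
        by (auto simp flip: ennreal_plus ennreal_mult intro!: ennreal_leI)
      have le2: "c p \<le> c p * indicator {r/2 - D..r/2} p + c p * indicator {r/2..r/2 + D} p"
      proof -
        have "D = sqrt (r\<^sup>2 / 4 - 1)" using r2 by (simp add: D_def)
        then have "p \<in> {r / 2 - D..r / 2} \<or> p \<in> {r / 2..r / 2 + D}" using ss_region[OF 3] by simp
        then have "(1::ennreal) \<le> indicator {r/2 - D..r/2} p + indicator {r/2..r/2 + D} p"
          by (auto simp: indicator_def)
        from mult_left_mono[OF this, of "c p"] show ?thesis by (simp add: distrib_left)
      qed
      have eq: "ennreal (\<bar>2 * p - r\<bar> powr - s) = e (- r + 2 * p)"
      proof -
        have "- r + 2 * p \<in> {- \<bar>r\<bar>..\<bar>r\<bar>}" using same_sign_abs(3)[OF pos] by (simp add: abs_le_iff)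
        moreover have "- r + 2 * p = 2 * p - r" by simp
        ultimately show ?thesis unfolding e_def by (metis indicator_simps(1) mult.right_neutral)
      qed
      from order_trans[OF le1 add_right_mono[OF le2]]
      have "ennreal (ss_integrand \<delta> r a p) \<le> (c p * indicator {r/2 - D..r/2} p + c p * indicator {r/2..r/2 + D} p) + ennreal (\<bar>r\<bar> powr (s - 1)) * e (- r + 2 * p)"
        unfolding eq .
      then show ?thesis by (rule add_increasing[OF zero_le])
    qed
  qed
  have C1: "(\<integral>\<^sup>+p. c p * indicator {r/2 - D..r/2} p \<partial>lborel) \<le> ennreal (2 / \<delta>)"
    and C2: "(\<integral>\<^sup>+p. c p * indicator {r/2..r/2 + D} p \<partial>lborel) \<le> ennreal (2 / \<delta>)"
  proof -
    have g: "1 \<le> p * (r - p) \<and> p \<noteq> 0 \<and> p \<noteq> r \<and> 1 \<le> \<bar>p * (r - p)\<bar>" if "\<bar>p - r/2\<bar> \<le> D" for p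
    proof -
      have "0 \<le> D" using that by linarith
      then have "2 \<le> \<bar>r\<bar>" "D = sqrt (r\<^sup>2 / 4 - 1)" by (auto simp: D_def split: if_splits)
      then have "1 \<le> p * (r - p)" using ss_region_conv[of r p] that by auto
      moreover from this have "1 \<le> \<bar>p * (r - p)\<bar>" by linarith
      moreover have "p \<noteq> 0" "p \<noteq> r" using \<open>1 \<le> p * (r - p)\<close> by auto
      ultimately show ?thesis by blast
    qed
    have ord: "p\<^sup>2 \<le> (r - p)\<^sup>2 \<longleftrightarrow> r * (2 * p - r) \<le> 0" "(r - p)\<^sup>2 \<le> p\<^sup>2 \<longleftrightarrow> 0 \<le> r * (2 * p - r)" for p
    proof -
      have "p\<^sup>2 - (r - p)\<^sup>2 = r * (2 * p - r)" by (simp add: power2_eq_square algebra_simps)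
      then show "p\<^sup>2 \<le> (r - p)\<^sup>2 \<longleftrightarrow> r * (2 * p - r) \<le> 0" "(r - p)\<^sup>2 \<le> p\<^sup>2 \<longleftrightarrow> 0 \<le> r * (2 * p - r)" by linarith+
    qed
    show "(\<integral>\<^sup>+p. c p * indicator {r/2 - D..r/2} p \<partial>lborel) \<le> ennreal (2 / \<delta>)"
      unfolding c_def P(2)[symmetric]
    proof (rule nn_integral_Psi)
      fix p assume "p \<in> {r/2 - D..r/2}"
      then have "\<bar>p - r/2\<bar> \<le> D" by auto
      from g[OF this] show "p \<noteq> 0 \<and> p \<noteq> r" "1 \<le> \<bar>p * (r - p)\<bar>" by auto
    next
      show "(\<forall>p\<in>{r/2 - D..r/2}. p\<^sup>2 \<le> (r - p)\<^sup>2) \<or> (\<forall>p\<in>{r/2 - D..r/2}. (r - p)\<^sup>2 \<le> p\<^sup>2)"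
      proof (cases "0 \<le> r")
        case True
        then show ?thesis unfolding ord by (intro disjI1 ballI mult_nonneg_nonpos) auto
      next
        case False
        then show ?thesis unfolding ord by (intro disjI2 ballI mult_nonpos_nonpos) auto
      qed
    qed (use P in auto)
    show "(\<integral>\<^sup>+p. c p * indicator {r/2..r/2 + D} p \<partial>lborel) \<le> ennreal (2 / \<delta>)"
      unfolding c_def P(2)[symmetric]
    proof (rule nn_integral_Psi)
      fix p assume "p \<in> {r/2..r/2 + D}"
      then have "\<bar>p - r/2\<bar> \<le> D" by auto
      from g[OF this] show "p \<noteq> 0 \<and> p \<noteq> r" "1 \<le> \<bar>p * (r - p)\<bar>" by auto
    next
      show "(\<forall>p\<in>{r/2..r/2 + D}. p\<^sup>2 \<le> (r - p)\<^sup>2) \<or> (\<forall>p\<in>{r/2..r/2 + D}. (r - p)\<^sup>2 \<le> p\<^sup>2)"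
      proof (cases "0 \<le> r")
        case True
        then show ?thesis unfolding ord by (intro disjI2 ballI mult_nonneg_nonneg) auto
      next
        case False
        then show ?thesis unfolding ord by (intro disjI1 ballI mult_nonpos_nonneg) auto
      qed
    qed (use P in auto)
  qed
  have E: "ennreal (\<bar>r\<bar> powr (s - 1)) * (\<integral>\<^sup>+p. e (- r + 2 * p) \<partial>lborel) \<le> ennreal ((1 + 2 * \<delta>) / \<delta>)"
  proof -
    have "(\<integral>\<^sup>+p. e p \<partial>lborel) = ennreal \<bar>2\<bar> * (\<integral>\<^sup>+p. e (- r + 2 * p) \<partial>lborel)"
      by (rule nn_integral_real_affine) auto
    moreover have "1 * (\<integral>\<^sup>+p. e (- r + 2 * p) \<partial>lborel) \<le> ennreal \<bar>2\<bar> * (\<integral>\<^sup>+p. e (- r + 2 * p) \<partial>lborel)"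
      by (rule mult_right_mono) auto
    ultimately have "(\<integral>\<^sup>+p. e (- r + 2 * p) \<partial>lborel) \<le> (\<integral>\<^sup>+p. e p \<partial>lborel)"
      by (simp only: mult_1)
    also have "\<dots> \<le> ennreal (2 * (\<bar>r\<bar> powr (1 - s) / (1 - s)))"
      unfolding e_def by (rule nn_integral_abs_powr) (use s in auto)
    finally have "ennreal (\<bar>r\<bar> powr (s - 1)) * (\<integral>\<^sup>+p. e (- r + 2 * p) \<partial>lborel) \<le> ennreal (\<bar>r\<bar> powr (s - 1)) * ennreal (2 * (\<bar>r\<bar> powr (1 - s) / (1 - s)))"
      by (intro mult_left_mono) auto
    also have "\<dots> = ennreal (\<bar>r\<bar> powr (s - 1) * (2 * (\<bar>r\<bar> powr (1 - s) / (1 - s))))"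
      by (rule ennreal_mult[symmetric]) (use s(1) in auto)
    also have "\<dots> \<le> ennreal ((1 + 2 * \<delta>) / \<delta>)"
    proof (rule ennreal_leI)
      have "\<bar>r\<bar> powr (s - 1) * (2 * (\<bar>r\<bar> powr (1 - s) / (1 - s))) = (\<bar>r\<bar> powr (s - 1) * \<bar>r\<bar> powr (1 - s)) * (2 / (1 - s))"
        by simp
      also have "\<dots> \<le> 1 * (2 / (1 - s))"
        using s(1) by (intro mult_right_mono) (auto simp flip: powr_add)
      also have "\<dots> = (1 + 2 * \<delta>) / \<delta>" unfolding s(3) using assms by (simp add: field_simps)
      finally show "\<bar>r\<bar> powr (s - 1) * (2 * (\<bar>r\<bar> powr (1 - s) / (1 - s))) \<le> (1 + 2 * \<delta>) / \<delta>" .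
    qed
    finally show ?thesis .
  qed
  have I: "(\<integral>\<^sup>+p. indicator {-1..1} (r - p) \<partial>lborel) = (2::ennreal)"
    using nn_integral_translate(4)[of "indicator {-1..1::real}" r] by simp
  have "(\<integral>\<^sup>+p. ennreal (ss_integrand \<delta> r a p) \<partial>lborel) \<le> (\<integral>\<^sup>+p. (indicator {-1..1} p + indicator {-1..1} (r - p)) +
      ((c p * indicator {r/2 - D..r/2} p + c p * indicator {r/2..r/2 + D} p) + ennreal (\<bar>r\<bar> powr (s - 1)) * e (- r + 2 * p)) \<partial>lborel)"
  proof (intro nn_integral_mono_AE)
    have "AE p in lborel. p \<noteq> r / 2" by (rule AE_lborel_singleton)
    then show "AE p in lborel. ennreal (ss_integrand \<delta> r a p) \<le> (indicator {-1..1} p + indicator {-1..1} (r - p)) +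
      ((c p * indicator {r/2 - D..r/2} p + c p * indicator {r/2..r/2 + D} p) + ennreal (\<bar>r\<bar> powr (s - 1)) * e (- r + 2 * p))"
    proof eventually_elim
      case (elim p)
      then have "2 * p \<noteq> r" by auto
      then show ?case by (rule pw)
    qed
  qed
  also have "\<dots> = ((\<integral>\<^sup>+p. indicator {-1..1::real} p \<partial>lborel) + (\<integral>\<^sup>+p. indicator {-1..1} (r - p) \<partial>lborel)) +
      (((\<integral>\<^sup>+p. c p * indicator {r/2 - D..r/2} p \<partial>lborel) + (\<integral>\<^sup>+p. c p * indicator {r/2..r/2 + D} p \<partial>lborel)) + ennreal (\<bar>r\<bar> powr (s - 1)) * (\<integral>\<^sup>+p. e (- r + 2 * p) \<partial>lborel))"
    apply (subst nn_integral_add)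
      apply measurable
    apply (subst nn_integral_add)
      apply measurable
    apply (subst nn_integral_add)
      apply measurable
    apply (subst nn_integral_add)
      apply measurable
    apply (subst nn_integral_cmult)
     apply measurable
    done
  also have "\<dots> \<le> (ennreal 2 + ennreal 2) + ((ennreal (2 / \<delta>) + ennreal (2 / \<delta>)) + ennreal ((1 + 2 * \<delta>) / \<delta>))"
    unfolding I by (intro add_mono C1 C2 E) auto
  also have "\<dots> = ennreal (2 + 2 + ((2 / \<delta> + 2 / \<delta>) + (1 + 2 * \<delta>) / \<delta>))"
    using assms by (simp add: ennreal_plus[symmetric] del: ennreal_plus ennreal_numeral)
  also have "2 + 2 + ((2 / \<delta> + 2 / \<delta>) + (1 + 2 * \<delta>) / \<delta>) = ss_const \<delta>"
    by (simp add: ss_const_def)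
  finally show ?thesis .
qed

section \<open>Square integrals of the kernels\<close>

text \<open>The modulation, i.e. the distance of the frequency from the dispersion surface in the direction of \<open>\<tau>\<close>.\<close>

definition lam :: "r3 \<Rightarrow> real" where
  "lam = (\<lambda>(\<xi>, \<eta>, \<tau>). \<tau> - phi \<xi> \<eta>)"

lemma lam_minus [simp]: "lam (- z) = - lam z"
  by (cases z) (simp add: lam_def phi_def)

lemma borel_measurable_fst_comp [measurable (raw)]:
  fixes f :: "'a \<Rightarrow> 'b::second_countable_topology \<times> 'c::second_countable_topology"
  assumes "f \<in> borel_measurable M" shows "(\<lambda>x. fst (f x)) \<in> borel_measurable M"
  using assms by (rule borel_measurable_continuous_on[OF continuous_on_fst[OF continuous_on_id], rotated])

lemma borel_measurable_snd_comp [measurable (raw)]: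
  fixes f :: "'a \<Rightarrow> 'b::second_countable_topology \<times> 'c::second_countable_topology"
  assumes "f \<in> borel_measurable M" shows "(\<lambda>x. snd (f x)) \<in> borel_measurable M"
  using assms by (rule borel_measurable_continuous_on[OF continuous_on_snd[OF continuous_on_id], rotated])

lemma lam_alt: "lam z = snd (snd z) - ((fst z) ^ 3 - ((fst (snd z))\<^sup>2 + 1) / fst z)"
  by (cases z) (simp add: lam_def phi_def)

lemma lam_measurable [measurable]: "lam \<in> borel_measurable borel"
  unfolding lam_alt[abs_def] by measurable

lemma nn_integral_r3:
  fixes f :: "r3 \<Rightarrow> ennreal"
  assumes [measurable]: "f \<in> borel_measurable borel"
  shows "(\<integral>\<^sup>+z. f z \<partial>lborel) = (\<integral>\<^sup>+\<xi>. \<integral>\<^sup>+\<eta>. \<integral>\<^sup>+\<tau>. f (\<xi>, \<eta>, \<tau>) \<partial>lborel \<partial>lborel \<partial>lborel)"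
proof -
  have m: "f \<in> borel_measurable (lborel \<Otimes>\<^sub>M lborel)" unfolding lborel_prod by simp
  have "(\<integral>\<^sup>+z. f z \<partial>lborel) = (\<integral>\<^sup>+z. f z \<partial>(lborel \<Otimes>\<^sub>M lborel))" unfolding lborel_prod ..
  also have "\<dots> = (\<integral>\<^sup>+\<xi>. \<integral>\<^sup>+w. f (\<xi>, w) \<partial>lborel \<partial>lborel)"
    by (rule lborel.nn_integral_fst[symmetric, OF m])
  also have "\<dots> = (\<integral>\<^sup>+\<xi>. \<integral>\<^sup>+\<eta>. \<integral>\<^sup>+\<tau>. f (\<xi>, \<eta>, \<tau>) \<partial>lborel \<partial>lborel \<partial>lborel)"
  proof (rule nn_integral_cong)
    fix \<xi> :: real
    have m: "(\<lambda>w. f (\<xi>, w)) \<in> borel_measurable (lborel \<Otimes>\<^sub>M lborel)" unfolding lborel_prod by simp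
    have "(\<integral>\<^sup>+w. f (\<xi>, w) \<partial>lborel) = (\<integral>\<^sup>+w. f (\<xi>, w) \<partial>(lborel \<Otimes>\<^sub>M lborel))" unfolding lborel_prod ..
    also have "\<dots> = (\<integral>\<^sup>+\<eta>. \<integral>\<^sup>+\<tau>. f (\<xi>, \<eta>, \<tau>) \<partial>lborel \<partial>lborel)"
      by (rule lborel.nn_integral_fst[symmetric, OF m])
    finally show "(\<integral>\<^sup>+w. f (\<xi>, w) \<partial>lborel) = (\<integral>\<^sup>+\<eta>. \<integral>\<^sup>+\<tau>. f (\<xi>, \<eta>, \<tau>) \<partial>lborel \<partial>lborel)" .
  qed
  finally show ?thesis .
qed

text \<open>Frequencies with \<open>\<xi> = 0\<close>, where the dispersion relation is singular, may be ignored.\<close>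

lemma AE_fst_neq_0: "AE z in (lborel :: r3 measure). fst z \<noteq> c"
proof -
  have "closed {z :: r3. fst z = c}"
    by (intro closed_Collect_eq continuous_intros)
  then have m: "{z :: r3. fst z = c} \<in> sets lborel" by simp
  have "emeasure lborel {z :: r3. fst z = c} = (\<integral>\<^sup>+z. indicator {z :: r3. fst z = c} z \<partial>lborel)"
    using m by simp
  also have "\<dots> = (\<integral>\<^sup>+z. indicator {c} (fst z) \<partial>(lborel :: r3 measure))"
    by (intro nn_integral_cong) (auto split: split_indicator)
  also have "\<dots> = (\<integral>\<^sup>+\<xi>. \<integral>\<^sup>+\<eta>. \<integral>\<^sup>+\<tau>. indicator {c} \<xi> \<partial>(lborel :: real measure) \<partial>(lborel :: real measure) \<partial>lborel)"
    by (subst nn_integral_r3) (simp_all only: fst_conv, measurable)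
  also have "\<dots> = (\<integral>\<^sup>+\<xi>. 0 \<partial>(lborel :: real measure))"
  proof (rule nn_integral_cong_AE)
    show "AE \<xi> in lborel. (\<integral>\<^sup>+\<eta>. \<integral>\<^sup>+\<tau>. indicator {c} \<xi> \<partial>(lborel :: real measure) \<partial>(lborel :: real measure)) = 0"
      using AE_lborel_singleton[of c] by eventually_elim simp
  qed
  finally have "emeasure lborel {z :: r3. fst z = c} = 0" by simp
  with m show ?thesis by (intro AE_I[where N = "{z. fst z = c}"]) auto
qed

definition pair_const :: "real \<Rightarrow> real" where
  "pair_const \<beta> = 2 powr \<beta> * 4 / (\<beta> - 1) * sq_const \<beta>"

lemma pair_const_nonneg: "\<beta> > 1 \<Longrightarrow> 0 \<le> pair_const \<beta>"
  by (simp add: pair_const_def sq_const_nonneg)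

text \<open>Completing the square in \<open>y\<close>. The quadratic coefficient is \<open>1 / p + 1 / (r - p)\<close>.\<close>

lemma lam_sum:
  assumes "r \<noteq> 0" "p \<noteq> 0" "p \<noteq> r"
  shows "t - phi (r - p) (e - y) - phi p y = (t + e\<^sup>2 / r - Psi r p) + (r / (p * (r - p))) * (y - p * e / r)\<^sup>2"
proof -
  define q where "q = r - p"
  have q: "q \<noteq> 0" "r = p + q" using assms by (auto simp: q_def)
  have pq: "p + q \<noteq> 0" using assms q by simp
  have "y\<^sup>2 / p + (e - y)\<^sup>2 / q = ((p + q) / (p * q)) * (y - p * e / (p + q))\<^sup>2 + e\<^sup>2 / (p + q)"
    using q(1) assms(2) pq by (simp add: divide_simps) (simp add: power2_eq_square algebra_simps)
  then show ?thesis unfolding phi_def Psi_def q_def[symmetric] unfolding q(2)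
    by (simp add: add_divide_distrib)
qed

text \<open>The integrations over \<open>\<tau>\<close> (a convolution of brackets) and over \<open>\<eta>\<close> (a bracket of a quadratic polynomial) are
carried out; what remains is a line integral over the first frequency \<open>p\<close> of one of the two waves. Its bound
does not depend on \<open>e\<close> and \<open>t\<close> except through the offset of the phase.\<close>

lemma nn_integral_pair_kernel:
  fixes g :: "real \<Rightarrow> real"
  assumes \<beta>: "\<beta> > 1" and r: "r \<noteq> 0" and [measurable]: "g \<in> borel_measurable borel" and g: "\<And>p. 0 \<le> g p"
  shows "(\<integral>\<^sup>+z. ennreal (g (fst z) * (bracket (lam z) powr - \<beta> * bracket (lam ((r, e, t) - z)) powr - \<beta>)) \<partial>lborel)
    \<le> ennreal (pair_const \<beta>) * (\<integral>\<^sup>+p. ennreal (g p * \<bar>p * (r - p) / r\<bar> powr (1/2) * bracket ((t + e\<^sup>2 / r) - Psi r p) powr - (1/2)) \<partial>lborel)"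
proof -
  let ?c1 = "2 powr \<beta> * 4 / (\<beta> - 1)"
  have c1: "0 \<le> ?c1" using \<beta> by simp
  have "(\<integral>\<^sup>+z. ennreal (g (fst z) * (bracket (lam z) powr - \<beta> * bracket (lam ((r, e, t) - z)) powr - \<beta>)) \<partial>lborel)
    = (\<integral>\<^sup>+p. \<integral>\<^sup>+y. \<integral>\<^sup>+s. ennreal (g p * (bracket (s - phi p y) powr - \<beta> * bracket ((t - phi (r - p) (e - y)) - s) powr - \<beta>)) \<partial>lborel \<partial>lborel \<partial>lborel)"
    by (subst nn_integral_r3, measurable) (simp add: lam_def algebra_simps)
  also have "\<dots> \<le> (\<integral>\<^sup>+p. \<integral>\<^sup>+y. ennreal (g p * ?c1) * ennreal (bracket (t - phi (r - p) (e - y) - phi p y) powr - \<beta>) \<partial>lborel \<partial>lborel)"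
  proof (intro nn_integral_mono)
    fix p y
    have "(\<integral>\<^sup>+s. ennreal (g p * (bracket (s - phi p y) powr - \<beta> * bracket ((t - phi (r - p) (e - y)) - s) powr - \<beta>)) \<partial>lborel)
      = ennreal (g p) * (\<integral>\<^sup>+s. ennreal (bracket (s - phi p y) powr - \<beta> * bracket ((t - phi (r - p) (e - y)) - s) powr - \<beta>) \<partial>lborel)"
      using g by (subst nn_integral_cmult[symmetric]) (auto simp: ennreal_mult)
    also have "\<dots> \<le> ennreal (g p) * ennreal (?c1 * bracket (t - phi (r - p) (e - y) - phi p y) powr - \<beta>)"
      by (intro mult_left_mono nn_integral_bracket_conv \<beta>) auto
    also have "\<dots> = ennreal (g p * ?c1) * ennreal (bracket (t - phi (r - p) (e - y) - phi p y) powr - \<beta>)"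
    proof -
      have "g p * (?c1 * x) = (g p * ?c1) * x" for x by (simp only: mult.assoc)
      then show ?thesis using g c1 by (simp only: ennreal_mult[symmetric] mult_nonneg_nonneg powr_ge_zero)
    qed
    finally show "(\<integral>\<^sup>+s. ennreal (g p * (bracket (s - phi p y) powr - \<beta> * bracket ((t - phi (r - p) (e - y)) - s) powr - \<beta>)) \<partial>lborel)
      \<le> ennreal (g p * ?c1) * ennreal (bracket (t - phi (r - p) (e - y) - phi p y) powr - \<beta>)" .
  qed
  also have "\<dots> \<le> (\<integral>\<^sup>+p. ennreal (pair_const \<beta>) * ennreal (g p * \<bar>p * (r - p) / r\<bar> powr (1/2) * bracket ((t + e\<^sup>2 / r) - Psi r p) powr - (1/2)) \<partial>lborel)"
  proof (rule nn_integral_mono_AE)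
    have "AE p in lborel. p \<noteq> 0 \<and> p \<noteq> r"
      using AE_lborel_singleton[of 0] AE_lborel_singleton[of r] by eventually_elim auto
    then show "AE p in lborel. (\<integral>\<^sup>+y. ennreal (g p * ?c1) * ennreal (bracket (t - phi (r - p) (e - y) - phi p y) powr - \<beta>) \<partial>lborel)
      \<le> ennreal (pair_const \<beta>) * ennreal (g p * \<bar>p * (r - p) / r\<bar> powr (1/2) * bracket ((t + e\<^sup>2 / r) - Psi r p) powr - (1/2))"
    proof eventually_elim
      case (elim p)
      let ?A = "(t + e\<^sup>2 / r) - Psi r p" and ?c = "r / (p * (r - p))"
      have cneq: "?c \<noteq> 0" using elim r by simp
      have cabs: "\<bar>?c\<bar> powr - (1/2) = \<bar>p * (r - p) / r\<bar> powr (1/2)"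
      proof -
        have "\<bar>p * (r - p) / r\<bar> = inverse \<bar>?c\<bar>" by (simp add: abs_mult divide_inverse)
        then show ?thesis by (simp only: inverse_powr abs_ge_zero powr_minus)
      qed
      have phim: "(\<lambda>y. t - phi (r - p) (e - y) - phi p y) \<in> borel_measurable borel" unfolding phi_def by measurable
      have "(\<integral>\<^sup>+y. ennreal (g p * ?c1) * ennreal (bracket (t - phi (r - p) (e - y) - phi p y) powr - \<beta>) \<partial>lborel)
        = ennreal (g p * ?c1) * (\<integral>\<^sup>+y. ennreal (bracket (t - phi (r - p) (e - y) - phi p y) powr - \<beta>) \<partial>lborel)"
        by (rule nn_integral_cmult) (use phim in measurable)
      also have "(\<integral>\<^sup>+y. ennreal (bracket (t - phi (r - p) (e - y) - phi p y) powr - \<beta>) \<partial>lborel) =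
        (\<integral>\<^sup>+y. ennreal (bracket (?A + ?c * (y - p * e / r)\<^sup>2) powr - \<beta>) \<partial>lborel)"
        by (simp only: lam_sum[OF r conjunct1[OF elim] conjunct2[OF elim]])
      also have "ennreal (g p * ?c1) * \<dots> \<le> ennreal (g p * ?c1) * ennreal (sq_const \<beta> * \<bar>?c\<bar> powr - (1/2) * bracket ?A powr - (1/2))"
        by (intro mult_left_mono nn_integral_bracket_quadratic \<beta> cneq) auto
      also have "\<dots> = ennreal ((g p * ?c1) * (sq_const \<beta> * \<bar>?c\<bar> powr - (1/2) * bracket ?A powr - (1/2)))"
        using g c1 sq_const_nonneg[OF \<beta>] by (intro ennreal_mult[symmetric] mult_nonneg_nonneg) auto
      also have "(g p * ?c1) * (sq_const \<beta> * \<bar>?c\<bar> powr - (1/2) * bracket ?A powr - (1/2)) =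
        pair_const \<beta> * (g p * \<bar>p * (r - p) / r\<bar> powr (1/2) * bracket ?A powr - (1/2))"
        unfolding cabs pair_const_def by (simp only: ac_simps)
      also have "ennreal \<dots> = ennreal (pair_const \<beta>) * ennreal (g p * \<bar>p * (r - p) / r\<bar> powr (1/2) * bracket ?A powr - (1/2))"
        using g pair_const_nonneg[OF \<beta>] by (intro ennreal_mult mult_nonneg_nonneg) auto
      finally show ?case .
    qed
  qed
  also have "\<dots> = ennreal (pair_const \<beta>) * (\<integral>\<^sup>+p. ennreal (g p * \<bar>p * (r - p) / r\<bar> powr (1/2) * bracket ((t + e\<^sup>2 / r) - Psi r p) powr - (1/2)) \<partial>lborel)"
    by (rule nn_integral_cmult) measurable
  finally show ?thesis .
qed

text \<open>The Strichartz factor. Convolving two functions with this factor corresponds to an \<open>L\<^sup>4\<close> estimate for free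
waves with a loss of \<open>\<delta>\<close> derivatives on each of them.\<close>

definition kS :: "real \<Rightarrow> real \<Rightarrow> r3 \<Rightarrow> real" where
  "kS \<delta> \<beta> z = bracket (fst z) powr - \<delta> * bracket (lam z) powr - (\<beta> / 2)"

text \<open>The high-low kernel: \<open>z\<close> has low frequency compared with \<open>\<zeta>\<close>, and the modulations are those of \<open>z\<close> and of
\<open>\<zeta> - z\<close>. The powers \<open>1 / 4\<close> and \<open>- 1 / 2\<close> are balanced so that the integral of its square is bounded
independently of \<open>\<zeta>\<close>.\<close>

definition kH :: "real \<Rightarrow> r3 \<Rightarrow> r3 \<Rightarrow> real" where
  "kH \<beta> \<zeta> z = (if \<bar>fst z\<bar> \<le> \<bar>fst \<zeta>\<bar> / 4 then \<bar>fst \<zeta>\<bar> powr (1/4) * \<bar>fst z\<bar> powr - (1/2) else 0) *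
     (bracket (lam z) powr - (\<beta> / 2) * bracket (lam (\<zeta> - z)) powr - (\<beta> / 2))"

lemma kS_measurable [measurable]: "kS \<delta> \<beta> \<in> borel_measurable borel"
  unfolding kS_def[abs_def] by measurable

lemma kS_nonneg [simp]: "0 \<le> kS \<delta> \<beta> z" by (simp add: kS_def)
lemma kH_nonneg [simp]: "0 \<le> kH \<beta> \<zeta> z" by (simp add: kH_def)
lemma kS_minus [simp]: "kS \<delta> \<beta> (- z) = kS \<delta> \<beta> z" by (simp add: kS_def)

lemma kH_measurable [measurable]: "(\<lambda>x. kH \<beta> (fst x) (snd x)) \<in> borel_measurable (borel :: (r3 \<times> r3) measure)"
  unfolding kH_def[abs_def] by measurable

lemma powr_half_square: "(x powr - (\<beta> / 2))\<^sup>2 = x powr - \<beta>" for x :: real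
  by (simp add: power2_eq_square flip: powr_add)

lemma bracket_mult_ge: "bracket (x + y) \<le> bracket x * bracket y"
proof -
  have "0 \<le> \<bar>x\<bar> * \<bar>y\<bar>" by simp
  moreover have "(1 + \<bar>x\<bar>) * (1 + \<bar>y\<bar>) = 1 + \<bar>x\<bar> + \<bar>y\<bar> + \<bar>x\<bar> * \<bar>y\<bar>" by (simp add: algebra_simps)
  ultimately show ?thesis using abs_triangle_ineq[of x y] unfolding bracket_def by linarith
qed

text \<open>The two factors \<open>\<langle>\<xi>\<^sub>i\<rangle> powr - \<delta>\<close> are replaced by one power of \<open>\<langle>\<xi>\<rangle>\<close> since the bracket is submultiplicative.\<close>

lemma nn_integral_kS_same_sign:
  assumes "\<beta> > 1" "\<delta> > 0" "fst \<zeta> \<noteq> 0"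
  shows "(\<integral>\<^sup>+z. ennreal (if 0 < fst z * fst (\<zeta> - z) then (kS \<delta> \<beta> z * kS \<delta> \<beta> (\<zeta> - z))\<^sup>2 else 0) \<partial>lborel)
    \<le> ennreal (pair_const \<beta> * ss_const \<delta>)"
proof -
  obtain r e t where \<zeta>: "\<zeta> = (r, e, t)" by (cases \<zeta>) auto
  have r: "r \<noteq> 0" using assms(3) by (simp add: \<zeta>)
  define g where "g = (\<lambda>p. if 0 < p * (r - p) then bracket r powr - (2 * \<delta>) else 0)"
  have gm: "g \<in> borel_measurable borel" unfolding g_def by measurable
  have "(\<integral>\<^sup>+z. ennreal (if 0 < fst z * fst (\<zeta> - z) then (kS \<delta> \<beta> z * kS \<delta> \<beta> (\<zeta> - z))\<^sup>2 else 0) \<partial>lborel)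
    \<le> (\<integral>\<^sup>+z. ennreal (g (fst z) * (bracket (lam z) powr - \<beta> * bracket (lam ((r, e, t) - z)) powr - \<beta>)) \<partial>lborel)"
  proof (intro nn_integral_mono ennreal_leI)
    fix z
    show "(if 0 < fst z * fst (\<zeta> - z) then (kS \<delta> \<beta> z * kS \<delta> \<beta> (\<zeta> - z))\<^sup>2 else 0) \<le> g (fst z) * (bracket (lam z) powr - \<beta> * bracket (lam ((r, e, t) - z)) powr - \<beta>)"
    proof (cases "0 < fst z * (r - fst z)")
      case True
      have "bracket r \<le> bracket (fst z) * bracket (r - fst z)" using bracket_mult_ge[of "fst z" "r - fst z"] by simp
      then have "(bracket (fst z) * bracket (r - fst z)) powr - (2 * \<delta>) \<le> bracket r powr - (2 * \<delta>)"
        using assms(2) by (intro powr_mono2') auto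
      moreover have "(kS \<delta> \<beta> z * kS \<delta> \<beta> (\<zeta> - z))\<^sup>2 = (bracket (fst z) * bracket (r - fst z)) powr - (2 * \<delta>) * (bracket (lam z) powr - \<beta> * bracket (lam ((r, e, t) - z)) powr - \<beta>)"
        using powr_half_square[of "bracket (fst z)" "2 * \<delta>"] powr_half_square[of "bracket (r - fst z)" "2 * \<delta>"]
        by (simp add: kS_def power_mult_distrib powr_half_square powr_mult \<zeta>)
      ultimately show ?thesis using True by (auto simp: \<zeta> g_def intro!: mult_right_mono)
    qed (simp add: g_def \<zeta>)
  qed
  also have "\<dots> \<le> ennreal (pair_const \<beta>) * (\<integral>\<^sup>+p. ennreal (g p * \<bar>p * (r - p) / r\<bar> powr (1/2) * bracket ((t + e\<^sup>2 / r) - Psi r p) powr - (1/2)) \<partial>lborel)"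
    by (rule nn_integral_pair_kernel[OF assms(1) r gm]) (simp add: g_def)
  also have "(\<integral>\<^sup>+p. ennreal (g p * \<bar>p * (r - p) / r\<bar> powr (1/2) * bracket ((t + e\<^sup>2 / r) - Psi r p) powr - (1/2)) \<partial>lborel)
     = (\<integral>\<^sup>+p. ennreal (ss_integrand \<delta> r (t + e\<^sup>2 / r) p) \<partial>lborel)"
    unfolding g_def ss_integrand_def ..
  also have "ennreal (pair_const \<beta>) * \<dots> \<le> ennreal (pair_const \<beta>) * ennreal (ss_const \<delta>)"
    by (intro mult_left_mono nn_integral_ss assms) auto
  also have "\<dots> = ennreal (pair_const \<beta> * ss_const \<delta>)"
    using pair_const_nonneg[OF assms(1)] assms(2) by (intro ennreal_mult[symmetric]) (auto simp: ss_const_def)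
  finally show ?thesis .
qed

lemma nn_integral_kH:
  assumes "\<beta> > 1" "fst \<zeta> \<noteq> 0"
  shows "(\<integral>\<^sup>+z. ennreal ((kH \<beta> \<zeta> z)\<^sup>2) \<partial>lborel) \<le> ennreal (pair_const \<beta> * 48)"
proof -
  obtain r e t where \<zeta>: "\<zeta> = (r, e, t)" by (cases \<zeta>) auto
  have r: "r \<noteq> 0" using assms(2) by (simp add: \<zeta>)
  define g where "g = (\<lambda>p. if \<bar>p\<bar> \<le> \<bar>r\<bar> / 4 then \<bar>r\<bar> powr (1/2) / \<bar>p\<bar> else 0)"
  have gm: "g \<in> borel_measurable borel" unfolding g_def by measurable
  have 4: "(x powr (1/4))\<^sup>2 = x powr (1/2)" for x :: real by (simp add: power2_eq_square flip: powr_add)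
  have 2: "(\<bar>x\<bar> powr - (1/2))\<^sup>2 = 1 / \<bar>x\<bar>" for x :: real
    by (simp add: power2_eq_square powr_minus_divide flip: powr_add)
  have "(\<integral>\<^sup>+z. ennreal ((kH \<beta> \<zeta> z)\<^sup>2) \<partial>lborel) = (\<integral>\<^sup>+z. ennreal (g (fst z) * (bracket (lam z) powr - \<beta> * bracket (lam ((r, e, t) - z)) powr - \<beta>)) \<partial>lborel)"
    by (intro nn_integral_cong arg_cong[of _ _ ennreal])
       (auto simp: kH_def g_def \<zeta> power_mult_distrib powr_half_square 2 4)
  also have "\<dots> \<le> ennreal (pair_const \<beta>) * (\<integral>\<^sup>+p. ennreal (g p * \<bar>p * (r - p) / r\<bar> powr (1/2) * bracket ((t + e\<^sup>2 / r) - Psi r p) powr - (1/2)) \<partial>lborel)"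
    by (rule nn_integral_pair_kernel[OF assms(1) r gm]) (simp add: g_def)
  also have "(\<integral>\<^sup>+p. ennreal (g p * \<bar>p * (r - p) / r\<bar> powr (1/2) * bracket ((t + e\<^sup>2 / r) - Psi r p) powr - (1/2)) \<partial>lborel)
     = (\<integral>\<^sup>+p. ennreal (hl_integrand r (t + e\<^sup>2 / r) p) \<partial>lborel)"
    unfolding g_def hl_integrand_def ..
  also have "ennreal (pair_const \<beta>) * \<dots> \<le> ennreal (pair_const \<beta>) * ennreal 48"
    by (intro mult_left_mono nn_integral_hl r) auto
  also have "\<dots> = ennreal (pair_const \<beta> * 48)"
    using pair_const_nonneg[OF assms(1)] by (intro ennreal_mult[symmetric]) auto
  finally show ?thesis .
qed

section \<open>The Cauchy-Schwarz test for trilinear forms\<close>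

lemma nn_integral_swap:
  fixes F :: "'a::euclidean_space \<Rightarrow> 'b::euclidean_space \<Rightarrow> ennreal"
  assumes "(\<lambda>x. F (fst x) (snd x)) \<in> borel_measurable borel"
  shows "(\<integral>\<^sup>+x. \<integral>\<^sup>+y. F x y \<partial>lborel \<partial>lborel) = (\<integral>\<^sup>+y. \<integral>\<^sup>+x. F x y \<partial>lborel \<partial>lborel)"
proof (rule lborel_pair.Fubini'[symmetric])
  show "(\<lambda>(x, y). F x y) \<in> borel_measurable (lborel \<Otimes>\<^sub>M lborel)"
    using assms unfolding lborel_prod by (simp add: case_prod_beta')
qed

lemma measurable_inner_nn_integral:
  fixes F :: "'a::euclidean_space \<Rightarrow> 'b::euclidean_space \<Rightarrow> ennreal"
  assumes "(\<lambda>x. F (fst x) (snd x)) \<in> borel_measurable borel"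
  shows "(\<lambda>x. \<integral>\<^sup>+y. F x y \<partial>lborel) \<in> borel_measurable borel"
proof -
  have "(\<lambda>(x, y). F x y) \<in> borel_measurable (lborel \<Otimes>\<^sub>M (lborel :: 'b measure))"
    using assms unfolding lborel_prod by (simp add: case_prod_beta')
  then have "(\<lambda>x. \<integral>\<^sup>+y. F x y \<partial>lborel) \<in> borel_measurable (lborel :: 'a measure)"
    by (rule lborel.borel_measurable_nn_integral)
  then show ?thesis by simp
qed

lemma ennreal_amgm: "(a::ennreal) * b \<le> a\<^sup>2 + b\<^sup>2"
proof (cases "a \<le> b")
  case True
  then have "a * b \<le> b\<^sup>2" unfolding power2_eq_square by (rule mult_right_mono) simp
  then show ?thesis by (rule add_increasing[OF zero_le])
next
  case False
  then have "a * b \<le> a\<^sup>2" unfolding power2_eq_square by (intro mult_left_mono) auto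
  then show ?thesis by (rule add_increasing2[OF zero_le])
qed

lemma nn_integral_product_square:
  fixes f g :: "r3 \<Rightarrow> ennreal"
  assumes [measurable]: "f \<in> borel_measurable borel" "g \<in> borel_measurable borel"
  shows "(\<integral>\<^sup>+x. \<integral>\<^sup>+y. (f x * g y)\<^sup>2 \<partial>lborel \<partial>lborel) = (\<integral>\<^sup>+x. (f x)\<^sup>2 \<partial>lborel) * (\<integral>\<^sup>+y. (g y)\<^sup>2 \<partial>lborel)"
  by (simp add: power_mult_distrib nn_integral_cmult nn_integral_multc)

lemma kernel_compose:
  fixes K :: "r3 \<Rightarrow> r3 \<Rightarrow> 'b::topological_space"
  assumes "(\<lambda>x. K (fst x) (snd x)) \<in> borel_measurable borel"
    and "a \<in> borel_measurable M" "b \<in> borel_measurable M"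
  shows "(\<lambda>x. K (a x) (b x)) \<in> borel_measurable M"
  using measurable_compose[OF borel_measurable_Pair[OF assms(2,3)] assms(1)] by simp

text \<open>By the arithmetic-geometric inequality the kernel is squared together with \<open>f0\<close>, and for a fixed value \<open>\<zeta>\<close>
of \<open>x + y\<close> the remaining integration only meets the kernel. The bound is a sum instead of a product of
norms, which is as good for normalized functions.\<close>

lemma trilinear_output:
  fixes K :: "r3 \<Rightarrow> r3 \<Rightarrow> real" and f0 f1 f2 :: "r3 \<Rightarrow> ennreal"
  assumes [measurable]: "f0 \<in> borel_measurable borel" "f1 \<in> borel_measurable borel" "f2 \<in> borel_measurable borel"
    and Km [measurable]: "(\<lambda>x. K (fst x) (snd x)) \<in> borel_measurable borel"
    and K0: "\<And>x y. 0 \<le> K x y"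
    and K: "\<And>\<zeta>. fst \<zeta> \<noteq> 0 \<Longrightarrow> (\<integral>\<^sup>+z. ennreal ((K \<zeta> z)\<^sup>2) \<partial>lborel) \<le> C"
  shows "(\<integral>\<^sup>+x. \<integral>\<^sup>+y. ennreal (K (x + y) y) * (f0 (x + y) * (f1 x * f2 y)) \<partial>lborel \<partial>lborel)
     \<le> C * (\<integral>\<^sup>+\<zeta>. (f0 \<zeta>)\<^sup>2 \<partial>lborel) + (\<integral>\<^sup>+x. (f1 x)\<^sup>2 \<partial>lborel) * (\<integral>\<^sup>+y. (f2 y)\<^sup>2 \<partial>lborel)"
proof -
  note kernel_compose[OF Km, measurable (raw)]
  have m2: "(\<lambda>x :: r3 \<times> r3. ennreal ((K (fst x + snd x) (snd x))\<^sup>2) * (f0 (fst x + snd x))\<^sup>2) \<in> borel_measurable borel"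
    by measurable
  have "(\<integral>\<^sup>+x. \<integral>\<^sup>+y. ennreal (K (x + y) y) * (f0 (x + y) * (f1 x * f2 y)) \<partial>lborel \<partial>lborel) \<le>
    (\<integral>\<^sup>+x. \<integral>\<^sup>+y. ennreal ((K (x + y) y)\<^sup>2) * (f0 (x + y))\<^sup>2 + (f1 x * f2 y)\<^sup>2 \<partial>lborel \<partial>lborel)"
  proof (intro nn_integral_mono)
    fix x y
    show "ennreal (K (x + y) y) * (f0 (x + y) * (f1 x * f2 y)) \<le> ennreal ((K (x + y) y)\<^sup>2) * (f0 (x + y))\<^sup>2 + (f1 x * f2 y)\<^sup>2"
      using ennreal_amgm[of "ennreal (K (x + y) y) * f0 (x + y)" "f1 x * f2 y"]
      by (simp add: power_mult_distrib ennreal_power[OF K0] mult.assoc)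
  qed
  also have "\<dots> = (\<integral>\<^sup>+x. (\<integral>\<^sup>+y. ennreal ((K (x + y) y)\<^sup>2) * (f0 (x + y))\<^sup>2 \<partial>lborel) + (\<integral>\<^sup>+y. (f1 x * f2 y)\<^sup>2 \<partial>lborel) \<partial>lborel)"
    by (intro nn_integral_cong nn_integral_add) measurable
  also have "\<dots> = (\<integral>\<^sup>+x. \<integral>\<^sup>+y. ennreal ((K (x + y) y)\<^sup>2) * (f0 (x + y))\<^sup>2 \<partial>lborel \<partial>lborel) + (\<integral>\<^sup>+x. \<integral>\<^sup>+y. (f1 x * f2 y)\<^sup>2 \<partial>lborel \<partial>lborel)"
    by (rule nn_integral_add) (simp_all add: measurable_inner_nn_integral)
  also have "(\<integral>\<^sup>+x. \<integral>\<^sup>+y. (f1 x * f2 y)\<^sup>2 \<partial>lborel \<partial>lborel) = (\<integral>\<^sup>+x. (f1 x)\<^sup>2 \<partial>lborel) * (\<integral>\<^sup>+y. (f2 y)\<^sup>2 \<partial>lborel)"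
    by (rule nn_integral_product_square) measurable
  also have "(\<integral>\<^sup>+x. \<integral>\<^sup>+y. ennreal ((K (x + y) y)\<^sup>2) * (f0 (x + y))\<^sup>2 \<partial>lborel \<partial>lborel) =
     (\<integral>\<^sup>+y. \<integral>\<^sup>+x. ennreal ((K (x + y) y)\<^sup>2) * (f0 (x + y))\<^sup>2 \<partial>lborel \<partial>lborel)"
    by (rule nn_integral_swap) (rule m2)
  also have "\<dots> = (\<integral>\<^sup>+y. \<integral>\<^sup>+\<zeta>. ennreal ((K \<zeta> y)\<^sup>2) * (f0 \<zeta>)\<^sup>2 \<partial>lborel \<partial>lborel)"
    by (intro nn_integral_cong nn_integral_translate(1)[where f = "\<lambda>\<zeta>. ennreal ((K \<zeta> _)\<^sup>2) * (f0 \<zeta>)\<^sup>2"]) measurable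
  also have "\<dots> = (\<integral>\<^sup>+\<zeta>. \<integral>\<^sup>+y. ennreal ((K \<zeta> y)\<^sup>2) * (f0 \<zeta>)\<^sup>2 \<partial>lborel \<partial>lborel)"
    by (rule nn_integral_swap) measurable
  also have "\<dots> \<le> (\<integral>\<^sup>+\<zeta>. C * (f0 \<zeta>)\<^sup>2 \<partial>lborel)"
  proof (rule nn_integral_mono_AE)
    show "AE \<zeta> in lborel. (\<integral>\<^sup>+y. ennreal ((K \<zeta> y)\<^sup>2) * (f0 \<zeta>)\<^sup>2 \<partial>lborel) \<le> C * (f0 \<zeta>)\<^sup>2"
      using AE_fst_neq_0[of 0]
    proof eventually_elim
      case (elim \<zeta>)
      have "(\<integral>\<^sup>+y. ennreal ((K \<zeta> y)\<^sup>2) * (f0 \<zeta>)\<^sup>2 \<partial>lborel) = (\<integral>\<^sup>+y. ennreal ((K \<zeta> y)\<^sup>2) \<partial>lborel) * (f0 \<zeta>)\<^sup>2"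
        by (rule nn_integral_multc) measurable
      also have "\<dots> \<le> C * (f0 \<zeta>)\<^sup>2" by (intro mult_right_mono K elim) simp
      finally show ?case .
    qed
  qed
  also have "\<dots> = C * (\<integral>\<^sup>+\<zeta>. (f0 \<zeta>)\<^sup>2 \<partial>lborel)"
    by (rule nn_integral_cmult) measurable
  finally show ?thesis by (simp add: add_right_mono)
qed

section \<open>Bilinear Strichartz estimates\<close>

lemma nn_integral_swap_sum:
  fixes F :: "r3 \<Rightarrow> r3 \<Rightarrow> ennreal"
  assumes [measurable]: "(\<lambda>x. F (fst x) (snd x)) \<in> borel_measurable borel"
  shows "(\<integral>\<^sup>+x. \<integral>\<^sup>+y. F x y \<partial>lborel \<partial>lborel) = (\<integral>\<^sup>+\<zeta>. \<integral>\<^sup>+x. F x (\<zeta> - x) \<partial>lborel \<partial>lborel)"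
proof -
  note kernel_compose[OF assms, measurable (raw)]
  have "(\<integral>\<^sup>+x. \<integral>\<^sup>+y. F x y \<partial>lborel \<partial>lborel) = (\<integral>\<^sup>+x. \<integral>\<^sup>+\<zeta>. F x (\<zeta> - x) \<partial>lborel \<partial>lborel)"
    by (intro nn_integral_cong nn_integral_translate(3)[symmetric]) measurable
  also have "\<dots> = (\<integral>\<^sup>+\<zeta>. \<integral>\<^sup>+x. F x (\<zeta> - x) \<partial>lborel \<partial>lborel)"
    by (rule nn_integral_swap) measurable
  finally show ?thesis .
qed

lemma strichartz_same_sign:
  fixes f0 f1 f2 :: "r3 \<Rightarrow> ennreal"
  assumes [measurable]: "f0 \<in> borel_measurable borel" "f1 \<in> borel_measurable borel" "f2 \<in> borel_measurable borel"
    and "\<beta> > 1" "\<delta> > 0"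
  defines "C \<equiv> ennreal (pair_const \<beta> * ss_const \<delta>)"
  shows "(\<integral>\<^sup>+x. \<integral>\<^sup>+y. ennreal (if 0 < fst x * fst y then kS \<delta> \<beta> x * kS \<delta> \<beta> y else 0) * (f0 (x + y) * (f1 x * f2 y)) \<partial>lborel \<partial>lborel)
    \<le> C * (\<integral>\<^sup>+\<zeta>. (f0 \<zeta>)\<^sup>2 \<partial>lborel) + (\<integral>\<^sup>+x. (f1 x)\<^sup>2 \<partial>lborel) * (\<integral>\<^sup>+y. (f2 y)\<^sup>2 \<partial>lborel)"
proof -
  define K where "K = (\<lambda>\<zeta> z. if 0 < fst z * fst (\<zeta> - z) then kS \<delta> \<beta> z * kS \<delta> \<beta> (\<zeta> - z) else 0)"
  have main: "(\<integral>\<^sup>+x. \<integral>\<^sup>+y. ennreal (K (x + y) y) * (f0 (x + y) * (f1 x * f2 y)) \<partial>lborel \<partial>lborel)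
    \<le> C * (\<integral>\<^sup>+\<zeta>. (f0 \<zeta>)\<^sup>2 \<partial>lborel) + (\<integral>\<^sup>+x. (f1 x)\<^sup>2 \<partial>lborel) * (\<integral>\<^sup>+y. (f2 y)\<^sup>2 \<partial>lborel)"
  proof (rule trilinear_output)
    show "(\<lambda>x. K (fst x) (snd x)) \<in> borel_measurable borel" unfolding K_def by measurable
    show "0 \<le> K x y" for x y by (simp add: K_def)
    fix \<zeta> :: r3 assume "fst \<zeta> \<noteq> 0"
    from nn_integral_kS_same_sign[OF assms(4,5) this]
    show "(\<integral>\<^sup>+z. ennreal ((K \<zeta> z)\<^sup>2) \<partial>lborel) \<le> C"
      unfolding C_def K_def by (rule order_trans[rotated]) (intro nn_integral_mono, simp)
  qed measurable
  have "K (x + y) y = (if 0 < fst x * fst y then kS \<delta> \<beta> x * kS \<delta> \<beta> y else 0)" for x y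
    by (simp add: K_def mult.commute)
  with main show ?thesis by simp
qed

text \<open>Write \<open>F\<^sub>i\<close> for \<open>f\<^sub>i\<close> times its factor \<open>kS\<close>, restricted to the required sign. The square of the convolution at \<open>\<zeta>\<close> is
the double integral of \<open>F\<^sub>1 a * F\<^sub>2 (\<zeta> - a) * F\<^sub>1 c * F\<^sub>2 (\<zeta> - c)\<close>. The arithmetic-geometric inequality pairs the
factors \<open>kS\<close> at \<open>a\<close> and at \<open>\<zeta> - c\<close> instead of those at \<open>a\<close> and at \<open>\<zeta> - a\<close>. With \<open>b = \<zeta> - a\<close> and \<open>c\<close> fixed, \<open>a\<close> and
\<open>c - \<zeta> = (c - b) - a\<close> have the sum \<open>c - b\<close>, and since \<open>kS\<close> is even they are two frequencies of the same sign.\<close>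

lemma strichartz_opposite_sign:
  fixes f0 f1 f2 :: "r3 \<Rightarrow> ennreal" and s :: real
  assumes [measurable]: "f0 \<in> borel_measurable borel" "f1 \<in> borel_measurable borel" "f2 \<in> borel_measurable borel"
    and "\<beta> > 1" "\<delta> > 0"
  defines "C \<equiv> ennreal (pair_const \<beta> * ss_const \<delta>)"
  shows "(\<integral>\<^sup>+x. \<integral>\<^sup>+y. ennreal (if 0 < s * fst x \<and> s * fst y < 0 then kS \<delta> \<beta> x * kS \<delta> \<beta> y else 0) * (f0 (x + y) * (f1 x * f2 y)) \<partial>lborel \<partial>lborel)
    \<le> (\<integral>\<^sup>+\<zeta>. (f0 \<zeta>)\<^sup>2 \<partial>lborel) + 2 * C * ((\<integral>\<^sup>+x. (f1 x)\<^sup>2 \<partial>lborel) * (\<integral>\<^sup>+y. (f2 y)\<^sup>2 \<partial>lborel))"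
proof -
  define k where "k = kS \<delta> \<beta>"
  have km [measurable]: "k \<in> borel_measurable borel" by (simp add: k_def)
  have k0 [simp]: "0 \<le> k z" for z by (simp add: k_def)
  have kminus: "k (- z) = k z" for z by (simp add: k_def)
  define F1 where "F1 = (\<lambda>x. ennreal (if 0 < s * fst x then k x else 0) * f1 x)"
  define F2 where "F2 = (\<lambda>x. ennreal (if s * fst x < 0 then k x else 0) * f2 x)"
  have [measurable]: "F1 \<in> borel_measurable borel" "F2 \<in> borel_measurable borel"
    unfolding F1_def F2_def by measurable
  define G where "G = (\<lambda>\<zeta>. \<integral>\<^sup>+a. F1 a * F2 (\<zeta> - a) \<partial>lborel)"
  have Gm [measurable]: "G \<in> borel_measurable borel"
    unfolding G_def by (rule measurable_inner_nn_integral) measurable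
  \<comment> \<open>the squared kernel of the rearranged form: \<open>kS\<close> at \<open>a\<close> and at \<open>\<zeta> - c\<close>, the functions at \<open>c\<close> and at \<open>\<zeta> - a\<close>\<close>
  define H where "H = (\<lambda>\<zeta> a c. ennreal ((if 0 < s * fst a \<and> s * fst (\<zeta> - c) < 0 then k a * k (\<zeta> - c) else 0)\<^sup>2) * (f1 c * f2 (\<zeta> - a))\<^sup>2)"
  have Hm: "(\<lambda>x. H (u x) (v x) (w x)) \<in> borel_measurable M"
    if "u \<in> borel_measurable M" "v \<in> borel_measurable M" "w \<in> borel_measurable M" for u v w :: "'z \<Rightarrow> r3" and M
    using that unfolding H_def by measurable
  note Hm[measurable (raw)]
  have Hint: "(\<integral>\<^sup>+\<zeta>. \<integral>\<^sup>+a. \<integral>\<^sup>+c. H \<zeta> a c \<partial>lborel \<partial>lborel \<partial>lborel) \<le> C * ((\<integral>\<^sup>+x. (f1 x)\<^sup>2 \<partial>lborel) * (\<integral>\<^sup>+y. (f2 y)\<^sup>2 \<partial>lborel))"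
  proof -
    have "(\<integral>\<^sup>+\<zeta>. \<integral>\<^sup>+a. \<integral>\<^sup>+c. H \<zeta> a c \<partial>lborel \<partial>lborel \<partial>lborel) = (\<integral>\<^sup>+a. \<integral>\<^sup>+\<zeta>. \<integral>\<^sup>+c. H \<zeta> a c \<partial>lborel \<partial>lborel \<partial>lborel)"
      by (rule nn_integral_swap) (rule measurable_inner_nn_integral, measurable)
    also have "\<dots> = (\<integral>\<^sup>+a. \<integral>\<^sup>+b. \<integral>\<^sup>+c. H (b + a) a c \<partial>lborel \<partial>lborel \<partial>lborel)"
      by (intro nn_integral_cong nn_integral_translate(1)[symmetric] measurable_inner_nn_integral) measurable
    also have "\<dots> = (\<integral>\<^sup>+b. \<integral>\<^sup>+a. \<integral>\<^sup>+c. H (b + a) a c \<partial>lborel \<partial>lborel \<partial>lborel)"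
      by (rule nn_integral_swap) (rule measurable_inner_nn_integral, measurable)
    also have "\<dots> = (\<integral>\<^sup>+b. \<integral>\<^sup>+c. \<integral>\<^sup>+a. H (b + a) a c \<partial>lborel \<partial>lborel \<partial>lborel)"
      by (intro nn_integral_cong nn_integral_swap) measurable
    also have "\<dots> \<le> (\<integral>\<^sup>+b. \<integral>\<^sup>+c. C * (f2 b * f1 c)\<^sup>2 \<partial>lborel \<partial>lborel)"
    proof (rule nn_integral_mono, rule nn_integral_mono_AE)
      fix b :: r3
      show "AE c in lborel. (\<integral>\<^sup>+a. H (b + a) a c \<partial>lborel) \<le> C * (f2 b * f1 c)\<^sup>2"
        using AE_fst_neq_0[of "fst b"]
      proof eventually_elim
        case (elim c)
        then have cb: "fst (c - b) \<noteq> 0" by simp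
        have "(\<integral>\<^sup>+a. H (b + a) a c \<partial>lborel) \<le> (\<integral>\<^sup>+a. ennreal (if 0 < fst a * fst ((c - b) - a) then (k a * k ((c - b) - a))\<^sup>2 else 0) * (f2 b * f1 c)\<^sup>2 \<partial>lborel)"
        proof (intro nn_integral_mono)
          fix a
          have "k (b + a - c) = k ((c - b) - a)" using kminus[of "(c - b) - a"] by (simp add: algebra_simps)
          moreover have "0 < fst a * fst ((c - b) - a)" if "0 < s * fst a" "s * fst (b + a - c) < 0"
            using that by (auto simp: zero_less_mult_iff mult_less_0_iff)
          ultimately show "H (b + a) a c \<le> ennreal (if 0 < fst a * fst ((c - b) - a) then (k a * k ((c - b) - a))\<^sup>2 else 0) * (f2 b * f1 c)\<^sup>2"
            unfolding H_def by (auto simp: mult.commute)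
        qed
        also have "\<dots> = (\<integral>\<^sup>+a. ennreal (if 0 < fst a * fst ((c - b) - a) then (k a * k ((c - b) - a))\<^sup>2 else 0) \<partial>lborel) * (f2 b * f1 c)\<^sup>2"
          by (rule nn_integral_multc) measurable
        also have "\<dots> \<le> C * (f2 b * f1 c)\<^sup>2"
          unfolding C_def k_def by (intro mult_right_mono nn_integral_kS_same_sign assms cb) simp
        finally show ?case .
      qed
    qed
    also have "\<dots> = (\<integral>\<^sup>+b. C * (\<integral>\<^sup>+c. (f2 b * f1 c)\<^sup>2 \<partial>lborel) \<partial>lborel)"
      by (intro nn_integral_cong nn_integral_cmult) measurable
    also have "\<dots> = C * (\<integral>\<^sup>+b. \<integral>\<^sup>+c. (f2 b * f1 c)\<^sup>2 \<partial>lborel \<partial>lborel)"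
      by (rule nn_integral_cmult) (simp add: measurable_inner_nn_integral)
    also have "(\<integral>\<^sup>+b. \<integral>\<^sup>+c. (f2 b * f1 c)\<^sup>2 \<partial>lborel \<partial>lborel) = (\<integral>\<^sup>+x. (f1 x)\<^sup>2 \<partial>lborel) * (\<integral>\<^sup>+y. (f2 y)\<^sup>2 \<partial>lborel)"
      by (subst nn_integral_product_square) (simp_all add: mult.commute)
    finally show ?thesis .
  qed
  have G2: "(\<integral>\<^sup>+\<zeta>. (G \<zeta>)\<^sup>2 \<partial>lborel) \<le> 2 * C * ((\<integral>\<^sup>+x. (f1 x)\<^sup>2 \<partial>lborel) * (\<integral>\<^sup>+y. (f2 y)\<^sup>2 \<partial>lborel))"
  proof -
    have pw: "(G \<zeta>)\<^sup>2 \<le> (\<integral>\<^sup>+a. \<integral>\<^sup>+c. H \<zeta> a c \<partial>lborel \<partial>lborel) + (\<integral>\<^sup>+a. \<integral>\<^sup>+c. H \<zeta> a c \<partial>lborel \<partial>lborel)" for \<zeta>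
    proof -
      have "(G \<zeta>)\<^sup>2 = (\<integral>\<^sup>+a. F1 a * F2 (\<zeta> - a) * G \<zeta> \<partial>lborel)"
        unfolding power2_eq_square by (subst nn_integral_multc) (simp_all add: G_def)
      also have "\<dots> = (\<integral>\<^sup>+a. \<integral>\<^sup>+c. (F1 a * F2 (\<zeta> - a)) * (F1 c * F2 (\<zeta> - c)) \<partial>lborel \<partial>lborel)"
        unfolding G_def by (intro nn_integral_cong nn_integral_cmult[symmetric]) measurable
      also have "\<dots> \<le> (\<integral>\<^sup>+a. \<integral>\<^sup>+c. H \<zeta> a c + H \<zeta> c a \<partial>lborel \<partial>lborel)"
      proof (intro nn_integral_mono)
        fix a c
        define U where "U = (\<lambda>a c. ennreal (if 0 < s * fst a \<and> s * fst (\<zeta> - c) < 0 then k a * k (\<zeta> - c) else 0) * (f1 c * f2 (\<zeta> - a)))"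
        have "(F1 a * F2 (\<zeta> - a)) * (F1 c * F2 (\<zeta> - c)) = U a c * U c a"
        proof -
          have e: "ennreal (if P \<and> Q then x * y else 0) = ennreal (if P then x else 0) * ennreal (if Q then y else 0)" if "0 \<le> x" "0 \<le> y" for P Q and x y :: real
            using that by (auto simp: ennreal_mult)
          show ?thesis unfolding U_def F1_def F2_def e[OF k0 k0] by (simp only: mult_ac)
        qed
        also have "\<dots> \<le> (U a c)\<^sup>2 + (U c a)\<^sup>2" by (rule ennreal_amgm)
        also have "\<dots> = H \<zeta> a c + H \<zeta> c a"
          unfolding U_def H_def by (simp only: power_mult_distrib ennreal_power mult_nonneg_nonneg k0 if_split) (auto simp: ennreal_power power_mult_distrib)
        finally show "(F1 a * F2 (\<zeta> - a)) * (F1 c * F2 (\<zeta> - c)) \<le> H \<zeta> a c + H \<zeta> c a" .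
      qed
      also have "\<dots> = (\<integral>\<^sup>+a. (\<integral>\<^sup>+c. H \<zeta> a c \<partial>lborel) + (\<integral>\<^sup>+c. H \<zeta> c a \<partial>lborel) \<partial>lborel)"
        by (intro nn_integral_cong nn_integral_add) measurable
      also have "\<dots> = (\<integral>\<^sup>+a. \<integral>\<^sup>+c. H \<zeta> a c \<partial>lborel \<partial>lborel) + (\<integral>\<^sup>+a. \<integral>\<^sup>+c. H \<zeta> c a \<partial>lborel \<partial>lborel)"
        by (rule nn_integral_add) (simp_all add: measurable_inner_nn_integral)
      also have "(\<integral>\<^sup>+a. \<integral>\<^sup>+c. H \<zeta> c a \<partial>lborel \<partial>lborel) = (\<integral>\<^sup>+a. \<integral>\<^sup>+c. H \<zeta> a c \<partial>lborel \<partial>lborel)"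
        by (rule nn_integral_swap) measurable
      finally show ?thesis .
    qed
    have Hm2: "(\<lambda>\<zeta>. \<integral>\<^sup>+a. \<integral>\<^sup>+c. H \<zeta> a c \<partial>lborel \<partial>lborel) \<in> borel_measurable lborel"
      unfolding measurable_lborel2 by (rule measurable_inner_nn_integral, rule measurable_inner_nn_integral) measurable
    have "(\<integral>\<^sup>+\<zeta>. (G \<zeta>)\<^sup>2 \<partial>lborel) \<le> (\<integral>\<^sup>+\<zeta>. (\<integral>\<^sup>+a. \<integral>\<^sup>+c. H \<zeta> a c \<partial>lborel \<partial>lborel) + (\<integral>\<^sup>+a. \<integral>\<^sup>+c. H \<zeta> a c \<partial>lborel \<partial>lborel) \<partial>lborel)"
      by (intro nn_integral_mono pw)
    also have "\<dots> = (\<integral>\<^sup>+\<zeta>. \<integral>\<^sup>+a. \<integral>\<^sup>+c. H \<zeta> a c \<partial>lborel \<partial>lborel \<partial>lborel) + (\<integral>\<^sup>+\<zeta>. \<integral>\<^sup>+a. \<integral>\<^sup>+c. H \<zeta> a c \<partial>lborel \<partial>lborel \<partial>lborel)"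
      by (rule nn_integral_add[OF Hm2 Hm2])
    also have "\<dots> \<le> C * ((\<integral>\<^sup>+x. (f1 x)\<^sup>2 \<partial>lborel) * (\<integral>\<^sup>+y. (f2 y)\<^sup>2 \<partial>lborel)) + C * ((\<integral>\<^sup>+x. (f1 x)\<^sup>2 \<partial>lborel) * (\<integral>\<^sup>+y. (f2 y)\<^sup>2 \<partial>lborel))"
      by (intro add_mono Hint)
    finally show ?thesis by (simp only: mult_2 distrib_right)
  qed
  have "(\<integral>\<^sup>+x. \<integral>\<^sup>+y. ennreal (if 0 < s * fst x \<and> s * fst y < 0 then kS \<delta> \<beta> x * kS \<delta> \<beta> y else 0) * (f0 (x + y) * (f1 x * f2 y)) \<partial>lborel \<partial>lborel)
    = (\<integral>\<^sup>+x. \<integral>\<^sup>+y. f0 (x + y) * (F1 x * F2 y) \<partial>lborel \<partial>lborel)"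
  proof (intro nn_integral_cong)
    fix x y
    show "ennreal (if 0 < s * fst x \<and> s * fst y < 0 then kS \<delta> \<beta> x * kS \<delta> \<beta> y else 0) * (f0 (x + y) * (f1 x * f2 y)) = f0 (x + y) * (F1 x * F2 y)"
      by (auto simp: F1_def F2_def k_def ennreal_mult mult_ac)
  qed
  also have "\<dots> = (\<integral>\<^sup>+\<zeta>. \<integral>\<^sup>+x. f0 \<zeta> * (F1 x * F2 (\<zeta> - x)) \<partial>lborel \<partial>lborel)"
  proof -
    have "(\<lambda>x. f0 (fst x + snd x) * (F1 (fst x) * F2 (snd x))) \<in> borel_measurable borel" by measurable
    from nn_integral_swap_sum[OF this] show ?thesis by simp
  qed
  also have "\<dots> = (\<integral>\<^sup>+\<zeta>. f0 \<zeta> * G \<zeta> \<partial>lborel)"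
    unfolding G_def by (intro nn_integral_cong nn_integral_cmult) measurable
  also have "\<dots> \<le> (\<integral>\<^sup>+\<zeta>. (f0 \<zeta>)\<^sup>2 + (G \<zeta>)\<^sup>2 \<partial>lborel)"
    by (intro nn_integral_mono ennreal_amgm)
  also have "\<dots> = (\<integral>\<^sup>+\<zeta>. (f0 \<zeta>)\<^sup>2 \<partial>lborel) + (\<integral>\<^sup>+\<zeta>. (G \<zeta>)\<^sup>2 \<partial>lborel)"
    by (rule nn_integral_add) measurable
  also have "\<dots> \<le> (\<integral>\<^sup>+\<zeta>. (f0 \<zeta>)\<^sup>2 \<partial>lborel) + 2 * C * ((\<integral>\<^sup>+x. (f1 x)\<^sup>2 \<partial>lborel) * (\<integral>\<^sup>+y. (f2 y)\<^sup>2 \<partial>lborel))"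
    by (intro add_left_mono G2)
  finally show ?thesis .
qed

section \<open>Trilinear forms with all three frequencies\<close>

definition sq_int :: "(r3 \<Rightarrow> ennreal) \<Rightarrow> ennreal" where
  "sq_int f = (\<integral>\<^sup>+z. (f z)\<^sup>2 \<partial>lborel)"

definition trilinear :: "(r3 \<Rightarrow> r3 \<Rightarrow> real) \<Rightarrow> (r3 \<Rightarrow> ennreal) \<Rightarrow> (r3 \<Rightarrow> ennreal) \<Rightarrow> (r3 \<Rightarrow> ennreal) \<Rightarrow> ennreal" where
  "trilinear K f0 f1 f2 = (\<integral>\<^sup>+x. \<integral>\<^sup>+y. ennreal (K x y) * (f0 (x + y) * (f1 x * f2 y)) \<partial>lborel \<partial>lborel)"

lemma sq_int_minus:
  assumes [measurable]: "f \<in> borel_measurable borel"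
  shows "sq_int (\<lambda>z. f (- z)) = sq_int f"
  unfolding sq_int_def by (rule nn_integral_translate(5)[where f = "\<lambda>y. (f y)\<^sup>2"]) measurable

lemma sq_int_cmult:
  assumes "f \<in> borel_measurable borel" shows "sq_int (\<lambda>z. c * f z) = c\<^sup>2 * sq_int f"
  unfolding sq_int_def power_mult_distrib using assms by (intro nn_integral_cmult) simp

lemma trilinear_add:
  assumes [measurable]: "f0 \<in> borel_measurable borel" "f1 \<in> borel_measurable borel" "f2 \<in> borel_measurable borel"
    and Km: "(\<lambda>x. K (fst x) (snd x)) \<in> borel_measurable borel" and Lm: "(\<lambda>x. L (fst x) (snd x)) \<in> borel_measurable borel"
    and nn: "\<And>x y. 0 \<le> K x y" "\<And>x y. 0 \<le> L x y"
  shows "trilinear (\<lambda>x y. K x y + L x y) f0 f1 f2 = trilinear K f0 f1 f2 + trilinear L f0 f1 f2"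
proof -
  note kernel_compose[OF Km, measurable (raw)] kernel_compose[OF Lm, measurable (raw)]
  have "trilinear (\<lambda>x y. K x y + L x y) f0 f1 f2 =
    (\<integral>\<^sup>+x. \<integral>\<^sup>+y. ennreal (K x y) * (f0 (x + y) * (f1 x * f2 y)) + ennreal (L x y) * (f0 (x + y) * (f1 x * f2 y)) \<partial>lborel \<partial>lborel)"
    unfolding trilinear_def using nn by (simp add: distrib_right)
  also have "\<dots> = (\<integral>\<^sup>+x. (\<integral>\<^sup>+y. ennreal (K x y) * (f0 (x + y) * (f1 x * f2 y)) \<partial>lborel) + (\<integral>\<^sup>+y. ennreal (L x y) * (f0 (x + y) * (f1 x * f2 y)) \<partial>lborel) \<partial>lborel)"
    by (intro nn_integral_cong nn_integral_add) measurable
  also have "\<dots> = trilinear K f0 f1 f2 + trilinear L f0 f1 f2"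
    unfolding trilinear_def by (rule nn_integral_add) (simp_all add: measurable_inner_nn_integral)
  finally show ?thesis .
qed

lemma trilinear_mono:
  assumes "\<And>x y. fst x \<noteq> 0 \<Longrightarrow> fst y \<noteq> 0 \<Longrightarrow> fst x + fst y \<noteq> 0 \<Longrightarrow> K x y \<le> L x y"
  shows "trilinear K f0 f1 f2 \<le> trilinear L f0 f1 f2"
  unfolding trilinear_def
proof (rule nn_integral_mono_AE)
  show "AE x in lborel. (\<integral>\<^sup>+y. ennreal (K x y) * (f0 (x + y) * (f1 x * f2 y)) \<partial>lborel) \<le> (\<integral>\<^sup>+y. ennreal (L x y) * (f0 (x + y) * (f1 x * f2 y)) \<partial>lborel)"
    using AE_fst_neq_0[of 0]
  proof eventually_elim
    case (elim x)
    show ?case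
    proof (rule nn_integral_mono_AE)
      show "AE y in lborel. ennreal (K x y) * (f0 (x + y) * (f1 x * f2 y)) \<le> ennreal (L x y) * (f0 (x + y) * (f1 x * f2 y))"
        using AE_fst_neq_0[of 0] AE_fst_neq_0[of "- fst x"]
      proof eventually_elim
        case (elim y)
        then have "fst x + fst y \<noteq> 0" by auto
        then have "ennreal (K x y) \<le> ennreal (L x y)" using elim \<open>fst x \<noteq> 0\<close> by (intro ennreal_leI assms) auto
        then show ?case by (rule mult_right_mono) simp
      qed
    qed
  qed
qed

lemma trilinear_cmult:
  assumes [measurable]: "f0 \<in> borel_measurable borel" "f1 \<in> borel_measurable borel" "f2 \<in> borel_measurable borel"
    and Km: "(\<lambda>x. K (fst x) (snd x)) \<in> borel_measurable borel" and c: "0 \<le> c"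
  shows "trilinear (\<lambda>x y. c * K x y) f0 f1 f2 = ennreal c * trilinear K f0 f1 f2"
proof -
  note kernel_compose[OF Km, measurable (raw)]
  have "trilinear (\<lambda>x y. c * K x y) f0 f1 f2 = (\<integral>\<^sup>+x. \<integral>\<^sup>+y. ennreal c * (ennreal (K x y) * (f0 (x + y) * (f1 x * f2 y))) \<partial>lborel \<partial>lborel)"
    unfolding trilinear_def using c by (simp add: ennreal_mult' mult.assoc)
  also have "\<dots> = (\<integral>\<^sup>+x. ennreal c * (\<integral>\<^sup>+y. (ennreal (K x y) * (f0 (x + y) * (f1 x * f2 y))) \<partial>lborel) \<partial>lborel)"
    by (intro nn_integral_cong nn_integral_cmult) measurable
  also have "\<dots> = ennreal c * trilinear K f0 f1 f2"
    unfolding trilinear_def by (rule nn_integral_cmult) (simp add: measurable_inner_nn_integral)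
  finally show ?thesis .
qed

lemma trilinear_commute:
  assumes [measurable]: "f0 \<in> borel_measurable borel" "f1 \<in> borel_measurable borel" "f2 \<in> borel_measurable borel"
    and Km: "(\<lambda>x. K (fst x) (snd x)) \<in> borel_measurable borel"
  shows "trilinear K f0 f1 f2 = trilinear (\<lambda>x y. K y x) f0 f2 f1"
proof -
  note kernel_compose[OF Km, measurable (raw)]
  have "trilinear K f0 f1 f2 = (\<integral>\<^sup>+y. \<integral>\<^sup>+x. ennreal (K x y) * (f0 (x + y) * (f1 x * f2 y)) \<partial>lborel \<partial>lborel)"
    unfolding trilinear_def by (rule nn_integral_swap) measurable
  then show ?thesis unfolding trilinear_def by (simp add: add.commute mult.commute)
qed

text \<open>In the variables \<open>u = x + y\<close> and \<open>w = - y\<close> the roles of the output and of the first input are exchanged; this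
transports an estimate for one pair of frequencies to another pair.\<close>

lemma trilinear_exchange:
  assumes [measurable]: "f0 \<in> borel_measurable borel" "f1 \<in> borel_measurable borel" "f2 \<in> borel_measurable borel"
    and Km: "(\<lambda>x. K (fst x) (snd x)) \<in> borel_measurable borel"
  shows "trilinear K f0 f1 f2 = trilinear (\<lambda>u w. K (u + w) (- w)) f1 f0 (\<lambda>w. f2 (- w))"
proof -
  note kernel_compose[OF Km, measurable (raw)]
  have "trilinear K f0 f1 f2 = (\<integral>\<^sup>+y. \<integral>\<^sup>+x. ennreal (K x y) * (f0 (x + y) * (f1 x * f2 y)) \<partial>lborel \<partial>lborel)"
    unfolding trilinear_def by (rule nn_integral_swap) measurable
  also have "\<dots> = (\<integral>\<^sup>+y. \<integral>\<^sup>+\<zeta>. ennreal (K (\<zeta> - y) y) * (f0 \<zeta> * (f1 (\<zeta> - y) * f2 y)) \<partial>lborel \<partial>lborel)"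
  proof (rule nn_integral_cong)
    fix y
    show "(\<integral>\<^sup>+x. ennreal (K x y) * (f0 (x + y) * (f1 x * f2 y)) \<partial>lborel) = (\<integral>\<^sup>+\<zeta>. ennreal (K (\<zeta> - y) y) * (f0 \<zeta> * (f1 (\<zeta> - y) * f2 y)) \<partial>lborel)"
      using nn_integral_translate(3)[of "\<lambda>x. ennreal (K x y) * (f0 (x + y) * (f1 x * f2 y))" y] by simp
  qed
  also have "\<dots> = (\<integral>\<^sup>+w. \<integral>\<^sup>+\<zeta>. ennreal (K (\<zeta> + w) (- w)) * (f0 \<zeta> * (f1 (\<zeta> + w) * f2 (- w))) \<partial>lborel \<partial>lborel)"
    by (subst nn_integral_translate(5)[symmetric]) (simp_all add: measurable_inner_nn_integral)
  also have "\<dots> = (\<integral>\<^sup>+\<zeta>. \<integral>\<^sup>+w. ennreal (K (\<zeta> + w) (- w)) * (f1 (\<zeta> + w) * (f0 \<zeta> * f2 (- w))) \<partial>lborel \<partial>lborel)"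
    by (subst nn_integral_swap) (simp_all add: mult_ac)
  finally show ?thesis unfolding trilinear_def .
qed

text \<open>The product of the signs of the two frequencies decides between the same-sign estimate and one of the two
opposite-sign estimates.\<close>

lemma trilinear_kS:
  fixes f0 f1 f2 :: "r3 \<Rightarrow> ennreal"
  assumes [measurable]: "f0 \<in> borel_measurable borel" "f1 \<in> borel_measurable borel" "f2 \<in> borel_measurable borel"
    and "\<beta> > 1" "\<delta> > 0"
  defines "C \<equiv> ennreal (pair_const \<beta> * ss_const \<delta>)"
  shows "trilinear (\<lambda>x y. kS \<delta> \<beta> x * kS \<delta> \<beta> y) f0 f1 f2 \<le> (C + 2) * sq_int f0 + (1 + 4 * C) * (sq_int f1 * sq_int f2)"
proof -
  define ks where "ks = (\<lambda>x y. if 0 < fst x * fst y then kS \<delta> \<beta> x * kS \<delta> \<beta> y else 0)"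
  \<comment> \<open>the sign \<open>s\<close> tells which of the two frequencies is positive\<close>
  define ko where "ko = (\<lambda>s x y. if 0 < s * fst x \<and> s * fst y < 0 then kS \<delta> \<beta> x * kS \<delta> \<beta> y else 0)"
  have ksm: "(\<lambda>x. ks (fst x) (snd x)) \<in> borel_measurable borel" unfolding ks_def by measurable
  have kom: "(\<lambda>x. ko s (fst x) (snd x)) \<in> borel_measurable borel" for s unfolding ko_def by measurable
  have nn: "0 \<le> ks x y" "0 \<le> ko s x y" for x y s by (auto simp: ks_def ko_def)
  have "trilinear (\<lambda>x y. kS \<delta> \<beta> x * kS \<delta> \<beta> y) f0 f1 f2 \<le> trilinear (\<lambda>x y. ks x y + (ko 1 x y + ko (- 1) x y)) f0 f1 f2"
  proof (rule trilinear_mono)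
    fix x y :: r3
    assume "fst x \<noteq> 0" "fst y \<noteq> 0"
    then consider "0 < fst x * fst y" | "0 < fst x" "fst y < 0" | "fst x < 0" "0 < fst y"
      by (auto simp: zero_less_mult_iff linorder_neq_iff)
    then show "kS \<delta> \<beta> x * kS \<delta> \<beta> y \<le> ks x y + (ko 1 x y + ko (- 1) x y)"
    proof cases
      case 1
      then have "kS \<delta> \<beta> x * kS \<delta> \<beta> y = ks x y" by (simp add: ks_def)
      then show ?thesis using nn(1)[of x y] nn(2)[where s = 1 and x = x and y = y] nn(2)[where s = "- 1" and x = x and y = y] by linarith
    next
      case 2
      then have "kS \<delta> \<beta> x * kS \<delta> \<beta> y = ko 1 x y" by (simp add: ko_def)
      then show ?thesis using nn(1)[of x y] nn(2)[where s = 1 and x = x and y = y] nn(2)[where s = "- 1" and x = x and y = y] by linarith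
    next
      case 3
      then have "kS \<delta> \<beta> x * kS \<delta> \<beta> y = ko (- 1) x y" by (simp add: ko_def)
      then show ?thesis using nn(1)[of x y] nn(2)[where s = 1 and x = x and y = y] nn(2)[where s = "- 1" and x = x and y = y] by linarith
    qed
  qed
  also have "\<dots> = trilinear ks f0 f1 f2 + (trilinear (ko 1) f0 f1 f2 + trilinear (ko (- 1)) f0 f1 f2)"
  proof -
    have "(\<lambda>x. ko 1 (fst x) (snd x) + ko (- 1) (fst x) (snd x)) \<in> borel_measurable borel"
      by (intro borel_measurable_add kom)
    then have "trilinear (\<lambda>x y. ks x y + (ko 1 x y + ko (- 1) x y)) f0 f1 f2 = trilinear ks f0 f1 f2 + trilinear (\<lambda>x y. ko 1 x y + ko (- 1) x y) f0 f1 f2"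
      by (rule trilinear_add[OF assms(1-3) ksm]) (use nn in auto)
    moreover have "trilinear (\<lambda>x y. ko 1 x y + ko (- 1) x y) f0 f1 f2 = trilinear (ko 1) f0 f1 f2 + trilinear (ko (- 1)) f0 f1 f2"
      by (rule trilinear_add[OF assms(1-3) kom kom nn(2) nn(2)])
    ultimately show ?thesis by (simp only:)
  qed
  also have "\<dots> \<le> (C * sq_int f0 + sq_int f1 * sq_int f2) + ((sq_int f0 + 2 * C * (sq_int f1 * sq_int f2)) + (sq_int f0 + 2 * C * (sq_int f1 * sq_int f2)))"
    unfolding trilinear_def sq_int_def ks_def ko_def C_def
    by (intro add_mono strichartz_same_sign strichartz_opposite_sign assms)
  also have "\<dots> = (C + 2) * sq_int f0 + (1 + 4 * C) * (sq_int f1 * sq_int f2)"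
  proof -
    have 2: "(2::ennreal) = 1 + 1" by simp
    have 4: "(4::ennreal) = 1 + 1 + 1 + 1" by simp
    show ?thesis unfolding 2 4 by (simp only: distrib_right mult_1 add_ac)
  qed
  finally show ?thesis .
qed

text \<open>One constant that dominates all constants occurring in the bounds for the seven kernels.\<close>

definition tri_const :: "real \<Rightarrow> real \<Rightarrow> real" where
  "tri_const \<beta> \<delta> = 2 + 4 * (pair_const \<beta> * ss_const \<delta>) + pair_const \<beta> * 48"

lemma ss_const_nonneg: "\<delta> > 0 \<Longrightarrow> 0 \<le> ss_const \<delta>" by (simp add: ss_const_def)

lemma tri_const_bounds:
  assumes "\<beta> > 1" "\<delta> > 0"
  shows "0 < tri_const \<beta> \<delta>"
    and "ennreal (pair_const \<beta> * ss_const \<delta>) + 2 \<le> ennreal (tri_const \<beta> \<delta>)"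
    and "1 + 4 * ennreal (pair_const \<beta> * ss_const \<delta>) \<le> ennreal (tri_const \<beta> \<delta>)"
    and "ennreal (pair_const \<beta> * 48) \<le> ennreal (tri_const \<beta> \<delta>)"
    and "1 \<le> ennreal (tri_const \<beta> \<delta>)"
proof -
  define u where "u = pair_const \<beta> * ss_const \<delta>"
  have p: "0 \<le> pair_const \<beta>" "0 \<le> u"
    using pair_const_nonneg[OF assms(1)] ss_const_nonneg[OF assms(2)] by (auto simp: u_def)
  have t: "tri_const \<beta> \<delta> = 2 + 4 * u + pair_const \<beta> * 48" by (simp add: tri_const_def u_def)
  show "0 < tri_const \<beta> \<delta>" using p by (simp add: t)
  have "ennreal u + 2 = ennreal (u + 2)" using p by (subst ennreal_plus) auto
  also have "\<dots> \<le> ennreal (tri_const \<beta> \<delta>)" using p by (intro ennreal_leI) (simp add: t)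
  finally show "ennreal (pair_const \<beta> * ss_const \<delta>) + 2 \<le> ennreal (tri_const \<beta> \<delta>)" by (simp add: u_def)
  have "1 + 4 * ennreal u = ennreal (1 + 4 * u)" using p by (subst ennreal_plus) (auto simp: ennreal_mult')
  also have "\<dots> \<le> ennreal (tri_const \<beta> \<delta>)" using p by (intro ennreal_leI) (simp add: t)
  finally show "1 + 4 * ennreal (pair_const \<beta> * ss_const \<delta>) \<le> ennreal (tri_const \<beta> \<delta>)" by (simp add: u_def)
  show "ennreal (pair_const \<beta> * 48) \<le> ennreal (tri_const \<beta> \<delta>)" using p by (intro ennreal_leI) (simp add: t)
  show "1 \<le> ennreal (tri_const \<beta> \<delta>)" using p by (subst ennreal_1[symmetric], intro ennreal_leI) (simp add: t)
qed

lemma two_term_bound: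
  fixes a b D x y :: ennreal
  assumes "a \<le> D" "b \<le> D" "x \<le> u" "y \<le> v"
  shows "a * x + b * y \<le> D * (u + v)"
proof -
  have "a * x + b * y \<le> D * u + D * v" by (intro add_mono mult_mono assms) auto
  then show ?thesis by (simp add: distrib_left)
qed

text \<open>With normalized inputs all kernels obey a bound of the form \<open>D * (sq_int f0 + 1)\<close>, whichever function the
Cauchy-Schwarz test puts first; bounds of this form can be added.\<close>

locale normalized_inputs =
  fixes f0 f1 f2 :: "r3 \<Rightarrow> ennreal" and \<beta> \<delta> :: real
  assumes m0 [measurable]: "f0 \<in> borel_measurable borel" and m1 [measurable]: "f1 \<in> borel_measurable borel"
    and m2 [measurable]: "f2 \<in> borel_measurable borel"
    and n1: "sq_int f1 \<le> 1" and n2: "sq_int f2 \<le> 1" and \<beta>: "\<beta> > 1" and \<delta>: "\<delta> > 0"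
begin

abbreviation "D \<equiv> ennreal (tri_const \<beta> \<delta>)"

lemma prod_le: "x * y \<le> x" if "y \<le> 1" for x y :: ennreal
  using mult_left_mono[OF that, of x] by simp

lemma n12: "sq_int f1 * sq_int f2 \<le> 1"
  using order_trans[OF prod_le[OF n2] n1] .

lemma kS12: "trilinear (\<lambda>x y. kS \<delta> \<beta> x * kS \<delta> \<beta> y) f0 f1 f2 \<le> D * (sq_int f0 + 1)"
  by (rule order_trans[OF trilinear_kS[OF m0 m1 m2 \<beta> \<delta>] two_term_bound]) (use tri_const_bounds[OF \<beta> \<delta>] n12 in auto)

lemma kS01: "trilinear (\<lambda>x y. kS \<delta> \<beta> (x + y) * kS \<delta> \<beta> x) f0 f1 f2 \<le> D * (sq_int f0 + 1)"
proof -
  have "trilinear (\<lambda>x y. kS \<delta> \<beta> (x + y) * kS \<delta> \<beta> x) f0 f1 f2 = trilinear (\<lambda>x y. kS \<delta> \<beta> (x + y) * kS \<delta> \<beta> y) f0 f2 f1"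
    by (subst trilinear_commute) (simp_all add: add.commute)
  also have "\<dots> = trilinear (\<lambda>u w. kS \<delta> \<beta> u * kS \<delta> \<beta> w) f2 f0 (\<lambda>w. f1 (- w))"
    by (subst trilinear_exchange) simp_all
  also have "\<dots> \<le> D * (1 + sq_int f0)"
    by (rule order_trans[OF trilinear_kS[OF m2 m0 _ \<beta> \<delta>] two_term_bound])
       (use tri_const_bounds[OF \<beta> \<delta>] n2 prod_le[OF n1] in \<open>auto simp: sq_int_minus\<close>)
  finally show ?thesis by (simp add: add.commute)
qed

lemma kS02: "trilinear (\<lambda>x y. kS \<delta> \<beta> (x + y) * kS \<delta> \<beta> y) f0 f1 f2 \<le> D * (sq_int f0 + 1)"
proof -
  have "trilinear (\<lambda>x y. kS \<delta> \<beta> (x + y) * kS \<delta> \<beta> y) f0 f1 f2 = trilinear (\<lambda>u w. kS \<delta> \<beta> u * kS \<delta> \<beta> w) f1 f0 (\<lambda>w. f2 (- w))"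
    by (subst trilinear_exchange) simp_all
  also have "\<dots> \<le> D * (1 + sq_int f0)"
    by (rule order_trans[OF trilinear_kS[OF m1 m0 _ \<beta> \<delta>] two_term_bound])
       (use tri_const_bounds[OF \<beta> \<delta>] n1 prod_le[OF n2] in \<open>auto simp: sq_int_minus\<close>)
  finally show ?thesis by (simp add: add.commute)
qed

lemma kH_comp [measurable (raw)]:
  "a \<in> borel_measurable M \<Longrightarrow> b \<in> borel_measurable M \<Longrightarrow> (\<lambda>x. kH \<beta> (a x) (b x)) \<in> borel_measurable M"
  by (rule kernel_compose[OF kH_measurable])

lemma kH_out2: "trilinear (\<lambda>x y. kH \<beta> (x + y) y) f0 f1 f2 \<le> D * (sq_int f0 + 1)"
proof -
  have "trilinear (\<lambda>x y. kH \<beta> (x + y) y) f0 f1 f2 \<le> ennreal (pair_const \<beta> * 48) * sq_int f0 + 1 * (sq_int f1 * sq_int f2)"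
    unfolding trilinear_def sq_int_def mult_1 by (rule trilinear_output) (auto intro: nn_integral_kH \<beta>)
  also have "\<dots> \<le> D * (sq_int f0 + 1)"
    by (rule two_term_bound) (use tri_const_bounds[OF \<beta> \<delta>] n12 in auto)
  finally show ?thesis .
qed

lemma kH_in2: "trilinear (\<lambda>x y. kH \<beta> x (- y)) f0 f1 f2 \<le> D * (sq_int f0 + 1)"
proof -
  have "trilinear (\<lambda>x y. kH \<beta> x (- y)) f0 f1 f2 = trilinear (\<lambda>u w. kH \<beta> (u + w) w) f1 f0 (\<lambda>w. f2 (- w))"
    by (subst trilinear_exchange) simp_all
  also have "\<dots> \<le> ennreal (pair_const \<beta> * 48) * sq_int f1 + 1 * (sq_int f0 * sq_int (\<lambda>w. f2 (- w)))"
    unfolding trilinear_def sq_int_def mult_1 by (rule trilinear_output) (auto intro: nn_integral_kH \<beta>)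
  also have "\<dots> \<le> D * (1 + sq_int f0)"
    unfolding sq_int_minus[OF m2] by (rule two_term_bound) (use tri_const_bounds[OF \<beta> \<delta>] n1 prod_le[OF n2] in auto)
  finally show ?thesis by (simp add: add.commute)
qed

end

text \<open>The Strichartz kernels for the three pairs among \<open>x\<close>, \<open>y\<close>, \<open>x + y\<close>, and the high-low kernels in which the low
frequency is \<open>y\<close> or \<open>x\<close> and the modulation that does not occur is that of the output or that of the
high-frequency input.\<close>

definition ktot :: "real \<Rightarrow> real \<Rightarrow> r3 \<Rightarrow> r3 \<Rightarrow> real" where
  "ktot \<beta> \<delta> x y = kS \<delta> \<beta> x * kS \<delta> \<beta> y + (kS \<delta> \<beta> (x + y) * kS \<delta> \<beta> x + (kS \<delta> \<beta> (x + y) * kS \<delta> \<beta> y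
     + (kH \<beta> (x + y) y + (kH \<beta> (x + y) x + (kH \<beta> x (- y) + kH \<beta> y (- x))))))"

lemma ktot_nonneg: "0 \<le> ktot \<beta> \<delta> x y" by (simp add: ktot_def)

lemma trilinear_ktot:
  assumes "normalized_inputs f0 f1 f2 \<beta> \<delta>"
  shows "trilinear (ktot \<beta> \<delta>) f0 f1 f2 \<le> 7 * (ennreal (tri_const \<beta> \<delta>) * (sq_int f0 + 1))"
proof -
  interpret A: normalized_inputs f0 f1 f2 \<beta> \<delta> by fact
  interpret B: normalized_inputs f0 f2 f1 \<beta> \<delta>
    using A.m0 A.m1 A.m2 A.n1 A.n2 A.\<beta> A.\<delta> by unfold_locales
  note A.kH_comp[measurable (raw)] A.m0[measurable] A.m1[measurable] A.m2[measurable]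
  let ?B = "ennreal (tri_const \<beta> \<delta>) * (sq_int f0 + 1)"
  have H1: "trilinear (\<lambda>x y. kH \<beta> (x + y) x) f0 f1 f2 \<le> ?B"
    using B.kH_out2 by (subst trilinear_commute) (simp_all add: add.commute)
  have H2: "trilinear (\<lambda>x y. kH \<beta> y (- x)) f0 f1 f2 \<le> ?B"
    using B.kH_in2 by (subst trilinear_commute) (simp_all add: add.commute)
  define good where "good = (\<lambda>E K. trilinear K f0 f1 f2 \<le> E \<and>
    (\<lambda>x. K (fst x) (snd x)) \<in> borel_measurable borel \<and> (\<forall>x y. 0 \<le> K x y))"
  have goodI: "good E K" if "trilinear K f0 f1 f2 \<le> E" "(\<lambda>x. K (fst x) (snd x)) \<in> borel_measurable borel" "\<And>x y. 0 \<le> K x y" for E K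
    using that by (simp add: good_def)
  have step: "good (E + E') (\<lambda>x y. K x y + L x y)" if "good E K" "good E' L" for E E' K L
  proof -
    have "trilinear (\<lambda>x y. K x y + L x y) f0 f1 f2 = trilinear K f0 f1 f2 + trilinear L f0 f1 f2"
      by (rule trilinear_add[OF A.m0 A.m1 A.m2]) (use that in \<open>auto simp: good_def\<close>)
    moreover have "\<dots> \<le> E + E'" using that by (intro add_mono) (auto simp: good_def)
    ultimately show ?thesis using that by (simp add: good_def borel_measurable_add)
  qed
  have m1: "(\<lambda>z :: r3 \<times> r3. kS \<delta> \<beta> (fst z) * kS \<delta> \<beta> (snd z)) \<in> borel_measurable borel" by measurable
  have g1: "good ?B (\<lambda>x y. kS \<delta> \<beta> x * kS \<delta> \<beta> y)" by (rule goodI[OF A.kS12 m1]) simp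
  have m2: "(\<lambda>z :: r3 \<times> r3. kS \<delta> \<beta> ((fst z) + (snd z)) * kS \<delta> \<beta> (fst z)) \<in> borel_measurable borel" by measurable
  have g2: "good ?B (\<lambda>x y. kS \<delta> \<beta> (x + y) * kS \<delta> \<beta> x)" by (rule goodI[OF A.kS01 m2]) simp
  have m3: "(\<lambda>z :: r3 \<times> r3. kS \<delta> \<beta> ((fst z) + (snd z)) * kS \<delta> \<beta> (snd z)) \<in> borel_measurable borel" by measurable
  have g3: "good ?B (\<lambda>x y. kS \<delta> \<beta> (x + y) * kS \<delta> \<beta> y)" by (rule goodI[OF A.kS02 m3]) simp
  have m4: "(\<lambda>z :: r3 \<times> r3. kH \<beta> ((fst z) + (snd z)) (snd z)) \<in> borel_measurable borel" by measurable
  have g4: "good ?B (\<lambda>x y. kH \<beta> (x + y) y)" by (rule goodI[OF A.kH_out2 m4]) simp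
  have m5: "(\<lambda>z :: r3 \<times> r3. kH \<beta> ((fst z) + (snd z)) (fst z)) \<in> borel_measurable borel" by measurable
  have g5: "good ?B (\<lambda>x y. kH \<beta> (x + y) x)" by (rule goodI[OF H1 m5]) simp
  have m6: "(\<lambda>z :: r3 \<times> r3. kH \<beta> (fst z) (- (snd z))) \<in> borel_measurable borel" by measurable
  have g6: "good ?B (\<lambda>x y. kH \<beta> x (- y))" by (rule goodI[OF A.kH_in2 m6]) simp
  have m7: "(\<lambda>z :: r3 \<times> r3. kH \<beta> (snd z) (- (fst z))) \<in> borel_measurable borel" by measurable
  have g7: "good ?B (\<lambda>x y. kH \<beta> y (- x))" by (rule goodI[OF H2 m7]) simp
  have "good (?B + (?B + (?B + (?B + (?B + (?B + ?B)))))) (ktot \<beta> \<delta>)"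
    unfolding ktot_def[abs_def]
    by (rule step[OF g1 step[OF g2 step[OF g3 step[OF g4 step[OF g5 step[OF g6 g7]]]]]])
  then have "trilinear (ktot \<beta> \<delta>) f0 f1 f2 \<le> ?B + (?B + (?B + (?B + (?B + (?B + ?B)))))"
    by (simp add: good_def)
  also have "\<dots> = 7 * ?B"
  proof -
    have 7: "(7::ennreal) = 1 + (1 + (1 + (1 + (1 + (1 + 1)))))" by simp
    show ?thesis unfolding 7 by (simp only: distrib_right mult_1)
  qed
  finally show ?thesis .
qed

section \<open>From trilinear forms to bilinear estimates\<close>

text \<open>Test with \<open>f = t * h\<close> and optimize in \<open>t\<close>. As \<open>sq_int h\<close> is not known to be finite, \<open>h\<close> is first truncated in
height and to a ball, and the truncation is removed by monotone convergence.\<close>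

lemma sq_int_duality:
  fixes h :: "r3 \<Rightarrow> ennreal"
  assumes [measurable]: "h \<in> borel_measurable borel" and A: "0 < A"
    and dual: "\<And>f. f \<in> borel_measurable borel \<Longrightarrow> (\<integral>\<^sup>+z. f z * h z \<partial>lborel) \<le> ennreal A * (sq_int f + 1)"
  shows "sq_int h \<le> ennreal (4 * A\<^sup>2)"
proof -
  define g where "g = (\<lambda>n z. min (h z) (of_nat n) * indicator (cball 0 (real n)) z)"
  have cb [measurable]: "cball (0::r3) (real n) \<in> sets borel" for n by simp
  have gm [measurable]: "g n \<in> borel_measurable borel" for n unfolding g_def by measurable
  have gh: "g n z \<le> h z" for n z by (auto simp: g_def split: split_indicator)
  have mono: "incseq g"
    unfolding incseq_def le_fun_def
  proof (intro allI impI)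
    fix m n z assume mn: "(m::nat) \<le> n"
    then have "min (h z) (of_nat m) \<le> min (h z) (of_nat n)" by (intro min.mono) auto
    then show "g m z \<le> g n z" using mn by (auto simp: g_def split: split_indicator)
  qed
  have bound: "sq_int (g n) \<le> ennreal (4 * A\<^sup>2)" for n
  proof -
    have "sq_int (g n) \<le> (\<integral>\<^sup>+z. ennreal ((real n)\<^sup>2) * indicator (cball 0 (real n)) z \<partial>(lborel :: r3 measure))"
      unfolding sq_int_def
    proof (intro nn_integral_mono)
      fix z
      have "(min (h z) (of_nat n))\<^sup>2 \<le> (of_nat n)\<^sup>2" by (intro power_mono) auto
      also have "(of_nat n :: ennreal)\<^sup>2 = ennreal ((real n)\<^sup>2)" by (simp add: ennreal_of_nat_eq_real_of_nat ennreal_power)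
      finally show "(g n z)\<^sup>2 \<le> ennreal ((real n)\<^sup>2) * indicator (cball 0 (real n)) z"
        by (auto simp: g_def split: split_indicator)
    qed
    also have "\<dots> = ennreal ((real n)\<^sup>2) * emeasure lborel (cball (0::r3) (real n))"
      by (rule nn_integral_cmult_indicator) simp
    also have "\<dots> < top"
      using emeasure_bounded_finite[of "cball (0::r3) (real n)"] by (intro ennreal_mult_less_top[THEN iffD2]) auto
    finally have "sq_int (g n) < top" .
    then obtain I where I: "sq_int (g n) = ennreal I" "0 \<le> I" by (cases "sq_int (g n)") auto
    \<comment> \<open>the value for which \<open>t * I - A * t\<^sup>2 * I\<close> is largest\<close>
    define t where "t = 1 / (2 * A)"
    have t: "0 < t" using A by (simp add: t_def)
    have scale: "sq_int (\<lambda>z. ennreal t * g n z) = ennreal (t\<^sup>2 * I)"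
    proof -
      have "sq_int (\<lambda>z. ennreal t * g n z) = (ennreal t)\<^sup>2 * sq_int (g n)" by (rule sq_int_cmult) measurable
      also have "\<dots> = ennreal (t\<^sup>2 * I)" using t I by (simp add: ennreal_power ennreal_mult)
      finally show ?thesis .
    qed
    have "ennreal (t * I) = ennreal t * sq_int (g n)" using t I by (simp add: ennreal_mult)
    also have "\<dots> = (\<integral>\<^sup>+z. ennreal t * (g n z)\<^sup>2 \<partial>lborel)"
      unfolding sq_int_def by (rule nn_integral_cmult[symmetric]) measurable
    also have "\<dots> \<le> (\<integral>\<^sup>+z. (ennreal t * g n z) * h z \<partial>lborel)"
      unfolding power2_eq_square mult.assoc by (intro nn_integral_mono mult_left_mono gh) auto
    also have "\<dots> \<le> ennreal A * (sq_int (\<lambda>z. ennreal t * g n z) + 1)"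
      by (rule dual) measurable
    also have "\<dots> = ennreal (A * (t\<^sup>2 * I + 1))"
    proof -
      have "ennreal (t\<^sup>2 * I) + 1 = ennreal (t\<^sup>2 * I + 1)" using t I by (subst ennreal_plus) auto
      then show ?thesis unfolding scale using A t I by (simp add: ennreal_mult)
    qed
    finally have "t * I \<le> A * (t\<^sup>2 * I + 1)"
      using A t I by (subst (asm) ennreal_le_iff) (auto intro!: mult_nonneg_nonneg add_nonneg_nonneg)
    moreover have "t * I = I / (2 * A)" "A * (t\<^sup>2 * I + 1) = I / (4 * A) + A"
      using A by (auto simp: t_def field_simps power2_eq_square)
    ultimately have "I / (2 * A) - I / (4 * A) \<le> A" by linarith
    then have "I \<le> 4 * A\<^sup>2" using A by (simp add: field_simps power2_eq_square)
    then show ?thesis using I by (simp add: ennreal_leI)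
  qed
  have sup: "(h z)\<^sup>2 \<le> (SUP n. (g n z)\<^sup>2)" for z
  proof (cases "h z")
    case (real x)
    obtain n where "max x (norm z) \<le> real n" using real_arch_simple by blast
    then have "g n z = h z" using real
      by (auto simp: g_def ennreal_of_nat_eq_real_of_nat intro!: min_absorb1 ennreal_leI)
    then show ?thesis by (intro SUP_upper2[of n]) auto
  next
    case top
    have "(SUP n. of_nat n) \<le> (SUP n. (g n z)\<^sup>2)"
    proof (rule SUP_least)
      fix m :: nat
      obtain k where k: "norm z \<le> real k" using real_arch_simple by blast
      define n where "n = max m (max k 1)"
      have "norm z \<le> real n" using k by (simp add: n_def)
      then have "g n z = of_nat n" using top by (simp add: g_def)
      moreover have "(of_nat m :: ennreal) \<le> (of_nat n)\<^sup>2"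
      proof -
        have "m \<le> n * 1" by (simp add: n_def)
        also have "n * 1 \<le> n * n" by (intro mult_left_mono) (auto simp: n_def)
        finally have "(of_nat m :: ennreal) \<le> of_nat (n * n)" by (simp only: of_nat_le_iff)
        then show ?thesis by (simp add: power2_eq_square)
      qed
      ultimately show "of_nat m \<le> (SUP n. (g n z)\<^sup>2)" by (intro SUP_upper2[of n]) auto
    qed
    then have "(SUP n. (g n z)\<^sup>2) = top"
      unfolding ennreal_SUP_of_nat_eq_top by (rule top_unique[THEN iffD1])
    then show ?thesis by (simp only: top_greatest)
  qed
  have "sq_int h \<le> (\<integral>\<^sup>+z. (SUP n. (g n z)\<^sup>2) \<partial>lborel)"
    unfolding sq_int_def by (intro nn_integral_mono sup)
  also have "\<dots> = (SUP n. \<integral>\<^sup>+z. (g n z)\<^sup>2 \<partial>lborel)"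
  proof (rule nn_integral_monotone_convergence_SUP)
    show "incseq (\<lambda>n z. (g n z)\<^sup>2)"
      using mono unfolding incseq_def le_fun_def by (auto intro!: power_mono)
  qed measurable
  also have "\<dots> \<le> ennreal (4 * A\<^sup>2)"
    using bound unfolding sq_int_def by (intro SUP_least) auto
  finally show ?thesis .
qed

lemma bilinear_of_kernel:
  fixes m W :: "r3 \<Rightarrow> real"
  assumes [measurable]: "m \<in> borel_measurable borel" "W \<in> borel_measurable borel"
    and m0: "\<And>z. 0 \<le> m z" and W0: "\<And>z. fst z \<noteq> 0 \<Longrightarrow> 0 < W z"
    and c: "0 < c" and \<beta>: "\<beta> > 1" and \<delta>: "\<delta> > 0"
    and ker: "\<And>x y. fst x \<noteq> 0 \<Longrightarrow> fst y \<noteq> 0 \<Longrightarrow> fst x + fst y \<noteq> 0 \<Longrightarrow> m (x + y) \<le> c * (W x * W y * ktot \<beta> \<delta> x y)"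
    and [measurable]: "F1 \<in> borel_measurable borel" "F2 \<in> borel_measurable borel"
    and n1: "sq_int (\<lambda>z. ennreal (W z) * F1 z) \<le> 1" and n2: "sq_int (\<lambda>z. ennreal (W z) * F2 z) \<le> 1"
  shows "sq_int (\<lambda>\<zeta>. ennreal (m \<zeta>) * (\<integral>\<^sup>+z. F1 z * F2 (\<zeta> - z) \<partial>lborel)) \<le> ennreal (4 * (7 * c * tri_const \<beta> \<delta>)\<^sup>2)"
proof (rule sq_int_duality)
  have conv [measurable]: "(\<lambda>\<zeta>. \<integral>\<^sup>+z. F1 z * F2 (\<zeta> - z) \<partial>lborel) \<in> borel_measurable borel"
    by (rule measurable_inner_nn_integral) measurable
  show "(\<lambda>\<zeta>. ennreal (m \<zeta>) * (\<integral>\<^sup>+z. F1 z * F2 (\<zeta> - z) \<partial>lborel)) \<in> borel_measurable borel" by measurable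
  show "0 < 7 * c * tri_const \<beta> \<delta>" using c tri_const_bounds[OF \<beta> \<delta>] by simp
  fix f :: "r3 \<Rightarrow> ennreal" assume [measurable]: "f \<in> borel_measurable borel"
  let ?f1 = "\<lambda>z. ennreal (W z) * F1 z" and ?f2 = "\<lambda>z. ennreal (W z) * F2 z"
  interpret normalized_inputs f ?f1 ?f2 \<beta> \<delta>
    using n1 n2 \<beta> \<delta> by unfold_locales measurable
  note kH_comp[measurable (raw)]
  have km: "(\<lambda>x. ktot \<beta> \<delta> (fst x) (snd x)) \<in> borel_measurable borel"
    unfolding ktot_def by measurable
  have "(\<integral>\<^sup>+\<zeta>. f \<zeta> * (ennreal (m \<zeta>) * (\<integral>\<^sup>+z. F1 z * F2 (\<zeta> - z) \<partial>lborel)) \<partial>lborel)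
     = (\<integral>\<^sup>+\<zeta>. \<integral>\<^sup>+z. f \<zeta> * ennreal (m \<zeta>) * (F1 z * F2 (\<zeta> - z)) \<partial>lborel \<partial>lborel)"
  proof (intro nn_integral_cong)
    fix \<zeta>
    have "(\<integral>\<^sup>+z. f \<zeta> * ennreal (m \<zeta>) * (F1 z * F2 (\<zeta> - z)) \<partial>lborel) = f \<zeta> * ennreal (m \<zeta>) * (\<integral>\<^sup>+z. F1 z * F2 (\<zeta> - z) \<partial>lborel)"
      by (rule nn_integral_cmult) measurable
    then show "f \<zeta> * (ennreal (m \<zeta>) * (\<integral>\<^sup>+z. F1 z * F2 (\<zeta> - z) \<partial>lborel)) = (\<integral>\<^sup>+z. f \<zeta> * ennreal (m \<zeta>) * (F1 z * F2 (\<zeta> - z)) \<partial>lborel)"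
      by (simp only: mult.assoc)
  qed
  also have "\<dots> = (\<integral>\<^sup>+x. \<integral>\<^sup>+y. f (x + y) * ennreal (m (x + y)) * (F1 x * F2 y) \<partial>lborel \<partial>lborel)"
  proof -
    have "(\<lambda>x. f (fst x + snd x) * ennreal (m (fst x + snd x)) * (F1 (fst x) * F2 (snd x))) \<in> borel_measurable borel"
      by measurable
    from nn_integral_swap_sum[OF this] show ?thesis by simp
  qed
  also have "\<dots> \<le> trilinear (\<lambda>x y. c * ktot \<beta> \<delta> x y) f ?f1 ?f2"
    unfolding trilinear_def
  proof (rule nn_integral_mono_AE)
    show "AE x in lborel. (\<integral>\<^sup>+y. f (x + y) * ennreal (m (x + y)) * (F1 x * F2 y) \<partial>lborel)
      \<le> (\<integral>\<^sup>+y. ennreal (c * ktot \<beta> \<delta> x y) * (f (x + y) * (?f1 x * ?f2 y)) \<partial>lborel)"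
      using AE_fst_neq_0[of 0]
    proof eventually_elim
      case (elim x)
      show ?case
      proof (rule nn_integral_mono_AE)
        show "AE y in lborel. f (x + y) * ennreal (m (x + y)) * (F1 x * F2 y) \<le> ennreal (c * ktot \<beta> \<delta> x y) * (f (x + y) * (?f1 x * ?f2 y))"
          using AE_fst_neq_0[of 0] AE_fst_neq_0[of "- fst x"]
        proof eventually_elim
          case (elim y)
          then have *: "fst x + fst y \<noteq> 0" by auto
          have "ennreal (m (x + y)) \<le> ennreal (c * (W x * W y * ktot \<beta> \<delta> x y))"
            using elim * \<open>fst x \<noteq> 0\<close> by (intro ennreal_leI ker) auto
          also have "\<dots> = ennreal (c * ktot \<beta> \<delta> x y) * (ennreal (W x) * ennreal (W y))"
          proof -
            have "c * (W x * W y * ktot \<beta> \<delta> x y) = (c * ktot \<beta> \<delta> x y) * (W x * W y)" by (simp only: mult_ac)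
            then show ?thesis using W0[OF \<open>fst x \<noteq> 0\<close>] W0[OF elim(1)] c ktot_nonneg[of \<beta> \<delta> x y]
              by (simp only: ennreal_mult mult_nonneg_nonneg less_imp_le)
          qed
          finally have "ennreal (m (x + y)) * (f (x + y) * (F1 x * F2 y)) \<le> ennreal (c * ktot \<beta> \<delta> x y) * (ennreal (W x) * ennreal (W y)) * (f (x + y) * (F1 x * F2 y))"
            by (rule mult_right_mono) simp
          then show ?case by (simp only: mult_ac)
        qed
      qed
    qed
  qed
  also have "\<dots> = ennreal c * trilinear (ktot \<beta> \<delta>) f ?f1 ?f2"
    using c by (intro trilinear_cmult m0 m1 m2 km) auto
  also have "\<dots> \<le> ennreal c * (7 * (ennreal (tri_const \<beta> \<delta>) * (sq_int f + 1)))"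
    by (intro mult_left_mono trilinear_ktot) (auto simp: normalized_inputs_axioms)
  also have "\<dots> = ennreal (7 * c * tri_const \<beta> \<delta>) * (sq_int f + 1)"
  proof -
    have "ennreal (7 * c * tri_const \<beta> \<delta>) = 7 * ennreal c * ennreal (tri_const \<beta> \<delta>)"
      using c tri_const_bounds[OF \<beta> \<delta>] by (simp add: ennreal_mult)
    then show ?thesis by (simp only: mult_ac)
  qed
  finally show "(\<integral>\<^sup>+\<zeta>. f \<zeta> * (ennreal (m \<zeta>) * (\<integral>\<^sup>+z. F1 z * F2 (\<zeta> - z) \<partial>lborel)) \<partial>lborel) \<le> ennreal (7 * c * tri_const \<beta> \<delta>) * (sq_int f + 1)" .
qed

section \<open>The pointwise inequality in logarithmic variables\<close>

text \<open>The inequalities \<open>regime_*\<close> below are linear in the variables but have coefficients depending on \<open>E\<close>. They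
follow from finitely many hypotheses \<open>x \<le> y\<close>, once each of these is also available with both sides
multiplied by \<open>E\<close> and in the form \<open>E * (y - x) \<le> (y - x) / 100\<close>; the products with \<open>E\<close> are then atoms of
linear arithmetic.\<close>

lemma scaled_mono: "0 < E \<Longrightarrow> E < 1 / 100 \<Longrightarrow> x \<le> y \<Longrightarrow> E * x \<le> E * y" for E x y :: real
  by simp

lemma scaled_gap: "0 < E \<Longrightarrow> E < 1 / 100 \<Longrightarrow> x \<le> y \<Longrightarrow> E * y - E * x \<le> (y - x) / 100" for E x y :: real
  using mult_right_mono[of E "1 / 100" "y - x"] by (simp add: algebra_simps)

lemma add_max_le: "a + x \<le> c \<Longrightarrow> a + y \<le> c \<Longrightarrow> a + max x y \<le> c" for a c x y :: real
  by (simp add: max_def)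

lemmas linear_normal = algebra_simps add_divide_distrib diff_divide_distrib
  times_divide_eq_left times_divide_eq_right mult_1 mult_1_right

text \<open>In the following inequalities the indices \<open>0\<close>, \<open>1\<close>, \<open>2\<close> belong to the output and to the two inputs, \<open>z\<close> is the
logarithm of \<open>\<bar>\<xi>\<bar>\<close>, \<open>A\<close> that of \<open>\<langle>\<xi>\<rangle>\<close> and \<open>l\<close> that of \<open>\<langle>lam\<rangle>\<close>; \<open>L\<close> is the largest of the three \<open>l\<close> and \<open>m\<close> the
largest of the three \<open>A\<close>. The constant \<open>50\<close> absorbs the bounded errors of the hypotheses. In this first
regime the two inputs have comparable frequencies, and the output has the lowest one.\<close>

lemma regime_output_lowest:
  fixes E :: real
  assumes E: "0 < E" "E < 1 / 100"
    and h1: "0 \<le> A2" and h2: "z1 \<le> A1" and h3: "z2 \<le> A2" and h4: "z0 + z1 + z2 \<le> L"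
    and h5: "z0 \<le> z2" and h6: "z2 \<le> z1" and h7: "z1 \<le> z2 + 1" and h8: "A1 \<le> z1 + 2"
    and h9: "A2 \<le> z2 + 2" and h10: "A0 \<le> z1 + 2" and h11: "m \<le> z1 + 3"
  shows "(1 / 2 - 8 * E) * (A1 + A2 - A0) + z0 + (1 / 2 + E) * (A0 - z0) + (E - 1 / 2) * L
      + max 0 (E * L - 3 * E * A0) \<le> 50 - E / 2 * m"
proof (rule add_max_le)
  note facts = E h4 h6 h7 h8 h9
    scaled_mono[OF E h1] scaled_mono[OF E h2] scaled_mono[OF E h3] scaled_mono[OF E h10] scaled_mono[OF E h11] scaled_mono[OF E h5]
    scaled_gap[OF E h4] scaled_gap[OF E h6] scaled_gap[OF E h7]
  show "(1 / 2 - 8 * E) * (A1 + A2 - A0) + z0 + (1 / 2 + E) * (A0 - z0) + (E - 1 / 2) * L + 0 \<le> 50 - E / 2 * m"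
    using facts by (simp only: linear_normal)
  show "(1 / 2 - 8 * E) * (A1 + A2 - A0) + z0 + (1 / 2 + E) * (A0 - z0) + (E - 1 / 2) * L + (E * L - 3 * E * A0) \<le> 50 - E / 2 * m"
    using facts by (simp only: linear_normal)
qed

lemma regime_all_low:
  fixes E :: real
  assumes E: "0 < E" "E < 1 / 100"
    and h1: "0 \<le> A0" and h2: "0 \<le> A1" and h3: "0 \<le> A2" and h4: "z0 \<le> A0"
    and h5: "0 \<le> L" and h6: "z0 \<le> 0" and h7: "A0 \<le> 1" and h8: "A1 \<le> 1"
    and h9: "A2 \<le> 1" and h10: "m \<le> 1"
  shows "(1 / 2 - 8 * E) * (A1 + A2 - A0) + z0 + (1 / 2 + E) * (A0 - z0) + (E - 1 / 2) * L
      + max 0 (E * L - 3 * E * A0) \<le> 50 - E / 2 * m"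
proof (rule add_max_le)
  note facts = E h1 h5 h6 h7 h8 h9
    scaled_mono[OF E h2] scaled_mono[OF E h3] scaled_mono[OF E h10]
    scaled_gap[OF E h1] scaled_gap[OF E h4] scaled_gap[OF E h5] scaled_gap[OF E h7]
  show "(1 / 2 - 8 * E) * (A1 + A2 - A0) + z0 + (1 / 2 + E) * (A0 - z0) + (E - 1 / 2) * L + 0 \<le> 50 - E / 2 * m"
    using facts by (simp only: linear_normal)
  show "(1 / 2 - 8 * E) * (A1 + A2 - A0) + z0 + (1 / 2 + E) * (A0 - z0) + (E - 1 / 2) * L + (E * L - 3 * E * A0) \<le> 50 - E / 2 * m"
    using facts by (simp only: linear_normal)
qed

text \<open>The low frequency is at least about the power \<open>2 / 5\<close> of the high ones. The resonance is then so large that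
the modulation leaves a negative power of the highest frequency.\<close>

lemma regime_comparable:
  fixes E :: real
  assumes E: "0 < E" "E < 1 / 100"
    and h1: "0 \<le> A2" and h2: "z0 \<le> A0" and h3: "z1 \<le> A1" and h4: "z2 \<le> A2"
    and h5: "z0 + z1 + z2 \<le> L" and h6: "z1 \<le> z0 + 1" and h7: "z0 \<le> z1 + 1"
    and h8: "A1 \<le> z1 + 2" and h9: "A0 \<le> z0 + 2" and h10: "2 / 5 * z1 - 4 \<le> z2"
    and h11: "A2 \<le> z2 + 6" and h12: "m \<le> z1 + 3"
  shows "(1 / 2 - 8 * E) * (A1 + A2 - A0) + z0 + (1 / 2 + E) * (A0 - z0) + (E - 1 / 2) * L
      + max 0 (E * L - 3 * E * A0) \<le> 50 - E / 2 * m"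
proof (rule add_max_le)
  note facts = E h5 h6 h7 h8 h9 h11
    scaled_mono[OF E h1] scaled_mono[OF E h3] scaled_mono[OF E h4] scaled_mono[OF E h10] scaled_mono[OF E h12]
    scaled_gap[OF E h2] scaled_gap[OF E h5] scaled_gap[OF E h6] scaled_gap[OF E h7]
  show "(1 / 2 - 8 * E) * (A1 + A2 - A0) + z0 + (1 / 2 + E) * (A0 - z0) + (E - 1 / 2) * L + 0 \<le> 50 - E / 2 * m"
    using facts by (simp only: linear_normal)
  show "(1 / 2 - 8 * E) * (A1 + A2 - A0) + z0 + (1 / 2 + E) * (A0 - z0) + (E - 1 / 2) * L + (E * L - 3 * E * A0) \<le> 50 - E / 2 * m"
    using facts by (simp only: linear_normal)
qed

text \<open>If the low frequency is smaller than that power, the gain of the high-low kernel is needed.\<close>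

lemma regime_high_low:
  fixes E :: real
  assumes E: "0 < E" "E < 1 / 100"
    and h1: "0 \<le> A0" and h2: "0 \<le> A2" and h3: "z0 \<le> A0" and h4: "z1 \<le> A1"
    and h5: "z2 \<le> A2" and h6: "z0 + z1 + z2 \<le> L" and h7: "z1 \<le> z0 + 1"
    and h8: "z0 \<le> z1 + 1" and h9: "A1 \<le> z1 + 2" and h10: "A0 \<le> z0 + 2"
    and h11: "A2 \<le> 1 + p" and h12: "p \<le> 2 / 5 * z1 + 2 / 5" and h13: "z1 - 1 \<le> w"
  shows "(1 / 2 - 8 * E) * (A1 + A2 - A0) + z0 + (1 / 2 + E) * (A0 - z0) + (E - 1 / 2) * L
      + max 0 (E * L - 3 * E * A0) \<le> 50 + w / 4 - z2 / 2"
proof (rule add_max_le)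
  note facts = E h1 h6 h7 h8 h9 h10 h11 h12 h13
    scaled_mono[OF E h2] scaled_mono[OF E h4] scaled_mono[OF E h5] scaled_mono[OF E h8]
    scaled_gap[OF E h3] scaled_gap[OF E h6] scaled_gap[OF E h7] scaled_gap[OF E h11] scaled_gap[OF E h12]
  show "(1 / 2 - 8 * E) * (A1 + A2 - A0) + z0 + (1 / 2 + E) * (A0 - z0) + (E - 1 / 2) * L + 0 \<le> 50 + w / 4 - z2 / 2"
    using facts by (simp only: linear_normal)
  show "(1 / 2 - 8 * E) * (A1 + A2 - A0) + z0 + (1 / 2 + E) * (A0 - z0) + (E - 1 / 2) * L + (E * L - 3 * E * A0) \<le> 50 + w / 4 - z2 / 2"
    using facts by (simp only: linear_normal)
qed

text \<open>The low-frequency input has the largest modulation and is measured in the first space, which has almost a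
full power of \<open>\<langle>lam\<rangle>\<close>.\<close>

lemma regime_low_modulation_a:
  fixes E :: real
  assumes E: "0 < E" "E < 1 / 100"
    and h1: "0 \<le> A0" and h2: "0 \<le> A1" and h3: "0 \<le> A2" and h4: "z0 \<le> A0"
    and h5: "z1 \<le> A1" and h6: "z2 \<le> A2" and h7: "z0 + z1 + z2 \<le> L" and h8: "0 \<le> l1"
    and h9: "l0 \<le> L" and h10: "z1 \<le> z0 + 1" and h11: "z0 \<le> z1 + 1"
    and h12: "A1 \<le> z1 + 2" and h13: "A0 \<le> z0 + 2" and h14: "A2 \<le> 1 + p"
    and h15: "p \<le> 2 / 5 * z1 + 2 / 5"
  shows "(1 / 2 - 8 * E) * (A1 + A2 - A0) + z0 + (1 / 2 + E) * (A0 - z0) + (E - 1 / 2) * l0 - (1 / 2 + E / 2) * l1 - (1 - E / 2) * L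
      + max 0 (E * l0 - 3 * E * A0) \<le> 50 + z1 / 4 - z2 / 2 - (1 / 2 + E / 4) * (l0 + L)"
proof (rule add_max_le)
  note facts = E h7 h8 h10 h11 h12 h13 h14 h15
    scaled_mono[OF E h2] scaled_mono[OF E h3] scaled_mono[OF E h5] scaled_mono[OF E h6] scaled_mono[OF E h8] scaled_mono[OF E h9] scaled_mono[OF E h11]
    scaled_gap[OF E h1] scaled_gap[OF E h4] scaled_gap[OF E h7] scaled_gap[OF E h10]
  show "(1 / 2 - 8 * E) * (A1 + A2 - A0) + z0 + (1 / 2 + E) * (A0 - z0) + (E - 1 / 2) * l0 - (1 / 2 + E / 2) * l1 - (1 - E / 2) * L + 0 \<le> 50 + z1 / 4 - z2 / 2 - (1 / 2 + E / 4) * (l0 + L)"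
    using facts by (simp only: linear_normal)
  show "(1 / 2 - 8 * E) * (A1 + A2 - A0) + z0 + (1 / 2 + E) * (A0 - z0) + (E - 1 / 2) * l0 - (1 / 2 + E / 2) * l1 - (1 - E / 2) * L + (E * l0 - 3 * E * A0) \<le> 50 + z1 / 4 - z2 / 2 - (1 / 2 + E / 4) * (l0 + L)"
    using facts by (simp only: linear_normal)
qed

text \<open>The low-frequency input has the largest modulation and is measured in the second space; besides the
modulation its weight contains the additional factors \<open>\<bar>\<xi>\<bar> powr - \<sigma>\<close> and \<open>\<langle>lam\<rangle> powr \<epsilon>\<close>.\<close>

lemma regime_low_modulation_b:
  fixes E :: real
  assumes E: "0 < E" "E < 1 / 100"
    and h1: "0 \<le> A1" and h2: "0 \<le> A2" and h3: "z0 \<le> A0" and h4: "z1 \<le> A1"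
    and h5: "z2 \<le> A2" and h6: "z0 + z1 + z2 \<le> L" and h7: "0 \<le> l1" and h8: "l0 \<le> L"
    and h9: "z1 \<le> z0 + 1" and h10: "z0 \<le> z1 + 1" and h11: "A1 \<le> z1 + 2"
    and h12: "A0 \<le> z0 + 2" and h13: "m \<le> z1 + 3"
  shows "(1 / 2 - 8 * E) * (A1 + A2 - A0) + z0 + (1 / 2 + E) * (A0 - z0) + (E - 1 / 2) * l0 - (1 / 2 + E / 2) * l1 - ((1 / 2 + E) * (A2 - z2) + (1 / 2 + 3 / 2 * E) * L - 3 * E * A2)
      + max 0 (E * l0 - 3 * E * A0) \<le> 50 - E / 2 * m - (1 / 2 + E / 4) * (l0 + l1)"
proof (rule add_max_le)
  note facts = E h6 h9 h10 h11 h12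
    scaled_mono[OF E h2] scaled_mono[OF E h4] scaled_mono[OF E h5] scaled_mono[OF E h6] scaled_mono[OF E h7] scaled_mono[OF E h8] scaled_mono[OF E h10] scaled_mono[OF E h13] scaled_mono[OF E h1]
    scaled_gap[OF E h3] scaled_gap[OF E h9] scaled_gap[OF E h6]
  show "(1 / 2 - 8 * E) * (A1 + A2 - A0) + z0 + (1 / 2 + E) * (A0 - z0) + (E - 1 / 2) * l0 - (1 / 2 + E / 2) * l1 - ((1 / 2 + E) * (A2 - z2) + (1 / 2 + 3 / 2 * E) * L - 3 * E * A2) + 0 \<le> 50 - E / 2 * m - (1 / 2 + E / 4) * (l0 + l1)"
    using facts by (simp only: linear_normal)
  show "(1 / 2 - 8 * E) * (A1 + A2 - A0) + z0 + (1 / 2 + E) * (A0 - z0) + (E - 1 / 2) * l0 - (1 / 2 + E / 2) * l1 - ((1 / 2 + E) * (A2 - z2) + (1 / 2 + 3 / 2 * E) * L - 3 * E * A2) + (E * l0 - 3 * E * A0) \<le> 50 - E / 2 * m - (1 / 2 + E / 4) * (l0 + l1)"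
    using facts by (simp only: linear_normal)
qed

text \<open>The logarithm of \<open>W_in\<close> up to a bounded factor and without the Sobolev weights, in terms of the logarithms
\<open>A\<close>, \<open>z\<close>, \<open>l\<close> of \<open>\<langle>\<xi>\<rangle>\<close>, \<open>\<bar>\<xi>\<bar>\<close> and \<open>\<langle>lam\<rangle>\<close>. A sum of two weights is replaced by their maximum.\<close>

definition log_W :: "real \<Rightarrow> real \<Rightarrow> real \<Rightarrow> real \<Rightarrow> real" where
  "log_W E A z l = min ((1 - E / 2) * l) ((1 / 2 + E) * (A - z) + (1 / 2 + E / 2) * l + max 0 (E * l - 3 * E * A))"

lemma log_W_ge:
  assumes E: "0 < E" "E < 1 / 100" and "0 \<le> l" "z \<le> A"
  shows "(1 / 2 + E / 2) * l \<le> log_W E A z l"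
proof -
  have "0 \<le> (1 / 2 - E) * l" using assms by (intro mult_nonneg_nonneg) auto
  then have 1: "(1 / 2 + E / 2) * l \<le> (1 - E / 2) * l" by (simp add: algebra_simps)
  have "0 \<le> (1 / 2 + E) * (A - z)" using assms by (intro mult_nonneg_nonneg) auto
  then have 2: "(1 / 2 + E / 2) * l \<le> (1 / 2 + E) * (A - z) + (1 / 2 + E / 2) * l + max 0 (E * l - 3 * E * A)" by simp
  show ?thesis unfolding log_W_def using 1 2 by simp
qed

lemma log_W_cases:
  "(1 - E / 2) * l \<le> log_W E A z l \<or> (1 / 2 + E) * (A - z) + (1 / 2 + 3 / 2 * E) * l - 3 * E * A \<le> log_W E A z l"
proof -
  have "(1 / 2 + E) * (A - z) + (1 / 2 + E / 2) * l + (E * l - 3 * E * A) \<le> (1 / 2 + E) * (A - z) + (1 / 2 + E / 2) * l + max 0 (E * l - 3 * E * A)"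
    by simp
  moreover have "(1 / 2 + E) * (A - z) + (1 / 2 + E / 2) * l + (E * l - 3 * E * A) = (1 / 2 + E) * (A - z) + (1 / 2 + 3 / 2 * E) * l - 3 * E * A"
    by (simp add: algebra_simps)
  ultimately show ?thesis unfolding log_W_def min_def by auto
qed

text \<open>The output weight decreases in the modulation more slowly than the input weights increase. Hence the
situation only improves when the modulation \<open>l0\<close> of the output and a larger modulation \<open>l\<close> of an input are
exchanged, with a loss in the exponent from \<open>1 / 2 + E / 2\<close> to \<open>1 / 2 + E / 4\<close>.\<close>

lemma modulation_transfer:
  fixes E :: real
  assumes E: "0 < E" "E < 1 / 100" and l: "0 \<le> l0" "0 \<le> l" "0 \<le> l'" "l0 \<le> l"
  shows "(E - 1 / 2) * l0 + max 0 (E * l0 - 3 * E * A0) - (1 / 2 + E / 2) * (l + l')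
    \<le> (E - 1 / 2) * l + max 0 (E * l - 3 * E * A0) - (1 / 2 + E / 4) * (l0 + l')"
proof -
  have "E * l0 \<le> E * l" "0 \<le> E * l" "0 \<le> E * l'" using assms by auto
  then have "max 0 (E * l0 - 3 * E * A0) \<le> max 0 (E * l - 3 * E * A0)" by (intro max.mono) auto
  moreover have "(E - 1 / 2) * l0 - (1 / 2 + E / 2) * (l + l') \<le> (E - 1 / 2) * l - (1 / 2 + E / 4) * (l0 + l')"
    using \<open>E * l0 \<le> E * l\<close> \<open>0 \<le> E * l\<close> \<open>0 \<le> E * l'\<close> by (simp only: linear_normal)
  ultimately show ?thesis by linarith
qed

lemma pair_le_twice_max:
  fixes E :: real
  assumes "0 < E" "A \<le> m" "A' \<le> m"
  shows "50 - E / 2 * m \<le> 50 - E / 4 * (A + A')"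
  using mult_left_mono[of "A + A'" "2 * m" "E / 4"] assms by simp

text \<open>The logarithm \<open>T\<close> of the quotient of weights is bounded by the logarithm of one of the kernels. The first
three alternatives are Strichartz kernels, the last two high-low kernels. By \<open>modulation_transfer\<close> one may
pretend that the largest modulation sits on the output, and then the resonance bounds it from below; this
costs nothing but a case distinction on which pair of modulations remains. If the low-frequency input itself
has the largest modulation, the kernel that this would produce is not available when the frequencies are far
apart, and the two parts of the minimum in \<open>W_in\<close> are used separately.\<close>

lemma log_kernel_bound:
  fixes E A0 A1 A2 z0 z1 z2 l0 l1 l2 :: real
  assumes E: "0 < E" "E < 1 / 100"
    and A: "0 \<le> A0" "0 \<le> A1" "0 \<le> A2" and zA: "z0 \<le> A0" "z1 \<le> A1" "z2 \<le> A2"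
    and Az: "A0 \<le> 1 + max 0 z0" "A1 \<le> 1 + max 0 z1" "A2 \<le> 1 + max 0 z2"
    and tri: "z0 \<le> 1 + max z1 z2" "z1 \<le> 1 + max z0 z2" "z2 \<le> 1 + max z0 z1"
    and l: "0 \<le> l0" "0 \<le> l1" "0 \<le> l2"
    and res: "z0 + z1 + z2 \<le> max l0 (max l1 l2)" and ord: "z2 \<le> z1"
  defines "T \<equiv> (1 / 2 - 8 * E) * (A1 + A2 - A0) + z0 + (1 / 2 + E) * (A0 - z0) + (E - 1 / 2) * l0
      + max 0 (E * l0 - 3 * E * A0) - log_W E A1 z1 l1 - log_W E A2 z2 l2"
  shows "T \<le> 50 - E / 4 * (A1 + A2) - (1 / 2 + E / 4) * (l1 + l2)
    \<or> T \<le> 50 - E / 4 * (A0 + A1) - (1 / 2 + E / 4) * (l0 + l1)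
    \<or> T \<le> 50 - E / 4 * (A0 + A2) - (1 / 2 + E / 4) * (l0 + l2)
    \<or> (z2 \<le> z0 - 2 \<and> T \<le> 50 + z0 / 4 - z2 / 2 - (1 / 2 + E / 4) * (l1 + l2))
    \<or> (z2 \<le> z1 - 2 \<and> T \<le> 50 + z1 / 4 - z2 / 2 - (1 / 2 + E / 4) * (l0 + l2))"
proof -
  define L where "L = max l0 (max l1 l2)"
  define m where "m = max A0 (max A1 A2)"
  \<comment> \<open>\<open>H\<close> collects the frequencies and \<open>R\<close> the output weight at the largest modulation\<close>
  define H where "H = (1 / 2 - 8 * E) * (A1 + A2 - A0) + z0 + (1 / 2 + E) * (A0 - z0)"
  define R where "R = (E - 1 / 2) * L + max 0 (E * L - 3 * E * A0)"
  have L: "0 \<le> L" "l0 \<le> L" "l1 \<le> L" "l2 \<le> L" "z0 + z1 + z2 \<le> L" using l res by (auto simp: L_def)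
  have Am: "A0 \<le> m" "A1 \<le> m" "A2 \<le> m" by (auto simp: m_def)
  note v1 = log_W_ge[OF E l(2) zA(2)] and v2 = log_W_ge[OF E l(3) zA(3)]
  have T: "T \<le> H + ((E - 1 / 2) * l0 + max 0 (E * l0 - 3 * E * A0) - (1 / 2 + E / 2) * (l1 + l2))"
    using v1 v2 unfolding T_def H_def by (simp only: distrib_left)
  have L_cases: "L = l0 \<or> L = l1 \<or> L = l2" by (simp add: L_def max_def)
  have T0: "T \<le> H + R - (1 / 2 + E / 4) * (l1 + l2)" if "L = l0"
  proof -
    have "0 \<le> E / 4 * (l1 + l2)" using l E by simp
    moreover have "(1 / 2 + E / 2) * (l1 + l2) = (1 / 2 + E / 4) * (l1 + l2) + E / 4 * (l1 + l2)" by (simp add: algebra_simps)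
    ultimately show ?thesis using T that unfolding R_def by simp
  qed
  have T1: "T \<le> H + R - (1 / 2 + E / 4) * (l0 + l2)" if "L = l1"
    using T modulation_transfer[OF E l(1,2,3), of A0] L(2) that unfolding R_def by simp
  have T2: "T \<le> H + R - (1 / 2 + E / 4) * (l0 + l1)" if "L = l2"
    using T modulation_transfer[OF E l(1,3,2), of A0] L(2) that unfolding R_def by (simp add: add.commute)
  have small: ?thesis if "H + R \<le> 50 - E / 2 * m"
    using L_cases T0 T1 T2 that pair_le_twice_max[OF E(1) Am(2,3)] pair_le_twice_max[OF E(1) Am(1,2)] pair_le_twice_max[OF E(1) Am(1,3)]
    by (elim disjE) simp_all
  have Ltri: "z0 + z1 + z2 \<le> L" by (rule L(5))
  consider (low) "z0 \<le> 0" "z1 \<le> 0" "z2 \<le> 0" | (D) "z0 \<le> z2" "0 < z1" | (C) "z2 \<le> z0" "0 < max z0 z1"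
  proof (cases "0 < max z0 z1")
    case False
    then have "z0 \<le> 0" "z1 \<le> 0" by auto
    then show ?thesis using low ord by linarith
  next
    case True
    then show ?thesis using C D ord by (cases "z2 \<le> z0") (auto simp: max_def split: if_splits)
  qed
  then show ?thesis
  proof cases
    case low
    then have b: "A0 \<le> 1" "A1 \<le> 1" "A2 \<le> 1" using Az by auto
    then have "m \<le> 1" by (simp add: m_def)
    have "H + R \<le> 50 - E / 2 * m"
      unfolding H_def R_def add.assoc[symmetric]
      by (rule regime_all_low) (use E A zA L low b \<open>m \<le> 1\<close> in auto)
    then show ?thesis by (rule small)
  next
    case D
    then have z: "z1 \<le> z2 + 1" using tri(2) by simp
    then have b: "A1 \<le> z1 + 2" "A2 \<le> z2 + 2" "A0 \<le> z1 + 2" using Az D ord by (auto simp: max_def split: if_splits)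
    then have "m \<le> z1 + 3" using ord by (simp add: m_def)
    have "H + R \<le> 50 - E / 2 * m"
      unfolding H_def R_def add.assoc[symmetric]
      by (rule regime_output_lowest) (use E A zA L D z b ord \<open>m \<le> z1 + 3\<close> in auto)
    then show ?thesis by (rule small)
  next
    case C
    have z: "z0 \<le> z1 + 1" "z1 \<le> z0 + 1" using tri C ord by (auto simp: max_def)
    then have zl: "- 1 \<le> z0" "- 1 \<le> z1" using C by (auto simp: max_def split: if_splits)
    then have b: "A1 \<le> z1 + 2" "A0 \<le> z0 + 2" using Az by (auto simp: max_def split: if_splits)
    show ?thesis
    \<comment> \<open>at this threshold the gain of the modulation still beats the loss of derivatives\<close>
    proof (cases "2 / 5 * z1 - 4 \<le> z2")
      case True
      then have b2: "A2 \<le> z2 + 6" using Az zl by (auto simp: max_def split: if_splits)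
      have "m \<le> z1 + 3" using b z Az(3) ord zl by (auto simp: m_def max_def split: if_splits)
      have "H + R \<le> 50 - E / 2 * m"
        unfolding H_def R_def add.assoc[symmetric]
        by (rule regime_comparable) (use E A zA L z b b2 True \<open>m \<le> z1 + 3\<close> in auto)
      then show ?thesis by (rule small)
    next
      case False
      then have far: "z2 \<le> z1 - 2" "z2 \<le> z0 - 2" using zl z by linarith+
      define p where "p = max 0 z2"
      have p: "A2 \<le> 1 + p" "p \<le> 2 / 5 * z1 + 2 / 5" using Az(3) False zl by (auto simp: p_def)
      have HR: "H + R \<le> 50 + w / 4 - z2 / 2" if "z1 - 1 \<le> w" for w
        unfolding H_def R_def add.assoc[symmetric]
        by (rule regime_high_low[where p = p]) (use E A zA L z b p that in auto)
      consider "L = l0" | "L = l1" | "L = l2" using L_cases by blast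
      then show ?thesis
      proof cases
        case 1
        have "T \<le> 50 + z0 / 4 - z2 / 2 - (1 / 2 + E / 4) * (l1 + l2)"
          using T0[OF 1] HR[of z0] z by linarith
        then show ?thesis using far by blast
      next
        case 2
        have "T \<le> 50 + z1 / 4 - z2 / 2 - (1 / 2 + E / 4) * (l0 + l2)"
          using T1[OF 2] HR[of z1] by linarith
        then show ?thesis using far by blast
      next
        case 3
        have T': "T \<le> H + (E - 1 / 2) * l0 - (1 / 2 + E / 2) * l1 - log_W E A2 z2 l2 + max 0 (E * l0 - 3 * E * A0)"
          using v1 unfolding T_def H_def by linarith
        from log_W_cases[of E l2 A2 z2] show ?thesis
        proof
          assume v: "(1 - E / 2) * l2 \<le> log_W E A2 z2 l2"
          have "H + (E - 1 / 2) * l0 - (1 / 2 + E / 2) * l1 - (1 - E / 2) * L + max 0 (E * l0 - 3 * E * A0)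
             \<le> 50 + z1 / 4 - z2 / 2 - (1 / 2 + E / 4) * (l0 + L)"
            unfolding H_def
            by (rule regime_low_modulation_a[where p = p]) (use E A zA L l z b p in auto)
          then have "T \<le> 50 + z1 / 4 - z2 / 2 - (1 / 2 + E / 4) * (l0 + l2)" using T' v unfolding 3 by linarith
          then show ?thesis using far by blast
        next
          assume v: "(1 / 2 + E) * (A2 - z2) + (1 / 2 + 3 / 2 * E) * l2 - 3 * E * A2 \<le> log_W E A2 z2 l2"
          have "m \<le> z1 + 3" using b z Az(3) ord zl by (auto simp: m_def max_def split: if_splits)
          have "H + (E - 1 / 2) * l0 - (1 / 2 + E / 2) * l1 - ((1 / 2 + E) * (A2 - z2) + (1 / 2 + 3 / 2 * E) * L - 3 * E * A2) + max 0 (E * l0 - 3 * E * A0)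
             \<le> 50 - E / 2 * m - (1 / 2 + E / 4) * (l0 + l1)"
            unfolding H_def
            by (rule regime_low_modulation_b) (use E A zA L l z b \<open>m \<le> z1 + 3\<close> in auto)
          then have "T \<le> 50 - E / 4 * (A0 + A1) - (1 / 2 + E / 4) * (l0 + l1)"
            using T' v pair_le_twice_max[OF E(1) Am(1,2)] unfolding 3 by linarith
          then show ?thesis by blast
        qed
      qed
    qed
  qed
qed

section \<open>The resonance and the weights\<close>

definition ln_bracket :: "real \<Rightarrow> real" where "ln_bracket x = ln (bracket x)"

lemma ln_bracket_nonneg: "0 \<le> ln_bracket x" unfolding ln_bracket_def using bracket_ge_1 by simp

lemma bracket_powr_exp: "bracket x powr a = exp (a * ln_bracket x)"
  by (simp add: powr_def ln_bracket_def)

lemma ln_abs_le_ln_bracket: "x \<noteq> 0 \<Longrightarrow> ln \<bar>x\<bar> \<le> ln_bracket x"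
  unfolding ln_bracket_def by (simp add: bracket_def)

lemma ln_two_le_1: "ln (2::real) \<le> 1"
  using ln_le_minus_one[of 2] by simp

lemma ln_bracket_le: assumes "x \<noteq> 0" shows "ln_bracket x \<le> 1 + max 0 (ln \<bar>x\<bar>)"
proof (cases "\<bar>x\<bar> \<le> 1")
  case True
  then have "ln_bracket x \<le> ln 2" unfolding ln_bracket_def by (simp add: bracket_def)
  then show ?thesis using ln_two_le_1 by simp
next
  case False
  then have "ln_bracket x \<le> ln (2 * \<bar>x\<bar>)" unfolding ln_bracket_def by (simp add: bracket_def)
  also have "\<dots> = ln 2 + ln \<bar>x\<bar>" using assms by (simp add: ln_mult)
  finally show ?thesis using ln_two_le_1 by simp
qed

lemma ln_abs_triangle:
  fixes x y z :: real
  assumes "\<bar>x\<bar> \<le> \<bar>y\<bar> + \<bar>z\<bar>" "x \<noteq> 0" "y \<noteq> 0" "z \<noteq> 0"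
  shows "ln \<bar>x\<bar> \<le> 1 + max (ln \<bar>y\<bar>) (ln \<bar>z\<bar>)"
proof -
  have *: "ln \<bar>x\<bar> \<le> 1 + ln w" if "\<bar>x\<bar> \<le> 2 * w" "0 < w" for w
  proof -
    have "ln \<bar>x\<bar> \<le> ln (2 * w)" using that assms by simp
    also have "\<dots> = ln 2 + ln w" using that by (simp add: ln_mult)
    finally show ?thesis using ln_two_le_1 by simp
  qed
  show ?thesis
  proof (cases "\<bar>y\<bar> \<le> \<bar>z\<bar>")
    case True
    then have "ln \<bar>x\<bar> \<le> 1 + ln \<bar>z\<bar>" using assms by (intro *) auto
    then show ?thesis by simp
  next
    case False
    then have "ln \<bar>x\<bar> \<le> 1 + ln \<bar>y\<bar>" using assms by (intro *) auto
    then show ?thesis by simp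
  qed
qed

text \<open>The cubic parts give \<open>3 P\<close> with \<open>P = \<xi> \<xi>\<^sub>1 \<xi>\<^sub>2\<close>, and the fractions add up to \<open>Q / P\<close> with \<open>Q \<ge> 0\<close>. The two terms have
the same sign, so they cannot cancel.\<close>

lemma resonance:
  assumes "fst x \<noteq> 0" "fst y \<noteq> 0" "fst x + fst y \<noteq> 0"
  shows "3 * \<bar>(fst x + fst y) * fst x * fst y\<bar> \<le> \<bar>lam x + lam y - lam (x + y)\<bar>"
proof -
  obtain p1 e1 t1 p2 e2 t2 where xy: "x = (p1, e1, t1)" "y = (p2, e2, t2)" by (cases x, cases y) auto
  have nz: "p1 \<noteq> 0" "p2 \<noteq> 0" "p1 + p2 \<noteq> 0" using assms by (auto simp: xy)
  define P where "P = (p1 + p2) * p1 * p2"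
  define Q where "Q = (e1 * p2 - e2 * p1)\<^sup>2 + (p1\<^sup>2 + p1 * p2 + p2\<^sup>2)"
  have "P \<noteq> 0" using nz by (simp add: P_def)
  have "0 \<le> (p1 + p2 / 2)\<^sup>2 + 3 / 4 * p2\<^sup>2" by simp
  also have "(p1 + p2 / 2)\<^sup>2 + 3 / 4 * p2\<^sup>2 = p1\<^sup>2 + p1 * p2 + p2\<^sup>2" by (simp add: power2_eq_square algebra_simps)
  finally have Q: "0 \<le> Q" by (simp add: Q_def)
  have "lam x + lam y - lam (x + y) = phi (p1 + p2) (e1 + e2) - phi p1 e1 - phi p2 e2"
    by (simp add: lam_def xy)
  also have "\<dots> = 3 * P + Q / P"
  proof -
    have c: "(p1 + p2) ^ 3 - p1 ^ 3 - p2 ^ 3 = 3 * P" by (simp add: P_def power3_eq_cube algebra_simps)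
    have d: "(e1\<^sup>2 + 1) / p1 + (e2\<^sup>2 + 1) / p2 - ((e1 + e2)\<^sup>2 + 1) / (p1 + p2) = Q / P"
      using nz unfolding P_def Q_def by (simp add: divide_simps) (simp add: power2_eq_square algebra_simps)
    show ?thesis unfolding phi_def using c d by linarith
  qed
  finally have eq: "lam x + lam y - lam (x + y) = 3 * P + Q / P" .
  have "3 * \<bar>P\<bar> \<le> \<bar>3 * P + Q / P\<bar>"
  proof (cases "P > 0")
    case True
    then have "0 \<le> Q / P" using Q by simp
    then show ?thesis using True by simp
  next
    case False
    then have "P < 0" using \<open>P \<noteq> 0\<close> by simp
    then have "Q / P \<le> 0" using Q by (simp add: divide_nonneg_neg)
    then show ?thesis using \<open>P < 0\<close> by simp
  qed
  moreover have "(fst x + fst y) * fst x * fst y = P" by (simp add: P_def xy)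
  ultimately show ?thesis by (simp only: eq)
qed

lemma ln_resonance:
  assumes "fst x \<noteq> 0" "fst y \<noteq> 0" "fst x + fst y \<noteq> 0"
  shows "ln \<bar>fst x + fst y\<bar> + ln \<bar>fst x\<bar> + ln \<bar>fst y\<bar> \<le> max (ln_bracket (lam (x + y))) (max (ln_bracket (lam x)) (ln_bracket (lam y)))"
proof -
  define P where "P = \<bar>(fst x + fst y) * fst x * fst y\<bar>"
  have P: "0 < P" using assms by (simp add: P_def)
  have "ln P = ln \<bar>fst x + fst y\<bar> + ln \<bar>fst x\<bar> + ln \<bar>fst y\<bar>"
    using assms by (simp add: P_def abs_mult ln_mult)
  moreover have "3 * P \<le> \<bar>lam x\<bar> + \<bar>lam y\<bar> + \<bar>lam (x + y)\<bar>"
    using resonance[OF assms] unfolding P_def by linarith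
  then have "P \<le> bracket (lam (x + y)) \<or> P \<le> bracket (lam x) \<or> P \<le> bracket (lam y)"
    unfolding bracket_def by linarith
  then have "ln P \<le> ln_bracket (lam (x + y)) \<or> ln P \<le> ln_bracket (lam x) \<or> ln P \<le> ln_bracket (lam y)"
    unfolding ln_bracket_def using P by auto
  ultimately show ?thesis by linarith
qed

text \<open>The factor that all the weights have in common, up to the shift of \<open>s1\<close> by \<open>3 * \<epsilon>\<close>.\<close>

definition sobolev_weight :: "real \<Rightarrow> real \<Rightarrow> r3 \<Rightarrow> real" where
  "sobolev_weight s1 s2 z = exp (s1 * ln_bracket (fst z)) * exp (s2 * ln_bracket (fst (snd z)))"

lemma sobolev_weight_pos: "0 < sobolev_weight s1 s2 z" by (simp add: sobolev_weight_def)

lemma weight_exp: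
  assumes "fst z \<noteq> 0"
  shows "weight \<sigma> s1 s2 b z = sobolev_weight s1 s2 z * exp (\<sigma> * (ln_bracket (fst z) - ln \<bar>fst z\<bar>) + b * ln_bracket (lam z))"
    and "weight \<sigma> (s1 - d) s2 b z = sobolev_weight s1 s2 z * exp (\<sigma> * (ln_bracket (fst z) - ln \<bar>fst z\<bar>) + b * ln_bracket (lam z) - d * ln_bracket (fst z))"
  using assms
  by (cases z; simp add: weight_def sobolev_weight_def lam_def bracket_powr_exp powr_def[of "\<bar>_\<bar>"] flip: exp_add; simp add: algebra_simps)+

text \<open>The weight for the inputs: whatever summand of \<open>X\<close> a piece of a function is measured in, its weight is at
least this one.\<close>

definition W_in :: "real \<Rightarrow> real \<Rightarrow> real \<Rightarrow> r3 \<Rightarrow> real" where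
  "W_in \<epsilon> s1 s2 z = min (weight 0 s1 s2 (1 - \<epsilon> / 2) z)
     (weight (1 / 2 + \<epsilon>) s1 s2 (1 / 2 + \<epsilon> / 2) z + weight (1 / 2 + \<epsilon>) (s1 - 3 * \<epsilon>) s2 (1 / 2 + 3 / 2 * \<epsilon>) z)"

text \<open>The sum of the two weights of the second summand of the target space, times the derivative.\<close>

definition m_out :: "real \<Rightarrow> real \<Rightarrow> real \<Rightarrow> r3 \<Rightarrow> real" where
  "m_out \<epsilon> s1 s2 z = \<bar>fst z\<bar> * (weight (1 / 2 + \<epsilon>) s1 s2 (\<epsilon> - 1 / 2) z + weight (1 / 2 + \<epsilon>) (s1 - 3 * \<epsilon>) s2 (2 * \<epsilon> - 1 / 2) z)"

lemma exp_max_le: "exp (max a b) \<le> exp a + exp b" for a b :: real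
  by (simp add: max_def)

lemma exp_sum_le_max: "exp a + exp b \<le> 2 * exp (max a b)" for a b :: real
  by (simp add: max_def)

lemma W_in_ge:
  assumes "fst z \<noteq> 0"
  shows "sobolev_weight s1 s2 z * exp (log_W \<epsilon> (ln_bracket (fst z)) (ln \<bar>fst z\<bar>) (ln_bracket (lam z))) \<le> W_in \<epsilon> s1 s2 z"
proof -
  let ?A = "ln_bracket (fst z)" and ?Z = "ln \<bar>fst z\<bar>" and ?l = "ln_bracket (lam z)"
  define c where "c = (1 / 2 + \<epsilon>) * (?A - ?Z) + (1 / 2 + \<epsilon> / 2) * ?l"
  have 1: "exp (log_W \<epsilon> ?A ?Z ?l) \<le> exp ((1 - \<epsilon> / 2) * ?l)" by (simp add: log_W_def)
  have "exp (log_W \<epsilon> ?A ?Z ?l) \<le> exp (c + max 0 (\<epsilon> * ?l - 3 * \<epsilon> * ?A))" by (simp add: log_W_def c_def)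
  also have "c + max 0 (\<epsilon> * ?l - 3 * \<epsilon> * ?A) = max c (c + (\<epsilon> * ?l - 3 * \<epsilon> * ?A))" by (simp add: max_def)
  also have "exp \<dots> \<le> exp c + exp (c + (\<epsilon> * ?l - 3 * \<epsilon> * ?A))" by (rule exp_max_le)
  finally have 2: "exp (log_W \<epsilon> ?A ?Z ?l) \<le> exp c + exp (c + (\<epsilon> * ?l - 3 * \<epsilon> * ?A))" .
  have e1: "weight 0 s1 s2 (1 - \<epsilon> / 2) z = sobolev_weight s1 s2 z * exp ((1 - \<epsilon> / 2) * ?l)"
    by (simp add: weight_exp(1)[OF assms])
  have e2: "weight (1 / 2 + \<epsilon>) s1 s2 (1 / 2 + \<epsilon> / 2) z = sobolev_weight s1 s2 z * exp c"
    unfolding weight_exp(1)[OF assms] c_def ..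
  have e3: "weight (1 / 2 + \<epsilon>) (s1 - 3 * \<epsilon>) s2 (1 / 2 + 3 / 2 * \<epsilon>) z = sobolev_weight s1 s2 z * exp (c + (\<epsilon> * ?l - 3 * \<epsilon> * ?A))"
  proof -
    have "(1 / 2 + \<epsilon>) * (?A - ?Z) + (1 / 2 + 3 / 2 * \<epsilon>) * ?l - 3 * \<epsilon> * ?A = c + (\<epsilon> * ?l - 3 * \<epsilon> * ?A)"
      unfolding c_def by (simp only: linear_normal)
    then show ?thesis unfolding weight_exp(2)[OF assms] by simp
  qed
  have w: "0 \<le> sobolev_weight s1 s2 z" using sobolev_weight_pos[of s1 s2 z] by simp
  show ?thesis
    unfolding W_in_def e1 e2 e3 distrib_left[symmetric]
    using mult_left_mono[OF 1 w] mult_left_mono[OF 2 w] by simp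
qed

lemma m_out_le:
  assumes "fst z \<noteq> 0"
  shows "m_out \<epsilon> s1 s2 z \<le> 2 * (sobolev_weight s1 s2 z * exp (ln \<bar>fst z\<bar> + (1 / 2 + \<epsilon>) * (ln_bracket (fst z) - ln \<bar>fst z\<bar>)
     + (\<epsilon> - 1 / 2) * ln_bracket (lam z) + max 0 (\<epsilon> * ln_bracket (lam z) - 3 * \<epsilon> * ln_bracket (fst z))))"
proof -
  let ?A = "ln_bracket (fst z)" and ?Z = "ln \<bar>fst z\<bar>" and ?l = "ln_bracket (lam z)"
  define c where "c = (1 / 2 + \<epsilon>) * (?A - ?Z) + (\<epsilon> - 1 / 2) * ?l"
  have e2: "weight (1 / 2 + \<epsilon>) s1 s2 (\<epsilon> - 1 / 2) z = sobolev_weight s1 s2 z * exp c"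
    unfolding weight_exp(1)[OF assms] c_def ..
  have e3: "weight (1 / 2 + \<epsilon>) (s1 - 3 * \<epsilon>) s2 (2 * \<epsilon> - 1 / 2) z = sobolev_weight s1 s2 z * exp (c + (\<epsilon> * ?l - 3 * \<epsilon> * ?A))"
  proof -
    have "(1 / 2 + \<epsilon>) * (?A - ?Z) + (2 * \<epsilon> - 1 / 2) * ?l - 3 * \<epsilon> * ?A = c + (\<epsilon> * ?l - 3 * \<epsilon> * ?A)"
      unfolding c_def by (simp only: linear_normal)
    then show ?thesis unfolding weight_exp(2)[OF assms] by simp
  qed
  have "m_out \<epsilon> s1 s2 z = sobolev_weight s1 s2 z * (\<bar>fst z\<bar> * (exp c + exp (c + (\<epsilon> * ?l - 3 * \<epsilon> * ?A))))"
    unfolding m_out_def e2 e3 by (simp add: algebra_simps)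
  also have "\<dots> \<le> sobolev_weight s1 s2 z * (\<bar>fst z\<bar> * (2 * exp (max c (c + (\<epsilon> * ?l - 3 * \<epsilon> * ?A)))))"
    using sobolev_weight_pos[of s1 s2 z] by (intro mult_left_mono exp_sum_le_max) auto
  also have "max c (c + (\<epsilon> * ?l - 3 * \<epsilon> * ?A)) = c + max 0 (\<epsilon> * ?l - 3 * \<epsilon> * ?A)" by (simp add: max_def)
  also have "\<bar>fst z\<bar> * (2 * exp (c + max 0 (\<epsilon> * ?l - 3 * \<epsilon> * ?A))) = 2 * exp (?Z + (c + max 0 (\<epsilon> * ?l - 3 * \<epsilon> * ?A)))"
    using assms by (simp add: exp_add)
  finally show ?thesis unfolding c_def by (simp add: add.assoc mult.left_commute)
qed

lemma ln_bracket_add_le: "ln_bracket (x + y) \<le> ln_bracket x + ln_bracket y"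
proof -
  have "ln (bracket (x + y)) \<le> ln (bracket x * bracket y)"
    using bracket_mult_ge[of x y] by simp
  then show ?thesis by (simp add: ln_bracket_def ln_mult)
qed

text \<open>The bracket is submultiplicative. For \<open>\<eta>\<close> this suffices as \<open>s2 \<ge> 0\<close>; for \<open>\<xi>\<close> the exponent \<open>s1\<close> may be
negative, and the worst case \<open>s1 = - 1 / 2 + 8 * \<epsilon>\<close> is kept explicitly.\<close>

lemma sobolev_weight_add_le:
  assumes "- 1 / 2 + 8 * \<epsilon> \<le> s1" "0 \<le> s2"
  shows "sobolev_weight s1 s2 (x + y) \<le> sobolev_weight s1 s2 x * sobolev_weight s1 s2 y * exp ((1 / 2 - 8 * \<epsilon>) * (ln_bracket (fst x) + ln_bracket (fst y) - ln_bracket (fst x + fst y)))"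
proof -
  have "0 \<le> (s1 + 1 / 2 - 8 * \<epsilon>) * (ln_bracket (fst x) + ln_bracket (fst y) - ln_bracket (fst x + fst y))"
    using assms ln_bracket_add_le[of "fst x" "fst y"] by (intro mult_nonneg_nonneg) auto
  moreover have "s2 * ln_bracket (fst (snd x) + fst (snd y)) \<le> s2 * (ln_bracket (fst (snd x)) + ln_bracket (fst (snd y)))"
    using assms ln_bracket_add_le by (intro mult_left_mono) auto
  ultimately have "s1 * ln_bracket (fst x + fst y) + s2 * ln_bracket (fst (snd x) + fst (snd y)) \<le>
    s1 * ln_bracket (fst x) + s2 * ln_bracket (fst (snd x)) + (s1 * ln_bracket (fst y) + s2 * ln_bracket (fst (snd y)))
     + (1 / 2 - 8 * \<epsilon>) * (ln_bracket (fst x) + ln_bracket (fst y) - ln_bracket (fst x + fst y))"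
    by (simp only: linear_normal)
  then show ?thesis by (simp add: sobolev_weight_def flip: exp_add)
qed

lemma kS_exp: "kS (\<epsilon> / 4) (1 + \<epsilon> / 2) z = exp (- (\<epsilon> / 4 * ln_bracket (fst z)) - (1 / 2 + \<epsilon> / 4) * ln_bracket (lam z))"
  unfolding kS_def bracket_powr_exp exp_add[symmetric] by (simp add: algebra_simps)

text \<open>A gap of \<open>2\<close> between logarithms is enough for the ratio \<open>4\<close> in \<open>kH\<close> since \<open>exp 2 \<ge> 4\<close>.\<close>

lemma kH_exp:
  assumes "fst \<zeta> \<noteq> 0" "fst z \<noteq> 0" "ln \<bar>fst z\<bar> \<le> ln \<bar>fst \<zeta>\<bar> - 2"
  shows "kH (1 + \<epsilon> / 2) \<zeta> z = exp (ln \<bar>fst \<zeta>\<bar> / 4 - ln \<bar>fst z\<bar> / 2 - (1 / 2 + \<epsilon> / 4) * (ln_bracket (lam z) + ln_bracket (lam (\<zeta> - z))))"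
proof -
  have "(4::real) \<le> exp 2"
  proof -
    have "(2::real) * 2 \<le> exp 1 * exp 1" using exp_ge_add_one_self[of 1] by (intro mult_mono) auto
    then show ?thesis by (simp flip: exp_add)
  qed
  have "\<bar>fst z\<bar> = exp (ln \<bar>fst z\<bar>)" using assms by simp
  also have "\<dots> \<le> exp (ln \<bar>fst \<zeta>\<bar> - 2)" using assms(3) by (simp only: exp_le_cancel_iff)
  also have "\<dots> = \<bar>fst \<zeta>\<bar> / exp 2" using assms by (simp add: exp_diff)
  also have "\<dots> \<le> \<bar>fst \<zeta>\<bar> / 4" using \<open>4 \<le> exp 2\<close> by (intro divide_left_mono) auto
  finally have "\<bar>fst z\<bar> \<le> \<bar>fst \<zeta>\<bar> / 4" .
  then show ?thesis unfolding kH_def bracket_powr_exp using assms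
    by (simp add: powr_def flip: exp_add) (simp add: field_simps)
qed

text \<open>The translation of \<open>log_kernel_bound\<close>, with the parameters \<open>\<beta> = 1 + \<epsilon> / 2\<close> and \<open>\<delta> = \<epsilon> / 4\<close> of the kernels dictated
by the exponents there.\<close>

lemma kernel_bound_ordered:
  assumes E: "0 < \<epsilon>" "\<epsilon> < 1 / 100" and s: "- 1 / 2 + 8 * \<epsilon> \<le> s1" "0 \<le> s2"
    and nz: "fst x \<noteq> 0" "fst y \<noteq> 0" "fst x + fst y \<noteq> 0" and ord: "\<bar>fst y\<bar> \<le> \<bar>fst x\<bar>"
  shows "m_out \<epsilon> s1 s2 (x + y) \<le> (2 * exp 50) * (W_in \<epsilon> s1 s2 x * W_in \<epsilon> s1 s2 y * ktot (1 + \<epsilon> / 2) (\<epsilon> / 4) x y)"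
proof -
  define A0 A1 A2 where "A0 = ln_bracket (fst x + fst y)" and "A1 = ln_bracket (fst x)" and "A2 = ln_bracket (fst y)"
  define z0 z1 z2 where "z0 = ln \<bar>fst x + fst y\<bar>" and "z1 = ln \<bar>fst x\<bar>" and "z2 = ln \<bar>fst y\<bar>"
  define l0 l1 l2 where "l0 = ln_bracket (lam (x + y))" and "l1 = ln_bracket (lam x)" and "l2 = ln_bracket (lam y)"
  define v1 v2 where "v1 = log_W \<epsilon> A1 z1 l1" and "v2 = log_W \<epsilon> A2 z2 l2"
  define T where "T = (1 / 2 - 8 * \<epsilon>) * (A1 + A2 - A0) + z0 + (1 / 2 + \<epsilon>) * (A0 - z0) + (\<epsilon> - 1 / 2) * l0
      + max 0 (\<epsilon> * l0 - 3 * \<epsilon> * A0) - v1 - v2"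
  note defs = A0_def A1_def A2_def z0_def z1_def z2_def l0_def l1_def l2_def
  define kt where "kt = ktot (1 + \<epsilon> / 2) (\<epsilon> / 4) x y"
  let ?k = "kS (\<epsilon> / 4) (1 + \<epsilon> / 2)" and ?h = "kH (1 + \<epsilon> / 2)"
  have kt: "?k x * ?k y \<le> kt" "?k (x + y) * ?k x \<le> kt" "?k (x + y) * ?k y \<le> kt" "?h (x + y) y \<le> kt" "?h x (- y) \<le> kt"
  proof -
    have "0 \<le> ?k x * ?k y" "0 \<le> ?k (x + y) * ?k x" "0 \<le> ?k (x + y) * ?k y" by simp_all
    then show "?k x * ?k y \<le> kt" "?k (x + y) * ?k x \<le> kt" "?k (x + y) * ?k y \<le> kt" "?h (x + y) y \<le> kt" "?h x (- y) \<le> kt"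
      using kH_nonneg[of "1 + \<epsilon> / 2" "x + y" y] kH_nonneg[of "1 + \<epsilon> / 2" "x + y" x] kH_nonneg[of "1 + \<epsilon> / 2" x "- y"] kH_nonneg[of "1 + \<epsilon> / 2" y "- x"]
      unfolding kt_def ktot_def by linarith+
  qed
  have alt: "T \<le> 50 - \<epsilon> / 4 * (A1 + A2) - (1 / 2 + \<epsilon> / 4) * (l1 + l2)
    \<or> T \<le> 50 - \<epsilon> / 4 * (A0 + A1) - (1 / 2 + \<epsilon> / 4) * (l0 + l1)
    \<or> T \<le> 50 - \<epsilon> / 4 * (A0 + A2) - (1 / 2 + \<epsilon> / 4) * (l0 + l2)
    \<or> (z2 \<le> z0 - 2 \<and> T \<le> 50 + z0 / 4 - z2 / 2 - (1 / 2 + \<epsilon> / 4) * (l1 + l2))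
    \<or> (z2 \<le> z1 - 2 \<and> T \<le> 50 + z1 / 4 - z2 / 2 - (1 / 2 + \<epsilon> / 4) * (l0 + l2))"
    unfolding T_def v1_def v2_def
  proof (rule log_kernel_bound[OF E])
    show "0 \<le> A0" "0 \<le> A1" "0 \<le> A2" "0 \<le> l0" "0 \<le> l1" "0 \<le> l2" by (simp_all add: defs ln_bracket_nonneg)
    show "z0 \<le> A0" "z1 \<le> A1" "z2 \<le> A2" using nz by (simp_all add: defs ln_abs_le_ln_bracket)
    show "A0 \<le> 1 + max 0 z0" "A1 \<le> 1 + max 0 z1" "A2 \<le> 1 + max 0 z2" unfolding defs by (rule ln_bracket_le[OF nz(3)] ln_bracket_le[OF nz(1)] ln_bracket_le[OF nz(2)])+
    show "z0 \<le> 1 + max z1 z2" "z1 \<le> 1 + max z0 z2" "z2 \<le> 1 + max z0 z1"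
      unfolding defs using nz by (intro ln_abs_triangle; linarith)+
    show "z0 + z1 + z2 \<le> max l0 (max l1 l2)" unfolding defs by (rule ln_resonance[OF nz])
    show "z2 \<le> z1" unfolding defs using nz ord by simp
  qed
  have expT: "exp T \<le> exp 50 * kt"
  proof -
    have step: "exp T \<le> exp 50 * kt" if "T \<le> 50 + c" "exp c \<le> kt" for c
    proof -
      have "exp T \<le> exp (50 + c)" using that by simp
      also have "\<dots> = exp 50 * exp c" by (simp add: exp_add)
      also have "\<dots> \<le> exp 50 * kt" using that by simp
      finally show ?thesis .
    qed
    have k12: "exp (- (\<epsilon> / 4 * (A1 + A2)) - (1 / 2 + \<epsilon> / 4) * (l1 + l2)) = ?k x * ?k y"
      unfolding kS_exp defs exp_add[symmetric] by (simp add: algebra_simps)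
    have k01: "exp (- (\<epsilon> / 4 * (A0 + A1)) - (1 / 2 + \<epsilon> / 4) * (l0 + l1)) = ?k (x + y) * ?k x"
      unfolding kS_exp defs exp_add[symmetric] by (simp add: algebra_simps)
    have k02: "exp (- (\<epsilon> / 4 * (A0 + A2)) - (1 / 2 + \<epsilon> / 4) * (l0 + l2)) = ?k (x + y) * ?k y"
      unfolding kS_exp defs exp_add[symmetric] by (simp add: algebra_simps)
    have h0: "exp (z0 / 4 - z2 / 2 - (1 / 2 + \<epsilon> / 4) * (l1 + l2)) = ?h (x + y) y" if "z2 \<le> z0 - 2"
      using kH_exp[of "x + y" y \<epsilon>] nz that by (simp add: defs add.commute)
    have h1: "exp (z1 / 4 - z2 / 2 - (1 / 2 + \<epsilon> / 4) * (l0 + l2)) = ?h x (- y)" if "z2 \<le> z1 - 2"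
      using kH_exp[of x "- y" \<epsilon>] nz that by (simp add: defs ln_bracket_def add.commute)
    show ?thesis using alt
    proof (elim disjE conjE)
      assume "T \<le> 50 - \<epsilon> / 4 * (A1 + A2) - (1 / 2 + \<epsilon> / 4) * (l1 + l2)"
      then show ?thesis using kt(1) unfolding k12[symmetric] by (intro step[of "- (\<epsilon> / 4 * (A1 + A2)) - (1 / 2 + \<epsilon> / 4) * (l1 + l2)"]) auto
    next
      assume "T \<le> 50 - \<epsilon> / 4 * (A0 + A1) - (1 / 2 + \<epsilon> / 4) * (l0 + l1)"
      then show ?thesis using kt(2) unfolding k01[symmetric] by (intro step[of "- (\<epsilon> / 4 * (A0 + A1)) - (1 / 2 + \<epsilon> / 4) * (l0 + l1)"]) auto
    next
      assume "T \<le> 50 - \<epsilon> / 4 * (A0 + A2) - (1 / 2 + \<epsilon> / 4) * (l0 + l2)"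
      then show ?thesis using kt(3) unfolding k02[symmetric] by (intro step[of "- (\<epsilon> / 4 * (A0 + A2)) - (1 / 2 + \<epsilon> / 4) * (l0 + l2)"]) auto
    next
      assume "z2 \<le> z0 - 2" "T \<le> 50 + z0 / 4 - z2 / 2 - (1 / 2 + \<epsilon> / 4) * (l1 + l2)"
      then show ?thesis using kt(4) h0 by (intro step[of "z0 / 4 - z2 / 2 - (1 / 2 + \<epsilon> / 4) * (l1 + l2)"]) auto
    next
      assume "z2 \<le> z1 - 2" "T \<le> 50 + z1 / 4 - z2 / 2 - (1 / 2 + \<epsilon> / 4) * (l0 + l2)"
      then show ?thesis using kt(5) h1 by (intro step[of "z1 / 4 - z2 / 2 - (1 / 2 + \<epsilon> / 4) * (l0 + l2)"]) auto
    qed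
  qed
  define u where "u = sobolev_weight s1 s2 x * sobolev_weight s1 s2 y"
  have u: "0 < u" by (simp add: u_def sobolev_weight_pos)
  define X where "X = z0 + (1 / 2 + \<epsilon>) * (A0 - z0) + (\<epsilon> - 1 / 2) * l0 + max 0 (\<epsilon> * l0 - 3 * \<epsilon> * A0)"
  have "m_out \<epsilon> s1 s2 (x + y) \<le> 2 * (sobolev_weight s1 s2 (x + y) * exp X)"
    using m_out_le[of "x + y" \<epsilon> s1 s2] nz by (simp add: X_def defs)
  also have "\<dots> \<le> 2 * ((u * exp ((1 / 2 - 8 * \<epsilon>) * (A1 + A2 - A0))) * exp X)"
    using sobolev_weight_add_le[OF s, of x y] by (intro mult_left_mono mult_right_mono) (auto simp: u_def defs)
  also have "\<dots> = 2 * (u * (exp T * (exp v1 * exp v2)))"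
    unfolding mult.assoc exp_add[symmetric] T_def X_def by (simp add: algebra_simps)
  also have "\<dots> \<le> 2 * (u * ((exp 50 * kt) * (exp v1 * exp v2)))"
    using u expT by (intro mult_left_mono mult_right_mono) auto
  also have "\<dots> = 2 * exp 50 * ((sobolev_weight s1 s2 x * exp v1) * (sobolev_weight s1 s2 y * exp v2) * kt)"
    by (simp add: u_def)
  also have "\<dots> \<le> 2 * exp 50 * (W_in \<epsilon> s1 s2 x * W_in \<epsilon> s1 s2 y * kt)"
  proof -
    have g1: "sobolev_weight s1 s2 x * exp v1 \<le> W_in \<epsilon> s1 s2 x" and g2: "sobolev_weight s1 s2 y * exp v2 \<le> W_in \<epsilon> s1 s2 y"
      using W_in_ge[of x s1 s2 \<epsilon>] W_in_ge[of y s1 s2 \<epsilon>] nz by (simp_all add: v1_def v2_def defs)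
    have "0 < sobolev_weight s1 s2 x * exp v1" "0 < sobolev_weight s1 s2 y * exp v2" by (simp_all add: sobolev_weight_pos)
    moreover have "0 \<le> kt" by (simp add: kt_def ktot_nonneg)
    ultimately show ?thesis using g1 g2 by (intro mult_left_mono mult_right_mono mult_mono) auto
  qed
  finally show ?thesis unfolding kt_def .
qed

lemma ktot_commute: "ktot \<beta> \<delta> x y = ktot \<beta> \<delta> y x"
  unfolding ktot_def add.commute[of y x] by (simp only: mult.commute[of "kS \<delta> \<beta> y" "kS \<delta> \<beta> x"] add_ac)

lemma kernel_bound:
  assumes E: "0 < \<epsilon>" "\<epsilon> < 1 / 100" and s: "- 1 / 2 + 8 * \<epsilon> \<le> s1" "0 \<le> s2"
    and nz: "fst x \<noteq> 0" "fst y \<noteq> 0" "fst x + fst y \<noteq> 0"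
  shows "m_out \<epsilon> s1 s2 (x + y) \<le> (2 * exp 50) * (W_in \<epsilon> s1 s2 x * W_in \<epsilon> s1 s2 y * ktot (1 + \<epsilon> / 2) (\<epsilon> / 4) x y)"
proof (cases "\<bar>fst y\<bar> \<le> \<bar>fst x\<bar>")
  case True
  then show ?thesis by (rule kernel_bound_ordered[OF E s nz])
next
  case False
  then have "m_out \<epsilon> s1 s2 (y + x) \<le> (2 * exp 50) * (W_in \<epsilon> s1 s2 y * W_in \<epsilon> s1 s2 x * ktot (1 + \<epsilon> / 2) (\<epsilon> / 4) y x)"
    using nz by (intro kernel_bound_ordered E s) (auto simp: add.commute)
  then show ?thesis using ktot_commute[of _ _ x y] by (simp add: add.commute mult.commute)
qed

lemma weight_measurable [measurable]: "weight \<sigma> s1 s2 b \<in> borel_measurable borel"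
proof -
  have "weight \<sigma> s1 s2 b = (\<lambda>z. bracket (fst z) powr (s1 + \<sigma>) * \<bar>fst z\<bar> powr (- \<sigma>) * bracket (fst (snd z)) powr s2 * bracket (lam z) powr b)"
    by (auto simp: weight_def lam_def fun_eq_iff)
  then show ?thesis by simp
qed

lemma weight_nonneg: "0 \<le> weight \<sigma> s1 s2 b z"
  by (cases z) (simp add: weight_def)

lemma weight_pos: "fst z \<noteq> 0 \<Longrightarrow> 0 < weight \<sigma> s1 s2 b z"
  by (simp add: weight_exp(1) sobolev_weight_pos)

lemma W_in_measurable [measurable]: "W_in \<epsilon> s1 s2 \<in> borel_measurable borel"
  unfolding W_in_def[abs_def] by measurable

lemma m_out_measurable [measurable]: "m_out \<epsilon> s1 s2 \<in> borel_measurable borel"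
  unfolding m_out_def[abs_def] by measurable

theorem bilinear_weighted:
  assumes E: "0 < \<epsilon>" "\<epsilon> < 1 / 100" and s: "- 1 / 2 + 8 * \<epsilon> \<le> s1" "0 \<le> s2"
  obtains C :: real where "0 < C"
    and "\<And>F1 F2. F1 \<in> borel_measurable borel \<Longrightarrow> F2 \<in> borel_measurable borel \<Longrightarrow>
       sq_int (\<lambda>z. ennreal (W_in \<epsilon> s1 s2 z) * F1 z) \<le> 1 \<Longrightarrow> sq_int (\<lambda>z. ennreal (W_in \<epsilon> s1 s2 z) * F2 z) \<le> 1 \<Longrightarrow>
       sq_int (\<lambda>\<zeta>. ennreal (m_out \<epsilon> s1 s2 \<zeta>) * (\<integral>\<^sup>+z. F1 z * F2 (\<zeta> - z) \<partial>lborel)) \<le> ennreal C"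
proof
  let ?c = "2 * exp 50 :: real" and ?\<beta> = "1 + \<epsilon> / 2" and ?\<delta> = "\<epsilon> / 4"
  have bd: "?\<beta> > 1" "?\<delta> > 0" using E by auto
  show "0 < 4 * (7 * ?c * tri_const ?\<beta> ?\<delta>)\<^sup>2" using tri_const_bounds(1)[OF bd] by simp
  fix F1 F2 :: "r3 \<Rightarrow> ennreal"
  assume "F1 \<in> borel_measurable borel" "F2 \<in> borel_measurable borel"
    "sq_int (\<lambda>z. ennreal (W_in \<epsilon> s1 s2 z) * F1 z) \<le> 1" "sq_int (\<lambda>z. ennreal (W_in \<epsilon> s1 s2 z) * F2 z) \<le> 1"
  then show "sq_int (\<lambda>\<zeta>. ennreal (m_out \<epsilon> s1 s2 \<zeta>) * (\<integral>\<^sup>+z. F1 z * F2 (\<zeta> - z) \<partial>lborel)) \<le> ennreal (4 * (7 * ?c * tri_const ?\<beta> ?\<delta>)\<^sup>2)"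
  proof (intro bilinear_of_kernel bd)
    show "m_out \<epsilon> s1 s2 \<in> borel_measurable borel" by measurable
    show "W_in \<epsilon> s1 s2 \<in> borel_measurable borel" by measurable
    show "0 \<le> m_out \<epsilon> s1 s2 z" for z by (simp add: m_out_def weight_nonneg)
    show "0 < W_in \<epsilon> s1 s2 z" if "fst z \<noteq> 0" for z using that by (simp add: W_in_def weight_pos add_pos_pos)
    show "m_out \<epsilon> s1 s2 (x + y) \<le> ?c * (W_in \<epsilon> s1 s2 x * W_in \<epsilon> s1 s2 y * ktot ?\<beta> ?\<delta> x y)"
      if "fst x \<noteq> 0" "fst y \<noteq> 0" "fst x + fst y \<noteq> 0" for x y
      by (rule kernel_bound[OF E s that])
  qed auto
qed

section \<open>Schwartz functions\<close>

definition rapid :: "(r3 \<Rightarrow> complex) \<Rightarrow> bool" where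
  "rapid f \<longleftrightarrow> (\<forall>k::nat. bounded (range (\<lambda>z. (1 + norm z) ^ k *\<^sub>R f z)))"

lemma rapid_iff: "rapid f \<longleftrightarrow> (\<forall>k::nat. \<exists>B. \<forall>z. (1 + norm z) ^ k * cmod (f z) \<le> B)"
  unfolding rapid_def bounded_iff by simp

lemma rapidD: "rapid f \<Longrightarrow> \<exists>B. \<forall>z. (1 + norm z) ^ k * cmod (f z) \<le> B"
  unfolding rapid_iff by blast

text \<open>Membership in the Schwartz space is coinductive: a set of differentiable, rapidly decreasing functions that
is closed under partial derivatives consists of Schwartz functions. All closure properties are obtained in
this way.\<close>

lemma schwartz_coinduct:
  assumes "f \<in> S"
    and "\<And>f z. f \<in> S \<Longrightarrow> f differentiable (at z)" and "\<And>f. f \<in> S \<Longrightarrow> rapid f"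
    and "\<And>f e. f \<in> S \<Longrightarrow> e \<in> Basis \<Longrightarrow> partial_deriv e f \<in> S"
  shows "f \<in> schwartz"
proof -
  have "iter_deriv es f \<in> S" if "set es \<subseteq> Basis" for es
    using that by (induction es) (auto simp: iter_deriv_def assms)
  then show ?thesis using assms(2,3) unfolding schwartz_def rapid_def by blast
qed

lemma iter_deriv_Nil [simp]: "iter_deriv [] f = f" by (simp add: iter_deriv_def)

lemma schwartzD:
  assumes "f \<in> schwartz" "set es \<subseteq> Basis"
  shows "iter_deriv es f differentiable (at z)" "rapid (iter_deriv es f)"
  using assms unfolding schwartz_def rapid_def by blast+

lemma schwartz_differentiable: "f \<in> schwartz \<Longrightarrow> f differentiable (at z)"
  using schwartzD(1)[of f "[]"] by simp

lemma schwartz_rapid: "f \<in> schwartz \<Longrightarrow> rapid f"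
  using schwartzD(2)[of f "[]"] by simp

lemma iter_deriv_snoc: "iter_deriv es (partial_deriv e f) = iter_deriv (es @ [e]) f"
  by (simp add: iter_deriv_def)

lemma schwartz_partial_deriv: "f \<in> schwartz \<Longrightarrow> e \<in> Basis \<Longrightarrow> partial_deriv e f \<in> schwartz"
  unfolding schwartz_def by (simp add: iter_deriv_snoc)

lemma partial_deriv_eq:
  assumes "(f has_derivative f') (at z)" shows "partial_deriv e f z = f' e"
  unfolding partial_deriv_def using frechet_derivative_at[OF assms] by simp

lemma schwartz_has_derivative:
  "f \<in> schwartz \<Longrightarrow> (f has_derivative (\<lambda>e. partial_deriv e f z)) (at z)"
  unfolding partial_deriv_def using schwartz_differentiable frechet_derivative_works by blast

lemma rapid_add:
  assumes "rapid f" "rapid g" shows "rapid (\<lambda>z. f z + g z)"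
  unfolding rapid_iff
proof
  fix k
  obtain B where B: "\<And>z. (1 + norm z) ^ k * cmod (f z) \<le> B" using rapidD[OF assms(1), of "k"] by blast
  obtain C where C: "\<And>z. (1 + norm z) ^ k * cmod (g z) \<le> C" using rapidD[OF assms(2), of "k"] by blast
  have "(1 + norm z) ^ k * cmod (f z + g z) \<le> B + C" for z
  proof -
    have "(1 + norm z) ^ k * cmod (f z + g z) \<le> (1 + norm z) ^ k * (cmod (f z) + cmod (g z))"
      by (intro mult_left_mono norm_triangle_ineq) simp
    also have "\<dots> \<le> B + C" using B[of z] C[of z] by (simp add: distrib_left)
    finally show ?thesis .
  qed
  then show "\<exists>B. \<forall>z. (1 + norm z) ^ k * cmod (f z + g z) \<le> B" by blast
qed

lemma schwartz_add:
  assumes "f \<in> schwartz" "g \<in> schwartz" shows "(\<lambda>z. f z + g z) \<in> schwartz"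
proof (rule schwartz_coinduct[where S = "{\<lambda>z. f z + g z | f g. f \<in> schwartz \<and> g \<in> schwartz}"])
  fix h :: "r3 \<Rightarrow> complex" assume "h \<in> {\<lambda>z. f z + g z | f g. f \<in> schwartz \<and> g \<in> schwartz}"
  then obtain f g where h: "h = (\<lambda>z. f z + g z)" and fg: "f \<in> schwartz" "g \<in> schwartz" by blast
  show "h differentiable (at z)" for z unfolding h using fg by (intro differentiable_add schwartz_differentiable)
  show "rapid h" unfolding h using fg by (intro rapid_add schwartz_rapid)
  fix e :: r3 assume e: "e \<in> Basis"
  have "partial_deriv e h = (\<lambda>z. partial_deriv e f z + partial_deriv e g z)"
    unfolding h by (rule ext, rule partial_deriv_eq) (intro has_derivative_add schwartz_has_derivative fg)
  then show "partial_deriv e h \<in> {\<lambda>z. f z + g z | f g. f \<in> schwartz \<and> g \<in> schwartz}"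
    using fg e schwartz_partial_deriv by blast
qed (use assms in blast)

lemma schwartz_cmult:
  assumes "f \<in> schwartz" shows "(\<lambda>z. c * f z) \<in> schwartz"
proof (rule schwartz_coinduct[where S = "{\<lambda>z. c * f z | f. f \<in> schwartz}"])
  fix h :: "r3 \<Rightarrow> complex" assume "h \<in> {\<lambda>z. c * f z | f. f \<in> schwartz}"
  then obtain f where h: "h = (\<lambda>z. c * f z)" and f: "f \<in> schwartz" by blast
  show "h differentiable (at z)" for z unfolding h by (intro differentiable_mult differentiable_const schwartz_differentiable[OF f])
  show "rapid h" unfolding rapid_iff
  proof
    fix k
    obtain B where B: "\<And>z. (1 + norm z) ^ k * cmod (f z) \<le> B" using rapidD[OF schwartz_rapid[OF f], of "k"] by blast
    have "(1 + norm z) ^ k * cmod (h z) \<le> cmod c * B" for z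
      using mult_left_mono[OF B[of z], of "cmod c"] by (simp add: h norm_mult mult.left_commute)
    then show "\<exists>B. \<forall>z. (1 + norm z) ^ k * cmod (h z) \<le> B" by blast
  qed
  fix e :: r3 assume e: "e \<in> Basis"
  have "partial_deriv e h = (\<lambda>z. c * partial_deriv e f z)"
    unfolding h by (rule ext, rule partial_deriv_eq) (intro has_derivative_mult_right schwartz_has_derivative f)
  then show "partial_deriv e h \<in> {\<lambda>z. c * f z | f. f \<in> schwartz}"
    using f e schwartz_partial_deriv by blast
qed (use assms in blast)

text \<open>The derivatives of such a product are of the form product plus Schwartz function; this is the set on which
the coinduction runs.\<close>

lemma schwartz_coord_mult:
  assumes "f \<in> schwartz" shows "(\<lambda>z. complex_of_real (z \<bullet> a) * f z) \<in> schwartz"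
proof (rule schwartz_coinduct[where S = "{\<lambda>z. complex_of_real (z \<bullet> a) * f z + g z | f g. f \<in> schwartz \<and> g \<in> schwartz}"])
  have "(\<lambda>z. 0 * f z) \<in> schwartz" using assms by (rule schwartz_cmult)
  then show "(\<lambda>z. complex_of_real (z \<bullet> a) * f z) \<in> {\<lambda>z. complex_of_real (z \<bullet> a) * f z + g z | f g. f \<in> schwartz \<and> g \<in> schwartz}"
    using assms by (intro CollectI exI[of _ f] exI[of _ "\<lambda>z. 0"]) simp
next
  fix h :: "r3 \<Rightarrow> complex" assume "h \<in> {\<lambda>z. complex_of_real (z \<bullet> a) * f z + g z | f g. f \<in> schwartz \<and> g \<in> schwartz}"
  then obtain f g where h: "h = (\<lambda>z. complex_of_real (z \<bullet> a) * f z + g z)" and fg: "f \<in> schwartz" "g \<in> schwartz" by blast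
  have D: "(h has_derivative (\<lambda>e. complex_of_real (z \<bullet> a) * partial_deriv e f z + complex_of_real (e \<bullet> a) * f z + partial_deriv e g z)) (at z)" for z
    unfolding h by (intro has_derivative_add has_derivative_mult schwartz_has_derivative fg
       bounded_linear.has_derivative[OF bounded_linear_of_real] has_derivative_inner_left has_derivative_ident)
  show "h differentiable (at z)" for z using D unfolding differentiable_def by blast
  show "rapid h" unfolding h
  proof (intro rapid_add schwartz_rapid[OF fg(2)])
    show "rapid (\<lambda>z. complex_of_real (z \<bullet> a) * f z)" unfolding rapid_iff
    proof
      fix k
      obtain B where B: "\<And>z. (1 + norm z) ^ (Suc k) * cmod (f z) \<le> B" using rapidD[OF schwartz_rapid[OF fg(1)], of "Suc k"] by blast
      have "(1 + norm z) ^ k * cmod (complex_of_real (z \<bullet> a) * f z) \<le> norm a * B" for z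
      proof -
        have "\<bar>z \<bullet> a\<bar> \<le> norm z * norm a" by (rule Cauchy_Schwarz_ineq2)
        also have "\<dots> \<le> (1 + norm z) * norm a" by (intro mult_right_mono) auto
        finally have "(1 + norm z) ^ k * (\<bar>z \<bullet> a\<bar> * cmod (f z)) \<le> (1 + norm z) ^ k * (((1 + norm z) * norm a) * cmod (f z))"
          by (intro mult_left_mono mult_right_mono) auto
        also have "\<dots> = norm a * ((1 + norm z) ^ (Suc k) * cmod (f z))" by (simp add: mult_ac)
        also have "\<dots> \<le> norm a * B" by (intro mult_left_mono B) auto
        finally show ?thesis by (simp add: norm_mult)
      qed
      then show "\<exists>B. \<forall>z. (1 + norm z) ^ k * cmod (complex_of_real (z \<bullet> a) * f z) \<le> B" by blast
    qed
  qed
  fix e :: r3 assume e: "e \<in> Basis"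
  have "partial_deriv e h = (\<lambda>z. complex_of_real (z \<bullet> a) * partial_deriv e f z + (complex_of_real (e \<bullet> a) * f z + partial_deriv e g z))"
    by (rule ext, subst partial_deriv_eq[OF D]) (simp add: add.assoc)
  moreover have "(\<lambda>z. complex_of_real (e \<bullet> a) * f z + partial_deriv e g z) \<in> schwartz"
    using fg e by (intro schwartz_add schwartz_cmult schwartz_partial_deriv)
  ultimately show "partial_deriv e h \<in> {\<lambda>z. complex_of_real (z \<bullet> a) * f z + g z | f g. f \<in> schwartz \<and> g \<in> schwartz}"
    using schwartz_partial_deriv[OF fg(1) e]
    by (intro CollectI exI[of _ "partial_deriv e f"] exI[of _ "\<lambda>z. complex_of_real (e \<bullet> a) * f z + partial_deriv e g z"]) simp
qed

text \<open>An integrable weight that is comparable under bounded translations. The exponent \<open>6\<close> comes from estimating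
it by \<open>(1 + \<bar>x\<bar>) ^ (- 2)\<close> in each of the three coordinates.\<close>

definition decay6 :: "r3 \<Rightarrow> real" where "decay6 z = 1 / (1 + norm z) ^ 6"

lemma norm_r3_ge: "\<bar>x\<bar> \<le> norm (x, y, t)" "\<bar>y\<bar> \<le> norm (x, y, t)" "\<bar>t\<bar> \<le> norm (x, y, t)" for x y t :: real
proof -
  have "norm x \<le> norm (x, y, t)" by (rule norm_fst_le)
  then show "\<bar>x\<bar> \<le> norm (x, y, t)" by simp
  have s: "norm (y, t) \<le> norm (x, y, t)" by (rule norm_snd_le)
  have "norm y \<le> norm (y, t)" by (rule norm_fst_le)
  with s show "\<bar>y\<bar> \<le> norm (x, y, t)" by simp
  have "norm t \<le> norm (y, t)" by (rule norm_snd_le)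
  with s show "\<bar>t\<bar> \<le> norm (x, y, t)" by simp
qed

lemma decay6_pos: "0 < decay6 z" unfolding decay6_def by (intro divide_pos_pos zero_less_power add_pos_nonneg) auto

lemma decay6_measurable [measurable]: "decay6 \<in> borel_measurable borel"
proof -
  have "(\<lambda>z::r3. (1 + norm z) ^ 6) \<in> borel_measurable borel" by measurable
  from borel_measurable_divide[OF borel_measurable_const this, of 1] show ?thesis
    unfolding decay6_def[abs_def] .
qed

lemma integrable_decay6: "integrable lborel decay6"
proof (rule integrableI_bounded)
  show "decay6 \<in> borel_measurable lborel" by measurable
  let ?b = "\<lambda>x. bracket x powr - 2"
  have "(\<integral>\<^sup>+z. ennreal (norm (decay6 z)) \<partial>lborel) \<le> (\<integral>\<^sup>+z. ennreal (?b (fst z) * (?b (fst (snd z)) * ?b (snd (snd z)))) \<partial>lborel)"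
  proof (intro nn_integral_mono ennreal_leI)
    fix z :: r3
    obtain x y t where z: "z = (x, y, t)" by (cases z) auto
    have "bracket x * (bracket y * bracket t) \<le> (1 + norm z) * ((1 + norm z) * (1 + norm z))"
      unfolding bracket_def z using norm_r3_ge[where x = x and y = y and t = t] by (intro mult_mono) auto
    then have "(bracket x * (bracket y * bracket t))\<^sup>2 \<le> ((1 + norm z) * ((1 + norm z) * (1 + norm z)))\<^sup>2"
      by (intro power_mono) auto
    also have "\<dots> = (1 + norm z) ^ 6" by (simp add: power2_eq_square eval_nat_numeral)
    finally have "1 / (1 + norm z) ^ 6 \<le> 1 / (bracket x * (bracket y * bracket t))\<^sup>2"
      by (intro divide_left_mono) (auto intro!: mult_pos_pos add_pos_nonneg)
    also have "\<dots> = ?b x * (?b y * ?b t)"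
      by (simp add: powr_minus divide_inverse power_mult_distrib powr_numeral)
    finally show "norm (decay6 z) \<le> ?b (fst z) * (?b (fst (snd z)) * ?b (snd (snd z)))"
      using decay6_pos[of z] unfolding decay6_def by (simp add: z)
  qed
  also have "\<dots> = (\<integral>\<^sup>+x. \<integral>\<^sup>+y. \<integral>\<^sup>+t. ennreal (?b x) * (ennreal (?b y) * ennreal (?b t)) \<partial>lborel \<partial>lborel \<partial>lborel)"
    by (subst nn_integral_r3) (simp_all add: ennreal_mult)
  also have "\<dots> = (\<integral>\<^sup>+x. ennreal (?b x) \<partial>lborel) * ((\<integral>\<^sup>+x. ennreal (?b x) \<partial>lborel) * (\<integral>\<^sup>+x. ennreal (?b x) \<partial>lborel))"
    by (simp add: nn_integral_cmult nn_integral_multc)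
  also have "\<dots> \<le> ennreal (2 / (2 - 1)) * (ennreal (2 / (2 - 1)) * ennreal (2 / (2 - 1)))"
    by (intro mult_mono nn_integral_bracket_powr) auto
  also have "\<dots> < \<infinity>" by (simp add: ennreal_mult_less_top)
  finally show "(\<integral>\<^sup>+z. ennreal (norm (decay6 z)) \<partial>lborel) < \<infinity>" .
qed

lemma schwartz_continuous: "f \<in> schwartz \<Longrightarrow> continuous_on UNIV f"
  using schwartz_differentiable by (intro continuous_at_imp_continuous_on ballI differentiable_imp_continuous_within)

lemma schwartz_measurable: "f \<in> schwartz \<Longrightarrow> f \<in> borel_measurable borel"
  by (intro borel_measurable_continuous_onI schwartz_continuous)

lemma le_decay6_iff: "(1 + norm z) ^ 6 * x \<le> B \<longleftrightarrow> x \<le> B * decay6 z"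
proof -
  have "0 < (1 + norm z) ^ 6" by (intro zero_less_power) (simp add: add_pos_nonneg)
  then show ?thesis by (simp add: decay6_def field_simps)
qed

lemma integrable_le_decay6:
  fixes f :: "r3 \<Rightarrow> 'b::{banach, second_countable_topology}"
  assumes "f \<in> borel_measurable borel" "\<And>z. norm (f z) \<le> B * decay6 z"
  shows "integrable lborel f"
  by (rule Bochner_Integration.integrable_bound[OF integrable_mult_right[OF integrable_decay6, of B]])
     (use assms(1) in \<open>auto simp del: split_paired_All intro!: AE_I2 order_trans[OF assms(2) abs_ge_self]\<close>)

lemma rapid_integrable:
  assumes "rapid f" "f \<in> borel_measurable borel" shows "integrable lborel f"
proof -
  obtain B where B: "\<And>z. (1 + norm z) ^ 6 * cmod (f z) \<le> B" using rapidD[OF assms(1), of "6"] by blast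
  show ?thesis by (rule integrable_le_decay6[OF assms(2)]) (use B le_decay6_iff in blast)
qed

lemma schwartz_integrable: "f \<in> schwartz \<Longrightarrow> integrable lborel f"
  by (intro rapid_integrable schwartz_rapid schwartz_measurable)

lemma cis_measurable [measurable]: "cis \<in> borel_measurable borel"
  by (intro borel_measurable_continuous_onI continuous_intros)

lemma integrable_cis_mult:
  assumes "integrable lborel f" and [measurable]: "g \<in> borel_measurable borel"
  shows "integrable lborel (\<lambda>z::r3. cis (g z) * f z)"
proof -
  have [measurable]: "f \<in> borel_measurable lborel" using assms(1) by (rule borel_measurable_integrable)
  show ?thesis
    by (rule Bochner_Integration.integrable_bound[OF assms(1)]) (auto simp: norm_mult)
qed

lemma fourier_norm_le:
  assumes "f \<in> borel_measurable borel" "\<And>z. (1 + norm z) ^ 6 * cmod (f z) \<le> B"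
  shows "cmod (fourier f \<zeta>) \<le> B * (LINT z|lborel. decay6 z)"
proof -
  have f: "integrable lborel f" by (rule integrable_le_decay6[OF assms(1)]) (use assms(2) le_decay6_iff in blast)
  have "cmod (fourier f \<zeta>) \<le> (LINT z|lborel. cmod (cis (- (z \<bullet> \<zeta>)) * f z))"
    unfolding fourier_def by (rule integral_norm_bound)
  also have "\<dots> \<le> (LINT z|lborel. B * decay6 z)"
  proof (rule integral_mono)
    show "integrable lborel (\<lambda>z. cmod (cis (- (z \<bullet> \<zeta>)) * f z))"
      by (intro integrable_norm integrable_cis_mult f) measurable
    show "integrable lborel (\<lambda>z. B * decay6 z)" by (intro integrable_mult_right integrable_decay6)
    show "cmod (cis (- (z \<bullet> \<zeta>)) * f z) \<le> B * decay6 z" for z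
      using assms(2)[of z] le_decay6_iff[of z "cmod (f z)" B] by (simp add: norm_mult)
  qed
  finally show ?thesis by simp
qed

lemma fourier_add:
  assumes "f \<in> schwartz" "g \<in> schwartz"
  shows "fourier (\<lambda>z. f z + g z) \<zeta> = fourier f \<zeta> + fourier g \<zeta>"
  unfolding fourier_def distrib_left
  by (rule Bochner_Integration.integral_add) (intro integrable_cis_mult schwartz_integrable assms; measurable)+

lemma fourier_cmult: "fourier (\<lambda>z. c * f z) \<zeta> = c * fourier f \<zeta>"
  unfolding fourier_def by (simp add: mult.left_commute)

section \<open>The Fourier transform of Schwartz functions\<close>

lemma cis_taylor1: "cmod (cis x - 1 - \<i> * x) \<le> x\<^sup>2"
proof -
  have "cmod (iexp x - (\<Sum>k \<le> 1. (\<i> * x)^k / fact k)) \<le> \<bar>x\<bar>^(Suc 1) / fact (Suc 1)"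
    by (rule iexp_approx1)
  then have "cmod (cis x - (1 + \<i> * x)) \<le> x\<^sup>2 / 2" by (simp add: cis_conv_exp power2_eq_square)
  also have "\<dots> \<le> x\<^sup>2" by simp
  finally show ?thesis by (simp add: diff_diff_eq)
qed

text \<open>A quadratic Taylor estimate identifies the derivative.\<close>

lemma has_derivative_quadratic:
  fixes F :: "'a::real_normed_vector \<Rightarrow> 'b::real_normed_vector"
  assumes L: "bounded_linear L" and q: "\<And>h. norm (F (x + h) - F x - L h) \<le> C * (norm h)\<^sup>2"
  shows "(F has_derivative L) (at x)"
  unfolding has_derivative_at
proof (intro conjI L)
  have lim: "((\<lambda>h. C * norm h) \<longlongrightarrow> 0) (at (0::'a))"
    by (auto intro!: tendsto_eq_intros)
  show "(\<lambda>h. norm (F (x + h) - F x - L h) / norm h) \<midarrow>0\<rightarrow> 0"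
  proof (rule tendsto_sandwich[OF _ _ tendsto_const lim])
    show "\<forall>\<^sub>F h in at 0. 0 \<le> norm (F (x + h) - F x - L h) / norm h" by simp
    show "\<forall>\<^sub>F h in at 0. norm (F (x + h) - F x - L h) / norm h \<le> C * norm h"
    proof (rule eventually_at_topological[THEN iffD2], intro exI[of _ UNIV] conjI ballI impI)
      fix h :: 'a assume "h \<noteq> 0"
      then show "norm (F (x + h) - F x - L h) / norm h \<le> C * norm h"
        using q[of h] by (simp add: divide_le_eq power2_eq_square mult.assoc)
    qed auto
  qed
qed

text \<open>Differentiation under the integral sign in all directions at once: the Taylor remainder of the exponential is
quadratic in \<open>z \<bullet> h\<close>, and the function decays fast enough to absorb two powers of \<open>z\<close>.\<close>

lemma fourier_has_derivative:
  assumes f: "f \<in> schwartz"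
  shows "(fourier f has_derivative (\<lambda>h. fourier (\<lambda>z. - \<i> * (complex_of_real (z \<bullet> h) * f z)) \<zeta>)) (at \<zeta>)"
proof -
  have fh: "(\<lambda>z. - \<i> * (complex_of_real (z \<bullet> h) * f z)) \<in> schwartz" for h
    by (intro schwartz_cmult schwartz_coord_mult f)
  let ?L = "\<lambda>h. fourier (\<lambda>z. - \<i> * (complex_of_real (z \<bullet> h) * f z)) \<zeta>"
  obtain B where B: "\<And>z. (1 + norm z) ^ 8 * cmod (f z) \<le> B" using rapidD[OF schwartz_rapid[OF f], of 8] by blast
  let ?J = "LINT z|lborel. decay6 z"
  have bd: "(1 + norm z) ^ 6 * ((norm z) ^ j * cmod (f z)) \<le> B" if "j \<le> 2" for z j
  proof -
    have "(norm z) ^ j \<le> (1 + norm z) ^ j" by (intro power_mono) auto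
    also have "\<dots> \<le> (1 + norm z) ^ 2" using that by (intro power_increasing) auto
    finally have "(1 + norm z) ^ 6 * ((norm z) ^ j * cmod (f z)) \<le> (1 + norm z) ^ 6 * ((1 + norm z) ^ 2 * cmod (f z))"
      by (intro mult_left_mono mult_right_mono) auto
    also have "\<dots> = (1 + norm z) ^ 8 * cmod (f z)"
      by (simp only: mult.assoc[symmetric] power_add[symmetric]) simp
    finally show ?thesis using B[of z] by linarith
  qed
  have lin: "bounded_linear ?L"
  proof (rule bounded_linear_intro[where K = "B * ?J"])
    fix g h :: r3
    have "?L (g + h) = fourier (\<lambda>z. - \<i> * (complex_of_real (z \<bullet> g) * f z) + - \<i> * (complex_of_real (z \<bullet> h) * f z)) \<zeta>"
      by (simp add: inner_add_right algebra_simps)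
    then show "?L (g + h) = ?L g + ?L h" using fourier_add[OF fh fh] by simp
  next
    fix r and h :: r3
    have "?L (r *\<^sub>R h) = fourier (\<lambda>z. complex_of_real r * (- \<i> * (complex_of_real (z \<bullet> h) * f z))) \<zeta>"
      by (simp add: mult_ac)
    then show "?L (r *\<^sub>R h) = r *\<^sub>R ?L h" unfolding fourier_cmult by (simp add: scaleR_conv_of_real)
  next
    fix h :: r3
    have "cmod (?L h) \<le> (norm h * B) * ?J"
    proof (rule fourier_norm_le)
      show "(\<lambda>z. - \<i> * (complex_of_real (z \<bullet> h) * f z)) \<in> borel_measurable borel" by (rule schwartz_measurable[OF fh])
      fix z :: r3
      have "\<bar>z \<bullet> h\<bar> \<le> norm z * norm h" by (rule Cauchy_Schwarz_ineq2)
      then have "(1 + norm z) ^ 6 * (\<bar>z \<bullet> h\<bar> * cmod (f z)) \<le> (1 + norm z) ^ 6 * ((norm z * norm h) * cmod (f z))"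
        by (intro mult_left_mono mult_right_mono) auto
      also have "\<dots> = norm h * ((1 + norm z) ^ 6 * ((norm z) ^ 1 * cmod (f z)))" by (simp add: mult_ac)
      also have "\<dots> \<le> norm h * B" by (intro mult_left_mono bd) auto
      finally show "(1 + norm z) ^ 6 * cmod (- \<i> * (complex_of_real (z \<bullet> h) * f z)) \<le> norm h * B"
        by (simp add: norm_mult)
    qed
    then show "norm (?L h) \<le> norm h * (B * ?J)" by (simp add: mult.assoc)
  qed
  show ?thesis
  proof (rule has_derivative_quadratic[OF lin, where C = "B * ?J"])
    fix h :: r3
    let ?r = "\<lambda>z. (cis (- (z \<bullet> h)) - 1 - \<i> * complex_of_real (- (z \<bullet> h))) * f z"
    have fm [measurable]: "f \<in> borel_measurable borel" by (rule schwartz_measurable[OF f])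
    have rm: "?r \<in> borel_measurable borel" by measurable
    have "fourier f (\<zeta> + h) - fourier f \<zeta> - ?L h = fourier ?r \<zeta>"
    proof -
      have i1: "integrable lborel (\<lambda>z. cis (- (z \<bullet> (\<zeta> + h))) * f z)" by (intro integrable_cis_mult schwartz_integrable f) measurable
      have i2: "integrable lborel (\<lambda>z. cis (- (z \<bullet> \<zeta>)) * f z)" by (intro integrable_cis_mult schwartz_integrable f) measurable
      have i3: "integrable lborel (\<lambda>z. cis (- (z \<bullet> \<zeta>)) * (- \<i> * (complex_of_real (z \<bullet> h) * f z)))" by (intro integrable_cis_mult schwartz_integrable fh) measurable
      have "fourier f (\<zeta> + h) - fourier f \<zeta> - ?L h = (LINT z|lborel. cis (- (z \<bullet> (\<zeta> + h))) * f z - cis (- (z \<bullet> \<zeta>)) * f z - cis (- (z \<bullet> \<zeta>)) * (- \<i> * (complex_of_real (z \<bullet> h) * f z)))"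
        unfolding fourier_def using i1 i2 i3 by (simp add: Bochner_Integration.integral_diff)
      also have "\<dots> = fourier ?r \<zeta>"
        unfolding fourier_def
      proof (rule Bochner_Integration.integral_cong[OF refl])
        fix z :: r3
        have "cis (- (z \<bullet> (\<zeta> + h))) = cis (- (z \<bullet> \<zeta>)) * cis (- (z \<bullet> h))" by (simp add: cis_mult inner_add_right)
        then show "cis (- (z \<bullet> (\<zeta> + h))) * f z - cis (- (z \<bullet> \<zeta>)) * f z - cis (- (z \<bullet> \<zeta>)) * (- \<i> * (complex_of_real (z \<bullet> h) * f z)) = cis (- (z \<bullet> \<zeta>)) * ?r z"
          by (simp add: algebra_simps)
      qed
      finally show ?thesis .
    qed
    also have "cmod (fourier ?r \<zeta>) \<le> ((norm h)\<^sup>2 * B) * ?J"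
    proof (rule fourier_norm_le[OF rm])
      fix z :: r3
      have "\<bar>z \<bullet> h\<bar> \<le> norm z * norm h" by (rule Cauchy_Schwarz_ineq2)
      then have "\<bar>z \<bullet> h\<bar>\<^sup>2 \<le> (norm z * norm h)\<^sup>2" by (intro power_mono) auto
      then have "(- (z \<bullet> h))\<^sup>2 \<le> (norm z)\<^sup>2 * (norm h)\<^sup>2" by (simp add: power_mult_distrib)
      with cis_taylor1[of "- (z \<bullet> h)"] have "cmod (cis (- (z \<bullet> h)) - 1 - \<i> * complex_of_real (- (z \<bullet> h))) \<le> (norm z)\<^sup>2 * (norm h)\<^sup>2" by linarith
      then have "(1 + norm z) ^ 6 * cmod (?r z) \<le> (1 + norm z) ^ 6 * (((norm z)\<^sup>2 * (norm h)\<^sup>2) * cmod (f z))"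
        unfolding norm_mult by (intro mult_left_mono mult_right_mono) auto
      also have "\<dots> = (norm h)\<^sup>2 * ((1 + norm z) ^ 6 * ((norm z) ^ 2 * cmod (f z)))" by (simp add: mult_ac)
      also have "\<dots> \<le> (norm h)\<^sup>2 * B" by (intro mult_left_mono bd) auto
      finally show "(1 + norm z) ^ 6 * cmod (?r z) \<le> (norm h)\<^sup>2 * B" .
    qed
    finally show "norm (fourier f (\<zeta> + h) - fourier f \<zeta> - ?L h) \<le> B * ?J * (norm h)\<^sup>2" by (simp add: mult_ac)
  qed
qed

lemma lborel_integral_translate:
  fixes f :: "'a::euclidean_space \<Rightarrow> 'b::{banach, second_countable_topology}"
  shows "(LINT z|lborel. f (z + a)) = (LINT z|lborel. f z)"
proof -
  have "(LINT z|lborel. f z) = (LINT z|distr lborel borel ((+) a). f z)" by (simp add: lborel_distr_plus)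
  also have "\<dots> = (LINT z|lborel. f (a + z))"
  proof (cases "f \<in> borel_measurable borel")
    case True
    then show ?thesis by (intro integral_distr) auto
  next
    case False
    have "(\<lambda>z. f (a + z)) \<notin> borel_measurable borel"
    proof
      assume "(\<lambda>z. f (a + z)) \<in> borel_measurable borel"
      then have "(\<lambda>z. f (a + (z - a))) \<in> borel_measurable borel"
        by (rule measurable_compose[rotated, where g = "\<lambda>z. f (a + z)"]) measurable
      then show False using False by simp
    qed
    then have "\<not> integrable lborel (\<lambda>z. f (a + z))" "\<not> integrable (distr lborel borel ((+) a)) f"
      using False by (auto simp: lborel_distr_plus dest!: borel_measurable_integrable)
    then show ?thesis by (simp add: not_integrable_integral_eq)
  qed
  finally show ?thesis by (simp add: add.commute)
qed

text \<open>The integrals of the difference quotients vanish by translation invariance, and the mean value theorem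
provides a dominating function.\<close>

lemma integral_directional_derivative_zero:
  fixes h :: "r3 \<Rightarrow> complex" and h' :: "r3 \<Rightarrow> complex"
  assumes e: "norm e = 1" and D: "\<And>z. (h has_derivative H z) (at z)" and h': "\<And>z. H z e = h' z"
    and hint: "integrable lborel h" and bd: "\<And>z. cmod (h' z) \<le> B * decay6 z"
  shows "(LINT z|lborel. h' z) = 0"
proof -
  \<comment> \<open>the steps of the difference quotients\<close>
  define t where "t = (\<lambda>n. 1 / real (Suc n))"
  have t: "0 < t n" "t n \<le> 1" for n by (simp_all add: t_def)
  have t0: "t \<longlonglongrightarrow> 0" unfolding t_def by (rule LIMSEQ_inverse_real_of_nat[unfolded inverse_eq_divide])
  define q where "q = (\<lambda>n z. (1 / t n) *\<^sub>R (h (z + t n *\<^sub>R e) - h z))"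
  have hcont: "continuous_on UNIV h" using D by (intro continuous_at_imp_continuous_on ballI has_derivative_continuous)
  have hm [measurable]: "h \<in> borel_measurable borel" using hcont by (rule borel_measurable_continuous_onI)
  have qm [measurable]: "q n \<in> borel_measurable borel" for n unfolding q_def by measurable
  have Hlin: "H z (s *\<^sub>R e) = s *\<^sub>R h' z" for z s
    using D[of z] h'[of z] by (simp add: has_derivative_linear linear_cmul)
  have line: "((\<lambda>s. h (z + s *\<^sub>R e)) has_derivative (\<lambda>u. u *\<^sub>R h' (z + s *\<^sub>R e))) (at s within S)" for z s S
  proof -
    have "((\<lambda>s. h (z + s *\<^sub>R e)) has_derivative (\<lambda>u. H (z + s *\<^sub>R e) (u *\<^sub>R e))) (at s within S)"
      by (rule has_derivative_compose[of "\<lambda>s. z + s *\<^sub>R e" "\<lambda>u. u *\<^sub>R e", where g = h])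
         (auto intro!: derivative_eq_intros D)
    then show ?thesis by (simp add: Hlin)
  qed
  have lim: "(\<lambda>n. q n z) \<longlonglongrightarrow> h' z" for z
  proof -
    from line[of z 0 UNIV]
    have N: "(\<lambda>s. norm (h (z + s *\<^sub>R e) - h z - s *\<^sub>R h' z) / norm s) \<midarrow>0\<rightarrow> 0"
      by (simp add: has_derivative_at)
    have "((\<lambda>s. norm ((1 / s) *\<^sub>R (h (z + s *\<^sub>R e) - h z) - h' z)) \<longlongrightarrow> 0) (at 0)"
    proof (rule Lim_transform_eventually[OF N])
      have "\<forall>\<^sub>F s in at (0::real). s \<noteq> 0" by (simp add: eventually_at_filter)
      then show "\<forall>\<^sub>F s in at 0. norm (h (z + s *\<^sub>R e) - h z - s *\<^sub>R h' z) / norm s = norm ((1 / s) *\<^sub>R (h (z + s *\<^sub>R e) - h z) - h' z)"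
      proof eventually_elim
        case (elim s)
        then have "(1 / s) *\<^sub>R (h (z + s *\<^sub>R e) - h z) - h' z = (1 / s) *\<^sub>R (h (z + s *\<^sub>R e) - h z - s *\<^sub>R h' z)"
          by (simp add: scaleR_diff_right)
        then show ?case by simp
      qed
    qed
    then have L: "((\<lambda>s. (1 / s) *\<^sub>R (h (z + s *\<^sub>R e) - h z)) \<longlongrightarrow> h' z) (at 0)"
      by (rule LIM_zero_cancel[OF tendsto_norm_zero_cancel])
    have "filterlim t (at 0) sequentially"
      using t0 t(1) by (intro filterlim_atI always_eventually allI) (auto dest: less_imp_neq[THEN not_sym])
    from filterlim_compose[OF L this] show ?thesis unfolding q_def .
  qed
  have B: "0 \<le> B"
  proof -
    have "0 \<le> B * decay6 0" using bd[of 0] norm_ge_zero order_trans by blast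
    then show ?thesis using decay6_pos[of 0] by (simp add: zero_le_mult_iff)
  qed
  have decay6_shift: "decay6 (z + s *\<^sub>R e) \<le> 64 * decay6 z" if "\<bar>s\<bar> \<le> 1" for z s
  proof -
    have "norm z \<le> norm (z + s *\<^sub>R e) + norm (s *\<^sub>R e)" using norm_triangle_ineq4[of "z + s *\<^sub>R e" "s *\<^sub>R e"] by simp
    then have "1 + norm z \<le> 2 * (1 + norm (z + s *\<^sub>R e))"
    proof -
      have "norm (s *\<^sub>R e) \<le> 1" using that e by simp
      moreover have "1 + a \<le> 2 * (1 + b)" if "a \<le> b + c" "c \<le> 1" "0 \<le> b" for a b c :: real
        using that by simp
      ultimately show ?thesis using \<open>norm z \<le> norm (z + s *\<^sub>R e) + norm (s *\<^sub>R e)\<close> norm_ge_zero by blast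
    qed
    then have "(1 + norm z) ^ 6 \<le> (2 * (1 + norm (z + s *\<^sub>R e))) ^ 6" by (intro power_mono) auto
    then have "(1 + norm z) ^ 6 \<le> 64 * (1 + norm (z + s *\<^sub>R e)) ^ 6" unfolding power_mult_distrib by simp
    moreover have "0 < (1 + norm z) ^ 6" "0 < (1 + norm (z + s *\<^sub>R e)) ^ 6" by (intro zero_less_power add_pos_nonneg; simp)+
    ultimately show ?thesis by (simp add: decay6_def field_simps)
  qed
  have qbd: "cmod (q n z) \<le> (64 * B) * decay6 z" for n z
  proof -
    have "norm (h (z + t n *\<^sub>R e) - h (z + 0 *\<^sub>R e)) \<le> ((64 * B) * decay6 z) * norm (t n - 0)"
    proof (rule differentiable_bound[where S = "{0..t n}" and f' = "\<lambda>s u. u *\<^sub>R h' (z + s *\<^sub>R e)"])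
      fix s assume s: "s \<in> {0..t n}"
      show "((\<lambda>s. h (z + s *\<^sub>R e)) has_derivative (\<lambda>u. u *\<^sub>R h' (z + s *\<^sub>R e))) (at s within {0..t n})" by (rule line)
      have "cmod (h' (z + s *\<^sub>R e)) \<le> B * decay6 (z + s *\<^sub>R e)" by (rule bd)
      also have "\<dots> \<le> B * (64 * decay6 z)" using s t(2)[of n] by (intro mult_left_mono decay6_shift B) auto
      finally have v: "cmod (h' (z + s *\<^sub>R e)) \<le> (64 * B) * decay6 z" by simp
      show "onorm (\<lambda>u. u *\<^sub>R h' (z + s *\<^sub>R e)) \<le> (64 * B) * decay6 z"
        using v by (intro onorm_le) (auto simp: mult.commute[of _ "\<bar>_\<bar>"] intro!: mult_left_mono)
    qed (use t(1)[of n] in auto)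
    then have "norm (h (z + t n *\<^sub>R e) - h z) \<le> ((64 * B) * decay6 z) * t n" using t(1)[of n] by simp
    then show ?thesis unfolding q_def using t(1)[of n] by (simp add: divide_le_eq)
  qed
  have qint: "integrable lborel (q n)" for n by (rule integrable_le_decay6[OF qm qbd])
  have "(LINT z|lborel. q n z) = 0" for n
  proof -
    have sh: "integrable lborel (\<lambda>z. h (z + t n *\<^sub>R e))"
    proof -
      have tn: "t n \<noteq> 0" using t(1)[of n] by linarith
      have "h z + t n *\<^sub>R q n z = h (z + t n *\<^sub>R e)" for z
        unfolding q_def scaleR_scaleR using tn by simp
      moreover have "integrable lborel (\<lambda>z. h z + t n *\<^sub>R q n z)"
        by (intro Bochner_Integration.integrable_add hint integrable_scaleR_right qint)
      ultimately show ?thesis by (simp only:)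
    qed
    have "(LINT z|lborel. q n z) = (1 / t n) *\<^sub>R ((LINT z|lborel. h (z + t n *\<^sub>R e)) - (LINT z|lborel. h z))"
      unfolding q_def using sh hint by simp
    then show ?thesis by (simp add: lborel_integral_translate)
  qed
  moreover have "(\<lambda>n. LINT z|lborel. q n z) \<longlonglongrightarrow> (LINT z|lborel. h' z)"
  proof (rule integral_dominated_convergence[where w = "\<lambda>z. (64 * B) * decay6 z"])
    show "h' \<in> borel_measurable lborel"
      by (rule borel_measurable_LIMSEQ_metric[where f = q]) (use lim in auto)
    show "integrable lborel (\<lambda>z. (64 * B) * decay6 z)" by (intro integrable_mult_right integrable_decay6)
  qed (use lim qbd in \<open>auto simp del: split_paired_All\<close>)
  ultimately show ?thesis by (simp add: LIMSEQ_const_iff)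
qed

text \<open>Integration by parts: the function \<open>h'\<close> is the derivative of \<open>cis (- (z \<bullet> \<zeta>)) * f z\<close> in the direction \<open>e\<close>, and
its integral vanishes.\<close>

lemma fourier_partial_deriv:
  assumes f: "f \<in> schwartz" and e: "e \<in> Basis"
  shows "fourier (partial_deriv e f) \<zeta> = \<i> * complex_of_real (\<zeta> \<bullet> e) * fourier f \<zeta>"
proof -
  define h where "h = (\<lambda>z. cis (- (z \<bullet> \<zeta>)) * f z)"
  define H where "H = (\<lambda>z d. cis (- (z \<bullet> \<zeta>)) * partial_deriv d f z + (- (d \<bullet> \<zeta>)) *\<^sub>R (\<i> * cis (- (z \<bullet> \<zeta>))) * f z)"
  define h' where "h' = (\<lambda>z. cis (- (z \<bullet> \<zeta>)) * partial_deriv e f z + - \<i> * complex_of_real (\<zeta> \<bullet> e) * (cis (- (z \<bullet> \<zeta>)) * f z))"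
  have fe: "partial_deriv e f \<in> schwartz" by (rule schwartz_partial_deriv[OF f e])
  obtain B1 where B1: "\<And>z. (1 + norm z) ^ 6 * cmod (f z) \<le> B1" using rapidD[OF schwartz_rapid[OF f], of 6] by blast
  obtain B2 where B2: "\<And>z. (1 + norm z) ^ 6 * cmod (partial_deriv e f z) \<le> B2" using rapidD[OF schwartz_rapid[OF fe], of 6] by blast
  have i1: "integrable lborel (\<lambda>z. cis (- (z \<bullet> \<zeta>)) * partial_deriv e f z)" by (intro integrable_cis_mult schwartz_integrable fe) measurable
  have i2: "integrable lborel (\<lambda>z. cis (- (z \<bullet> \<zeta>)) * f z)" by (intro integrable_cis_mult schwartz_integrable f) measurable
  have "(LINT z|lborel. h' z) = 0"
  proof (rule integral_directional_derivative_zero[where h = h and H = H and e = e])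
    show "norm e = 1" using e by simp
    show "(h has_derivative H z) (at z)" for z
    proof -
      have "((\<lambda>z. cis (- (z \<bullet> \<zeta>))) has_derivative (\<lambda>d. (- (d \<bullet> \<zeta>)) *\<^sub>R (\<i> * cis (- (z \<bullet> \<zeta>))))) (at z)"
        by (auto intro!: derivative_eq_intros)
      from has_derivative_mult[OF this schwartz_has_derivative[OF f]] show ?thesis
        unfolding h_def H_def by simp
    qed
    show "H z e = h' z" for z by (simp add: H_def h'_def scaleR_conv_of_real inner_commute mult_ac)
    show "integrable lborel h" unfolding h_def by (rule i2)
    fix z
    have "cmod (h' z) \<le> cmod (partial_deriv e f z) + \<bar>\<zeta> \<bullet> e\<bar> * cmod (f z)"
      unfolding h'_def by (rule order_trans[OF norm_triangle_ineq]) (simp add: norm_mult)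
    also have "\<dots> \<le> B2 * decay6 z + \<bar>\<zeta> \<bullet> e\<bar> * (B1 * decay6 z)"
      using B1[of z] B2[of z] le_decay6_iff by (intro add_mono mult_left_mono) auto
    finally show "cmod (h' z) \<le> (B2 + \<bar>\<zeta> \<bullet> e\<bar> * B1) * decay6 z" by (simp add: algebra_simps)
  qed
  then show ?thesis unfolding h'_def fourier_def using i1 i2
    by (simp add: Bochner_Integration.integral_add)
qed

lemma schwartz_norm_ge:
  assumes f: "f \<in> schwartz" and es: "set es \<subseteq> Basis" "length es \<le> N"
  shows "(1 + norm z) ^ N * cmod (iter_deriv es f z) \<le> schwartz_norm N f"
proof -
  let ?s = "\<lambda>es. SUP z. (1 + norm z) ^ N * cmod (iter_deriv es f z)"
  have bdd: "bdd_above (range (\<lambda>z. (1 + norm z) ^ N * cmod (iter_deriv es f z)))" if es: "set es \<subseteq> Basis" for es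
  proof -
    obtain B where "\<And>z. (1 + norm z) ^ N * cmod (iter_deriv es f z) \<le> B"
      using rapidD[OF schwartzD(2)[OF f es], of N] by blast
    then show ?thesis by (intro bdd_aboveI2)
  qed
  have up: "(1 + norm z) ^ N * cmod (iter_deriv es f z) \<le> ?s es" if "set es \<subseteq> Basis" for es z
    by (rule cSUP_upper[OF UNIV_I bdd[OF that]])
  have nn: "0 \<le> ?s es" if "set es \<subseteq> Basis" for es
    using up[OF that, of 0] by (rule order_trans[rotated]) simp
  have fin: "finite {es :: r3 list. set es \<subseteq> Basis \<and> length es \<le> N}"
    by (rule finite_lists_length_le) simp
  have "?s es \<le> (\<Sum>es | set es \<subseteq> Basis \<and> length es \<le> N. ?s es)"
    by (rule member_le_sum[where f = ?s]) (use es fin nn in auto)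
  with up[OF es(1), of z] show ?thesis unfolding schwartz_norm_def by linarith
qed

text \<open>Each power of \<open>1 + norm \<zeta>\<close> is at most \<open>1\<close> plus the three coordinates, which turn into derivatives of \<open>f\<close>; so each
power multiplies the bound by \<open>4\<close>.\<close>

lemma fourier_decay:
  assumes "f \<in> schwartz" and "\<And>es z. set es \<subseteq> Basis \<Longrightarrow> length es \<le> k \<Longrightarrow> (1 + norm z) ^ 6 * cmod (iter_deriv es f z) \<le> B"
  shows "(1 + norm \<zeta>) ^ k * cmod (fourier f \<zeta>) \<le> 4 ^ k * (B * (LINT z|lborel. decay6 z))"
  using assms
proof (induction k arbitrary: f)
  case 0
  have "cmod (fourier f \<zeta>) \<le> B * (LINT z|lborel. decay6 z)"
    by (rule fourier_norm_le[OF schwartz_measurable[OF 0(1)]]) (use 0(2)[of "[]"] in simp)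
  then show ?case by simp
next
  case (Suc k)
  let ?J = "LINT z|lborel. decay6 z"
  have IHf: "(1 + norm \<zeta>) ^ k * cmod (fourier f \<zeta>) \<le> 4 ^ k * (B * ?J)"
    by (rule Suc.IH[OF Suc.prems(1)]) (use Suc.prems(2) in auto)
  have IHe: "(1 + norm \<zeta>) ^ k * (\<bar>\<zeta> \<bullet> e\<bar> * cmod (fourier f \<zeta>)) \<le> 4 ^ k * (B * ?J)" if e: "e \<in> Basis" for e
  proof -
    have "(1 + norm \<zeta>) ^ k * cmod (fourier (partial_deriv e f) \<zeta>) \<le> 4 ^ k * (B * ?J)"
    proof (rule Suc.IH[OF schwartz_partial_deriv[OF Suc.prems(1) e]])
      fix es :: "r3 list" and z assume "set es \<subseteq> Basis" "length es \<le> k"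
      then show "(1 + norm z) ^ 6 * cmod (iter_deriv es (partial_deriv e f) z) \<le> B"
        unfolding iter_deriv_snoc using e by (intro Suc.prems(2)) auto
    qed
    then show ?thesis unfolding fourier_partial_deriv[OF Suc.prems(1) e] by (simp add: norm_mult)
  qed
  have "1 + norm \<zeta> \<le> 1 + (\<Sum>e\<in>Basis. \<bar>\<zeta> \<bullet> e\<bar>)" using norm_le_l1[of \<zeta>] by simp
  then have "(1 + norm \<zeta>) ^ Suc k * cmod (fourier f \<zeta>) \<le> (1 + norm \<zeta>) ^ k * ((1 + (\<Sum>e\<in>Basis. \<bar>\<zeta> \<bullet> e\<bar>)) * cmod (fourier f \<zeta>))"
    unfolding power_Suc2 mult.assoc by (intro mult_left_mono mult_right_mono) auto
  also have "\<dots> = (1 + norm \<zeta>) ^ k * cmod (fourier f \<zeta>) + (\<Sum>e\<in>Basis. (1 + norm \<zeta>) ^ k * (\<bar>\<zeta> \<bullet> e\<bar> * cmod (fourier f \<zeta>)))"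
    by (simp add: distrib_left distrib_right sum_distrib_left sum_distrib_right)
  also have "\<dots> \<le> 4 ^ k * (B * ?J) + (\<Sum>e\<in>(Basis :: r3 set). 4 ^ k * (B * ?J))"
    by (intro add_mono IHf sum_mono IHe)
  also have "\<dots> = 4 ^ Suc k * (B * ?J)" by simp
  finally show ?case .
qed

text \<open>Only seminorms of \<open>f\<close> itself occur, which is what continuity of a tempered distribution asks for.\<close>

lemma fourier_decay_schwartz_norm:
  assumes f: "f \<in> schwartz"
  shows "(1 + norm \<zeta>) ^ k * cmod (fourier f \<zeta>) \<le> 4 ^ k * (schwartz_norm (max 6 k) f * (LINT z|lborel. decay6 z))"
proof (rule fourier_decay[OF f])
  fix es :: "r3 list" and z :: r3 assume es: "set es \<subseteq> Basis" "length es \<le> k"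
  have "(1 + norm z) ^ 6 * cmod (iter_deriv es f z) \<le> (1 + norm z) ^ max 6 k * cmod (iter_deriv es f z)"
    by (intro mult_right_mono power_increasing) auto
  also have "\<dots> \<le> schwartz_norm (max 6 k) f" using es by (intro schwartz_norm_ge f) auto
  finally show "(1 + norm z) ^ 6 * cmod (iter_deriv es f z) \<le> schwartz_norm (max 6 k) f" .
qed

lemma schwartz_fourier:
  assumes "f \<in> schwartz" shows "fourier f \<in> schwartz"
proof (rule schwartz_coinduct[where S = "fourier ` schwartz"])
  fix h assume "h \<in> fourier ` schwartz"
  then obtain f where h: "h = fourier f" and f: "f \<in> schwartz" by blast
  note D = fourier_has_derivative[OF f]
  show "h differentiable (at z)" for z unfolding h differentiable_def using D by blast
  show "rapid h" unfolding rapid_iff h using fourier_decay_schwartz_norm[OF f] by blast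
  fix e :: r3 assume "e \<in> Basis"
  have "partial_deriv e h = fourier (\<lambda>z. - \<i> * (complex_of_real (z \<bullet> e) * f z))"
    unfolding h by (rule ext) (rule partial_deriv_eq[OF D])
  moreover have "(\<lambda>z. - \<i> * (complex_of_real (z \<bullet> e) * f z)) \<in> schwartz"
    by (intro schwartz_cmult schwartz_coord_mult f)
  ultimately show "partial_deriv e h \<in> fourier ` schwartz" by blast
qed (use assms in blast)

section \<open>Polynomials times exponentials of polynomials\<close>

text \<open>Functions \<open>p * exp (- Q)\<close> with a coercive polynomial \<open>Q\<close> provide all explicit Schwartz functions that are needed:
the class is closed under differentiation, it contains Gaussians, and by choosing \<open>Q\<close> as a high even power it
contains good approximations of indicator functions of intervals.\<close>

definition coercive :: "real poly \<Rightarrow> bool" where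
  "coercive Q \<longleftrightarrow> (\<exists>a b. 0 < a \<and> (\<forall>x. a * \<bar>x\<bar> - b \<le> poly Q x))"

definition expoly :: "real poly \<Rightarrow> real poly \<Rightarrow> real \<Rightarrow> real" where
  "expoly Q p x = poly p x * exp (- poly Q x)"

lemma poly_growth: "\<exists>C m. 0 \<le> C \<and> (\<forall>x::real. \<bar>poly p x\<bar> \<le> C * (1 + \<bar>x\<bar>) ^ m)"
proof (induction p)
  case 0
  show ?case by (intro exI[of _ 0]) simp
next
  case (pCons a p)
  then obtain C m where C: "0 \<le> C" "\<And>x. \<bar>poly p x\<bar> \<le> C * (1 + \<bar>x\<bar>) ^ m" by blast
  have "\<bar>poly (pCons a p) x\<bar> \<le> (\<bar>a\<bar> + C) * (1 + \<bar>x\<bar>) ^ Suc m" for x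
  proof -
    have 1: "1 \<le> (1 + \<bar>x\<bar>) ^ Suc m" by (rule one_le_power) simp
    have "\<bar>poly (pCons a p) x\<bar> \<le> \<bar>a\<bar> + \<bar>x\<bar> * \<bar>poly p x\<bar>"
      using abs_triangle_ineq[of a "x * poly p x"] by (simp add: abs_mult)
    also have "\<dots> \<le> \<bar>a\<bar> * (1 + \<bar>x\<bar>) ^ Suc m + (1 + \<bar>x\<bar>) * (C * (1 + \<bar>x\<bar>) ^ m)"
      using C(2)[of x] mult_left_mono[OF 1, of "\<bar>a\<bar>"] by (intro add_mono mult_mono) auto
    also have "\<dots> = (\<bar>a\<bar> + C) * (1 + \<bar>x\<bar>) ^ Suc m" by (simp add: algebra_simps)
    finally show ?thesis .
  qed
  then show ?case using C(1) by (intro exI[of _ "\<bar>a\<bar> + C"] exI[of _ "Suc m"]) auto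
qed

lemma power_le_exp:
  assumes "0 < a"
  shows "\<exists>C. 0 \<le> C \<and> (\<forall>x::real. (1 + \<bar>x\<bar>) ^ n \<le> C * exp (a * \<bar>x\<bar>))"
proof (cases "n = 0")
  case True
  then show ?thesis using assms by (intro exI[of _ 1]) auto
next
  case False
  let ?C = "(real n / a) ^ n * exp a"
  have "(1 + \<bar>x\<bar>) ^ n \<le> ?C * exp (a * \<bar>x\<bar>)" for x :: real
  proof -
    let ?y = "a * (1 + \<bar>x\<bar>)"
    have "(?y / real n) ^ n \<le> (1 + ?y / real n) ^ n" using assms by (intro power_mono) auto
    also have "\<dots> \<le> exp ?y" using assms False by (intro exp_ge_one_plus_x_over_n_power_n) (auto intro: order_trans[of _ 0])
    finally have *: "(?y / real n) ^ n \<le> exp ?y" .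
    have "(1 + \<bar>x\<bar>) ^ n = (real n / a) ^ n * (?y / real n) ^ n"
      using assms False by (simp flip: power_mult_distrib)
    also have "\<dots> \<le> (real n / a) ^ n * exp ?y" using * assms by (intro mult_left_mono) auto
    also have "exp ?y = exp a * exp (a * \<bar>x\<bar>)" by (simp add: distrib_left exp_add)
    finally show ?thesis by (simp add: mult.assoc)
  qed
  then show ?thesis using assms by (intro exI[of _ ?C]) auto
qed

lemma expoly_decay:
  assumes "coercive Q"
  shows "\<exists>B. 0 \<le> B \<and> (\<forall>x. (1 + \<bar>x\<bar>) ^ k * \<bar>expoly Q p x\<bar> \<le> B)"
proof -
  obtain a b where a: "0 < a" and ab: "\<And>x. a * \<bar>x\<bar> - b \<le> poly Q x" using assms unfolding coercive_def by blast
  obtain C m where C: "0 \<le> C" "\<And>x. \<bar>poly p x\<bar> \<le> C * (1 + \<bar>x\<bar>) ^ m" using poly_growth by blast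
  obtain D where D: "0 \<le> D" "\<And>x::real. (1 + \<bar>x\<bar>) ^ (k + m) \<le> D * exp (a * \<bar>x\<bar>)" using power_le_exp[OF a] by blast
  have "(1 + \<bar>x\<bar>) ^ k * \<bar>expoly Q p x\<bar> \<le> C * D * exp b" for x
  proof -
    have "(1 + \<bar>x\<bar>) ^ k * \<bar>expoly Q p x\<bar> = (1 + \<bar>x\<bar>) ^ k * (\<bar>poly p x\<bar> * exp (- poly Q x))"
      by (simp add: expoly_def abs_mult)
    also have "\<dots> \<le> (1 + \<bar>x\<bar>) ^ k * ((C * (1 + \<bar>x\<bar>) ^ m) * exp (b - a * \<bar>x\<bar>))"
      using C(2)[of x] ab[of x] C(1) by (intro mult_left_mono mult_mono) auto
    also have "\<dots> = C * ((1 + \<bar>x\<bar>) ^ (k + m) * exp (b - a * \<bar>x\<bar>))" by (simp add: power_add mult_ac)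
    also have "\<dots> \<le> C * ((D * exp (a * \<bar>x\<bar>)) * exp (b - a * \<bar>x\<bar>))"
      using C(1) D(2)[of x] by (intro mult_left_mono mult_right_mono) auto
    also have "\<dots> = C * D * exp b" by (simp add: mult.assoc flip: exp_add)
    finally show ?thesis .
  qed
  then show ?thesis using C(1) D(1) by (intro exI[of _ "C * D * exp b"]) auto
qed

lemma DERIV_expoly: "(expoly Q p has_real_derivative expoly Q (pderiv p - p * pderiv Q) x) (at x)"
  unfolding expoly_def[abs_def]
  by (auto intro!: derivative_eq_intros simp: algebra_simps)

definition tensor :: "(real \<Rightarrow> real) \<Rightarrow> (real \<Rightarrow> real) \<Rightarrow> (real \<Rightarrow> real) \<Rightarrow> r3 \<Rightarrow> complex" where
  "tensor f g h z = complex_of_real (f (fst z) * (g (fst (snd z)) * h (snd (snd z))))"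

lemma tensor_has_derivative:
  assumes "\<And>x. (f has_real_derivative f' x) (at x)" "\<And>x. (g has_real_derivative g' x) (at x)" "\<And>x. (h has_real_derivative h' x) (at x)"
  shows "(tensor f g h has_derivative (\<lambda>d. tensor f' g h z * complex_of_real (fst d) + (tensor f g' h z * complex_of_real (fst (snd d)) + tensor f g h' z * complex_of_real (snd (snd d))))) (at z)"
proof -
  have 1: "((\<lambda>z. f (fst z)) has_derivative (\<lambda>d. fst d * f' (fst z))) (at z)"
    by (rule DERIV_compose_FDERIV[OF assms(1)]) (auto intro!: derivative_eq_intros)
  have 2: "((\<lambda>z. g (fst (snd z))) has_derivative (\<lambda>d. fst (snd d) * g' (fst (snd z)))) (at z)"
    by (rule DERIV_compose_FDERIV[OF assms(2)]) (auto intro!: derivative_eq_intros)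
  have 3: "((\<lambda>z. h (snd (snd z))) has_derivative (\<lambda>d. snd (snd d) * h' (snd (snd z)))) (at z)"
    by (rule DERIV_compose_FDERIV[OF assms(3)]) (auto intro!: derivative_eq_intros)
  have "((\<lambda>z. complex_of_real (f (fst z) * (g (fst (snd z)) * h (snd (snd z))))) has_derivative
     (\<lambda>d. complex_of_real (f (fst z) * (g (fst (snd z)) * (snd (snd d) * h' (snd (snd z))) + fst (snd d) * g' (fst (snd z)) * h (snd (snd z))) + fst d * f' (fst z) * (g (fst (snd z)) * h (snd (snd z)))))) (at z)"
    by (intro bounded_linear.has_derivative[OF bounded_linear_of_real] has_derivative_mult 1 2 3)
  then show ?thesis unfolding tensor_def[abs_def]
    by (rule has_derivative_eq_rhs) (simp add: fun_eq_iff algebra_simps)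
qed

text \<open>For fixed exponents the products \<open>p * exp (- Q)\<close> are closed under derivatives because only the polynomial
factors change, so that \<open>schwartz_coinduct\<close> applies.\<close>

lemma tensor_expoly_schwartz:
  assumes Q: "coercive Q1" "coercive Q2" "coercive Q3"
  shows "tensor (expoly Q1 p1) (expoly Q2 p2) (expoly Q3 p3) \<in> schwartz"
proof (rule schwartz_coinduct[where S = "{tensor (expoly Q1 p1) (expoly Q2 p2) (expoly Q3 p3) | p1 p2 p3. True}"])
  fix F assume "F \<in> {tensor (expoly Q1 p1) (expoly Q2 p2) (expoly Q3 p3) | p1 p2 p3. True}"
  then obtain p1 p2 p3 where F: "F = tensor (expoly Q1 p1) (expoly Q2 p2) (expoly Q3 p3)" by blast
  note D = tensor_has_derivative[OF DERIV_expoly DERIV_expoly DERIV_expoly, of Q1 p1 Q2 p2 Q3 p3]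
  show "F differentiable (at z)" for z unfolding F differentiable_def using D by blast
  show "rapid F" unfolding rapid_iff
  proof
    fix k
    obtain B1 where B1: "0 \<le> B1" "\<And>x. (1 + \<bar>x\<bar>) ^ k * \<bar>expoly Q1 p1 x\<bar> \<le> B1" using expoly_decay[OF Q(1)] by blast
    obtain B2 where B2: "0 \<le> B2" "\<And>x. (1 + \<bar>x\<bar>) ^ k * \<bar>expoly Q2 p2 x\<bar> \<le> B2" using expoly_decay[OF Q(2)] by blast
    obtain B3 where B3: "0 \<le> B3" "\<And>x. (1 + \<bar>x\<bar>) ^ k * \<bar>expoly Q3 p3 x\<bar> \<le> B3" using expoly_decay[OF Q(3)] by blast
    have "(1 + norm z) ^ k * cmod (F z) \<le> B1 * (B2 * B3)" for z
    proof -
      obtain x y t where z: "z = (x, y, t)" by (cases z) auto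
      have "norm z \<le> \<bar>x\<bar> + norm (y, t)" using norm_triangle_ineq[of "(x, 0::real \<times> real)" "(0, (y, t))"] by (simp add: z)
      also have "norm (y, t) \<le> \<bar>y\<bar> + \<bar>t\<bar>" using norm_triangle_ineq[of "(y, 0::real)" "(0, t)"] by simp
      finally have n: "norm z \<le> \<bar>x\<bar> + (\<bar>y\<bar> + \<bar>t\<bar>)" by simp
      have "0 \<le> \<bar>x\<bar> * \<bar>y\<bar> + \<bar>x\<bar> * \<bar>t\<bar> + \<bar>y\<bar> * \<bar>t\<bar> + \<bar>x\<bar> * \<bar>y\<bar> * \<bar>t\<bar>" by simp
      then have "1 + (\<bar>x\<bar> + (\<bar>y\<bar> + \<bar>t\<bar>)) \<le> (1 + \<bar>x\<bar>) * ((1 + \<bar>y\<bar>) * (1 + \<bar>t\<bar>))" by (simp only: algebra_simps mult_1 mult_1_right)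
      with n have "1 + norm z \<le> (1 + \<bar>x\<bar>) * ((1 + \<bar>y\<bar>) * (1 + \<bar>t\<bar>))" by linarith
      then have "(1 + norm z) ^ k \<le> ((1 + \<bar>x\<bar>) * ((1 + \<bar>y\<bar>) * (1 + \<bar>t\<bar>))) ^ k" by (intro power_mono) auto
      then have "(1 + norm z) ^ k * cmod (F z) \<le> ((1 + \<bar>x\<bar>) * ((1 + \<bar>y\<bar>) * (1 + \<bar>t\<bar>))) ^ k * cmod (F z)" by (intro mult_right_mono) auto
      also have "\<dots> = ((1 + \<bar>x\<bar>) ^ k * \<bar>expoly Q1 p1 x\<bar>) * (((1 + \<bar>y\<bar>) ^ k * \<bar>expoly Q2 p2 y\<bar>) * ((1 + \<bar>t\<bar>) ^ k * \<bar>expoly Q3 p3 t\<bar>))"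
      proof -
        have "cmod (F z) = \<bar>expoly Q1 p1 x\<bar> * (\<bar>expoly Q2 p2 y\<bar> * \<bar>expoly Q3 p3 t\<bar>)"
          unfolding F tensor_def z by (simp only: fst_conv snd_conv norm_of_real abs_mult)
        then show ?thesis by (simp only: power_mult_distrib mult_ac)
      qed
      also have "\<dots> \<le> B1 * (B2 * B3)"
        using B1 B2 B3 by (intro mult_mono) auto
      finally show ?thesis .
    qed
    then show "\<exists>B. \<forall>z. (1 + norm z) ^ k * cmod (F z) \<le> B" by blast
  qed
  fix e :: r3 assume "e \<in> Basis"
  then consider "e = (1, 0, 0)" | "e = (0, 1, 0)" | "e = (0, 0, 1)" by (auto simp: Basis_prod_def zero_prod_def)
  then have "partial_deriv e F = tensor (expoly Q1 (pderiv p1 - p1 * pderiv Q1)) (expoly Q2 p2) (expoly Q3 p3)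
    \<or> partial_deriv e F = tensor (expoly Q1 p1) (expoly Q2 (pderiv p2 - p2 * pderiv Q2)) (expoly Q3 p3)
    \<or> partial_deriv e F = tensor (expoly Q1 p1) (expoly Q2 p2) (expoly Q3 (pderiv p3 - p3 * pderiv Q3))"
    by cases (simp_all only: F fun_eq_iff partial_deriv_eq[OF D] fst_conv snd_conv of_real_0 of_real_1 mult_zero_right mult_1_right add_0 add_0_right simp_thms)
  then show "partial_deriv e F \<in> {tensor (expoly Q1 p1) (expoly Q2 p2) (expoly Q3 p3) | p1 p2 p3. True}" by blast
qed blast

section \<open>Gaussians\<close>

definition gauss :: "r3 \<Rightarrow> real" where "gauss z = exp (- (norm z)\<^sup>2 / 2)"

lemma gauss_prod: "gauss (x, y, t) = exp (- x\<^sup>2 / 2) * (exp (- y\<^sup>2 / 2) * exp (- t\<^sup>2 / 2))"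
  by (simp add: gauss_def norm_Pair real_sqrt_pow2 flip: exp_add)

lemma gauss_measurable [measurable]: "gauss \<in> borel_measurable borel"
  unfolding gauss_def[abs_def] by measurable

lemma gauss_bounds: "0 < gauss z" "gauss z \<le> 1" by (simp_all add: gauss_def)

lemma gauss_schwartz: "(\<lambda>z. complex_of_real (gauss z)) \<in> schwartz"
proof -
  have c: "coercive [:0, 0, 1 / 2:]"
  proof -
    have "1 * \<bar>x\<bar> - 1 / 2 \<le> poly [:0, 0, 1 / 2:] x" for x :: real
    proof -
      have "0 \<le> (\<bar>x\<bar> - 1)\<^sup>2" by simp
      also have "(\<bar>x\<bar> - 1)\<^sup>2 = x\<^sup>2 + 1 - 2 * \<bar>x\<bar>" by (simp add: power2_diff)
      finally show ?thesis by (simp add: power2_eq_square)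
    qed
    then show ?thesis unfolding coercive_def by (metis zero_less_one)
  qed
  have "(\<lambda>z. complex_of_real (gauss z)) = tensor (expoly [:0, 0, 1 / 2:] 1) (expoly [:0, 0, 1 / 2:] 1) (expoly [:0, 0, 1 / 2:] 1)"
    by (rule ext) (auto simp: tensor_def expoly_def gauss_prod power2_eq_square simp del: of_real_mult split: prod.splits)
  then show ?thesis using tensor_expoly_schwartz[OF c c c] by simp
qed

text \<open>This is the characteristic function of the normal distribution.\<close>

lemma gauss_integral_line:
  "integrable lborel (\<lambda>x. cis (t * x) * complex_of_real (exp (- x\<^sup>2 / 2)))" (is ?int)
  "(LINT x|lborel. cis (t * x) * complex_of_real (exp (- x\<^sup>2 / 2))) = complex_of_real (sqrt (2 * pi) * exp (- t\<^sup>2 / 2))"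
proof -
  have "integrable std_normal_distribution (\<lambda>x. iexp (t * x))"
  proof -
    interpret prob_space std_normal_distribution by (rule real_distribution.axioms(1)[OF real_dist_normal_dist])
    show ?thesis by (rule integrable_const_bound[of _ 1]) auto
  qed
  then have i: "integrable lborel (\<lambda>x. std_normal_density x *\<^sub>R iexp (t * x))"
    by (subst (asm) integrable_density) (auto simp: normal_density_nonneg)
  have e: "std_normal_density x *\<^sub>R iexp (t * x) = (1 / sqrt (2 * pi)) *\<^sub>R (cis (t * x) * complex_of_real (exp (- x\<^sup>2 / 2)))" for x
    by (simp add: std_normal_density_def scaleR_conv_of_real cis_conv_exp)
  have i': "integrable lborel (\<lambda>x. sqrt (2 * pi) *\<^sub>R (std_normal_density x *\<^sub>R iexp (t * x)))"
    using i by (rule integrable_scaleR_right)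
  have s: "sqrt (2 * pi) *\<^sub>R ((1 / sqrt (2 * pi)) *\<^sub>R w) = w" for w :: complex by simp
  show ?int using i' unfolding e s .
  have "complex_of_real (exp (- t\<^sup>2 / 2)) = (LINT x|std_normal_distribution. iexp (t * x))"
    using char_std_normal_distribution by (simp add: char_def fun_eq_iff)
  also have "\<dots> = (LINT x|lborel. std_normal_density x *\<^sub>R iexp (t * x))"
    by (rule integral_density) (auto simp: normal_density_nonneg)
  also have "\<dots> = (1 / sqrt (2 * pi)) *\<^sub>R (LINT x|lborel. cis (t * x) * complex_of_real (exp (- x\<^sup>2 / 2)))"
    unfolding e by simp
  finally have "sqrt (2 * pi) *\<^sub>R complex_of_real (exp (- t\<^sup>2 / 2)) = (LINT x|lborel. cis (t * x) * complex_of_real (exp (- x\<^sup>2 / 2)))"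
    by (simp only: s)
  then show "(LINT x|lborel. cis (t * x) * complex_of_real (exp (- x\<^sup>2 / 2))) = complex_of_real (sqrt (2 * pi) * exp (- t\<^sup>2 / 2))"
    by (simp add: scaleR_conv_of_real)
qed

lemma gauss_fourier:
  "(LINT \<zeta>|lborel. cis (v \<bullet> \<zeta>) * complex_of_real (gauss \<zeta>)) = complex_of_real (sqrt (2 * pi) ^ 3 * gauss v)"
proof -
  obtain a b c where v: "v = (a, b, c)" by (cases v) auto
  define E where "E = (\<lambda>t x. cis (t * x) * complex_of_real (exp (- x\<^sup>2 / 2)))"
  have split: "cis (v \<bullet> (x, y, t)) * complex_of_real (gauss (x, y, t)) = E a x * (E b y * E c t)" for x y t
    by (simp add: v E_def gauss_prod mult_ac flip: cis_mult)
  have E: "(LINT x|lborel. E t x) = complex_of_real (sqrt (2 * pi) * exp (- t\<^sup>2 / 2))" for t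
    unfolding E_def by (rule gauss_integral_line)
  have "integrable lborel (\<lambda>\<zeta>. cis (v \<bullet> \<zeta>) * complex_of_real (gauss \<zeta>))"
    by (intro integrable_cis_mult schwartz_integrable gauss_schwartz) measurable
  then have i: "integrable (lborel \<Otimes>\<^sub>M lborel) (\<lambda>\<zeta>. cis (v \<bullet> \<zeta>) * complex_of_real (gauss \<zeta>))" unfolding lborel_prod .
  have "(LINT \<zeta>|lborel. cis (v \<bullet> \<zeta>) * complex_of_real (gauss \<zeta>)) = (LINT \<zeta>|(lborel \<Otimes>\<^sub>M lborel). cis (v \<bullet> \<zeta>) * complex_of_real (gauss \<zeta>))"
    unfolding lborel_prod ..
  also have "\<dots> = (LINT x|lborel. LINT w|lborel. cis (v \<bullet> (x, w)) * complex_of_real (gauss (x, w)))"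
    by (rule lborel_pair.integral_fst'[symmetric, OF i])
  also have "\<dots> = (LINT x|lborel. E a x * (LINT w|lborel. E b (fst w) * E c (snd w)))"
  proof (rule Bochner_Integration.integral_cong[OF refl])
    fix x :: real
    have "(LINT w|lborel. cis (v \<bullet> (x, w)) * complex_of_real (gauss (x, w))) = (LINT w|lborel. E a x * (E b (fst w) * E c (snd w)))"
      using split by (intro Bochner_Integration.integral_cong refl) (metis prod.collapse)
    then show "(LINT w|lborel. cis (v \<bullet> (x, w)) * complex_of_real (gauss (x, w))) = E a x * (LINT w|lborel. E b (fst w) * E c (snd w))"
      by simp
  qed
  also have "(LINT w|lborel. E b (fst w) * E c (snd w)) = (LINT y|lborel. E b y) * (LINT t|lborel. E c t)"
  proof -
    have Em: "E t \<in> borel_measurable borel" for t unfolding E_def by measurable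
    note [measurable] = Em
    have "integrable (lborel \<Otimes>\<^sub>M lborel) (\<lambda>w. E b (fst w) * E c (snd w))"
    proof (rule lborel_pair.Fubini_integrable)
      show "(\<lambda>w. E b (fst w) * E c (snd w)) \<in> borel_measurable (lborel \<Otimes>\<^sub>M lborel)" by measurable
      have ni: "integrable lborel (\<lambda>x. cmod (E t x))" for t
        unfolding E_def by (intro integrable_norm gauss_integral_line)
      show "integrable lborel (\<lambda>x. LINT y|lborel. norm (E b (fst (x, y)) * E c (snd (x, y))))"
        using ni[of b] by (simp add: norm_mult)
      show "AE x in lborel. integrable lborel (\<lambda>y. E b (fst (x, y)) * E c (snd (x, y)))"
        using gauss_integral_line(1)[of c] by (auto simp: E_def)
    qed
    from lborel_pair.integral_fst'[OF this]
    have "(LINT w|(lborel \<Otimes>\<^sub>M lborel). E b (fst w) * E c (snd w)) = (LINT y|lborel. LINT t|lborel. E b y * E c t)" by simp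
    then show ?thesis unfolding lborel_prod by simp
  qed
  also have "(LINT x|lborel. E a x * ((LINT y|lborel. E b y) * (LINT t|lborel. E c t))) = (LINT x|lborel. E a x) * ((LINT y|lborel. E b y) * (LINT t|lborel. E c t))"
    by simp
  also have "\<dots> = complex_of_real (sqrt (2 * pi) ^ 3 * gauss v)"
    unfolding E v gauss_prod by (simp only: of_real_mult[symmetric] power3_eq_cube mult_ac)
  finally show ?thesis .
qed

section \<open>Fourier inversion\<close>

lemma lborel_affine_integral:
  fixes f :: "r3 \<Rightarrow> complex"
  assumes c: "c \<noteq> 0" and [measurable]: "f \<in> borel_measurable borel"
  shows "(LINT x|lborel. f x) = \<bar>c\<bar> ^ 3 *\<^sub>R (LINT x|lborel. f (t + c *\<^sub>R x))"
    and "integrable lborel f \<Longrightarrow> integrable lborel (\<lambda>x. f (t + c *\<^sub>R x))"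
proof -
  have D: "lborel = density (distr lborel borel (\<lambda>x. t + c *\<^sub>R x)) (\<lambda>_. ennreal (\<bar>c\<bar> ^ 3))"
  proof -
    have "DIM(r3) = 3" by simp
    then show ?thesis using lborel_affine[OF c, of t] by (simp only:)
  qed
  have "(LINT x|lborel. f x) = (LINT x|density (distr lborel borel (\<lambda>x. t + c *\<^sub>R x)) (\<lambda>_. ennreal (\<bar>c\<bar> ^ 3)). f x)"
    using D by simp
  also have "\<dots> = (LINT x|distr lborel borel (\<lambda>x. t + c *\<^sub>R x). \<bar>c\<bar> ^ 3 *\<^sub>R f x)"
    by (rule integral_density) auto
  also have "\<dots> = (LINT x|lborel. \<bar>c\<bar> ^ 3 *\<^sub>R f (t + c *\<^sub>R x))"
    by (rule integral_distr) auto
  finally show "(LINT x|lborel. f x) = \<bar>c\<bar> ^ 3 *\<^sub>R (LINT x|lborel. f (t + c *\<^sub>R x))" by simp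
  assume "integrable lborel f"
  then have "integrable (density (distr lborel borel (\<lambda>x. t + c *\<^sub>R x)) (\<lambda>_. ennreal (\<bar>c\<bar> ^ 3))) f" using D by simp
  then have "integrable (distr lborel borel (\<lambda>x. t + c *\<^sub>R x)) (\<lambda>x. \<bar>c\<bar> ^ 3 *\<^sub>R f x)"
    by (subst (asm) integrable_density) auto
  then have "integrable lborel (\<lambda>x. \<bar>c\<bar> ^ 3 *\<^sub>R f (t + c *\<^sub>R x))"
    by (rule integrable_distr[rotated]) auto
  then have "integrable lborel (\<lambda>x. (1 / \<bar>c\<bar> ^ 3) *\<^sub>R (\<bar>c\<bar> ^ 3 *\<^sub>R f (t + c *\<^sub>R x)))" by (rule integrable_scaleR_right)
  then show "integrable lborel (\<lambda>x. f (t + c *\<^sub>R x))" using c by simp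
qed

text \<open>The Gaussian factor makes the double integral absolutely convergent; after Fubini the inner integral is the
transform of a Gaussian, and scaling turns the result into an average of \<open>f\<close> near \<open>z\<close>.\<close>

lemma fourier_inversion_gauss:
  assumes f: "f \<in> schwartz" and d: "0 < d"
  shows "(LINT \<zeta>|lborel. cis (z \<bullet> \<zeta>) * complex_of_real (gauss (d *\<^sub>R \<zeta>)) * fourier f \<zeta>)
    = complex_of_real (sqrt (2 * pi) ^ 3) * (LINT v|lborel. f (z - d *\<^sub>R v) * complex_of_real (gauss v))"
proof -
  let ?K = "complex_of_real (sqrt (2 * pi) ^ 3)"
  have fm [measurable]: "f \<in> borel_measurable borel" by (rule schwartz_measurable[OF f])
  have fi: "integrable lborel f" by (rule schwartz_integrable[OF f])
  have gi: "integrable lborel (\<lambda>\<zeta>. complex_of_real (gauss (d *\<^sub>R \<zeta>)))"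
    using lborel_affine_integral(2)[of d "\<lambda>\<zeta>. complex_of_real (gauss \<zeta>)" 0] schwartz_integrable[OF gauss_schwartz] d by simp
  define F where "F = (\<lambda>\<zeta> w. cis (z \<bullet> \<zeta>) * complex_of_real (gauss (d *\<^sub>R \<zeta>)) * (cis (- (w \<bullet> \<zeta>)) * f w))"
  have Fint: "integrable (lborel \<Otimes>\<^sub>M lborel) (\<lambda>(\<zeta>, w). F \<zeta> w)"
  proof (rule lborel_pair.Fubini_integrable)
    have "(\<lambda>x. F (fst x) (snd x)) \<in> borel_measurable borel" unfolding F_def by measurable
    then show "(\<lambda>(\<zeta>, w). F \<zeta> w) \<in> borel_measurable (lborel \<Otimes>\<^sub>M lborel)" unfolding lborel_prod by (simp add: case_prod_beta')
    have "(\<lambda>\<zeta>. LINT w|lborel. norm (case (\<zeta>, w) of (\<zeta>, w) \<Rightarrow> F \<zeta> w)) = (\<lambda>\<zeta>. cmod (complex_of_real (gauss (d *\<^sub>R \<zeta>))) * (LINT w|lborel. cmod (f w)))"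
      by (simp add: F_def norm_mult)
    then show "integrable lborel (\<lambda>\<zeta>. LINT w|lborel. norm (case (\<zeta>, w) of (\<zeta>, w) \<Rightarrow> F \<zeta> w))"
      using integrable_norm[OF gi] by simp
    show "AE \<zeta> in lborel. integrable lborel (\<lambda>w. case (\<zeta>, w) of (\<zeta>, w) \<Rightarrow> F \<zeta> w)"
      unfolding F_def prod.case by (intro AE_I2 integrable_mult_right integrable_cis_mult fi) measurable
  qed
  have scale: "(LINT \<zeta>|lborel. cis (u \<bullet> \<zeta>) * complex_of_real (gauss (d *\<^sub>R \<zeta>))) = (1 / d) ^ 3 *\<^sub>R (?K * complex_of_real (gauss ((1 / d) *\<^sub>R u)))" for u
  proof -
    have "(LINT \<zeta>|lborel. cis (u \<bullet> \<zeta>) * complex_of_real (gauss (d *\<^sub>R \<zeta>))) =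
      \<bar>1 / d\<bar> ^ 3 *\<^sub>R (LINT x|lborel. cis (u \<bullet> (0 + (1 / d) *\<^sub>R x)) * complex_of_real (gauss (d *\<^sub>R (0 + (1 / d) *\<^sub>R x))))"
      by (rule lborel_affine_integral(1)) (use d in auto)
    also have "(LINT x|lborel. cis (u \<bullet> (0 + (1 / d) *\<^sub>R x)) * complex_of_real (gauss (d *\<^sub>R (0 + (1 / d) *\<^sub>R x))))
       = (LINT x|lborel. cis (((1 / d) *\<^sub>R u) \<bullet> x) * complex_of_real (gauss x))"
      using d by simp
    also have "\<dots> = ?K * complex_of_real (gauss ((1 / d) *\<^sub>R u))"
      unfolding gauss_fourier by simp
    finally show ?thesis using d by simp
  qed
  have "(LINT \<zeta>|lborel. cis (z \<bullet> \<zeta>) * complex_of_real (gauss (d *\<^sub>R \<zeta>)) * fourier f \<zeta>) = (LINT \<zeta>|lborel. LINT w|lborel. F \<zeta> w)"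
    unfolding F_def fourier_def by simp
  also have "\<dots> = (LINT w|lborel. LINT \<zeta>|lborel. F \<zeta> w)"
    by (rule lborel_pair.Fubini_integral[symmetric, OF Fint])
  also have "\<dots> = (LINT w|lborel. f w * ((1 / d) ^ 3 *\<^sub>R (?K * complex_of_real (gauss ((1 / d) *\<^sub>R (z - w))))))"
  proof (rule Bochner_Integration.integral_cong[OF refl])
    fix w
    have "F \<zeta> w = f w * (cis ((z - w) \<bullet> \<zeta>) * complex_of_real (gauss (d *\<^sub>R \<zeta>)))" for \<zeta>
    proof -
      have "cis ((z - w) \<bullet> \<zeta>) = cis (z \<bullet> \<zeta>) * cis (- (w \<bullet> \<zeta>))" by (simp add: cis_mult inner_diff_left)
      then show ?thesis by (simp add: F_def)
    qed
    then show "(LINT \<zeta>|lborel. F \<zeta> w) = f w * ((1 / d) ^ 3 *\<^sub>R (?K * complex_of_real (gauss ((1 / d) *\<^sub>R (z - w)))))"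
      by (simp add: scale)
  qed
  also have "\<dots> = \<bar>- d\<bar> ^ 3 *\<^sub>R (LINT v|lborel. f (z + (- d) *\<^sub>R v) * ((1 / d) ^ 3 *\<^sub>R (?K * complex_of_real (gauss ((1 / d) *\<^sub>R (z - (z + (- d) *\<^sub>R v)))))))"
    by (rule lborel_affine_integral(1)) (use d in auto)
  also have "\<dots> = \<bar>- d\<bar> ^ 3 *\<^sub>R (LINT v|lborel. (1 / d) ^ 3 *\<^sub>R (?K * (f (z - d *\<^sub>R v) * complex_of_real (gauss v))))"
    using d by (intro arg_cong[of _ _ "\<lambda>x. _ *\<^sub>R x"] Bochner_Integration.integral_cong refl) (simp add: mult.left_commute)
  also have "\<dots> = ?K * (LINT v|lborel. f (z - d *\<^sub>R v) * complex_of_real (gauss v))"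
    using d by (simp add: power_divide)
  finally show ?thesis .
qed

text \<open>Let the Gaussian in \<open>fourier_inversion_gauss\<close> tend to \<open>1\<close>; the averages of \<open>f\<close> then tend to \<open>f z\<close>.\<close>

theorem fourier_inversion:
  assumes f: "f \<in> schwartz"
  shows "(LINT \<zeta>|lborel. cis (z \<bullet> \<zeta>) * fourier f \<zeta>) = complex_of_real ((2 * pi) ^ 3) * f z"
proof -
  let ?K = "complex_of_real (sqrt (2 * pi) ^ 3)"
  define d where "d = (\<lambda>n. 1 / real (Suc n))"
  have d: "0 < d n" for n by (simp add: d_def)
  have d0: "d \<longlonglongrightarrow> 0" unfolding d_def by (rule LIMSEQ_inverse_real_of_nat[unfolded inverse_eq_divide])
  have fm [measurable]: "f \<in> borel_measurable borel" by (rule schwartz_measurable[OF f])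
  note ff = schwartz_fourier[OF f]
  have ffm [measurable]: "fourier f \<in> borel_measurable borel" by (rule schwartz_measurable[OF ff])
  have gc: "continuous_on UNIV gauss" unfolding gauss_def[abs_def] by (intro continuous_intros) auto
  have A: "(\<lambda>n. LINT \<zeta>|lborel. cis (z \<bullet> \<zeta>) * complex_of_real (gauss (d n *\<^sub>R \<zeta>)) * fourier f \<zeta>) \<longlonglongrightarrow> (LINT \<zeta>|lborel. cis (z \<bullet> \<zeta>) * fourier f \<zeta>)"
  proof (rule integral_dominated_convergence[where w = "\<lambda>\<zeta>. cmod (fourier f \<zeta>)"])
    show "integrable lborel (\<lambda>\<zeta>. cmod (fourier f \<zeta>))" by (intro integrable_norm schwartz_integrable ff)
    show "AE \<zeta> in lborel. (\<lambda>n. cis (z \<bullet> \<zeta>) * complex_of_real (gauss (d n *\<^sub>R \<zeta>)) * fourier f \<zeta>) \<longlonglongrightarrow> cis (z \<bullet> \<zeta>) * fourier f \<zeta>"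
    proof (rule AE_I2)
      fix \<zeta> :: r3
      have "(\<lambda>n. d n *\<^sub>R \<zeta>) \<longlonglongrightarrow> 0 *\<^sub>R \<zeta>" by (intro tendsto_scaleR d0 tendsto_const)
      then have "(\<lambda>n. gauss (d n *\<^sub>R \<zeta>)) \<longlonglongrightarrow> gauss (0 *\<^sub>R \<zeta>)"
        using gc unfolding continuous_on_eq_continuous_at[OF open_UNIV] by (intro isCont_tendsto_compose[of _ gauss]) blast+
      then have "(\<lambda>n. cis (z \<bullet> \<zeta>) * complex_of_real (gauss (d n *\<^sub>R \<zeta>)) * fourier f \<zeta>) \<longlonglongrightarrow> cis (z \<bullet> \<zeta>) * complex_of_real (gauss (0 *\<^sub>R \<zeta>)) * fourier f \<zeta>"
        by (intro tendsto_mult tendsto_of_real tendsto_const)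
      then show "(\<lambda>n. cis (z \<bullet> \<zeta>) * complex_of_real (gauss (d n *\<^sub>R \<zeta>)) * fourier f \<zeta>) \<longlonglongrightarrow> cis (z \<bullet> \<zeta>) * fourier f \<zeta>"
        by (simp add: gauss_def)
    qed
    show "AE \<zeta> in lborel. norm (cis (z \<bullet> \<zeta>) * complex_of_real (gauss (d n *\<^sub>R \<zeta>)) * fourier f \<zeta>) \<le> cmod (fourier f \<zeta>)" for n
    proof (rule AE_I2)
      fix \<zeta>
      have "\<bar>gauss (d n *\<^sub>R \<zeta>)\<bar> * cmod (fourier f \<zeta>) \<le> 1 * cmod (fourier f \<zeta>)"
        using gauss_bounds[of "d n *\<^sub>R \<zeta>"] by (intro mult_right_mono) auto
      then show "norm (cis (z \<bullet> \<zeta>) * complex_of_real (gauss (d n *\<^sub>R \<zeta>)) * fourier f \<zeta>) \<le> cmod (fourier f \<zeta>)" by (simp add: norm_mult)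
    qed
  qed measurable
  obtain B where B: "\<And>z. (1 + norm z) ^ 0 * cmod (f z) \<le> B" using rapidD[OF schwartz_rapid[OF f], of 0] by blast
  have gi: "integrable lborel (\<lambda>v. complex_of_real (gauss v))" by (rule schwartz_integrable[OF gauss_schwartz])
  have C: "(\<lambda>n. LINT v|lborel. f (z - d n *\<^sub>R v) * complex_of_real (gauss v)) \<longlonglongrightarrow> (LINT v|lborel. f z * complex_of_real (gauss v))"
  proof (rule integral_dominated_convergence[where w = "\<lambda>v. B * cmod (complex_of_real (gauss v))"])
    show "integrable lborel (\<lambda>v. B * cmod (complex_of_real (gauss v)))" by (intro integrable_mult_right integrable_norm gi)
    show "AE v in lborel. (\<lambda>n. f (z - d n *\<^sub>R v) * complex_of_real (gauss v)) \<longlonglongrightarrow> f z * complex_of_real (gauss v)"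
    proof (rule AE_I2)
      fix v :: r3
      have "(\<lambda>n. z - d n *\<^sub>R v) \<longlonglongrightarrow> z - 0 *\<^sub>R v" by (intro tendsto_diff tendsto_scaleR d0 tendsto_const)
      then have "(\<lambda>n. f (z - d n *\<^sub>R v)) \<longlonglongrightarrow> f (z - 0 *\<^sub>R v)"
        using schwartz_continuous[OF f] unfolding continuous_on_eq_continuous_at[OF open_UNIV] by (intro isCont_tendsto_compose[of _ f]) blast+
      then show "(\<lambda>n. f (z - d n *\<^sub>R v) * complex_of_real (gauss v)) \<longlonglongrightarrow> f z * complex_of_real (gauss v)"
        by (intro tendsto_mult tendsto_const) simp
    qed
    show "AE v in lborel. norm (f (z - d n *\<^sub>R v) * complex_of_real (gauss v)) \<le> B * cmod (complex_of_real (gauss v))" for n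
    proof (rule AE_I2)
      fix v :: r3
      show "norm (f (z - d n *\<^sub>R v) * complex_of_real (gauss v)) \<le> B * cmod (complex_of_real (gauss v))"
        unfolding norm_mult using B[of "z - d n *\<^sub>R v"] by (intro mult_right_mono) auto
    qed
  qed measurable
  have G: "(LINT v|lborel. complex_of_real (gauss v)) = ?K"
    using gauss_fourier[of 0] by (simp add: gauss_def)
  have "(\<lambda>n. ?K * (LINT v|lborel. f (z - d n *\<^sub>R v) * complex_of_real (gauss v))) \<longlonglongrightarrow> ?K * (LINT v|lborel. f z * complex_of_real (gauss v))"
    by (intro tendsto_mult tendsto_const C)
  then have "(\<lambda>n. LINT \<zeta>|lborel. cis (z \<bullet> \<zeta>) * complex_of_real (gauss (d n *\<^sub>R \<zeta>)) * fourier f \<zeta>) \<longlonglongrightarrow> ?K * (LINT v|lborel. f z * complex_of_real (gauss v))"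
    unfolding fourier_inversion_gauss[OF f d] .
  from LIMSEQ_unique[OF A this] have "(LINT \<zeta>|lborel. cis (z \<bullet> \<zeta>) * fourier f \<zeta>) = ?K * (f z * ?K)"
    by (simp only: integral_mult_right_zero G)
  also have "\<dots> = complex_of_real (sqrt (2 * pi) ^ 3 * sqrt (2 * pi) ^ 3) * f z" by simp
  also have "sqrt (2 * pi) ^ 3 * sqrt (2 * pi) ^ 3 = (2 * pi) ^ 3"
    by (simp flip: power_mult_distrib)
  finally show ?thesis .
qed

section \<open>Uniqueness of the Fourier transform\<close>

lemma enn2real_inj_finite:
  assumes "a \<noteq> \<infinity>" "b \<noteq> \<infinity>" "enn2real a = enn2real b"
  shows "a = b"
  using assms by (cases a; cases b) auto

lemma ennreal_eq_minus_imp_0: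
  assumes "ennreal x = ennreal (- x)" shows "x = 0"
proof (cases "0 \<le> x")
  case True
  then have "ennreal x = 0" using assms ennreal_neg[of "- x"] by simp
  then show ?thesis using True by (simp add: ennreal_eq_0_iff)
next
  case False
  then have "ennreal (- x) = 0" using assms ennreal_neg[of x] by simp
  then show ?thesis using False by (simp add: ennreal_eq_0_iff)
qed

lemma emeasure_density_indicator:
  fixes h :: "r3 \<Rightarrow> real"
  assumes [measurable]: "h \<in> borel_measurable borel" "A \<in> sets borel" "B \<in> sets borel"
  shows "emeasure (density lborel (\<lambda>z. ennreal (h z * indicator A z))) B = (\<integral>\<^sup>+z. ennreal (h z * indicator (A \<inter> B) z) \<partial>lborel)"
proof -
  have m: "(\<lambda>z. ennreal (h z * indicator A z)) \<in> borel_measurable lborel" by measurable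
  have "B \<in> sets lborel" by simp
  from emeasure_density[OF m this] show ?thesis
    by (simp add: indicator_inter_arith mult.assoc flip: ennreal_indicator ennreal_mult'')
qed

text \<open>The positive and the negative part of \<open>h\<close> define measures that agree on boxes, hence everywhere, and a finite
measure determines its density almost everywhere. The restriction to large boxes ensures finiteness.\<close>

lemma AE_zero_of_box_integrals:
  fixes h :: "r3 \<Rightarrow> real"
  assumes [measurable]: "h \<in> borel_measurable borel"
    and int: "\<And>a b. integrable lborel (\<lambda>z. h z * indicator (box a b) z)"
    and zero: "\<And>a b. (LINT z|lborel. h z * indicator (box a b) z) = 0"
  shows "AE z in lborel. h z = 0"
proof -
  define A where "A = (\<lambda>n::nat. box (- (real n *\<^sub>R One)) (real n *\<^sub>R One) :: r3 set)"
  have inter: "\<exists>c e. A n \<inter> box a b = box c e" for n a b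
    unfolding A_def box_Int_box by (intro exI) (rule refl)
  have pm: "(\<integral>\<^sup>+z. ennreal (h z * indicator (box a b) z) \<partial>lborel) = (\<integral>\<^sup>+z. ennreal (- (h z * indicator (box a b) z)) \<partial>lborel)
    \<and> (\<integral>\<^sup>+z. ennreal (h z * indicator (box a b) z) \<partial>lborel) < \<infinity>" for a b
  proof -
    let ?k = "\<lambda>z. h z * indicator (box a b) z"
    have fin: "(\<integral>\<^sup>+z. ennreal (?k z) \<partial>lborel) \<noteq> \<infinity>" "(\<integral>\<^sup>+z. ennreal (- ?k z) \<partial>lborel) \<noteq> \<infinity>"
      using int[of a b] by (auto simp: real_integrable_def)
    have "enn2real (\<integral>\<^sup>+z. ennreal (?k z) \<partial>lborel) = enn2real (\<integral>\<^sup>+z. ennreal (- ?k z) \<partial>lborel)"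
      using real_lebesgue_integral_def[OF int[of a b]] zero[of a b] by simp
    then have "(\<integral>\<^sup>+z. ennreal (?k z) \<partial>lborel) = (\<integral>\<^sup>+z. ennreal (- ?k z) \<partial>lborel)"
      by (rule enn2real_inj_finite[OF fin])
    then show ?thesis using fin by (simp add: less_top)
  qed
  have "AE z in lborel. h z * indicator (A n) z = 0" for n
  proof -
    let ?p = "\<lambda>z. ennreal (h z * indicator (A n) z)" and ?q = "\<lambda>z. ennreal (- (h z * indicator (A n) z))"
    have Am [measurable]: "A n \<in> sets borel" by (simp add: A_def)
    have em: "emeasure (density lborel ?p) (box a b) = emeasure (density lborel ?q) (box a b)" for a b
    proof -
      obtain c e where ce: "A n \<inter> box a b = box c e" using inter[of n a b] by (elim exE) (rule that)
      have "emeasure (density lborel ?p) (box a b) = (\<integral>\<^sup>+z. ennreal (h z * indicator (box c e) z) \<partial>lborel)"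
        unfolding ce[symmetric] by (intro emeasure_density_indicator) measurable
      also have "\<dots> = (\<integral>\<^sup>+z. ennreal (- (h z * indicator (box c e) z)) \<partial>lborel)" by (rule conjunct1[OF pm])
      also have "\<dots> = (\<integral>\<^sup>+z. ennreal ((- h z) * indicator (box c e) z) \<partial>lborel)" by (simp only: mult_minus_left)
      also have "\<dots> = emeasure (density lborel (\<lambda>z. ennreal ((- h z) * indicator (A n) z))) (box a b)"
        unfolding ce[symmetric] by (intro emeasure_density_indicator[symmetric]) measurable
      also have "\<dots> = emeasure (density lborel ?q) (box a b)" by (simp only: mult_minus_left)
      finally show ?thesis .
    qed
    have "density lborel ?p = density lborel ?q"
    proof (rule measure_eqI_generator_eq)
      let ?E = "range (\<lambda>(a, b). box a b::r3 set)"
      show "Int_stable ?E" by (auto simp: Int_stable_def box_Int_box)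
      show "?E \<subseteq> Pow UNIV" "sets (density lborel ?p) = sigma_sets UNIV ?E" "sets (density lborel ?q) = sigma_sets UNIV ?E"
        by (simp_all add: borel_eq_box)
      let ?A = "\<lambda>n::nat. box (- (real n *\<^sub>R One)) (real n *\<^sub>R One) :: r3 set"
      show "range ?A \<subseteq> ?E" "(\<Union>i. ?A i) = UNIV" unfolding UN_box_eq_UNIV by auto
      show "emeasure (density lborel ?p) (?A i) \<noteq> \<infinity>" for i
      proof -
        obtain c e where ce: "A n \<inter> ?A i = box c e" using inter[of n "- (real i *\<^sub>R One)" "real i *\<^sub>R One"] by (elim exE) (rule that)
        have "emeasure (density lborel ?p) (?A i) = (\<integral>\<^sup>+z. ennreal (h z * indicator (box c e) z) \<partial>lborel)"
          unfolding ce[symmetric] by (intro emeasure_density_indicator) measurable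
        then show ?thesis using pm[of c e] by auto
      qed
      show "emeasure (density lborel ?p) X = emeasure (density lborel ?q) X" if "X \<in> ?E" for X
        using that em by auto
    qed
    moreover have "(\<integral>\<^sup>+z. ?p z \<partial>lborel) \<noteq> \<infinity>"
      using pm[of "- (real n *\<^sub>R One)" "real n *\<^sub>R One"] by (auto simp: A_def)
    ultimately have "AE z in lborel. ?p z = ?q z"
      by (subst (asm) finite_density_unique) auto
    then show ?thesis
    proof eventually_elim
      case (elim z)
      then show ?case by (rule ennreal_eq_minus_imp_0)
    qed
  qed
  then have "AE z in lborel. \<forall>n. h z * indicator (A n) z = 0" unfolding AE_all_countable ..
  then show ?thesis
  proof eventually_elim
    case (elim z)
    have "z \<in> (\<Union>n. A n)" unfolding A_def UN_box_eq_UNIV by simp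
    then obtain n where "z \<in> A n" by blast
    then show ?case using elim[rule_format, of n] by simp
  qed
qed

text \<open>The functions \<open>exp (- ((x - c) / r) ^ (2 n))\<close> converge to the indicator function of the interval
\<open>\<bar>x - c\<bar> < r\<close> except at its endpoints.\<close>

definition plateau :: "nat \<Rightarrow> real \<Rightarrow> real \<Rightarrow> real poly" where
  "plateau n c r = [:- c / r, 1 / r:] ^ (2 * Suc n)"

lemma poly_plateau: "poly (plateau n c r) x = (((x - c) / r)\<^sup>2) ^ Suc n"
proof -
  have e: "poly [:- c / r, 1 / r:] x = (x - c) / r" by (simp add: diff_divide_distrib)
  show ?thesis unfolding plateau_def poly_power e power_mult ..
qed

text \<open>A bound uniform in \<open>n\<close>; it provides both coercivity and a dominating function.\<close>

lemma plateau_ge: "(((x - c) / r)\<^sup>2) - 1 \<le> poly (plateau n c r) x"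
proof -
  have "y - 1 \<le> y ^ Suc n" if "0 \<le> y" for y :: real
  proof (cases "1 \<le> y")
    case True
    then have "y ^ 1 \<le> y ^ Suc n" by (intro power_increasing) auto
    then show ?thesis by simp
  next
    case False
    moreover have "0 \<le> y ^ Suc n" using that by simp
    ultimately show ?thesis by linarith
  qed
  then show ?thesis unfolding poly_plateau by simp
qed

lemma coercive_plateau:
  assumes "0 < r" shows "coercive (plateau n c r)"
proof -
  have "(2 / r) * \<bar>x\<bar> - (2 * \<bar>c\<bar> / r + 2) \<le> poly (plateau n c r) x" for x
  proof -
    let ?y = "\<bar>(x - c) / r\<bar>"
    have "0 \<le> (?y - 1)\<^sup>2" by simp
    also have "(?y - 1)\<^sup>2 = ((x - c) / r)\<^sup>2 + 1 - 2 * ?y" by (simp only: power2_diff power2_abs) simp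
    finally have 1: "2 * ?y - 2 \<le> ((x - c) / r)\<^sup>2 - 1" by linarith
    have "\<bar>x\<bar> - \<bar>c\<bar> \<le> \<bar>x - c\<bar>" by linarith
    then have "(\<bar>x\<bar> - \<bar>c\<bar>) / r \<le> \<bar>x - c\<bar> / r" using assms by (intro divide_right_mono) auto
    also have "\<dots> = ?y" using assms by simp
    finally have "2 * ((\<bar>x\<bar> - \<bar>c\<bar>) / r) - 2 \<le> 2 * ?y - 2" by linarith
    also note 1
    also note plateau_ge[of x c r n]
    finally show ?thesis by (simp add: diff_divide_distrib)
  qed
  then show ?thesis using assms unfolding coercive_def by (intro exI[of _ "2 / r"] exI[of _ "2 * \<bar>c\<bar> / r + 2"]) auto
qed

lemma plateau_limit:
  assumes "0 < r"
  shows "(\<lambda>n. expoly (plateau n c r) 1 x) \<longlonglongrightarrow> (if \<bar>x - c\<bar> < r then 1 else if \<bar>x - c\<bar> = r then exp (- 1) else 0)"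
proof -
  define y where "y = ((x - c) / r)\<^sup>2"
  have e: "expoly (plateau n c r) 1 x = exp (- (y ^ Suc n))" for n
    by (simp add: expoly_def poly_plateau y_def)
  have y: "y = (\<bar>x - c\<bar> / r)\<^sup>2" by (simp add: y_def power_divide)
  consider "\<bar>x - c\<bar> < r" | "\<bar>x - c\<bar> = r" | "r < \<bar>x - c\<bar>" by linarith
  then show ?thesis
  proof cases
    case 1
    then have "\<bar>x - c\<bar> / r < 1" using assms by simp
    then have "y < 1" unfolding y using assms by (intro power_less_one_iff[THEN iffD2]) auto
    then have "(\<lambda>n. y ^ n) \<longlonglongrightarrow> 0" by (intro LIMSEQ_power_zero) (simp add: y)
    then have "(\<lambda>n. exp (- (y ^ Suc n))) \<longlonglongrightarrow> exp (- 0)" by (intro tendsto_exp tendsto_minus LIMSEQ_Suc)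
    then show ?thesis using 1 by (simp add: e del: power_Suc)
  next
    case 2
    then have "y = 1" unfolding y using assms by simp
    then show ?thesis using 2 by (simp add: e)
  next
    case 3
    then have "1 < \<bar>x - c\<bar> / r" using assms by simp
    then have "1 < y" unfolding y by (intro one_less_power) auto
    then have "(\<lambda>n. (1 / y) ^ n) \<longlonglongrightarrow> 0" by (intro LIMSEQ_power_zero) simp
    then have lim: "(\<lambda>n. (1 / y) ^ Suc n) \<longlonglongrightarrow> 0" by (rule LIMSEQ_Suc)
    have "(\<lambda>n. exp (- (y ^ Suc n))) \<longlonglongrightarrow> 0"
    proof (rule tendsto_sandwich[OF _ _ tendsto_const lim])
      show "\<forall>\<^sub>F n in sequentially. 0 \<le> exp (- (y ^ Suc n))" by simp
      have "exp (- (y ^ Suc n)) \<le> (1 / y) ^ Suc n" for n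
      proof -
        have p: "0 < y ^ Suc n" using \<open>1 < y\<close> by (intro zero_less_power) simp
        have "y ^ Suc n \<le> exp (y ^ Suc n)" using exp_ge_add_one_self[of "y ^ Suc n"] by linarith
        then have "1 / exp (y ^ Suc n) \<le> 1 / y ^ Suc n" using p by (intro divide_left_mono) auto
        then show ?thesis by (simp add: exp_minus inverse_eq_divide power_divide del: power_Suc)
      qed
      then show "\<forall>\<^sub>F n in sequentially. exp (- (y ^ Suc n)) \<le> (1 / y) ^ Suc n" by simp
    qed
    then show ?thesis using 3 by (simp add: e del: power_Suc)
  qed
qed

text \<open>The indicator function of a box is, off its boundary, the limit of tensor products of \<open>plateau\<close> functions, and
these are dominated by a multiple of the first of them.\<close>

lemma box_integral_zero:
  fixes D :: "r3 \<Rightarrow> complex"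
  assumes [measurable]: "D \<in> borel_measurable borel"
    and int: "\<And>f. f \<in> schwartz \<Longrightarrow> integrable lborel (\<lambda>z. D z * f z)"
    and zero: "\<And>f. f \<in> schwartz \<Longrightarrow> (LINT z|lborel. D z * f z) = 0"
  shows "integrable lborel (\<lambda>z. D z * indicator (box a b) z)" "(LINT z|lborel. D z * indicator (box a b) z) = 0"
proof -
  have "integrable lborel (\<lambda>z. D z * indicator (box a b) z) \<and> (LINT z|lborel. D z * indicator (box a b) z) = 0"
  proof (cases "box a b = {}")
    case True
    then show ?thesis by simp
  next
    case False
    obtain a1 a2 a3 b1 b2 b3 where ab: "a = (a1, a2, a3)" "b = (b1, b2, b3)" by (cases a, cases b) auto
    have B: "Basis = {(1, 0, 0), (0, 1, 0), (0, 0, 1) :: r3}" by (auto simp: Basis_prod_def zero_prod_def)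
    have lt: "a1 < b1" "a2 < b2" "a3 < b3" using False by (auto simp: box_ne_empty B ab)
    define r1 r2 r3 where "r1 = (b1 - a1) / 2" and "r2 = (b2 - a2) / 2" and "r3 = (b3 - a3) / 2"
    define c1 c2 c3 where "c1 = (a1 + b1) / 2" and "c2 = (a2 + b2) / 2" and "c3 = (a3 + b3) / 2"
    have r: "0 < r1" "0 < r2" "0 < r3" using lt by (auto simp: r1_def r2_def r3_def)
    define f where "f = (\<lambda>n. tensor (expoly (plateau n c1 r1) 1) (expoly (plateau n c2 r2) 1) (expoly (plateau n c3 r3) 1))"
    have fs: "f n \<in> schwartz" for n
      unfolding f_def by (intro tensor_expoly_schwartz coercive_plateau r)
    define cut :: "real \<Rightarrow> real \<Rightarrow> real \<Rightarrow> real" where "cut = (\<lambda>c r x. if \<bar>x - c\<bar> < r then 1 else if \<bar>x - c\<bar> = r then exp (- 1) else 0)"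
    have flim: "(\<lambda>n. f n z) \<longlonglongrightarrow> tensor (cut c1 r1) (cut c2 r2) (cut c3 r3) z" for z
      unfolding f_def tensor_def cut_def by (intro tendsto_of_real tendsto_mult plateau_limit r)
    have box_iff: "z \<in> box a b \<longleftrightarrow> \<bar>fst z - c1\<bar> < r1 \<and> \<bar>fst (snd z) - c2\<bar> < r2 \<and> \<bar>snd (snd z) - c3\<bar> < r3" for z
      by (cases z) (auto simp: mem_box B ab r1_def r2_def r3_def c1_def c2_def c3_def abs_less_iff field_simps)
    have cbox_iff: "z \<in> cbox a b \<longleftrightarrow> \<bar>fst z - c1\<bar> \<le> r1 \<and> \<bar>fst (snd z) - c2\<bar> \<le> r2 \<and> \<bar>snd (snd z) - c3\<bar> \<le> r3" for z
      by (cases z) (auto simp: mem_box B ab r1_def r2_def r3_def c1_def c2_def c3_def abs_le_iff field_simps)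
    have "AE z in lborel. z \<notin> cbox a b - box a b"
    proof -
      have "emeasure lborel (cbox a b - box a b) = emeasure lborel (cbox a b) - emeasure lborel (box a b)"
        by (intro emeasure_Diff box_subset_cbox) (auto simp: emeasure_lborel_box_eq)
      also have "\<dots> = 0" using lt by (simp add: emeasure_lborel_cbox_eq emeasure_lborel_box_eq B ab)
      finally have "cbox a b - box a b \<in> null_sets lborel" by (intro null_setsI) auto
      then show ?thesis by (rule AE_not_in)
    qed
    then have ae: "AE z in lborel. tensor (cut c1 r1) (cut c2 r2) (cut c3 r3) z = indicator (box a b) z"
    proof eventually_elim
      case (elim z)
      show ?case
      proof (cases "z \<in> box a b")
        case True
        then show ?thesis by (simp add: box_iff tensor_def cut_def)
      next
        case False
        then have "z \<notin> cbox a b" using elim by blast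
        then have "cut c1 r1 (fst z) = 0 \<or> cut c2 r2 (fst (snd z)) = 0 \<or> cut c3 r3 (snd (snd z)) = 0"
          by (auto simp: cbox_iff cut_def)
        then show ?thesis using False by (auto simp: tensor_def)
      qed
    qed
    \<comment> \<open>each of the three factors contributes \<open>exp 1\<close> by \<open>plateau_ge\<close>\<close>
    have bound: "cmod (f n z) \<le> exp 3 * cmod (f 0 z)" for n z
    proof -
      have g: "\<bar>expoly (plateau n c r) 1 x\<bar> \<le> exp 1 * \<bar>expoly (plateau 0 c r) 1 x\<bar>" for c r x :: real
        using plateau_ge[of x c r n] by (simp add: expoly_def poly_plateau[of 0] flip: exp_add)
      have "cmod (f n z) \<le> (exp 1 * \<bar>expoly (plateau 0 c1 r1) 1 (fst z)\<bar>) * ((exp 1 * \<bar>expoly (plateau 0 c2 r2) 1 (fst (snd z))\<bar>) * (exp 1 * \<bar>expoly (plateau 0 c3 r3) 1 (snd (snd z))\<bar>))"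
        unfolding f_def tensor_def norm_of_real abs_mult by (intro mult_mono g) auto
      also have "\<dots> = (exp 1 * (exp 1 * exp 1)) * cmod (f 0 z)"
        unfolding f_def tensor_def norm_of_real abs_mult by (simp only: mult_ac)
      also have "exp 1 * (exp 1 * exp 1) = (exp 3 :: real)" by (simp flip: exp_add)
      finally show ?thesis .
    qed
    have fm [measurable]: "f n \<in> borel_measurable borel" for n by (rule schwartz_measurable[OF fs])
    have "integrable lborel (\<lambda>z. D z * indicator (box a b) z) \<and> (\<lambda>n. LINT z|lborel. D z * f n z) \<longlonglongrightarrow> (LINT z|lborel. D z * indicator (box a b) z)"
    proof (rule conjI[OF integrable_dominated_convergence integral_dominated_convergence])
      show "integrable lborel (\<lambda>z. exp 3 * cmod (D z * f 0 z))" "integrable lborel (\<lambda>z. exp 3 * cmod (D z * f 0 z))"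
        by (intro integrable_mult_right integrable_norm int fs)+
      show "AE z in lborel. (\<lambda>n. D z * f n z) \<longlonglongrightarrow> D z * indicator (box a b) z" "AE z in lborel. (\<lambda>n. D z * f n z) \<longlonglongrightarrow> D z * indicator (box a b) z"
      proof -
        show 1: "AE z in lborel. (\<lambda>n. D z * f n z) \<longlonglongrightarrow> D z * indicator (box a b) z"
          using ae
        proof eventually_elim
          case (elim z)
          show ?case using tendsto_mult[OF tendsto_const flim[of z], of "D z"] unfolding elim .
        qed
        show "AE z in lborel. (\<lambda>n. D z * f n z) \<longlonglongrightarrow> D z * indicator (box a b) z" by (rule 1)
      qed
      have bb: "norm (D z * f n z) \<le> exp 3 * cmod (D z * f 0 z)" for n z
        using mult_left_mono[OF bound[of n z], of "cmod (D z)"] by (simp add: norm_mult mult_ac)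
      then show "AE z in lborel. norm (D z * f n z) \<le> exp 3 * cmod (D z * f 0 z)" "AE z in lborel. norm (D z * f n z) \<le> exp 3 * cmod (D z * f 0 z)" for n
        by (auto simp del: split_paired_All)
    qed measurable
    moreover have "(LINT z|lborel. D z * f n z) = 0" for n by (rule zero[OF fs])
    ultimately show ?thesis by (auto simp: LIMSEQ_const_iff)
  qed
  then show "integrable lborel (\<lambda>z. D z * indicator (box a b) z)" "(LINT z|lborel. D z * indicator (box a b) z) = 0" by auto
qed

text \<open>The difference of two representing functions is annihilated by all Schwartz functions, hence has vanishing
integrals over boxes.\<close>

theorem has_fourier_unique:
  assumes F: "has_fourier u F" and G: "has_fourier u G"
  shows "AE \<zeta> in lborel. F \<zeta> = G \<zeta>"
proof -
  have m [measurable]: "F \<in> borel_measurable borel" "G \<in> borel_measurable borel" using F G by (auto simp: has_fourier_def)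
  let ?D = "\<lambda>z. F z - G z"
  have s: "integrable lborel (\<lambda>z. ?D z * f z) \<and> (LINT z|lborel. ?D z * f z) = 0" if "f \<in> schwartz" for f
  proof -
    have i: "integrable lborel (\<lambda>z. F z * f z)" "integrable lborel (\<lambda>z. G z * f z)"
      and e: "u (fourier f) = (LINT z|lborel. F z * f z)" "u (fourier f) = (LINT z|lborel. G z * f z)"
      using F G that unfolding has_fourier_def by blast+
    show ?thesis using i e by (simp add: left_diff_distrib)
  qed
  have Dm: "?D \<in> borel_measurable borel" by measurable
  note bi = box_integral_zero[OF Dm conjunct1[OF s] conjunct2[OF s]]
  have "AE z in lborel. Re (?D z) = 0"
  proof (rule AE_zero_of_box_integrals)
    show "(\<lambda>z. Re (?D z)) \<in> borel_measurable borel" by measurable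
    fix a b :: r3
    have e: "Re (?D z) * indicator (box a b) z = Re (?D z * indicator (box a b) z)" for z by (simp split: split_indicator)
    show "integrable lborel (\<lambda>z. Re (?D z) * indicator (box a b) z)" unfolding e by (rule integrable_Re[OF bi(1)])
    have b2: "(LINT z|lborel. ?D z * indicator (box a b) z) = 0" by (rule bi(2))
    have "(LINT z|lborel. Re (?D z) * indicator (box a b) z) = Re (LINT z|lborel. ?D z * indicator (box a b) z)"
      unfolding e by (rule integral_Re[OF bi(1)])
    then show "(LINT z|lborel. Re (?D z) * indicator (box a b) z) = 0" unfolding b2 by simp
  qed
  moreover have "AE z in lborel. Im (?D z) = 0"
  proof (rule AE_zero_of_box_integrals)
    show "(\<lambda>z. Im (?D z)) \<in> borel_measurable borel" by measurable
    fix a b :: r3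
    have e: "Im (?D z) * indicator (box a b) z = Im (?D z * indicator (box a b) z)" for z by (simp split: split_indicator)
    show "integrable lborel (\<lambda>z. Im (?D z) * indicator (box a b) z)" unfolding e by (rule integrable_Im[OF bi(1)])
    have b2: "(LINT z|lborel. ?D z * indicator (box a b) z) = 0" by (rule bi(2))
    have "(LINT z|lborel. Im (?D z) * indicator (box a b) z) = Im (LINT z|lborel. ?D z * indicator (box a b) z)"
      unfolding e by (rule integral_Im[OF bi(1)])
    then show "(LINT z|lborel. Im (?D z) * indicator (box a b) z) = 0" unfolding b2 by simp
  qed
  ultimately show ?thesis by eventually_elim (simp add: complex_eq_iff)
qed

section \<open>Distributions with a given Fourier transform\<close>

lemma schwartz_norm_nonneg: "f \<in> schwartz \<Longrightarrow> 0 \<le> schwartz_norm N f"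
  using schwartz_norm_ge[of f "[]" N 0] by (intro order_trans[OF _ schwartz_norm_ge[of f "[]" N 0]]) auto

text \<open>Continuity bounds with different orders can be brought to a common order, as needed for sums of
distributions.\<close>

lemma schwartz_norm_compare:
  assumes "N \<le> M"
  obtains K where "0 \<le> K" and "\<And>f. f \<in> schwartz \<Longrightarrow> schwartz_norm N f \<le> K * schwartz_norm M f"
proof
  let ?L = "{es :: r3 list. set es \<subseteq> Basis \<and> length es \<le> N}"
  show "0 \<le> real (card ?L)" by simp
  fix f assume f: "f \<in> schwartz"
  have "(SUP z. (1 + norm z) ^ N * cmod (iter_deriv es f z)) \<le> schwartz_norm M f" if "es \<in> ?L" for es
  proof (rule cSUP_least)
    fix z
    have "(1 + norm z) ^ N * cmod (iter_deriv es f z) \<le> (1 + norm z) ^ M * cmod (iter_deriv es f z)"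
      using assms by (intro mult_right_mono power_increasing) auto
    also have "\<dots> \<le> schwartz_norm M f" using that assms by (intro schwartz_norm_ge f) auto
    finally show "(1 + norm z) ^ N * cmod (iter_deriv es f z) \<le> schwartz_norm M f" .
  qed simp
  then show "schwartz_norm N f \<le> real (card ?L) * schwartz_norm M f"
    unfolding schwartz_norm_def[of N] by (rule sum_bounded_above)
qed

lemma tempered_add:
  assumes u: "u \<in> tempered" and v: "v \<in> tempered"
  shows "(\<lambda>f. u f + v f) \<in> tempered"
proof -
  obtain C1 N1 where 1: "\<And>f. f \<in> schwartz \<Longrightarrow> cmod (u f) \<le> C1 * schwartz_norm N1 f" using u unfolding tempered_def by blast
  obtain C2 N2 where 2: "\<And>f. f \<in> schwartz \<Longrightarrow> cmod (v f) \<le> C2 * schwartz_norm N2 f" using v unfolding tempered_def by blast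
  let ?N = "max N1 N2"
  obtain K1 where K1: "0 \<le> K1" "\<And>f. f \<in> schwartz \<Longrightarrow> schwartz_norm N1 f \<le> K1 * schwartz_norm ?N f"
    using schwartz_norm_compare[of N1 ?N] by auto
  obtain K2 where K2: "0 \<le> K2" "\<And>f. f \<in> schwartz \<Longrightarrow> schwartz_norm N2 f \<le> K2 * schwartz_norm ?N f"
    using schwartz_norm_compare[of N2 ?N] by auto
  have "cmod (u f + v f) \<le> (\<bar>C1\<bar> * K1 + \<bar>C2\<bar> * K2) * schwartz_norm ?N f" if f: "f \<in> schwartz" for f
  proof -
    have "cmod (u f) \<le> \<bar>C1\<bar> * schwartz_norm N1 f"
      by (rule order_trans[OF 1[OF f]]) (intro mult_right_mono schwartz_norm_nonneg f; simp)
    also have "\<dots> \<le> \<bar>C1\<bar> * (K1 * schwartz_norm ?N f)" by (intro mult_left_mono K1(2) f) simp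
    finally have a: "cmod (u f) \<le> \<bar>C1\<bar> * (K1 * schwartz_norm ?N f)" .
    have "cmod (v f) \<le> \<bar>C2\<bar> * schwartz_norm N2 f"
      by (rule order_trans[OF 2[OF f]]) (intro mult_right_mono schwartz_norm_nonneg f; simp)
    also have "\<dots> \<le> \<bar>C2\<bar> * (K2 * schwartz_norm ?N f)" by (intro mult_left_mono K2(2) f) simp
    finally have b: "cmod (v f) \<le> \<bar>C2\<bar> * (K2 * schwartz_norm ?N f)" .
    have "cmod (u f + v f) \<le> \<bar>C1\<bar> * (K1 * schwartz_norm ?N f) + \<bar>C2\<bar> * (K2 * schwartz_norm ?N f)"
      by (rule order_trans[OF norm_triangle_ineq add_mono[OF a b]])
    then show ?thesis by (simp only: distrib_right mult.assoc)
  qed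
  then have bd: "\<exists>C N. \<forall>f\<in>schwartz. cmod (u f + v f) \<le> C * schwartz_norm N f" by blast
  have z: "u f + v f = 0" if "f \<notin> schwartz" for f
    using u v that unfolding tempered_def by simp
  have a: "u (\<lambda>z. f z + g z) + v (\<lambda>z. f z + g z) = (u f + v f) + (u g + v g)" if "f \<in> schwartz" "g \<in> schwartz" for f g
  proof -
    have "u (\<lambda>z. f z + g z) = u f + u g" "v (\<lambda>z. f z + g z) = v f + v g"
      using u v that unfolding tempered_def by blast+
    then show ?thesis by simp
  qed
  have c: "u (\<lambda>z. c * f z) + v (\<lambda>z. c * f z) = c * (u f + v f)" if "f \<in> schwartz" for f c
  proof -
    have "u (\<lambda>z. c * f z) = c * u f" "v (\<lambda>z. c * f z) = c * v f"
      using u v that unfolding tempered_def by blast+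
    then show ?thesis by (simp add: distrib_left)
  qed
  show ?thesis unfolding tempered_def mem_Collect_eq
    by (intro conjI allI ballI impI z a c bd)
qed

lemma has_fourierD:
  assumes "has_fourier u F"
  shows "u \<in> tempered" "F \<in> borel_measurable borel"
    "f \<in> schwartz \<Longrightarrow> integrable lborel (\<lambda>\<zeta>. F \<zeta> * f \<zeta>)"
    "f \<in> schwartz \<Longrightarrow> u (fourier f) = (LINT \<zeta>|lborel. F \<zeta> * f \<zeta>)"
  using assms unfolding has_fourier_def by auto

lemma has_fourier_add:
  assumes F: "has_fourier u F" and G: "has_fourier v G"
  shows "has_fourier (\<lambda>f. u f + v f) (\<lambda>\<zeta>. F \<zeta> + G \<zeta>)"
  unfolding has_fourier_def
proof (intro conjI ballI)
  show "(\<lambda>f. u f + v f) \<in> tempered" by (intro tempered_add has_fourierD(1)[OF F] has_fourierD(1)[OF G])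
  show "(\<lambda>\<zeta>. F \<zeta> + G \<zeta>) \<in> borel_measurable lborel"
    using has_fourierD(2)[OF F] has_fourierD(2)[OF G] by simp
  fix f assume f: "f \<in> schwartz"
  note F = has_fourierD(3,4)[OF F f] and G = has_fourierD(3,4)[OF G f]
  show "integrable lborel (\<lambda>\<zeta>. (F \<zeta> + G \<zeta>) * f \<zeta>)"
    unfolding distrib_right by (intro Bochner_Integration.integrable_add F G)
  show "u (fourier f) + v (fourier f) = (LINT \<zeta>|lborel. (F \<zeta> + G \<zeta>) * f \<zeta>)"
    unfolding distrib_right F(2) G(2) by (intro Bochner_Integration.integral_add[symmetric] F G)
qed

lemma has_fourier_zero: "has_fourier (\<lambda>f. 0) (\<lambda>\<zeta>. 0)"
proof -
  have "\<exists>C N. \<forall>f\<in>schwartz. cmod 0 \<le> C * schwartz_norm N f" by (intro exI[of _ 0]) simp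
  then show ?thesis by (simp add: has_fourier_def tempered_def)
qed

lemma has_fourier_FT: "has_fourier u F \<Longrightarrow> has_fourier u (FT u)"
  unfolding FT_def by (rule someI[where P = "has_fourier u"])

lemma FT_eq: "has_fourier u F \<Longrightarrow> AE \<zeta> in lborel. FT u \<zeta> = F \<zeta>"
  by (rule has_fourier_unique[OF has_fourier_FT])

text \<open>The distribution is \<open>f \<mapsto> \<integral> G * (inverse Fourier transform of f)\<close>; the inverse transform is written as
\<open>(2 * pi) ^ (- 3) * fourier f (- \<zeta>)\<close>, and it decays like \<open>decay6\<close> with a constant given by a Schwartz norm of \<open>f\<close>.
Fourier inversion shows that the Fourier transform of this distribution is \<open>G\<close>.\<close>

theorem has_fourier_exists:
  assumes [measurable]: "G \<in> borel_measurable borel"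
    and int: "integrable lborel (\<lambda>\<zeta>. cmod (G \<zeta>) * decay6 \<zeta>)"
  obtains v where "has_fourier v G"
proof
  let ?c = "complex_of_real (1 / (2 * pi) ^ 3)"
  let ?J = "LINT z|lborel. decay6 z"
  define v where "v = (\<lambda>f. if f \<in> schwartz then (LINT \<zeta>|lborel. G \<zeta> * (?c * fourier f (- \<zeta>))) else 0)"
  have c: "cmod ?c \<le> 1"
  proof -
    have "(1::real) \<le> (2 * pi) ^ 3" using pi_ge_two by (intro one_le_power) simp
    then have "1 / (2 * pi) ^ 3 \<le> 1" by simp
    then show ?thesis unfolding norm_of_real by simp
  qed
  have ff: "cmod (fourier f (- \<zeta>)) \<le> 4 ^ 6 * (schwartz_norm 6 f * ?J) * decay6 \<zeta>" if "f \<in> schwartz" for f \<zeta>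
  proof -
    have e: "decay6 (- \<zeta>) = decay6 \<zeta>" by (simp add: decay6_def)
    show ?thesis using fourier_decay_schwartz_norm[OF that, of "- \<zeta>" 6] unfolding le_decay6_iff e max.idem .
  qed
  have bd: "cmod (G \<zeta> * (?c * fourier f (- \<zeta>))) \<le> (4 ^ 6 * (schwartz_norm 6 f * ?J)) * (cmod (G \<zeta>) * decay6 \<zeta>)" if f: "f \<in> schwartz" for f \<zeta>
  proof -
    have "cmod (G \<zeta> * (?c * fourier f (- \<zeta>))) \<le> cmod (G \<zeta>) * (1 * (4 ^ 6 * (schwartz_norm 6 f * ?J) * decay6 \<zeta>))"
      unfolding norm_mult by (intro mult_left_mono mult_mono c ff f) auto
    then show ?thesis by (simp only: mult_ac mult_1)
  qed
  have fm: "(\<lambda>\<zeta>. fourier f (- \<zeta>)) \<in> borel_measurable borel" if "f \<in> schwartz" for f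
  proof -
    have [measurable]: "fourier f \<in> borel_measurable borel" by (intro schwartz_measurable schwartz_fourier that)
    show ?thesis by measurable
  qed
  have i: "integrable lborel (\<lambda>\<zeta>. G \<zeta> * (?c * fourier f (- \<zeta>)))" if f: "f \<in> schwartz" for f
  proof (rule Bochner_Integration.integrable_bound)
    show "integrable lborel (\<lambda>\<zeta>. (4 ^ 6 * (schwartz_norm 6 f * ?J)) * (cmod (G \<zeta>) * decay6 \<zeta>))"
      by (intro integrable_mult_right int)
    have [measurable]: "(\<lambda>\<zeta>. fourier f (- \<zeta>)) \<in> borel_measurable borel" by (rule fm[OF f])
    show "(\<lambda>\<zeta>. G \<zeta> * (?c * fourier f (- \<zeta>))) \<in> borel_measurable lborel" by measurable
    show "AE \<zeta> in lborel. norm (G \<zeta> * (?c * fourier f (- \<zeta>))) \<le> norm ((4 ^ 6 * (schwartz_norm 6 f * ?J)) * (cmod (G \<zeta>) * decay6 \<zeta>))"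
    proof (rule AE_I2)
      fix \<zeta>
      show "norm (G \<zeta> * (?c * fourier f (- \<zeta>))) \<le> norm ((4 ^ 6 * (schwartz_norm 6 f * ?J)) * (cmod (G \<zeta>) * decay6 \<zeta>))"
        unfolding real_norm_def by (rule order_trans[OF bd[OF f] abs_ge_self])
    qed
  qed
  have t: "v \<in> tempered" unfolding tempered_def mem_Collect_eq
  proof (intro conjI allI ballI impI)
    show "v f = 0" if "f \<notin> schwartz" for f using that by (simp add: v_def)
    show "v (\<lambda>z. f z + g z) = v f + v g" if f: "f \<in> schwartz" and g: "g \<in> schwartz" for f g
      using f g schwartz_add[OF f g]
      unfolding v_def fourier_add[OF f g] distrib_left by (simp only: if_True Bochner_Integration.integral_add[OF i[OF f] i[OF g]])
    show "v (\<lambda>z. c * f z) = c * v f" if f: "f \<in> schwartz" for f c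
      using f schwartz_cmult[OF f, of c]
      by (simp add: v_def fourier_cmult mult.left_commute flip: integral_mult_right_zero)
    let ?I = "LINT \<zeta>|lborel. cmod (G \<zeta>) * decay6 \<zeta>"
    have "cmod (v f) \<le> (4 ^ 6 * ?J * ?I) * schwartz_norm 6 f" if f: "f \<in> schwartz" for f
    proof -
      have "cmod (v f) \<le> (LINT \<zeta>|lborel. cmod (G \<zeta> * (?c * fourier f (- \<zeta>))))" using f unfolding v_def by (simp only: if_True integral_norm_bound)
      also have "\<dots> \<le> (LINT \<zeta>|lborel. (4 ^ 6 * (schwartz_norm 6 f * ?J)) * (cmod (G \<zeta>) * decay6 \<zeta>))"
        by (intro integral_mono integrable_norm i f integrable_mult_right int bd)
      also have "\<dots> = (4 ^ 6 * (schwartz_norm 6 f * ?J)) * ?I" by (rule integral_mult_right_zero)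
      finally show ?thesis by (simp only: mult_ac)
    qed
    then show "\<exists>C N. \<forall>f\<in>schwartz. cmod (v f) \<le> C * schwartz_norm N f" by blast
  qed
  show "has_fourier v G" unfolding has_fourier_def
  proof (intro conjI ballI t)
    show "G \<in> borel_measurable lborel" by simp
    fix f assume f: "f \<in> schwartz"
    note F = schwartz_fourier[OF f]
    have inv: "?c * fourier (fourier f) (- \<zeta>) = f \<zeta>" for \<zeta>
    proof -
      have "fourier (fourier f) (- \<zeta>) = (LINT z|lborel. cis (\<zeta> \<bullet> z) * fourier f z)"
        unfolding fourier_def[of "fourier f"] by (simp add: inner_commute)
      also have "\<dots> = complex_of_real ((2 * pi) ^ 3) * f \<zeta>" by (rule fourier_inversion[OF f])
      finally show ?thesis by simp
    qed
    show "integrable lborel (\<lambda>\<zeta>. G \<zeta> * f \<zeta>)" using i[OF F] unfolding inv .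
    show "v (fourier f) = (LINT \<zeta>|lborel. G \<zeta> * f \<zeta>)" using F unfolding v_def inv by simp
  qed
qed

section \<open>The norms on the Fourier side\<close>

lemma Xs_FT_measurable [measurable_dest]: "u \<in> Xs \<sigma> s1 s2 b \<Longrightarrow> FT u \<in> borel_measurable borel"
  unfolding Xs_def using has_fourierD(2)[OF has_fourier_FT] by blast

lemma Xs_norm_nonneg: "0 \<le> Xs_norm \<sigma> s1 s2 b u"
  unfolding Xs_norm_def by (intro real_sqrt_ge_zero Bochner_Integration.integral_nonneg) simp

lemma sq_int_weight_FT:
  assumes "u \<in> Xs \<sigma> s1 s2 b"
  shows "sq_int (\<lambda>z. ennreal (weight \<sigma> s1 s2 b z * cmod (FT u z))) = ennreal ((Xs_norm \<sigma> s1 s2 b u)\<^sup>2)"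
proof -
  have i: "integrable lborel (\<lambda>\<zeta>. (weight \<sigma> s1 s2 b \<zeta> * cmod (FT u \<zeta>))\<^sup>2)" using assms by (simp add: Xs_def)
  have "sq_int (\<lambda>z. ennreal (weight \<sigma> s1 s2 b z * cmod (FT u z))) = (\<integral>\<^sup>+z. ennreal ((weight \<sigma> s1 s2 b z * cmod (FT u z))\<^sup>2) \<partial>lborel)"
    unfolding sq_int_def by (intro nn_integral_cong ennreal_power mult_nonneg_nonneg weight_nonneg norm_ge_zero)
  also have "\<dots> = ennreal (LINT \<zeta>|lborel. (weight \<sigma> s1 s2 b \<zeta> * cmod (FT u \<zeta>))\<^sup>2)"
    by (rule nn_integral_eq_integral[OF i]) simp
  also have "(LINT \<zeta>|lborel. (weight \<sigma> s1 s2 b \<zeta> * cmod (FT u \<zeta>))\<^sup>2) = (Xs_norm \<sigma> s1 s2 b u)\<^sup>2"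
    unfolding Xs_norm_def by (intro real_sqrt_pow2[symmetric] Bochner_Integration.integral_nonneg) simp
  finally show ?thesis .
qed

text \<open>Membership and norm only depend on some function representing the Fourier transform, by uniqueness.\<close>

lemma Xs_of_sq_int:
  assumes v: "has_fourier v G" and B: "0 \<le> B"
    and le: "sq_int (\<lambda>z. ennreal (weight \<sigma> s1 s2 b z * cmod (G z))) \<le> ennreal (B\<^sup>2)"
  shows "v \<in> Xs \<sigma> s1 s2 b" "Xs_norm \<sigma> s1 s2 b v \<le> B"
proof -
  let ?k = "\<lambda>\<zeta>. (weight \<sigma> s1 s2 b \<zeta> * cmod (FT v \<zeta>))\<^sup>2"
  have [measurable]: "FT v \<in> borel_measurable borel" by (rule has_fourierD(2)[OF has_fourier_FT[OF v]])
  have km: "?k \<in> borel_measurable lborel" by measurable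
  have "(\<integral>\<^sup>+\<zeta>. ennreal (?k \<zeta>) \<partial>lborel) = sq_int (\<lambda>z. ennreal (weight \<sigma> s1 s2 b z * cmod (G z)))"
    unfolding sq_int_def
  proof (rule nn_integral_cong_AE)
    show "AE \<zeta> in lborel. ennreal (?k \<zeta>) = (ennreal (weight \<sigma> s1 s2 b \<zeta> * cmod (G \<zeta>)))\<^sup>2"
      using FT_eq[OF v]
    proof eventually_elim
      case (elim \<zeta>)
      show ?case unfolding elim by (intro ennreal_power[symmetric] mult_nonneg_nonneg weight_nonneg norm_ge_zero)
    qed
  qed
  with le have le': "(\<integral>\<^sup>+\<zeta>. ennreal (?k \<zeta>) \<partial>lborel) \<le> ennreal (B\<^sup>2)" by simp
  have i: "integrable lborel ?k"
  proof (rule integrableI_bounded[OF km])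
    have "(\<integral>\<^sup>+\<zeta>. ennreal (norm (?k \<zeta>)) \<partial>lborel) = (\<integral>\<^sup>+\<zeta>. ennreal (?k \<zeta>) \<partial>lborel)" by simp
    also have "\<dots> < \<infinity>" using le' by (rule order_le_less_trans) simp
    finally show "(\<integral>\<^sup>+\<zeta>. ennreal (norm (?k \<zeta>)) \<partial>lborel) < \<infinity>" .
  qed
  show "v \<in> Xs \<sigma> s1 s2 b" unfolding Xs_def using v i by blast
  have "ennreal (LINT \<zeta>|lborel. ?k \<zeta>) \<le> ennreal (B\<^sup>2)"
    using le' nn_integral_eq_integral[OF i] by simp
  then have "(LINT \<zeta>|lborel. ?k \<zeta>) \<le> B\<^sup>2" by (simp add: ennreal_le_iff)
  then show "Xs_norm \<sigma> s1 s2 b v \<le> B"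
    unfolding Xs_norm_def using B by (intro real_le_lsqrt) auto
qed

lemma three_squares: "(a + b + c)\<^sup>2 \<le> 3 * (a\<^sup>2 + b\<^sup>2 + c\<^sup>2)" for a b c :: real
proof -
  have "0 \<le> (a - b)\<^sup>2 + (b - c)\<^sup>2 + (c - a)\<^sup>2" by simp
  then show ?thesis by (simp add: power2_eq_square algebra_simps)
qed

text \<open>In the estimate \<open>W_in * \<bar>FT v + FT w\<bar> \<le> W_in * \<bar>FT v\<bar> + W_in * \<bar>FT w\<bar>\<close>, each summand is estimated by the branch of
the minimum \<open>W_in\<close> that belongs to its own space.\<close>

lemma sq_int_W_in_decomp:
  assumes v: "v \<in> Xs 0 s1 s2 (1 - \<epsilon> / 2)"
    and w: "w \<in> Xs (1 / 2 + \<epsilon>) s1 s2 (1 / 2 + \<epsilon> / 2)" "w \<in> Xs (1 / 2 + \<epsilon>) (s1 - 3 * \<epsilon>) s2 (1 / 2 + 3 / 2 * \<epsilon>)"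
  shows "sq_int (\<lambda>z. ennreal (W_in \<epsilon> s1 s2 z) * ennreal (cmod (FT (\<lambda>f. v f + w f) z)))
    \<le> ennreal (3 * (Xs_norm 0 s1 s2 (1 - \<epsilon> / 2) v +
         (Xs_norm (1 / 2 + \<epsilon>) s1 s2 (1 / 2 + \<epsilon> / 2) w + Xs_norm (1 / 2 + \<epsilon>) (s1 - 3 * \<epsilon>) s2 (1 / 2 + 3 / 2 * \<epsilon>) w))\<^sup>2)"
proof -
  let ?wa = "weight 0 s1 s2 (1 - \<epsilon> / 2)" and ?wb = "weight (1 / 2 + \<epsilon>) s1 s2 (1 / 2 + \<epsilon> / 2)"
    and ?wc = "weight (1 / 2 + \<epsilon>) (s1 - 3 * \<epsilon>) s2 (1 / 2 + 3 / 2 * \<epsilon>)"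
  let ?u = "\<lambda>f. v f + w f"
  let ?na = "Xs_norm 0 s1 s2 (1 - \<epsilon> / 2) v" and ?nb = "Xs_norm (1 / 2 + \<epsilon>) s1 s2 (1 / 2 + \<epsilon> / 2) w"
    and ?nc = "Xs_norm (1 / 2 + \<epsilon>) (s1 - 3 * \<epsilon>) s2 (1 / 2 + 3 / 2 * \<epsilon>) w"
  let ?a = "\<lambda>z. ennreal (?wa z * cmod (FT v z))" and ?b = "\<lambda>z. ennreal (?wb z * cmod (FT w z))" and ?c = "\<lambda>z. ennreal (?wc z * cmod (FT w z))"
  have [measurable]: "FT v \<in> borel_measurable borel" "FT w \<in> borel_measurable borel"
    by (rule Xs_FT_measurable[OF v], rule Xs_FT_measurable[OF w(1)])
  obtain F1 F2 where "has_fourier v F1" "has_fourier w F2" using v w unfolding Xs_def by blast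
  then have "has_fourier ?u (\<lambda>\<zeta>. FT v \<zeta> + FT w \<zeta>)" by (intro has_fourier_add has_fourier_FT)
  note eq = FT_eq[OF this]
  have pw: "(ennreal (W_in \<epsilon> s1 s2 z) * ennreal (cmod (FT v z + FT w z)))\<^sup>2 \<le> 3 * ((?a z)\<^sup>2 + (?b z)\<^sup>2 + (?c z)\<^sup>2)" for z
  proof -
    have W: "0 \<le> W_in \<epsilon> s1 s2 z" by (simp add: W_in_def weight_nonneg)
    note nn = weight_nonneg norm_ge_zero mult_nonneg_nonneg
    have "W_in \<epsilon> s1 s2 z * cmod (FT v z + FT w z) \<le> W_in \<epsilon> s1 s2 z * (cmod (FT v z) + cmod (FT w z))"
      by (intro mult_left_mono norm_triangle_ineq W)
    also have "\<dots> = W_in \<epsilon> s1 s2 z * cmod (FT v z) + W_in \<epsilon> s1 s2 z * cmod (FT w z)" by (rule distrib_left)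
    also have "\<dots> \<le> ?wa z * cmod (FT v z) + (?wb z + ?wc z) * cmod (FT w z)"
      unfolding W_in_def by (intro add_mono mult_right_mono) auto
    also have "\<dots> = ?wa z * cmod (FT v z) + ?wb z * cmod (FT w z) + ?wc z * cmod (FT w z)" by (simp only: distrib_right add.assoc)
    finally have "(W_in \<epsilon> s1 s2 z * cmod (FT v z + FT w z))\<^sup>2 \<le> (?wa z * cmod (FT v z) + ?wb z * cmod (FT w z) + ?wc z * cmod (FT w z))\<^sup>2"
      using W by (intro power_mono) auto
    also have "\<dots> \<le> 3 * ((?wa z * cmod (FT v z))\<^sup>2 + (?wb z * cmod (FT w z))\<^sup>2 + (?wc z * cmod (FT w z))\<^sup>2)" by (rule three_squares)
    finally have le: "ennreal ((W_in \<epsilon> s1 s2 z * cmod (FT v z + FT w z))\<^sup>2) \<le> ennreal (3 * ((?wa z * cmod (FT v z))\<^sup>2 + (?wb z * cmod (FT w z))\<^sup>2 + (?wc z * cmod (FT w z))\<^sup>2))"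
      by (rule ennreal_leI)
    have "(ennreal (W_in \<epsilon> s1 s2 z) * ennreal (cmod (FT v z + FT w z)))\<^sup>2 = ennreal ((W_in \<epsilon> s1 s2 z * cmod (FT v z + FT w z))\<^sup>2)"
      unfolding ennreal_mult[OF W norm_ge_zero, symmetric] by (rule ennreal_power) (simp add: W)
    also note le
    also have "ennreal (3 * ((?wa z * cmod (FT v z))\<^sup>2 + (?wb z * cmod (FT w z))\<^sup>2 + (?wc z * cmod (FT w z))\<^sup>2)) = 3 * ((?a z)\<^sup>2 + (?b z)\<^sup>2 + (?c z)\<^sup>2)"
    proof -
      have "ennreal (3 * (x\<^sup>2 + y\<^sup>2 + t\<^sup>2)) = 3 * ((ennreal x)\<^sup>2 + (ennreal y)\<^sup>2 + (ennreal t)\<^sup>2)"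
        if "0 \<le> x" "0 \<le> y" "0 \<le> t" for x y t
        using that by (simp add: ennreal_mult ennreal_plus ennreal_power)
      then show ?thesis by (simp only: nn)
    qed
    finally show ?thesis .
  qed
  have "sq_int (\<lambda>z. ennreal (W_in \<epsilon> s1 s2 z) * ennreal (cmod (FT ?u z))) = sq_int (\<lambda>z. ennreal (W_in \<epsilon> s1 s2 z) * ennreal (cmod (FT v z + FT w z)))"
    unfolding sq_int_def
  proof (rule nn_integral_cong_AE)
    show "AE z in lborel. (ennreal (W_in \<epsilon> s1 s2 z) * ennreal (cmod (FT ?u z)))\<^sup>2 = (ennreal (W_in \<epsilon> s1 s2 z) * ennreal (cmod (FT v z + FT w z)))\<^sup>2"
      using eq by eventually_elim simp
  qed
  also have "\<dots> \<le> (\<integral>\<^sup>+z. 3 * ((?a z)\<^sup>2 + (?b z)\<^sup>2 + (?c z)\<^sup>2) \<partial>lborel)"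
    unfolding sq_int_def by (intro nn_integral_mono pw)
  also have "\<dots> = 3 * (\<integral>\<^sup>+z. (?a z)\<^sup>2 + (?b z)\<^sup>2 + (?c z)\<^sup>2 \<partial>lborel)"
    by (rule nn_integral_cmult) measurable
  also have "(\<integral>\<^sup>+z. (?a z)\<^sup>2 + (?b z)\<^sup>2 + (?c z)\<^sup>2 \<partial>lborel) = sq_int ?a + sq_int ?b + sq_int ?c"
    unfolding sq_int_def by (subst nn_integral_add, measurable, subst nn_integral_add) auto
  also have "3 * (sq_int ?a + sq_int ?b + sq_int ?c) = ennreal (3 * (?na\<^sup>2 + ?nb\<^sup>2 + ?nc\<^sup>2))"
    unfolding sq_int_weight_FT[OF v] sq_int_weight_FT[OF w(1)] sq_int_weight_FT[OF w(2)]
    by (simp add: ennreal_mult ennreal_plus)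
  also have "\<dots> \<le> ennreal (3 * (?na + (?nb + ?nc))\<^sup>2)"
  proof (rule ennreal_leI)
    have "a\<^sup>2 + b\<^sup>2 + c\<^sup>2 \<le> (a + (b + c))\<^sup>2" if "0 \<le> a" "0 \<le> b" "0 \<le> c" for a b c :: real
      using mult_nonneg_nonneg[OF that(1,2)] mult_nonneg_nonneg[OF that(1,3)] mult_nonneg_nonneg[OF that(2,3)]
      by (simp add: power2_eq_square algebra_simps)
    from this[OF Xs_norm_nonneg Xs_norm_nonneg Xs_norm_nonneg]
    show "3 * (?na\<^sup>2 + ?nb\<^sup>2 + ?nc\<^sup>2) \<le> 3 * (?na + (?nb + ?nc))\<^sup>2" by (intro mult_left_mono) auto
  qed
  finally show ?thesis .
qed

lemma X_norm_nonneg: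
  assumes "u \<in> X s1 s2 \<epsilon> \<sigma> b b'" shows "0 \<le> X_norm s1 s2 \<epsilon> \<sigma> b b' u"
  unfolding X_norm_def sum_norm_def
proof (rule cInf_greatest)
  show "{X1_norm s1 s2 b b' v + X2_norm s1 s2 \<epsilon> \<sigma> b w | v w. v \<in> X1 s1 s2 b b' \<and> w \<in> X2 s1 s2 \<epsilon> \<sigma> b \<and> u = (\<lambda>f. v f + w f)} \<noteq> {}"
    using assms unfolding X_def sum_space_def by blast
  fix x assume "x \<in> {X1_norm s1 s2 b b' v + X2_norm s1 s2 \<epsilon> \<sigma> b w | v w. v \<in> X1 s1 s2 b b' \<and> w \<in> X2 s1 s2 \<epsilon> \<sigma> b \<and> u = (\<lambda>f. v f + w f)}"
  then obtain v w where "x = X1_norm s1 s2 b b' v + X2_norm s1 s2 \<epsilon> \<sigma> b w" by blast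
  then show "0 \<le> x" by (simp add: X1_norm_def X2_norm_def Xs_norm_nonneg)
qed

text \<open>The norm of \<open>X\<close> is an infimum that need not be attained, so the bound is stated for every larger number.\<close>

lemma sq_int_W_in_X:
  assumes u: "u \<in> X s1 s2 \<epsilon> (1 / 2 + \<epsilon>) (1 / 2 + \<epsilon> / 2) (- 1 / 2 + \<epsilon>)"
    and t: "X_norm s1 s2 \<epsilon> (1 / 2 + \<epsilon>) (1 / 2 + \<epsilon> / 2) (- 1 / 2 + \<epsilon>) u < t"
  shows "sq_int (\<lambda>z. ennreal (W_in \<epsilon> s1 s2 z) * ennreal (cmod (FT u z))) \<le> ennreal (3 * t\<^sup>2)"
proof -
  let ?b = "1 / 2 + \<epsilon> / 2" and ?b' = "- 1 / 2 + \<epsilon>" and ?\<sigma> = "1 / 2 + \<epsilon>"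
  let ?S = "{X1_norm s1 s2 ?b ?b' v + X2_norm s1 s2 \<epsilon> ?\<sigma> ?b w | v w. v \<in> X1 s1 s2 ?b ?b' \<and> w \<in> X2 s1 s2 \<epsilon> ?\<sigma> ?b \<and> u = (\<lambda>f. v f + w f)}"
  have ne: "?S \<noteq> {}" using u unfolding X_def sum_space_def by blast
  have "Inf ?S < t" using t unfolding X_norm_def sum_norm_def .
  from cInf_lessD[OF ne this] obtain v w where v: "v \<in> X1 s1 s2 ?b ?b'" and w: "w \<in> X2 s1 s2 \<epsilon> ?\<sigma> ?b" and ue: "u = (\<lambda>f. v f + w f)"
    and le: "X1_norm s1 s2 ?b ?b' v + X2_norm s1 s2 \<epsilon> ?\<sigma> ?b w < t" by blast
  have e: "?b - ?b' = 1 - \<epsilon> / 2" "?b + \<epsilon> = 1 / 2 + 3 / 2 * \<epsilon>" by (auto simp: field_simps)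
  note v = v[unfolded X1_def e] and w = w[unfolded X2_def e Int_iff] and le = le[unfolded X1_norm_def X2_norm_def e]
  show ?thesis unfolding ue
    by (rule order_trans[OF sq_int_W_in_decomp[OF v conjunct1[OF w] conjunct2[OF w]]])
      (intro ennreal_leI mult_left_mono power_mono less_imp_le[OF le] add_nonneg_nonneg Xs_norm_nonneg; simp)
qed

text \<open>A bilinear estimate for normalized functions scales to arbitrary ones.\<close>

lemma bilinear_homogeneous:
  assumes C: "\<And>F1 F2. F1 \<in> borel_measurable borel \<Longrightarrow> F2 \<in> borel_measurable borel \<Longrightarrow>
       sq_int (\<lambda>z. W z * F1 z) \<le> 1 \<Longrightarrow> sq_int (\<lambda>z. W z * F2 z) \<le> 1 \<Longrightarrow>
       sq_int (\<lambda>\<zeta>. m \<zeta> * (\<integral>\<^sup>+z. F1 z * F2 (\<zeta> - z) \<partial>lborel)) \<le> ennreal C"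
    and [measurable]: "W \<in> borel_measurable borel" "m \<in> borel_measurable borel" "F1 \<in> borel_measurable borel" "F2 \<in> borel_measurable borel"
    and a: "0 < a1" "sq_int (\<lambda>z. W z * F1 z) \<le> ennreal (a1\<^sup>2)" and b: "0 < a2" "sq_int (\<lambda>z. W z * F2 z) \<le> ennreal (a2\<^sup>2)"
    and "0 \<le> C"
  shows "sq_int (\<lambda>\<zeta>. m \<zeta> * (\<integral>\<^sup>+z. F1 z * F2 (\<zeta> - z) \<partial>lborel)) \<le> ennreal (C * (a1 * a2)\<^sup>2)"
proof -
  have norm: "sq_int (\<lambda>z. W z * (ennreal (1 / a) * F z)) \<le> 1"
    if [measurable]: "F \<in> borel_measurable borel" and a: "0 < a" and le: "sq_int (\<lambda>z. W z * F z) \<le> ennreal (a\<^sup>2)" for F a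
  proof -
    have "sq_int (\<lambda>z. W z * (ennreal (1 / a) * F z)) = (ennreal (1 / a))\<^sup>2 * sq_int (\<lambda>z. W z * F z)"
      unfolding mult.left_commute[of "W _"] by (rule sq_int_cmult) measurable
    also have "\<dots> \<le> (ennreal (1 / a))\<^sup>2 * ennreal (a\<^sup>2)" by (intro mult_left_mono le) simp
    also have "\<dots> = ennreal ((1 / a)\<^sup>2 * a\<^sup>2)" using a by (simp add: ennreal_power ennreal_mult)
    also have "(1 / a)\<^sup>2 * a\<^sup>2 = 1" using a by (simp add: power_divide)
    finally show ?thesis by simp
  qed
  define conv where "conv = (\<lambda>\<zeta>. \<integral>\<^sup>+z. F1 z * F2 (\<zeta> - z) \<partial>lborel)"
  have cm [measurable]: "conv \<in> borel_measurable borel"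
    unfolding conv_def by (rule lborel.borel_measurable_nn_integral) measurable
  have e: "(\<integral>\<^sup>+z. (ennreal (1 / a1) * F1 z) * (ennreal (1 / a2) * F2 (\<zeta> - z)) \<partial>lborel) = ennreal (1 / (a1 * a2)) * conv \<zeta>" for \<zeta>
  proof -
    have "(ennreal (1 / a1) * F1 z) * (ennreal (1 / a2) * F2 (\<zeta> - z)) = ennreal (1 / (a1 * a2)) * (F1 z * F2 (\<zeta> - z))" for z
    proof -
      have "ennreal (1 / (a1 * a2)) = ennreal (1 / a1) * ennreal (1 / a2)" using a(1) b(1) by (simp flip: ennreal_mult)
      then show ?thesis by (simp only: mult_ac)
    qed
    then show ?thesis unfolding conv_def by (simp add: nn_integral_cmult)
  qed
  have "sq_int (\<lambda>\<zeta>. m \<zeta> * (\<integral>\<^sup>+z. (ennreal (1 / a1) * F1 z) * (ennreal (1 / a2) * F2 (\<zeta> - z)) \<partial>lborel)) \<le> ennreal C"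
  proof (rule C)
    show "(\<lambda>z. ennreal (1 / a1) * F1 z) \<in> borel_measurable borel" by measurable
    show "(\<lambda>z. ennreal (1 / a2) * F2 z) \<in> borel_measurable borel" by measurable
    show "sq_int (\<lambda>z. W z * (ennreal (1 / a1) * F1 z)) \<le> 1" by (intro norm a) measurable
    show "sq_int (\<lambda>z. W z * (ennreal (1 / a2) * F2 z)) \<le> 1" by (intro norm b) measurable
  qed
  then have "sq_int (\<lambda>\<zeta>. ennreal (1 / (a1 * a2)) * (m \<zeta> * conv \<zeta>)) \<le> ennreal C" unfolding e mult.left_commute[of "m _"] .
  moreover have "sq_int (\<lambda>\<zeta>. ennreal (1 / (a1 * a2)) * (m \<zeta> * conv \<zeta>)) = (ennreal (1 / (a1 * a2)))\<^sup>2 * sq_int (\<lambda>\<zeta>. m \<zeta> * conv \<zeta>)"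
    by (rule sq_int_cmult) measurable
  ultimately have le: "(ennreal (1 / (a1 * a2)))\<^sup>2 * sq_int (\<lambda>\<zeta>. m \<zeta> * conv \<zeta>) \<le> ennreal C" by simp
  have p: "0 < a1 * a2" using a b by simp
  have "sq_int (\<lambda>\<zeta>. m \<zeta> * conv \<zeta>) = ennreal ((a1 * a2)\<^sup>2 * (1 / (a1 * a2))\<^sup>2) * sq_int (\<lambda>\<zeta>. m \<zeta> * conv \<zeta>)"
  proof -
    have "(a1 * a2)\<^sup>2 * (1 / (a1 * a2))\<^sup>2 = 1" unfolding power_mult_distrib[symmetric] using a(1) b(1) by simp
    then show ?thesis by (simp only: ennreal_1 mult_1)
  qed
  also have "\<dots> = ennreal ((a1 * a2)\<^sup>2) * ((ennreal (1 / (a1 * a2)))\<^sup>2 * sq_int (\<lambda>\<zeta>. m \<zeta> * conv \<zeta>))"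
    using p by (simp only: ennreal_mult zero_le_power2 ennreal_power zero_le_divide_1_iff less_imp_le mult.assoc)
  also have "\<dots> \<le> ennreal ((a1 * a2)\<^sup>2) * ennreal C" by (intro mult_left_mono le) simp
  also have "\<dots> = ennreal (C * (a1 * a2)\<^sup>2)" using \<open>0 \<le> C\<close> by (simp add: ennreal_mult mult.commute)
  finally show ?thesis unfolding conv_def .
qed

lemma X_FT:
  assumes "u \<in> X s1 s2 \<epsilon> \<sigma> b b'" shows "has_fourier u (FT u)"
proof -
  obtain v w where u: "u = (\<lambda>f. v f + w f)" and "v \<in> X1 s1 s2 b b'" "w \<in> X2 s1 s2 \<epsilon> \<sigma> b"
    using assms unfolding X_def sum_space_def by blast
  then obtain F1 F2 where "has_fourier v F1" "has_fourier w F2"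
    unfolding X1_def X2_def Xs_def by blast
  then have "has_fourier u (\<lambda>\<zeta>. F1 \<zeta> + F2 \<zeta>)" unfolding u by (rule has_fourier_add)
  then show ?thesis by (rule has_fourier_FT)
qed

section \<open>The convolution estimate\<close>

definition conv_abs :: "(r3 \<Rightarrow> complex) \<Rightarrow> (r3 \<Rightarrow> complex) \<Rightarrow> r3 \<Rightarrow> ennreal" where
  "conv_abs F1 F2 \<zeta> = (\<integral>\<^sup>+z. ennreal (cmod (F1 z)) * ennreal (cmod (F2 (\<zeta> - z))) \<partial>lborel)"

text \<open>The estimate holds with numbers \<open>N u1 + \<delta>\<close>, \<open>N u2 + \<delta>\<close> in place of the norms for all \<open>\<delta> > 0\<close>; adding \<open>\<delta>\<close> also
takes care of norms that vanish. At the end \<open>\<delta>\<close> tends to \<open>0\<close>.\<close>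

theorem convolution_bound:
  assumes E: "0 < \<epsilon>" "\<epsilon> < 1 / 100" and s: "- 1 / 2 + 8 * \<epsilon> \<le> s1" "0 \<le> s2"
  defines "\<X> \<equiv> X s1 s2 \<epsilon> (1 / 2 + \<epsilon>) (1 / 2 + \<epsilon> / 2) (- 1 / 2 + \<epsilon>)"
    and "N \<equiv> X_norm s1 s2 \<epsilon> (1 / 2 + \<epsilon>) (1 / 2 + \<epsilon> / 2) (- 1 / 2 + \<epsilon>)"
  obtains C where "0 < C"
    and "\<And>u1 u2. u1 \<in> \<X> \<Longrightarrow> u2 \<in> \<X> \<Longrightarrow>
      sq_int (\<lambda>\<zeta>. ennreal (m_out \<epsilon> s1 s2 \<zeta>) * conv_abs (FT u1) (FT u2) \<zeta>) \<le> ennreal ((C * N u1 * N u2)\<^sup>2)"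
proof -
  from bilinear_weighted[OF E s] obtain C where C: "0 < C"
    and bil: "\<And>F1 F2. F1 \<in> borel_measurable borel \<Longrightarrow> F2 \<in> borel_measurable borel \<Longrightarrow>
       sq_int (\<lambda>z. ennreal (W_in \<epsilon> s1 s2 z) * F1 z) \<le> 1 \<Longrightarrow> sq_int (\<lambda>z. ennreal (W_in \<epsilon> s1 s2 z) * F2 z) \<le> 1 \<Longrightarrow>
       sq_int (\<lambda>\<zeta>. ennreal (m_out \<epsilon> s1 s2 \<zeta>) * (\<integral>\<^sup>+z. F1 z * F2 (\<zeta> - z) \<partial>lborel)) \<le> ennreal C" by blast
  show thesis
  proof (rule that)
    show "0 < 3 * sqrt C" using C by simp
    fix u1 u2 assume u: "u1 \<in> \<X>" "u2 \<in> \<X>"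
    let ?I = "sq_int (\<lambda>\<zeta>. ennreal (m_out \<epsilon> s1 s2 \<zeta>) * conv_abs (FT u1) (FT u2) \<zeta>)"
    have [measurable]: "FT u1 \<in> borel_measurable borel" "FT u2 \<in> borel_measurable borel"
      using u unfolding \<X>_def by (auto intro!: has_fourierD(2) X_FT)
    have N0: "0 \<le> N u1" "0 \<le> N u2" using u unfolding \<X>_def N_def by (auto intro: X_norm_nonneg)
    have d: "?I \<le> ennreal (C * ((sqrt 3 * (N u1 + \<delta>)) * (sqrt 3 * (N u2 + \<delta>)))\<^sup>2)" if "0 < \<delta>" for \<delta>
      unfolding conv_abs_def
    proof (rule bilinear_homogeneous[OF bil])
      have X: "sq_int (\<lambda>z. ennreal (W_in \<epsilon> s1 s2 z) * ennreal (cmod (FT u z))) \<le> ennreal ((sqrt 3 * (N u + \<delta>))\<^sup>2)" if "u \<in> \<X>" for u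
      proof -
        have "N u < N u + \<delta>" using \<open>0 < \<delta>\<close> by simp
        from sq_int_W_in_X[OF that[unfolded \<X>_def] this[unfolded N_def]] show ?thesis
          unfolding N_def power_mult_distrib by simp
      qed
      show "sq_int (\<lambda>z. ennreal (W_in \<epsilon> s1 s2 z) * ennreal (cmod (FT u1 z))) \<le> ennreal ((sqrt 3 * (N u1 + \<delta>))\<^sup>2)" by (rule X[OF u(1)])
      show "sq_int (\<lambda>z. ennreal (W_in \<epsilon> s1 s2 z) * ennreal (cmod (FT u2 z))) \<le> ennreal ((sqrt 3 * (N u2 + \<delta>))\<^sup>2)" by (rule X[OF u(2)])
      show "0 < sqrt 3 * (N u1 + \<delta>)" "0 < sqrt 3 * (N u2 + \<delta>)" "0 \<le> C" using N0 that C by auto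
      show "(\<lambda>z. ennreal (W_in \<epsilon> s1 s2 z)) \<in> borel_measurable borel" by measurable
      show "(\<lambda>z. ennreal (m_out \<epsilon> s1 s2 z)) \<in> borel_measurable borel" by measurable
      show "(\<lambda>z. ennreal (cmod (FT u1 z))) \<in> borel_measurable borel" by measurable
      show "(\<lambda>z. ennreal (cmod (FT u2 z))) \<in> borel_measurable borel" by measurable
    qed
    have "(\<lambda>n. C * ((sqrt 3 * (N u1 + 1 / real (Suc n))) * (sqrt 3 * (N u2 + 1 / real (Suc n))))\<^sup>2)
        \<longlonglongrightarrow> C * ((sqrt 3 * (N u1 + 0)) * (sqrt 3 * (N u2 + 0)))\<^sup>2"
      by (intro tendsto_intros LIMSEQ_inverse_real_of_nat[unfolded inverse_eq_divide])
    then have "(\<lambda>n. ennreal (C * ((sqrt 3 * (N u1 + 1 / real (Suc n))) * (sqrt 3 * (N u2 + 1 / real (Suc n))))\<^sup>2))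
        \<longlonglongrightarrow> ennreal (C * ((sqrt 3 * (N u1 + 0)) * (sqrt 3 * (N u2 + 0)))\<^sup>2)" by (rule tendsto_ennrealI)
    moreover have "?I \<le> ennreal (C * ((sqrt 3 * (N u1 + 1 / real (Suc n))) * (sqrt 3 * (N u2 + 1 / real (Suc n))))\<^sup>2)" for n
      by (rule d) simp
    ultimately have "?I \<le> ennreal (C * ((sqrt 3 * (N u1 + 0)) * (sqrt 3 * (N u2 + 0)))\<^sup>2)"
      by (intro LIMSEQ_le_const) auto
    also have "C * ((sqrt 3 * (N u1 + 0)) * (sqrt 3 * (N u2 + 0)))\<^sup>2 = (3 * sqrt C * N u1 * N u2)\<^sup>2"
      using C by (simp add: power_mult_distrib)
    finally show "?I \<le> ennreal ((3 * sqrt C * N u1 * N u2)\<^sup>2)" .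
  qed
qed

text \<open>For \<open>\<xi> \<noteq> 0\<close> the inverse weight squared is at most
\<open>\<bar>\<xi>\<bar> powr (1 + 2 * \<epsilon>) * \<langle>lam\<rangle> powr (1 - 2 * \<epsilon>)\<close>. The modulation is singular at \<open>\<xi> = 0\<close>, but \<open>\<bar>\<xi>\<bar> * \<langle>lam\<rangle>\<close> is bounded by a
polynomial, and there are enough powers of \<open>\<bar>\<xi>\<bar>\<close> to complete \<open>\<langle>lam\<rangle>\<close> to such a product.\<close>

lemma weight_out_lower:
  assumes E: "0 < \<epsilon>" "\<epsilon> < 1 / 100" and s: "- 1 / 2 + 8 * \<epsilon> \<le> s1" "0 \<le> s2" and nz: "fst z \<noteq> 0"
  shows "(decay6 z / weight (1 / 2 + \<epsilon>) s1 s2 (- 1 / 2 + \<epsilon>) z)\<^sup>2 \<le> 6 * decay6 z"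
proof -
  obtain x y t where z: "z = (x, y, t)" by (cases z)
  define N where "N = 1 + norm z"
  have x0: "x \<noteq> 0" using nz z by simp
  have co: "\<bar>x\<bar> \<le> N" "\<bar>y\<bar> \<le> N" "\<bar>t\<bar> \<le> N" using norm_r3_ge(1)[of x y t] norm_r3_ge(2)[of y x t] norm_r3_ge(3)[of t x y] unfolding N_def z by auto
  have N1: "1 \<le> N" by (simp add: N_def)
  define L where "L = bracket (t - phi x y)"
  have L1: "1 \<le> L" by (simp add: L_def bracket_def)
  have xL: "\<bar>x\<bar> * L \<le> 5 * N ^ 4"
  proof -
    have "x * (t - phi x y) = x * t - x ^ 4 + (y\<^sup>2 + 1)" using x0 by (simp add: phi_def field_simps power2_eq_square power4_eq_xxxx power3_eq_cube)
    then have "\<bar>x\<bar> * L = \<bar>x\<bar> + \<bar>x * t - x ^ 4 + (y\<^sup>2 + 1)\<bar>" unfolding L_def bracket_def by (simp add: distrib_left flip: abs_mult)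
    also have "\<dots> \<le> \<bar>x\<bar> + (\<bar>x\<bar> * \<bar>t\<bar> + \<bar>x\<bar> ^ 4 + (\<bar>y\<bar> ^ 2 + 1))"
    proof -
      have "\<bar>a - b + (c + 1)\<bar> \<le> \<bar>a\<bar> + b + (c + 1)" if "0 \<le> b" "0 \<le> c" for a b c :: real using that by linarith
      from this[of "x ^ 4" "y\<^sup>2" "x * t"] show ?thesis by (simp add: abs_mult power_even_abs)
    qed
    also have "\<dots> \<le> N ^ 4 + (N ^ 4 + N ^ 4 + (N ^ 4 + N ^ 4))"
    proof (intro add_mono)
      have p: "N ^ k \<le> N ^ 4" if "k \<le> 4" for k using that N1 by (rule power_increasing)
      show "\<bar>x\<bar> \<le> N ^ 4" using co(1) p[of 1] by simp
      have "\<bar>x\<bar> * \<bar>t\<bar> \<le> N * N" using co by (intro mult_mono) auto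
      also have "\<dots> \<le> N ^ 4" using p[of 2] by (simp add: power2_eq_square)
      finally show "\<bar>x\<bar> * \<bar>t\<bar> \<le> N ^ 4" .
      show "\<bar>x\<bar> ^ 4 \<le> N ^ 4" using co by (intro power_mono) auto
      have "\<bar>y\<bar> ^ 2 \<le> N ^ 2" using co by (intro power_mono) auto
      then show "\<bar>y\<bar> ^ 2 \<le> N ^ 4" using p[of 2] by linarith
      show "1 \<le> N ^ 4" using N1 by (rule one_le_power)
    qed
    finally show ?thesis by simp
  qed
  let ?w = "weight (1 / 2 + \<epsilon>) s1 s2 (- 1 / 2 + \<epsilon>) z"
  have w: "\<bar>x\<bar> powr (- (1 / 2 + \<epsilon>)) * L powr (- 1 / 2 + \<epsilon>) \<le> ?w"
  proof -
    have "1 \<le> bracket x powr (s1 + (1 / 2 + \<epsilon>))" "1 \<le> bracket y powr s2"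
      using E s by (auto intro!: ge_one_powr_ge_zero simp: bracket_def)
    then have "1 * \<bar>x\<bar> powr (- (1 / 2 + \<epsilon>)) * 1 * L powr (- 1 / 2 + \<epsilon>) \<le> ?w"
      unfolding weight_def z prod.case L_def by (intro mult_mono mult_right_mono) auto
    then show ?thesis by simp
  qed
  have wp: "0 < \<bar>x\<bar> powr (- (1 / 2 + \<epsilon>)) * L powr (- 1 / 2 + \<epsilon>)" using x0 L1 by simp
  have "1 / ?w \<le> 1 / (\<bar>x\<bar> powr (- (1 / 2 + \<epsilon>)) * L powr (- 1 / 2 + \<epsilon>))" using w wp by (intro divide_left_mono) auto
  also have "\<dots> = \<bar>x\<bar> powr (1 / 2 + \<epsilon>) * L powr (1 / 2 - \<epsilon>)"
  proof -
    have "L powr (- 1 / 2 + \<epsilon>) = inverse (L powr (1 / 2 - \<epsilon>))" by (simp flip: powr_minus)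
    moreover have "\<bar>x\<bar> powr (- (1 / 2 + \<epsilon>)) = inverse (\<bar>x\<bar> powr (1 / 2 + \<epsilon>))" by (rule powr_minus)
    ultimately show ?thesis by (simp add: field_simps)
  qed
  finally have "(1 / ?w)\<^sup>2 \<le> (\<bar>x\<bar> powr (1 / 2 + \<epsilon>) * L powr (1 / 2 - \<epsilon>))\<^sup>2"
    by (intro power_mono) (auto simp: weight_nonneg)
  also have "\<dots> = (\<bar>x\<bar> * L) powr (1 - 2 * \<epsilon>) * \<bar>x\<bar> powr (4 * \<epsilon>)"
  proof -
    have "(\<bar>x\<bar> powr (1 / 2 + \<epsilon>) * L powr (1 / 2 - \<epsilon>))\<^sup>2 = \<bar>x\<bar> powr ((1 - 2 * \<epsilon>) + 4 * \<epsilon>) * L powr (1 - 2 * \<epsilon>)"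
      unfolding power_mult_distrib power2_eq_square[of "_ powr _"] powr_add[symmetric] by (simp add: algebra_simps)
    also have "\<dots> = (\<bar>x\<bar> * L) powr (1 - 2 * \<epsilon>) * \<bar>x\<bar> powr (4 * \<epsilon>)"
      using L1 by (simp only: powr_add powr_mult) simp
    finally show ?thesis .
  qed
  also have "\<dots> \<le> (5 * N ^ 4) powr (1 - 2 * \<epsilon>) * N powr (4 * \<epsilon>)"
    using E L1 by (intro mult_mono powr_mono2 xL co(1)) auto
  also have "\<dots> \<le> (5 * N ^ 4) powr 1 * N powr 1"
  proof -
    have "1 \<le> N ^ 4" using N1 by (rule one_le_power)
    then have "1 \<le> 5 * N ^ 4" by linarith
    then show ?thesis using N1 E by (intro mult_mono powr_mono) auto
  qed
  also have "\<dots> = 5 * N ^ 5"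
  proof -
    have N: "0 < N" using N1 by linarith
    then have "0 < N ^ 4" by (rule zero_less_power)
    then show ?thesis using N by (simp add: eval_nat_numeral)
  qed
  also have "\<dots> \<le> 6 * N ^ 6" using N1 by (intro mult_mono power_increasing) auto
  finally have k: "(1 / ?w)\<^sup>2 \<le> 6 * N ^ 6" .
  have "(decay6 z / ?w)\<^sup>2 = (decay6 z)\<^sup>2 * (1 / ?w)\<^sup>2" by (simp add: power_divide)
  also have "\<dots> \<le> (decay6 z)\<^sup>2 * (6 * N ^ 6)" by (intro mult_left_mono k) simp
  also have "\<dots> = 6 * decay6 z"
  proof -
    have "decay6 z * N ^ 6 = 1" using N1 by (simp add: decay6_def flip: N_def)
    then show ?thesis by (simp add: power2_eq_square mult.assoc)
  qed
  finally show ?thesis .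
qed

text \<open>By the arithmetic-geometric inequality \<open>\<bar>G\<bar> * decay6\<close> is at most \<open>(w * \<bar>G\<bar>)\<^sup>2 + (decay6 / w)\<^sup>2\<close>, and both terms are
integrable.\<close>

lemma has_fourier_exists_weighted:
  assumes E: "0 < \<epsilon>" "\<epsilon> < 1 / 100" and s: "- 1 / 2 + 8 * \<epsilon> \<le> s1" "0 \<le> s2"
    and [measurable]: "G \<in> borel_measurable borel"
    and fin: "sq_int (\<lambda>z. ennreal (weight (1 / 2 + \<epsilon>) s1 s2 (- 1 / 2 + \<epsilon>) z * cmod (G z))) < \<infinity>"
  obtains v where "has_fourier v G"
proof (rule has_fourier_exists)
  let ?w = "weight (1 / 2 + \<epsilon>) s1 s2 (- 1 / 2 + \<epsilon>)"
  show "G \<in> borel_measurable borel" by measurable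
  show "integrable lborel (\<lambda>\<zeta>. cmod (G \<zeta>) * decay6 \<zeta>)"
  proof (rule Bochner_Integration.integrable_bound)
    have m: "(\<lambda>z. (?w z * cmod (G z))\<^sup>2) \<in> borel_measurable lborel" by measurable
    have "(\<integral>\<^sup>+z. ennreal (norm ((?w z * cmod (G z))\<^sup>2)) \<partial>lborel) = sq_int (\<lambda>z. ennreal (?w z * cmod (G z)))"
      unfolding sq_int_def by (intro nn_integral_cong) (simp add: ennreal_power weight_nonneg)
    with fin have "integrable lborel (\<lambda>z. (?w z * cmod (G z))\<^sup>2)" by (intro integrableI_bounded m) simp
    then show "integrable lborel (\<lambda>z. (?w z * cmod (G z))\<^sup>2 + 6 * decay6 z)"
      by (intro Bochner_Integration.integrable_add integrable_mult_right integrable_decay6)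
    show "(\<lambda>\<zeta>. cmod (G \<zeta>) * decay6 \<zeta>) \<in> borel_measurable lborel" by measurable
    show "AE \<zeta> in lborel. norm (cmod (G \<zeta>) * decay6 \<zeta>) \<le> norm ((?w \<zeta> * cmod (G \<zeta>))\<^sup>2 + 6 * decay6 \<zeta>)"
      using AE_fst_neq_0[of 0]
    proof eventually_elim
      case (elim \<zeta>)
      have am: "a * b \<le> a\<^sup>2 + b\<^sup>2" if "0 \<le> a" "0 \<le> b" for a b :: real
        using mult_nonneg_nonneg[OF that] zero_le_power2[of "a - b"] unfolding power2_diff by linarith
      have j: "0 \<le> decay6 \<zeta>" using decay6_pos[of \<zeta>] by simp
      have "cmod (G \<zeta>) * decay6 \<zeta> = (?w \<zeta> * cmod (G \<zeta>)) * (decay6 \<zeta> / ?w \<zeta>)"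
        using weight_pos[OF elim, of "1 / 2 + \<epsilon>" s1 s2 "- 1 / 2 + \<epsilon>"] by simp
      also have "\<dots> \<le> (?w \<zeta> * cmod (G \<zeta>))\<^sup>2 + (decay6 \<zeta> / ?w \<zeta>)\<^sup>2"
        using j by (intro am) (auto simp: weight_nonneg)
      also have "\<dots> \<le> (?w \<zeta> * cmod (G \<zeta>))\<^sup>2 + 6 * decay6 \<zeta>"
        by (intro add_left_mono weight_out_lower E s elim)
      finally show ?case using j by simp
    qed
  qed
qed (rule that)

section \<open>The bilinear estimate\<close>

text \<open>A function whose weighted square is integrable is finite almost everywhere, as the weight is positive off
the plane \<open>\<xi> = 0\<close>.\<close>

lemma AE_integrable_convolution:
  assumes [measurable]: "F1 \<in> borel_measurable borel" "F2 \<in> borel_measurable borel" "m \<in> borel_measurable borel"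
    and pos: "\<And>\<zeta>. fst \<zeta> \<noteq> 0 \<Longrightarrow> 0 < m \<zeta>"
    and fin: "sq_int (\<lambda>\<zeta>. ennreal (m \<zeta>) * conv_abs F1 F2 \<zeta>) < \<infinity>"
  shows "AE \<zeta> in lborel. integrable lborel (\<lambda>z. F1 z * F2 (\<zeta> - z))"
proof -
  have [measurable]: "conv_abs F1 F2 \<in> borel_measurable borel"
    unfolding conv_abs_def[abs_def] by (rule measurable_inner_nn_integral) measurable
  have "AE \<zeta> in lborel. (ennreal (m \<zeta>) * conv_abs F1 F2 \<zeta>)\<^sup>2 \<noteq> \<infinity>"
    by (rule nn_integral_PInf_AE) (use fin in \<open>auto simp: sq_int_def\<close>)
  with AE_fst_neq_0[of 0] show ?thesis
  proof eventually_elim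
    case (elim \<zeta>)
    have "conv_abs F1 F2 \<zeta> \<noteq> \<infinity>"
    proof
      assume "conv_abs F1 F2 \<zeta> = \<infinity>"
      then have "ennreal (m \<zeta>) * conv_abs F1 F2 \<zeta> = \<infinity>" using pos[OF elim(1)] by (simp add: ennreal_mult_top)
      then show False using elim(2) by simp
    qed
    then show ?case
      by (intro integrableI_bounded) (auto simp: conv_abs_def norm_mult ennreal_mult less_top)
  qed
qed

lemma norm_convolution_le: "ennreal (cmod (LINT z|lborel. F1 z * F2 (\<zeta> - z))) \<le> conv_abs F1 F2 \<zeta>"
proof (cases "integrable lborel (\<lambda>z. F1 z * F2 (\<zeta> - z))")
  case True
  from integral_norm_bound_ennreal[OF this] show ?thesis
    by (simp add: conv_abs_def norm_mult ennreal_mult)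
next
  case False
  then show ?thesis by (simp add: not_integrable_integral_eq)
qed

lemma zero_in_Xs: "(\<lambda>f. 0) \<in> Xs \<sigma> s1 s2 b" "Xs_norm \<sigma> s1 s2 b (\<lambda>f. 0) = 0"
proof -
  note 0 = Xs_of_sq_int[OF has_fourier_zero order_refl, of \<sigma> s1 s2 b]
  have "sq_int (\<lambda>z. ennreal (weight \<sigma> s1 s2 b z * cmod 0)) \<le> ennreal (0\<^sup>2)" by (simp add: sq_int_def)
  note 0 = 0[OF this]
  show "(\<lambda>f. 0) \<in> Xs \<sigma> s1 s2 b" by (rule 0(1))
  show "Xs_norm \<sigma> s1 s2 b (\<lambda>f. 0) = 0" using 0(2) Xs_norm_nonneg by (rule antisym)
qed

text \<open>The decomposition with first summand \<open>0\<close> is admissible in the infimum.\<close>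

lemma Xt_of_Xt2:
  assumes v: "v \<in> Xt2 s1 s2 \<epsilon> \<sigma> b'"
  shows "v \<in> Xt s1 s2 \<epsilon> \<sigma> b'" "Xt_norm s1 s2 \<epsilon> \<sigma> b' v \<le> Xt2_norm s1 s2 \<epsilon> \<sigma> b' v"
proof -
  have z: "(\<lambda>f. 0) \<in> Xt1 s1 s2" "Xt1_norm s1 s2 (\<lambda>f. 0) = 0" unfolding Xt1_def Xt1_norm_def by (rule zero_in_Xs)+
  have e: "v = (\<lambda>f. (\<lambda>f. 0) f + v f)" by simp
  show "v \<in> Xt s1 s2 \<epsilon> \<sigma> b'" unfolding Xt_def sum_space_def mem_Collect_eq by (intro bexI[of _ "\<lambda>f. 0"] bexI[of _ v] z(1) v e)
  let ?S = "{Xt1_norm s1 s2 v1 + Xt2_norm s1 s2 \<epsilon> \<sigma> b' w | v1 w. v1 \<in> Xt1 s1 s2 \<and> w \<in> Xt2 s1 s2 \<epsilon> \<sigma> b' \<and> v = (\<lambda>f. v1 f + w f)}"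
  have "Xt1_norm s1 s2 (\<lambda>f. 0) + Xt2_norm s1 s2 \<epsilon> \<sigma> b' v \<in> ?S" using z(1) v e by blast
  moreover have "bdd_below ?S"
  proof (rule bdd_belowI)
    fix x assume "x \<in> ?S"
    then obtain v1 w where "x = Xt1_norm s1 s2 v1 + Xt2_norm s1 s2 \<epsilon> \<sigma> b' w" by blast
    then show "0 \<le> x" by (simp add: Xt1_norm_def Xt2_norm_def Xs_norm_nonneg)
  qed
  ultimately have "Inf ?S \<le> Xt1_norm s1 s2 (\<lambda>f. 0) + Xt2_norm s1 s2 \<epsilon> \<sigma> b' v" by (rule cInf_lower)
  then show "Xt_norm s1 s2 \<epsilon> \<sigma> b' v \<le> Xt2_norm s1 s2 \<epsilon> \<sigma> b' v" unfolding Xt_norm_def sum_norm_def z(2) by simp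
qed

theorem theorem1p1:
  fixes s1 s2 \<epsilon> b b' \<sigma> :: real
  assumes "s1 > - 1 / 2" and "s2 \<ge> 0"
    and "0 < \<epsilon>" and "\<epsilon> < 1 / 100" and "s1 \<ge> - 1 / 2 + 8 * \<epsilon>"
    and "b = 1 / 2 + \<epsilon> / 2" and "b' = - 1 / 2 + \<epsilon>" and "\<sigma> = 1 / 2 + \<epsilon>"
  shows "\<exists>C>0. \<forall>u1 \<in> X s1 s2 \<epsilon> \<sigma> b b'. \<forall>u2 \<in> X s1 s2 \<epsilon> \<sigma> b b'.
    \<exists>v. is_dx_product u1 u2 v \<and> v \<in> Xt s1 s2 \<epsilon> \<sigma> b' \<and>
        Xt_norm s1 s2 \<epsilon> \<sigma> b' v \<le> C * X_norm s1 s2 \<epsilon> \<sigma> b b' u1 * X_norm s1 s2 \<epsilon> \<sigma> b b' u2"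
proof -
  note E = assms(3,4) and s = assms(5,2)
  let ?X = "X s1 s2 \<epsilon> \<sigma> b b'" and ?N = "X_norm s1 s2 \<epsilon> \<sigma> b b'"
  obtain C where C: "0 < C"
    and bd: "\<And>u1 u2. u1 \<in> ?X \<Longrightarrow> u2 \<in> ?X \<Longrightarrow>
      sq_int (\<lambda>\<zeta>. ennreal (m_out \<epsilon> s1 s2 \<zeta>) * conv_abs (FT u1) (FT u2) \<zeta>) \<le> ennreal ((C * ?N u1 * ?N u2)\<^sup>2)"
    using convolution_bound[OF E s] unfolding assms(6-8) by blast
  show ?thesis
  proof (rule exI[of _ "2 * C"], intro conjI ballI)
    show "0 < 2 * C" using C by simp
    fix u1 u2 assume u: "u1 \<in> ?X" "u2 \<in> ?X"
    let ?B = "C * ?N u1 * ?N u2"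
    have B0: "0 \<le> ?B" using C u by (intro mult_nonneg_nonneg X_norm_nonneg) auto
    note le = bd[OF u]
    have [measurable]: "FT u1 \<in> borel_measurable borel" "FT u2 \<in> borel_measurable borel"
      by (rule has_fourierD(2)[OF X_FT[OF u(1)]], rule has_fourierD(2)[OF X_FT[OF u(2)]])
    define G where "G = (\<lambda>\<zeta>. \<i> * complex_of_real (fst \<zeta>) *
       (complex_of_real (1 / (2 * pi) ^ 3) * (LINT \<zeta>1|lborel. FT u1 \<zeta>1 * FT u2 (\<zeta> - \<zeta>1))))"
    have Gm [measurable]: "G \<in> borel_measurable borel"
    proof -
      have [measurable]: "(\<lambda>\<zeta>. LINT \<zeta>1|lborel. FT u1 \<zeta>1 * FT u2 (\<zeta> - \<zeta>1)) \<in> borel_measurable borel"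
        by (rule lborel.borel_measurable_lebesgue_integral) measurable
      show ?thesis unfolding G_def by measurable
    qed
    have G: "ennreal (w * cmod (G \<zeta>)) \<le> ennreal (m_out \<epsilon> s1 s2 \<zeta>) * conv_abs (FT u1) (FT u2) \<zeta>"
      if w: "0 \<le> w" "\<bar>fst \<zeta>\<bar> * w \<le> m_out \<epsilon> s1 s2 \<zeta>" for w \<zeta>
    proof -
      let ?I = "LINT \<zeta>1|lborel. FT u1 \<zeta>1 * FT u2 (\<zeta> - \<zeta>1)"
      have "(1::real) \<le> (2 * pi) ^ 3" using pi_ge_two by (intro one_le_power) simp
      then have "1 / (2 * pi) ^ 3 \<le> 1" "0 \<le> 1 / (2 * pi) ^ 3" by simp_all
      then have "(\<bar>fst \<zeta>\<bar> * w) * (1 / (2 * pi) ^ 3 * cmod ?I) \<le> m_out \<epsilon> s1 s2 \<zeta> * (1 * cmod ?I)"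
        using w by (intro mult_mono) (auto simp: m_out_def weight_nonneg)
      moreover have "w * cmod (G \<zeta>) = (\<bar>fst \<zeta>\<bar> * w) * (1 / (2 * pi) ^ 3 * cmod ?I)"
        unfolding G_def norm_mult norm_ii norm_of_real by simp
      ultimately have "ennreal (w * cmod (G \<zeta>)) \<le> ennreal (m_out \<epsilon> s1 s2 \<zeta> * cmod ?I)" by (intro ennreal_leI) simp
      also have "\<dots> = ennreal (m_out \<epsilon> s1 s2 \<zeta>) * ennreal (cmod ?I)"
        by (rule ennreal_mult) (simp_all add: m_out_def weight_nonneg)
      also have "\<dots> \<le> ennreal (m_out \<epsilon> s1 s2 \<zeta>) * conv_abs (FT u1) (FT u2) \<zeta>"
        by (intro mult_left_mono norm_convolution_le) simp
      finally show ?thesis .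
    qed
    have Gs: "sq_int (\<lambda>\<zeta>. ennreal (w \<zeta> * cmod (G \<zeta>))) \<le> ennreal (?B\<^sup>2)"
      if w: "\<And>\<zeta>. 0 \<le> w \<zeta>" "\<And>\<zeta>. \<bar>fst \<zeta>\<bar> * w \<zeta> \<le> m_out \<epsilon> s1 s2 \<zeta>" for w
      by (rule order_trans[OF _ le], unfold sq_int_def) (intro nn_integral_mono power_mono G w; simp)
    have e: "\<epsilon> - 1 / 2 = b'" "2 * \<epsilon> - 1 / 2 = b' + \<epsilon>" "1 / 2 + \<epsilon> = \<sigma>" using assms(6-8) by auto
    have G1: "sq_int (\<lambda>\<zeta>. ennreal (weight \<sigma> s1 s2 b' \<zeta> * cmod (G \<zeta>))) \<le> ennreal (?B\<^sup>2)"
      by (rule Gs) (auto simp: weight_nonneg m_out_def e intro!: mult_left_mono)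
    have G2: "sq_int (\<lambda>\<zeta>. ennreal (weight \<sigma> (s1 - 3 * \<epsilon>) s2 (b' + \<epsilon>) \<zeta> * cmod (G \<zeta>))) \<le> ennreal (?B\<^sup>2)"
      by (rule Gs) (auto simp: weight_nonneg m_out_def e intro!: mult_left_mono)
    have "sq_int (\<lambda>\<zeta>. ennreal (weight \<sigma> s1 s2 b' \<zeta> * cmod (G \<zeta>))) < \<infinity>" by (rule order_le_less_trans[OF G1]) simp
    then obtain v where v: "has_fourier v G"
      using has_fourier_exists_weighted[OF E s Gm] unfolding assms(6-8) by blast
    have "AE \<zeta> in lborel. integrable lborel (\<lambda>\<zeta>1. FT u1 \<zeta>1 * FT u2 (\<zeta> - \<zeta>1))"
    proof (rule AE_integrable_convolution[where m = "m_out \<epsilon> s1 s2"])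
      show "0 < m_out \<epsilon> s1 s2 \<zeta>" if "fst \<zeta> \<noteq> 0" for \<zeta>
        unfolding m_out_def using that by (intro mult_pos_pos add_pos_pos weight_pos) auto
      show "sq_int (\<lambda>\<zeta>. ennreal (m_out \<epsilon> s1 s2 \<zeta>) * conv_abs (FT u1) (FT u2) \<zeta>) < \<infinity>"
        by (rule order_le_less_trans[OF le]) simp
    qed measurable
    then have dx: "is_dx_product u1 u2 v" using v unfolding is_dx_product_def G_def by blast
    have v2: "v \<in> Xt2 s1 s2 \<epsilon> \<sigma> b'"
      unfolding Xt2_def using Xs_of_sq_int(1)[OF v B0 G1] Xs_of_sq_int(1)[OF v B0 G2] by blast
    have "Xt2_norm s1 s2 \<epsilon> \<sigma> b' v \<le> ?B + ?B"
      unfolding Xt2_norm_def by (rule add_mono[OF Xs_of_sq_int(2)[OF v B0 G1] Xs_of_sq_int(2)[OF v B0 G2]])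
    then have "Xt_norm s1 s2 \<epsilon> \<sigma> b' v \<le> 2 * C * ?N u1 * ?N u2" using Xt_of_Xt2(2)[OF v2] by simp
    with dx Xt_of_Xt2(1)[OF v2] show "\<exists>v. is_dx_product u1 u2 v \<and> v \<in> Xt s1 s2 \<epsilon> \<sigma> b' \<and>
        Xt_norm s1 s2 \<epsilon> \<sigma> b' v \<le> 2 * C * ?N u1 * ?N u2" by blast
  qed
qed

end
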